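(* Consider the two-team static game $\mathcal P_N$ (finite team sizes $N_1,N_2\in\mathbb N$) with a given (static) information structure, described in the context. Assume: (a) (Exchangeable costs) For $i=1,2$, all permutations $\sigma$ of $\{1,\dots,N_1\}$ and $\tau$ of $\{1,\dots,N_2\}$, and all $\omega_0$ and all actions, $$c^i(\omega_0,u^1_{1},\dots,u^1_{N_1},u^2_1,\dots,u^2_{N_2})=c^i(\omega_0,u^1_{\sigma(1)},\dots,u^1_{\sigma(N_1)},u^2_{\tau(1)},\dots,u^2_{\tau(N_2)}).$$ (b) (Absolute continuity) For every pair of team sizes $M_1,M_2\in\mathbb N\cup\{\infty\}$, let $\tilde\mu^{M}(\cdot\mid\omega_0)$ be the conditional distribution, given $\omega_0$, of all observations $(y^1_{1:M_1},y^2_{1:M_2})$ in the game with team sizes $M_1,M_2$. For $i=1,2$ and every DM $k$ of team $i$ there exist a probability measure $Q^i_k$ on $\mathbb Y^i$ (allowed to depend on the DM $k$) and a bounded function $f^i_k:\mathbb Y^i\times\Omega_0\times\prod_{j=1,j\ne k}^{M_i}\mathbb Y^i\times\prod_{j=1}^{M_{-i}}\mathbb Y^{-i}\to\mathbb R_+$ such that for all Borel sets $B^i_k\subseteq\mathbb Y^i$, with $B=\prod_{i=1}^2 B^i_1\times\cdots\times B^i_{M_i}$, $$\tilde\mu^{M}(B\mid\omega_0)=\int_B\prod_{i=1}^2\prod_{k=1}^{M_i} f^i_k\big(y^i_k,\omega_0,y^i_{-k},\underline y^{-i}\big)\,Q^i_k(dy^i_k),$$ where $y^i_{-k}$ denotes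 the observations of team $i$ other than $y^i_k$ and $\underline y^{-i}$ all observations of the other team. (c) For $i=1,2$: $\mathbb U^i$ is compact; $c^i(\omega_0,\cdot,\dots,\cdot)$ is continuous and (uniformly) bounded for all $\omega_0$; $(y^i_k)_{k=1}^{N_i}$ are $N_i$-exchangeable conditioned on $\omega_0$; and $(y^1_k)_{k=1}^{N_1}$ and $(y^2_k)_{k=1}^{N_2}$ are mutually independent conditioned on $\omega_0$. Then there exists an exchangeable Nash equilibrium $(P_\pi^{1*},P_\pi^{2*})\in L^1_{\mathrm{EX},N}\times L^2_{\mathrm{EX},N}$ for $\mathcal P_N$ among all policies in $L^1_N\times L^2_N$, i.e. for $i=1,2$, $$J^i_{\pi,N}(P^{i*}_\pi,P^{-i*}_\pi)\le J^i_{\pi,N}(P^{i}_\pi,P^{-i*}_\pi)\qquad\text{for all }P^i_\pi\in L^i_N ,$$ where $J^i_{\pi,N}(P^i_\pi,P^{-i}_\pi)$ denotes the cost of team $i$ when team $i$ uses $P^i_\pi$ and the other team uses $P^{-i}_\pi$.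
   Context: Game. There are two players (teams) $i\in\{1,2\}$; $-i$ denotes the other one. Team $i$ consists of $N_i$ decision makers (DMs) $k=1,\dots,N_i$. The game is regarded as a member of a family of games indexed by the team sizes. DM $k$ of team $i$ observes $y^i_k\in\mathbb Y^i$ and chooses an action $u^i_k\in\mathbb U^i$, where $\mathbb Y^i\subseteq\mathbb R^{m_i}$ and $\mathbb U^i\subseteq\mathbb R^{n_i}$ are standard Borel. The game is static: the observations are exogenous random variables on a probability space $(\Omega,\mathcal F,\mathbb P)$, unaffected by actions. $\omega_0$ is an exogenous random variable with values in a Borel space $\Omega_0$, and $c^i:\Omega_0\times\prod_{j=1}^2(\mathbb U^j)^{N_j}\to\mathbb R_+$ is the Borel measurable cost function common to all DMs of team $i$. $\mu^N$ is the joint law of $(\omega_0,y^1_{1:N_1},y^2_{1:N_2})$. $\mathcal P(\cdot)$ denotes the Borel probability measures on a space. Random variables $x^1,\dots,x^m$ are $m$-exchangeable if their joint law is invariant under every permutation of indices. Policies. Let $Q^i_k$ be the reference measures of hypothesis (b) for the team sizes $N_1,N_2$. A (relaxed) policy of DM $k$ of team $i$ is a stochastic kernel $\gamma^i_k(du\mid y)$ from $\mathbb Y^i$ to $\mathbb U^i$, identified with the measure $\gamma^i_k(du\mid y)Q^i_k(dy)\in\mathcal P(\mathbb U^i\times\mathbb Y^i)$; $\Gamma^i_k$ is the set of these, with the topology of weak convergence of the measures $\gamma^i_k(du\mid y)Q^i_k(dy)$ and its Borel $\sigma$-field $\mathcal B(\Gamma^i_k)$. $\Gamma^i_N=\prod_{k=1}^{N_i}\Gamma^i_k$,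 and the set of randomized policies of team $i$ is $L^i_N=\mathcal P(\Gamma^i_N)$. The set of exchangeable randomized policies is $$L^i_{\mathrm{EX},N}=\{P_\pi\in L^i_N:\ P_\pi(\gamma^i_1\in A_1,\dots,\gamma^i_{N_i}\in A_{N_i})=P_\pi(\gamma^i_{\sigma(1)}\in A_1,\dots,\gamma^i_{\sigma(N_i)}\in A_{N_i})\ \ \forall A_k\in\mathcal B(\Gamma^i_k),\ \forall\text{ permutations }\sigma\text{ of }\{1,\dots,N_i\}\}$$ (in comparing permuted policies, the spaces $\Gamma^i_k$, $k=1,\dots,N_i$, are all regarded as the space of kernels from $\mathbb Y^i$ to $\mathbb U^i$). Expected cost of team $i$ under $(P^1_\pi,P^2_\pi)\in L^1_N\times L^2_N$: $$J^i_{\pi,N}(P^1_\pi,P^2_\pi)=\int c^i(\omega_0,u^1_{1:N_1},u^2_{1:N_2})\prod_{j=1}^2\prod_{k=1}^{N_j}\gamma^j_k(du^j_k\mid y^j_k)\,\prod_{j=1}^2P^j_\pi(d\gamma^j_{1:N_j})\,\mu^N(d\omega_0,dy^1_{1:N_1},dy^2_{1:N_2}).$$ *)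

theory Defs
  imports "HOL-Probability.Probability"
begin

abbreviation sborel :: "'a::topological_space set \<Rightarrow> 'a measure" where
  "sborel S \<equiv> restrict_space borel S"

text \<open>The decision makers of a team of size \<open>M\<close> (possibly infinite) are numbered from 0.\<close>

definition dms :: "enat \<Rightarrow> nat set" where
  "dms M = {k. enat k < M}"

abbreviation prof_space :: "'a::topological_space set \<Rightarrow> nat set \<Rightarrow> (nat \<Rightarrow> 'a) measure" where
  "prof_space S I \<equiv> PiM I (\<lambda>_. sborel S)"

definition borel_of :: "'a topology \<Rightarrow> 'a measure" where
  "borel_of T = sigma (topspace T) {V. openin T V}"

definition weak_topology :: "'a::topological_space set \<Rightarrow> 'a measure topology" where
  "weak_topology S = topology_generated_by
     {{m \<in> space (prob_algebra (sborel S)). (\<integral>z. g z \<partial>m) \<in> V} | (g :: 'a \<Rightarrow> real) V.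
        continuous_on S g \<and> bounded (g ` S) \<and> open V}"

definition is_cond_dist ::
  "'w measure \<Rightarrow> 's measure \<Rightarrow> ('w \<Rightarrow> 's) \<Rightarrow> 't measure \<Rightarrow> ('w \<Rightarrow> 't) \<Rightarrow> ('s \<Rightarrow> 't measure) \<Rightarrow> bool" where
  "is_cond_dist Pr S X T Z \<kappa> \<longleftrightarrow>
     \<kappa> \<in> S \<rightarrow>\<^sub>M prob_algebra T \<and>
     (\<forall>A\<in>sets S. \<forall>B\<in>sets T.
        measure Pr {\<omega> \<in> space Pr. X \<omega> \<in> A \<and> Z \<omega> \<in> B}
          = (\<integral>\<omega>. indicator A (X \<omega>) * measure (\<kappa> (X \<omega>)) B \<partial>Pr))"

definition obs_pair ::
  "nat set \<Rightarrow> nat set \<Rightarrow> (nat \<Rightarrow> 'w \<Rightarrow> 'a) \<Rightarrow> (nat \<Rightarrow> 'w \<Rightarrow> 'b) \<Rightarrow> 'w \<Rightarrow> (nat \<Rightarrow> 'a) \<times> (nat \<Rightarrow> 'b)" where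
  "obs_pair I1 I2 y1 y2 \<omega> = ((\<lambda>k\<in>I1. y1 k \<omega>), (\<lambda>k\<in>I2. y2 k \<omega>))"

definition exchangeable_vars ::
  "'t measure \<Rightarrow> nat \<Rightarrow> 's measure \<Rightarrow> (nat \<Rightarrow> 't \<Rightarrow> 's) \<Rightarrow> bool" where
  "exchangeable_vars \<nu> N S X \<longleftrightarrow>
     (\<forall>\<sigma>. \<sigma> permutes {..<N} \<longrightarrow>
        distr \<nu> (PiM {..<N} (\<lambda>_. S)) (\<lambda>t. \<lambda>k\<in>{..<N}. X (\<sigma> k) t)
          = distr \<nu> (PiM {..<N} (\<lambda>_. S)) (\<lambda>t. \<lambda>k\<in>{..<N}. X k t))"

text \<open>The library's \<open>indep_var\<close> requires both variables to have values in the same type.\<close>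

definition independent_vars ::
  "'t measure \<Rightarrow> 's measure \<Rightarrow> ('t \<Rightarrow> 's) \<Rightarrow> 'r measure \<Rightarrow> ('t \<Rightarrow> 'r) \<Rightarrow> bool" where
  "independent_vars \<nu> S X T Z \<longleftrightarrow>
     prob_space.indep_set \<nu> {X -` A \<inter> space \<nu> | A. A \<in> sets S} {Z -` B \<inter> space \<nu> | B. B \<in> sets T}"

text \<open>An infinite product is the limit of its partial products. The library's \<open>prodinf\<close> is not
  used, since it does not admit partial products that tend to 0 with nonzero factors.\<close>

definition dm_prod :: "enat \<Rightarrow> (nat \<Rightarrow> real) \<Rightarrow> real" where
  "dm_prod M a = (case M of enat n \<Rightarrow> (\<Prod>k<n. a k) | \<infinity> \<Rightarrow> lim (\<lambda>n. \<Prod>k<n. a k))"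

definition dm_prod_exists :: "enat \<Rightarrow> (nat \<Rightarrow> real) \<Rightarrow> bool" where
  "dm_prod_exists M a \<longleftrightarrow> (M = \<infinity> \<longrightarrow> convergent (\<lambda>n. \<Prod>k<n. a k))"

text \<open>The arguments of \<open>f k\<close> are \<open>y\<^sup>i\<^sub>k\<close>, \<open>\<omega>\<^sub>0\<close>, the observations of the other members of the team
  and those of the other team.\<close>

definition factor ::
  "enat \<Rightarrow> (nat \<Rightarrow> 'a \<Rightarrow> 'o \<Rightarrow> (nat \<Rightarrow> 'a) \<Rightarrow> (nat \<Rightarrow> 'b) \<Rightarrow> real) \<Rightarrow> 'o \<Rightarrow> (nat \<Rightarrow> 'a) \<Rightarrow> (nat \<Rightarrow> 'b) \<Rightarrow> nat \<Rightarrow> real" where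
  "factor M f w x z k = f k (x k) w (restrict x (dms M - {k})) z"

definition bounded_factors ::
  "'o::topological_space set \<Rightarrow> 'a::topological_space set \<Rightarrow> 'b::topological_space set \<Rightarrow> enat \<Rightarrow> enat
    \<Rightarrow> (nat \<Rightarrow> 'a \<Rightarrow> 'o \<Rightarrow> (nat \<Rightarrow> 'a) \<Rightarrow> (nat \<Rightarrow> 'b) \<Rightarrow> real) \<Rightarrow> bool" where
  "bounded_factors \<Omega>0 Y Y' M M' f \<longleftrightarrow>
     (\<forall>k\<in>dms M.
        (\<lambda>(y, w, x, z). f k y w x z) \<in> borel_measurable
           (sborel Y \<Otimes>\<^sub>M sborel \<Omega>0 \<Otimes>\<^sub>M prof_space Y (dms M - {k}) \<Otimes>\<^sub>M prof_space Y' (dms M')) \<and>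
        (\<exists>C. \<forall>y\<in>Y. \<forall>w\<in>\<Omega>0. \<forall>x \<in> PiE (dms M - {k}) (\<lambda>_. Y). \<forall>z \<in> PiE (dms M') (\<lambda>_. Y').
           0 \<le> f k y w x z \<and> f k y w x z \<le> C))"

definition is_ref_measure :: "'a::topological_space set \<Rightarrow> 'a measure \<Rightarrow> bool" where
  "is_ref_measure Y Q \<longleftrightarrow> prob_space Q \<and> sets Q = sets (sborel Y)"

text \<open>Hypothesis on one pair of team sizes \<open>M1\<close>, \<open>M2\<close>; \<open>\<nu>\<close> is the conditional distribution of all
  observations given that \<open>\<omega>\<^sub>0\<close> has the value \<open>w\<close>.\<close>

definition has_product_density ::
  "'a::topological_space set \<Rightarrow> 'b::topological_space set \<Rightarrow> enat \<Rightarrow> enat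
    \<Rightarrow> (nat \<Rightarrow> 'a measure) \<Rightarrow> (nat \<Rightarrow> 'b measure)
    \<Rightarrow> (nat \<Rightarrow> 'a \<Rightarrow> 'o \<Rightarrow> (nat \<Rightarrow> 'a) \<Rightarrow> (nat \<Rightarrow> 'b) \<Rightarrow> real)
    \<Rightarrow> (nat \<Rightarrow> 'b \<Rightarrow> 'o \<Rightarrow> (nat \<Rightarrow> 'b) \<Rightarrow> (nat \<Rightarrow> 'a) \<Rightarrow> real)
    \<Rightarrow> 'o \<Rightarrow> ((nat \<Rightarrow> 'a) \<times> (nat \<Rightarrow> 'b)) measure \<Rightarrow> bool" where
  "has_product_density Y1 Y2 M1 M2 Q1 Q2 f1 f2 w \<nu> \<longleftrightarrow>
     (AE (x, z) in PiM (dms M1) Q1 \<Otimes>\<^sub>M PiM (dms M2) Q2.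
        dm_prod_exists M1 (factor M1 f1 w x z) \<and> dm_prod_exists M2 (factor M2 f2 w z x)) \<and>
     (\<forall>B1 B2. (\<forall>k\<in>dms M1. B1 k \<in> sets (sborel Y1)) \<longrightarrow> (\<forall>k\<in>dms M2. B2 k \<in> sets (sborel Y2)) \<longrightarrow>
        emeasure \<nu> (PiE (dms M1) B1 \<times> PiE (dms M2) B2)
          = (\<integral>\<^sup>+(x, z) \<in> PiE (dms M1) B1 \<times> PiE (dms M2) B2.
               ennreal (dm_prod M1 (factor M1 f1 w x z) * dm_prod M2 (factor M2 f2 w z x))
               \<partial>(PiM (dms M1) Q1 \<Otimes>\<^sub>M PiM (dms M2) Q2)))"

definition exchangeable_cost ::
  "'o set \<Rightarrow> 'u set \<Rightarrow> 'v set \<Rightarrow> nat \<Rightarrow> nat \<Rightarrow> ('o \<Rightarrow> (nat \<Rightarrow> 'u) \<Rightarrow> (nat \<Rightarrow> 'v) \<Rightarrow> real) \<Rightarrow> bool" where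
  "exchangeable_cost \<Omega>0 U1 U2 N1 N2 c \<longleftrightarrow>
     (\<forall>\<sigma> \<tau>. \<sigma> permutes {..<N1} \<longrightarrow> \<tau> permutes {..<N2} \<longrightarrow>
        (\<forall>w\<in>\<Omega>0. \<forall>u \<in> PiE {..<N1} (\<lambda>_. U1). \<forall>v \<in> PiE {..<N2} (\<lambda>_. U2).
           c w u v = c w (\<lambda>k\<in>{..<N1}. u (\<sigma> k)) (\<lambda>k\<in>{..<N2}. v (\<tau> k))))"

text \<open>Continuity refers to the product topology on \<open>nat \<Rightarrow> _\<close>; on \<open>PiE {..<N} (\<lambda>_. U)\<close>, where the
  coordinates outside \<open>{..<N}\<close> are constant, it induces the topology of \<open>U\<^sup>N\<close>.\<close>

definition is_cost ::
  "'o::topological_space set \<Rightarrow> 'u::topological_space set \<Rightarrow> 'v::topological_space set \<Rightarrow> nat \<Rightarrow> nat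
    \<Rightarrow> ('o \<Rightarrow> (nat \<Rightarrow> 'u) \<Rightarrow> (nat \<Rightarrow> 'v) \<Rightarrow> real) \<Rightarrow> bool" where
  "is_cost \<Omega>0 U1 U2 N1 N2 c \<longleftrightarrow>
     (\<lambda>(w, u, v). c w u v) \<in> borel_measurable
        (sborel \<Omega>0 \<Otimes>\<^sub>M prof_space U1 {..<N1} \<Otimes>\<^sub>M prof_space U2 {..<N2}) \<and>
     (\<forall>w\<in>\<Omega>0. \<forall>u \<in> PiE {..<N1} (\<lambda>_. U1). \<forall>v \<in> PiE {..<N2} (\<lambda>_. U2). 0 \<le> c w u v)"

definition continuous_bounded_cost ::
  "'o set \<Rightarrow> 'u::topological_space set \<Rightarrow> 'v::topological_space set \<Rightarrow> nat \<Rightarrow> nat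
    \<Rightarrow> ('o \<Rightarrow> (nat \<Rightarrow> 'u) \<Rightarrow> (nat \<Rightarrow> 'v) \<Rightarrow> real) \<Rightarrow> bool" where
  "continuous_bounded_cost \<Omega>0 U1 U2 N1 N2 c \<longleftrightarrow>
     (\<forall>w\<in>\<Omega>0. continuous_on (PiE {..<N1} (\<lambda>_. U1) \<times> PiE {..<N2} (\<lambda>_. U2)) (\<lambda>(u, v). c w u v)) \<and>
     (\<exists>C. \<forall>w\<in>\<Omega>0. \<forall>u \<in> PiE {..<N1} (\<lambda>_. U1). \<forall>v \<in> PiE {..<N2} (\<lambda>_. U2). \<bar>c w u v\<bar> \<le> C)"

definition kernels :: "'a::topological_space set \<Rightarrow> 'u::topological_space set \<Rightarrow> ('a \<Rightarrow> 'u measure) set" where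
  "kernels Y U = sborel Y \<rightarrow>\<^sub>M prob_algebra (sborel U)"

text \<open>The measure \<open>\<gamma>(du | y) Q(dy)\<close> on \<open>U \<times> Y\<close>.\<close>

definition policy_measure ::
  "'a::topological_space set \<Rightarrow> 'u::topological_space set \<Rightarrow> 'a measure \<Rightarrow> ('a \<Rightarrow> 'u measure) \<Rightarrow> ('u \<times> 'a) measure" where
  "policy_measure Y U Q \<gamma> = Q \<bind> (\<lambda>y. distr (\<gamma> y) (sborel (U \<times> Y)) (\<lambda>u. (u, y)))"

definition policies ::
  "'a::topological_space set \<Rightarrow> 'u::topological_space set \<Rightarrow> 'a measure \<Rightarrow> ('u \<times> 'a) measure set" where
  "policies Y U Q = policy_measure Y U Q ` kernels Y U"

text \<open>A kernel represented by a policy; it is determined \<open>Q\<close>-almost everywhere.\<close>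

definition kernel_of ::
  "'a::topological_space set \<Rightarrow> 'u::topological_space set \<Rightarrow> 'a measure \<Rightarrow> ('u \<times> 'a) measure \<Rightarrow> ('a \<Rightarrow> 'u measure)" where
  "kernel_of Y U Q m = (SOME \<gamma>. \<gamma> \<in> kernels Y U \<and> policy_measure Y U Q \<gamma> = m)"

definition policy_topology ::
  "'a::topological_space set \<Rightarrow> 'u::topological_space set \<Rightarrow> 'a measure \<Rightarrow> ('u \<times> 'a) measure topology" where
  "policy_topology Y U Q = subtopology (weak_topology (U \<times> Y)) (policies Y U Q)"

definition team_policy_algebra ::
  "'a::topological_space set \<Rightarrow> 'u::topological_space set \<Rightarrow> nat \<Rightarrow> (nat \<Rightarrow> 'a measure) \<Rightarrow> (nat \<Rightarrow> ('u \<times> 'a) measure) measure" where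
  "team_policy_algebra Y U N Q = borel_of (product_topology (\<lambda>k. policy_topology Y U (Q k)) {..<N})"

definition randomized_policies ::
  "'a::topological_space set \<Rightarrow> 'u::topological_space set \<Rightarrow> nat \<Rightarrow> (nat \<Rightarrow> 'a measure) \<Rightarrow> (nat \<Rightarrow> ('u \<times> 'a) measure) measure set" where
  "randomized_policies Y U N Q = space (prob_algebra (team_policy_algebra Y U N Q))"

text \<open>To compare permuted policies, the policy spaces of all members of the team are regarded as one
  space, that of kernels. Its events are generated by the Borel sets of all these policy spaces.\<close>

definition kernel_algebra ::
  "'a::topological_space set \<Rightarrow> 'u::topological_space set \<Rightarrow> nat \<Rightarrow> (nat \<Rightarrow> 'a measure) \<Rightarrow> ('a \<Rightarrow> 'u measure) measure" where
  "kernel_algebra Y U N Q = sigma (kernels Y U)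
     {{\<gamma> \<in> kernels Y U. policy_measure Y U (Q k) \<gamma> \<in> A} | k A.
        k < N \<and> A \<in> sets (borel_of (policy_topology Y U (Q k)))}"

text \<open>A randomized policy \<open>P\<close> is exchangeable if it is the law of random kernels whose joint law \<open>R\<close>
  is invariant under permutations. When the reference measures \<open>Q k\<close> differ, a policy of one member
  does not determine a policy of another one (a null set of \<open>Q k\<close> need not be a null set of \<open>Q l\<close>),
  so the events that a permuted policy lies in a Borel set are events for \<open>R\<close> but in general not
  for \<open>P\<close>. When all \<open>Q k\<close> agree, \<open>R\<close> is just \<open>P\<close>, transported to kernels.\<close>

definition exchangeable_policies ::
  "'a::topological_space set \<Rightarrow> 'u::topological_space set \<Rightarrow> nat \<Rightarrow> (nat \<Rightarrow> 'a measure) \<Rightarrow> (nat \<Rightarrow> ('u \<times> 'a) measure) measure set" where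
  "exchangeable_policies Y U N Q =
     {P \<in> randomized_policies Y U N Q.
        \<exists>R \<in> space (prob_algebra (PiM {..<N} (\<lambda>_. kernel_algebra Y U N Q))).
          P = distr R (team_policy_algebra Y U N Q)
                (\<lambda>\<gamma>. \<lambda>k\<in>{..<N}. policy_measure Y U (Q k) (\<gamma> k)) \<and>
          (\<forall>\<sigma> A. \<sigma> permutes {..<N} \<longrightarrow> (\<forall>k<N. A k \<in> sets (kernel_algebra Y U N Q)) \<longrightarrow>
             measure R {\<gamma> \<in> space R. \<forall>k<N. \<gamma> k \<in> A k}
               = measure R {\<gamma> \<in> space R. \<forall>k<N. \<gamma> (\<sigma> k) \<in> A k})}"

text \<open>The expected cost of the policies \<open>m1\<close>, \<open>m2\<close> of the decision makers, under the joint law \<open>\<mu>\<close> of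
  \<open>(\<omega>\<^sub>0, y\<^sup>1, y\<^sup>2)\<close>.\<close>

definition policy_cost ::
  "'a::topological_space set \<Rightarrow> 'b::topological_space set \<Rightarrow> 'u::topological_space set \<Rightarrow> 'v::topological_space set
    \<Rightarrow> nat \<Rightarrow> nat \<Rightarrow> (nat \<Rightarrow> 'a measure) \<Rightarrow> (nat \<Rightarrow> 'b measure)
    \<Rightarrow> ('o \<times> (nat \<Rightarrow> 'a) \<times> (nat \<Rightarrow> 'b)) measure \<Rightarrow> ('o \<Rightarrow> (nat \<Rightarrow> 'u) \<Rightarrow> (nat \<Rightarrow> 'v) \<Rightarrow> real)
    \<Rightarrow> (nat \<Rightarrow> ('u \<times> 'a) measure) \<Rightarrow> (nat \<Rightarrow> ('v \<times> 'b) measure) \<Rightarrow> real" where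
  "policy_cost Y1 Y2 U1 U2 N1 N2 Q1 Q2 \<mu> c m1 m2 =
     (\<integral>(w, y1, y2).
        (\<integral>(u, v). c w u v
           \<partial>(PiM {..<N1} (\<lambda>k. kernel_of Y1 U1 (Q1 k) (m1 k) (y1 k)) \<Otimes>\<^sub>M
             PiM {..<N2} (\<lambda>k. kernel_of Y2 U2 (Q2 k) (m2 k) (y2 k))))
        \<partial>\<mu>)"

text \<open>The policies are integrated last: for fixed policies the integral over the observations does
  not depend on the choice made in \<open>kernel_of\<close>, whereas for fixed observations
  \<open>\<gamma>(du | y)\<close> is not a well-defined function of the policy.\<close>

definition expected_cost ::
  "'a::topological_space set \<Rightarrow> 'b::topological_space set \<Rightarrow> 'u::topological_space set \<Rightarrow> 'v::topological_space set
    \<Rightarrow> nat \<Rightarrow> nat \<Rightarrow> (nat \<Rightarrow> 'a measure) \<Rightarrow> (nat \<Rightarrow> 'b measure)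
    \<Rightarrow> ('o \<times> (nat \<Rightarrow> 'a) \<times> (nat \<Rightarrow> 'b)) measure \<Rightarrow> ('o \<Rightarrow> (nat \<Rightarrow> 'u) \<Rightarrow> (nat \<Rightarrow> 'v) \<Rightarrow> real)
    \<Rightarrow> (nat \<Rightarrow> ('u \<times> 'a) measure) measure \<Rightarrow> (nat \<Rightarrow> ('v \<times> 'b) measure) measure \<Rightarrow> real" where
  "expected_cost Y1 Y2 U1 U2 N1 N2 Q1 Q2 \<mu> c P1 P2 =
     (\<integral>(m1, m2). policy_cost Y1 Y2 U1 U2 N1 N2 Q1 Q2 \<mu> c m1 m2 \<partial>(P1 \<Otimes>\<^sub>M P2))"

end

theory Submission
  imports Defs
begin

text \<open>
  By the absolute continuity, the expected cost of a pair of kernel profiles \<open>\<gamma>\<close> depends only on the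
  integrals \<open>\<integral>\<^sub>B \<integral>h(u) \<gamma>\<^sub>k(du|y) Q(dy)\<close> with \<open>B\<close> Borel and \<open>h\<close> continuous, and depends on them
  continuously: the cost is a uniform limit of sums of products of functions of single actions, and the
  joint law of the observations is a density times a product measure. Continuity, measurability and
  independence of the chosen version of a kernel all follow from this by one argument, because in each
  case the admissible functions form an algebra that is closed under uniform limits.

  Kernels are compact in the topology of these integrals (Young measures). Taking a reference measure
  that dominates all \<open>Q\<^sub>k\<close>, the kernel profiles of a team form a compact metrizable space, hence a
  continuous image of a compact set of reals. The game thus becomes one with continuous costs on compact
  sets of reals; it has an equilibrium in mixed strategies, obtained as a limit of equilibria of finite
  games, which exist by Brouwer's theorem.

  Finally, each mixed strategy is composed with an independent uniform random permutation of the decision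
  makers. This makes it exchangeable. It changes no cost, since the law of the observations is invariant
  under permutations of each team (exchangeability and independence given \<open>\<omega>\<^sub>0\<close>) and so are the cost
  functions; hence the symmetrized strategies still form an equilibrium.
\<close>

section \<open>Algebras of functions closed under uniform limits\<close>

text \<open>Products are the obstacle: weak limits of kernels do not commute with products of
  functions of the same observation, and the joint law of correlated observations may concentrate on
  such a diagonal. The density removes it. Under a product measure the integral of a product of
  functions of single observations is a product of integrals, one for each decision maker, and each
  factor is a test of one kernel; the density itself enters only as an integrable weight, which is
  approximated in the mean. Real parameters replace compactness of measures on an abstract policy
  space by Helly's selection on the line. They may be redundant, many parameters giving the same
  policy, since only costs have to be carried over. Kernels rather than policies are parametrized
  because symmetrization hands the kernel of one member to another; the dominating reference measure
  keeps enough information for this when the null sets of the \<open>Q k\<close> differ.\<close>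

locale uniform_algebra =
  fixes T :: "'t set" and F :: "('t \<Rightarrow> real) set"
  assumes const: "(\<lambda>_. c) \<in> F"
    and add: "f \<in> F \<Longrightarrow> g \<in> F \<Longrightarrow> (\<lambda>t. f t + g t) \<in> F"
    and mult: "f \<in> F \<Longrightarrow> g \<in> F \<Longrightarrow> (\<lambda>t. f t * g t) \<in> F"
    and approx: "(\<And>e. e > 0 \<Longrightarrow> \<exists>f\<in>F. \<forall>t\<in>T. \<bar>f t - g t\<bar> \<le> e) \<Longrightarrow> g \<in> F"
begin

text \<open>Uniform approximation is measured on \<open>T\<close> alone, so \<open>f\<close>
  approximates \<open>g\<close> with error 0; values outside \<open>T\<close> never matter.\<close>

lemma cong: "f \<in> F \<Longrightarrow> (\<And>t. t \<in> T \<Longrightarrow> f t = g t) \<Longrightarrow> g \<in> F"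
  by (rule approx) (auto intro!: bexI[of _ f])

lemma scale: "f \<in> F \<Longrightarrow> (\<lambda>t. c * f t) \<in> F"
  by (intro mult const)

lemma diff: "f \<in> F \<Longrightarrow> g \<in> F \<Longrightarrow> (\<lambda>t. f t - g t) \<in> F"
  using add[of f "\<lambda>t. - 1 * g t"] scale[of g "-1"] by simp

lemma sum: "(\<And>i. i \<in> I \<Longrightarrow> f i \<in> F) \<Longrightarrow> (\<lambda>t. \<Sum>i\<in>I. f i t) \<in> F"
  by (induction I rule: infinite_finite_induct) (auto intro: const add)

lemma prod: "(\<And>i. i \<in> I \<Longrightarrow> f i \<in> F) \<Longrightarrow> (\<lambda>t. \<Prod>i\<in>I. f i t) \<in> F"
  by (induction I rule: infinite_finite_induct) (auto intro: const mult)

lemma limit: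
  assumes "\<And>n. f n \<in> F" "e \<longlonglongrightarrow> 0" "\<And>n t. t \<in> T \<Longrightarrow> \<bar>f n t - g t\<bar> \<le> e n"
  shows "g \<in> F"
proof (rule approx)
  fix d :: real assume "d > 0"
  with assms(2) obtain n where "e n < d"
    using order_tendstoD(2)[of e 0 sequentially d] by (auto simp: eventually_sequentially)
  then show "\<exists>f\<in>F. \<forall>t\<in>T. \<bar>f t - g t\<bar> \<le> d"
    using assms(1)[of n] assms(3)[of _ n] by (intro bexI[of _ "f n"]) (auto intro: order_trans less_imp_le)
qed

text \<open>The sets \<open>B\<close> with this property form a Dynkin system. Complements use
  linearity. For disjoint unions the partial sums converge uniformly in \<open>t\<close>, since the
  remainder is at most \<open>C\<close> times the measure of the remaining set, which does not
  involve \<open>t\<close>.\<close>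

lemma integral_indicator_sigma:
  assumes "finite_measure Q"
    and a: "\<And>t. t \<in> T \<Longrightarrow> a t \<in> borel_measurable Q"
    and bd: "\<And>t y. t \<in> T \<Longrightarrow> y \<in> space Q \<Longrightarrow> \<bar>a t y\<bar> \<le> C"
    and E: "Int_stable E" "E \<subseteq> Pow (space Q)" "sets Q = sigma_sets (space Q) E" "space Q \<in> E"
    and base: "\<And>B. B \<in> E \<Longrightarrow> (\<lambda>t. \<integral>y. indicator B y * a t y \<partial>Q) \<in> F"
    and B: "B \<in> sets Q"
  shows "(\<lambda>t. \<integral>y. indicator B y * a t y \<partial>Q) \<in> F"
proof -
  interpret finite_measure Q by fact
  have int: "integrable Q (\<lambda>y. indicator B y * a t y)" if "t \<in> T" "B \<in> sets Q" for t B
    using a[OF that(1)] bd[OF that(1)] that(2)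
    by (intro integrable_const_bound[where B="\<bar>C\<bar>"] AE_I2 borel_measurable_times borel_measurable_indicator)
      (force split: split_indicator)+
  have intm: "integrable Q (\<lambda>y. a t y)" if "t \<in> T" for t
    using a[OF that(1)] bd[OF that(1)]
    by (intro integrable_const_bound[where B="C"]) auto
  have C: "0 \<le> C" if "t \<in> T" "y \<in> space Q" for t y
    using bd[OF that] by linarith
  from B have "B \<in> sigma_sets (space Q) E" using E by simp
  with E(1,2) show ?thesis
  proof (induction B rule: sigma_sets_induct_disjoint)
    case (basic A) then show ?case by (rule base)
  next
    case empty show ?case by (simp add: const)
  next
    case (compl A)
    have A: "A \<in> sets Q" using compl E by simp
    have "(\<lambda>t. (\<integral>y. indicator (space Q) y * a t y \<partial>Q) - (\<integral>y. indicator A y * a t y \<partial>Q)) \<in> F"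
      by (intro diff base compl E)
    then show ?case
    proof (rule cong)
      fix t assume t: "t \<in> T"
      show "(\<integral>y. indicator (space Q) y * a t y \<partial>Q) - (\<integral>y. indicator A y * a t y \<partial>Q) =
            (\<integral>y. indicator (space Q - A) y * a t y \<partial>Q)"
        using A by (subst Bochner_Integration.integral_diff[symmetric])
          (auto intro!: int t Bochner_Integration.integral_cong split: split_indicator)
    qed
  next
    case (union A)
    have A: "range A \<subseteq> sets Q" using union E by auto
    \<comment> \<open>Absolute value, because nothing forces \<open>C\<close> to be nonnegative when
      \<open>T\<close> or the space is empty.\<close>
    let ?e = "\<lambda>n. \<bar>C\<bar> * measure Q ((\<Union>i. A i) - (\<Union>i<n. A i))"
    have e: "?e \<longlonglongrightarrow> 0"
    proof -
      have "(\<lambda>n. measure Q ((\<Union>i. A i) - (\<Union>i<n. A i))) \<longlonglongrightarrow> measure Q (\<Inter>n. (\<Union>i. A i) - (\<Union>i<n. A i))"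
        using A by (intro finite_Lim_measure_decseq) (auto simp: decseq_def intro!: sets.Diff sets.countable_UN'')
      also have "(\<Inter>n. (\<Union>i. A i) - (\<Union>i<n. A i)) = {}" by auto
      finally show ?thesis using tendsto_mult_right_zero by fastforce
    qed
    have s: "(\<lambda>t. \<Sum>i<n. \<integral>y. indicator (A i) y * a t y \<partial>Q) \<in> F" for n
      by (intro sum union)
    show ?case
    proof (rule limit[OF s e])
      fix n t assume t: "t \<in> T"
      have fin: "(\<Sum>i<n. \<integral>y. indicator (A i) y * a t y \<partial>Q) = (\<integral>y. indicator (\<Union>i<n. A i) y * a t y \<partial>Q)"
      proof -
        have d: "disjoint_family_on A {..<n}" using union(1) by (auto simp: disjoint_family_on_def)
        have "(\<Sum>i<n. \<integral>y. indicator (A i) y * a t y \<partial>Q) = (\<integral>y. (\<Sum>i<n. indicator (A i) y * a t y) \<partial>Q)"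
          using A by (intro Bochner_Integration.integral_sum[symmetric] int t) auto
        also have "\<dots> = (\<integral>y. indicator (\<Union>i<n. A i) y * a t y \<partial>Q)"
          by (intro Bochner_Integration.integral_cong)
            (simp_all add: sum_distrib_right[symmetric] indicator_UN_disjoint[OF finite_lessThan d])
        finally show ?thesis .
      qed
      have "(\<Sum>i<n. \<integral>y. indicator (A i) y * a t y \<partial>Q) - (\<integral>y. indicator (\<Union> (range A)) y * a t y \<partial>Q)
        = (\<integral>y. - (indicator ((\<Union>i. A i) - (\<Union>i<n. A i)) y * a t y) \<partial>Q)"
        unfolding fin using A
        by (subst Bochner_Integration.integral_diff[symmetric])
          (auto intro!: int t Bochner_Integration.integral_cong sets.countable_UN'' split: split_indicator
             simp del: Bochner_Integration.integral_minus)
      also have "\<bar>\<dots>\<bar> \<le> (\<integral>y. \<bar>C\<bar> * indicator ((\<Union>i. A i) - (\<Union>i<n. A i)) y \<partial>Q)"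
      proof (intro integral_abs_bound[THEN order_trans] integral_mono integrable_abs Bochner_Integration.integrable_minus int t)
        show S: "\<Union> (range A) - \<Union> (A ` {..<n}) \<in> sets Q" using A by auto
        show "integrable Q (\<lambda>y. \<bar>C\<bar> * indicator (\<Union> (range A) - \<Union> (A ` {..<n})) y)"
          using S by (intro integrable_mult_right integrable_real_indicator) (auto simp: emeasure_eq_measure)
        fix y assume "y \<in> space Q"
        then show "\<bar>- (indicat_real (\<Union> (range A) - \<Union> (A ` {..<n})) y * a t y)\<bar>
            \<le> \<bar>C\<bar> * indicator (\<Union> (range A) - \<Union> (A ` {..<n})) y"
          using bd[OF t] by (force split: split_indicator)
      qed
      also have "\<dots> = ?e n"
      proof -
        have "(\<Union> (range A) - \<Union> (A ` {..<n})) \<inter> space Q = \<Union> (range A) - \<Union> (A ` {..<n})"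
          using A by (auto dest: sets.sets_into_space)
        then show ?thesis by simp
      qed
      finally show "\<bar>(\<Sum>i<n. \<integral>y. indicator (A i) y * a t y \<partial>Q) - (\<integral>y. indicator (\<Union> (range A)) y * a t y \<partial>Q)\<bar> \<le> ?e n" .
    qed
  qed
qed

text \<open>Induction on the weight. The limit step is uniform in \<open>t\<close> because replacing
  the weight by another one changes the integral by at most \<open>C\<close> times their distance in
  the mean.\<close>

lemma integral_integrable:
  assumes "finite_measure Q"
    and a: "\<And>t. t \<in> T \<Longrightarrow> a t \<in> borel_measurable Q"
    and bd: "\<And>t y. t \<in> T \<Longrightarrow> y \<in> space Q \<Longrightarrow> \<bar>a t y\<bar> \<le> C"
    and base: "\<And>B. B \<in> sets Q \<Longrightarrow> (\<lambda>t. \<integral>y. indicator B y * a t y \<partial>Q) \<in> F"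
    and "integrable Q \<phi>"
  shows "(\<lambda>t. \<integral>y. \<phi> y * a t y \<partial>Q) \<in> F"
proof -
  interpret finite_measure Q by fact
  have int: "integrable Q (\<lambda>y. f y * a t y)" if "t \<in> T" "integrable Q f" for t and f :: "_ \<Rightarrow> real"
  proof (rule Bochner_Integration.integrable_bound[OF integrable_mult_right[OF that(2), of C]])
    show "AE y in Q. norm (f y * a t y) \<le> norm (C * f y)"
    proof (rule AE_I2)
      fix y assume "y \<in> space Q"
      then have "\<bar>a t y\<bar> \<le> \<bar>C\<bar>" using bd[OF that(1)] by force
      then show "norm (f y * a t y) \<le> norm (C * f y)"
        by (simp add: abs_mult mult.commute[of "\<bar>C\<bar>"] mult_left_mono)
    qed
  qed (use a[OF that(1)] that(2) in auto)
  note plus = add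
  show ?thesis using \<open>integrable Q \<phi>\<close>
  proof (induction \<phi>)
    case (base A c)
    have "(\<integral>y. indicator A y *\<^sub>R c * a t y \<partial>Q) = (\<integral>y. c * (indicator A y * a t y) \<partial>Q)" for t
      by (intro Bochner_Integration.integral_cong) auto
    then show ?case by (intro cong[OF scale[OF assms(4)[OF base(1)], of c]]) simp
  next
    case (add f g)
    show ?case
      by (rule cong[OF plus[OF add(3) add(4)]])
        (simp add: distrib_right int add)
  next
    case (lim f s)
    have li: "\<And>i. integrable Q (s i)" "\<And>x. x \<in> space Q \<Longrightarrow> (\<lambda>i. s i x) \<longlonglongrightarrow> f x"
        "\<And>i x. x \<in> space Q \<Longrightarrow> \<bar>s i x\<bar> \<le> 2 * \<bar>f x\<bar>" "integrable Q f"
      using lim.hyps by simp_all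
    show ?case
    proof (rule limit[OF lim.IH])
      show "(\<lambda>n. \<bar>C\<bar> * (\<integral>y. \<bar>s n y - f y\<bar> \<partial>Q)) \<longlonglongrightarrow> 0"
      proof -
        have m: "f \<in> borel_measurable Q" "\<And>n. s n \<in> borel_measurable Q" using li by auto
        \<comment> \<open>The induction principle supplies functions \<open>s n\<close> bounded by
          twice the absolute value of \<open>f\<close>, hence the majorant with factor 3.\<close>
        have "(\<lambda>n. \<integral>y. \<bar>s n y - f y\<bar> \<partial>Q) \<longlonglongrightarrow> (\<integral>y. 0 \<partial>Q)"
        proof (rule integral_dominated_convergence[where w="\<lambda>y. 3 * \<bar>f y\<bar>"])
          show "AE x in Q. (\<lambda>i. \<bar>s i x - f x\<bar>) \<longlonglongrightarrow> 0"
            by (intro AE_I2 tendsto_rabs_zero LIM_zero li)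
          show "AE x in Q. norm \<bar>s i x - f x\<bar> \<le> 3 * \<bar>f x\<bar>" for i
          proof (rule AE_I2)
            fix x assume "x \<in> space Q"
            then show "norm \<bar>s i x - f x\<bar> \<le> 3 * \<bar>f x\<bar>" using li(3)[of x i] by (simp add: abs_if split: if_splits)
          qed
        qed (use m li in auto)
        then show ?thesis by (auto intro: tendsto_mult_right_zero)
      qed
      fix n t assume t: "t \<in> T"
      have "(\<integral>y. s n y * a t y \<partial>Q) - (\<integral>y. f y * a t y \<partial>Q) = (\<integral>y. (s n y - f y) * a t y \<partial>Q)"
        by (subst Bochner_Integration.integral_diff[symmetric], intro int t li, intro int t li)
          (intro Bochner_Integration.integral_cong, simp_all add: left_diff_distrib)
      also have "\<bar>\<dots>\<bar> \<le> (\<integral>y. \<bar>C\<bar> * \<bar>s n y - f y\<bar> \<partial>Q)"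
      proof (intro integral_abs_bound[THEN order_trans] integral_mono integrable_abs int t
          Bochner_Integration.integrable_diff li integrable_mult_right)
        fix y assume "y \<in> space Q"
        then have "\<bar>a t y\<bar> \<le> \<bar>C\<bar>" using bd[OF t] by force
        then show "\<bar>(s n y - f y) * a t y\<bar> \<le> \<bar>C\<bar> * \<bar>s n y - f y\<bar>"
          by (simp add: abs_mult mult.commute[of "\<bar>C\<bar>"] mult_left_mono)
      qed
      finally show "\<bar>(\<integral>y. s n y * a t y \<partial>Q) - (\<integral>y. f y * a t y \<partial>Q)\<bar> \<le> \<bar>C\<bar> * (\<integral>y. \<bar>s n y - f y\<bar> \<partial>Q)"
        by simp
    qed
  qed
qed

end

section \<open>Instances: continuity, measurability, convergence, equality of two values\<close>

lemma uniform_algebra_continuous: "uniform_algebra T {f. continuous_on T f}"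
proof
  fix g :: "'a \<Rightarrow> real"
  assume "\<And>e. e > 0 \<Longrightarrow> \<exists>f\<in>{f. continuous_on T f}. \<forall>t\<in>T. \<bar>f t - g t\<bar> \<le> e"
  then have "\<forall>n. \<exists>f. continuous_on T f \<and> (\<forall>t\<in>T. \<bar>f t - g t\<bar> \<le> 1 / Suc n)" by auto
  then obtain f where f: "\<And>n. continuous_on T (f n)" "\<And>n t. t \<in> T \<Longrightarrow> \<bar>f n t - g t\<bar> \<le> 1 / Suc n" by metis
  have "uniform_limit T f g sequentially"
  proof (rule uniform_limitI)
    fix e :: real assume "e > 0"
    then have "\<forall>\<^sub>F n in sequentially. 1 / Suc n < e"
      using LIMSEQ_Suc[OF lim_1_over_n] by (rule order_tendstoD(2)[rotated])
    then show "\<forall>\<^sub>F n in sequentially. \<forall>x\<in>T. dist (f n x) (g x) < e"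
    proof eventually_elim
      case (elim n)
      then show ?case using f(2)[of _ n] by (auto simp: dist_real_def intro: le_less_trans)
    qed
  qed
  then show "g \<in> {f. continuous_on T f}"
    using uniform_limit_theorem[OF always_eventually, of T f g sequentially] f(1) by auto
qed (auto intro: continuous_intros)

lemma uniform_algebra_measurable: "uniform_algebra (space M) (borel_measurable M)"
proof
  fix g :: "'a \<Rightarrow> real"
  assume "\<And>e. e > 0 \<Longrightarrow> \<exists>f\<in>borel_measurable M. \<forall>t\<in>space M. \<bar>f t - g t\<bar> \<le> e"
  then have "\<forall>n. \<exists>f\<in>borel_measurable M. (\<forall>t\<in>space M. \<bar>f t - g t\<bar> \<le> 1 / Suc n)" by auto
  then obtain f where f: "\<And>n. f n \<in> borel_measurable M" "\<And>n t. t \<in> space M \<Longrightarrow> \<bar>f n t - g t\<bar> \<le> 1 / Suc n" by metis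
  show "g \<in> borel_measurable M"
  proof (rule borel_measurable_LIMSEQ_real[OF _ f(1)])
    fix x assume "x \<in> space M"
    then show "(\<lambda>n. f n x) \<longlonglongrightarrow> g x"
      using f(2)[of x]
      by (rule_tac LIM_zero_cancel, rule_tac Lim_null_comparison[where g="\<lambda>n. 1 / Suc n"])
        (auto simp del: of_nat_Suc intro: LIMSEQ_Suc[OF lim_1_over_n])
  qed
qed auto

text \<open>A sequence together with its limit is coded as one function on \<open>nat\<close>: the
  limit at 0, the n-th term at \<open>Suc n\<close>. Convergence becomes membership, and the closure
  lemmas pass from simple tests to general integrands.\<close>

lemma uniform_algebra_LIMSEQ: "uniform_algebra UNIV {f. (\<lambda>n. f (Suc n)) \<longlonglongrightarrow> f 0}"
proof
  fix g :: "nat \<Rightarrow> real"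
  assume *: "\<And>e. e > 0 \<Longrightarrow> \<exists>f\<in>{f. (\<lambda>n. f (Suc n)) \<longlonglongrightarrow> f 0}. \<forall>t\<in>UNIV. \<bar>f t - g t\<bar> \<le> e"
  have "(\<lambda>n. g (Suc n)) \<longlonglongrightarrow> g 0"
  proof (rule tendstoI)
    fix e :: real assume "e > 0"
    then obtain f where f: "(\<lambda>n. f (Suc n)) \<longlonglongrightarrow> f 0" "\<And>t. \<bar>f t - g t\<bar> \<le> e / 3"
      using *[of "e / 3"] by auto
    from tendstoD[OF f(1), of "e/3"] \<open>e > 0\<close> have "\<forall>\<^sub>F n in sequentially. dist (f (Suc n)) (f 0) < e / 3" by auto
    then show "\<forall>\<^sub>F n in sequentially. dist (g (Suc n)) (g 0) < e"
    proof eventually_elim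
      case (elim n)
      then show ?case using f(2)[of "Suc n"] f(2)[of 0] unfolding dist_real_def by linarith
    qed
  qed
  then show "g \<in> {f. (\<lambda>n. f (Suc n)) \<longlonglongrightarrow> f 0}" by simp
qed (auto intro: tendsto_intros)

text \<open>Convergence to an unnamed limit, for the point of the compactness proof where no limit
  kernel exists yet. Being a Cauchy sequence survives uniform approximation.\<close>

lemma uniform_algebra_convergent: "uniform_algebra UNIV {f :: nat \<Rightarrow> real. convergent f}"
proof
  fix g :: "nat \<Rightarrow> real"
  assume *: "\<And>e. e > 0 \<Longrightarrow> \<exists>f\<in>{f. convergent f}. \<forall>t\<in>UNIV. \<bar>f t - g t\<bar> \<le> e"
  have "Cauchy g"
  proof (rule metric_CauchyI)
    fix e :: real assume "e > 0"
    then obtain f where f: "convergent f" "\<And>t. \<bar>f t - g t\<bar> \<le> e / 4" using *[of "e / 4"] by auto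
    then obtain M where "\<forall>m\<ge>M. \<forall>n\<ge>M. dist (f m) (f n) < e / 4"
      using metric_CauchyD[OF convergent_Cauchy[OF f(1)], of "e / 4"] \<open>e > 0\<close> by auto
    then show "\<exists>M. \<forall>m\<ge>M. \<forall>n\<ge>M. dist (g m) (g n) < e"
    proof (intro exI[of _ M] allI impI)
      fix m n assume "\<forall>m\<ge>M. \<forall>n\<ge>M. dist (f m) (f n) < e / 4" "m \<ge> M" "n \<ge> M"
      then have "\<bar>f m - f n\<bar> < e / 4" by (simp add: dist_real_def)
      then show "dist (g m) (g n) < e"
        using f(2)[of m] f(2)[of n] \<open>e > 0\<close> unfolding dist_real_def by linarith
    qed
  qed
  then show "g \<in> {f. convergent f}" by (simp add: Cauchy_convergent)
qed (auto intro: convergent_add convergent_mult convergent_const)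

text \<open>For this algebra the closure lemmas are uniqueness statements: two families of kernels
  with equal tests have equal costs, so the version of a kernel is immaterial.\<close>

lemma uniform_algebra_eq: "uniform_algebra UNIV {f. f a = f b}"
proof
  fix g :: "'a \<Rightarrow> real"
  assume *: "\<And>e. e > 0 \<Longrightarrow> \<exists>f\<in>{f. f a = f b}. \<forall>t\<in>UNIV. \<bar>f t - g t\<bar> \<le> e"
  have "\<bar>g a - g b\<bar> \<le> e" if e: "e > 0" for e
  proof -
    obtain f where "f a = f b" "\<And>t. \<bar>f t - g t\<bar> \<le> e / 2" using *[of "e/2"] half_gt_zero[OF e] by blast
    from this(1) this(2)[of a] this(2)[of b] show ?thesis by linarith
  qed
  then show "g \<in> {f. f a = f b}" using field_le_epsilon[of "\<bar>g a - g b\<bar>" 0] by auto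
qed auto

text \<open>A partition of unity whose members live within \<open>d\<close> of their centers. The
  centers \<open>p\<close> are kept apart from the index because product partitions are indexed by
  functions and pairs; on a single space the index is the center itself and \<open>p\<close> is
  \<open>id\<close>.\<close>

definition fine_partition :: "'x::metric_space set \<Rightarrow> real \<Rightarrow> 'i set \<Rightarrow> ('i \<Rightarrow> 'x) \<Rightarrow> ('i \<Rightarrow> 'x \<Rightarrow> real) \<Rightarrow> bool" where
  "fine_partition X d I p h \<longleftrightarrow> finite I \<and> (\<forall>x\<in>X. (\<Sum>i\<in>I. h i x) = 1) \<and>
     (\<forall>i\<in>I. p i \<in> X \<and> continuous_on X (h i) \<and> (\<forall>x\<in>X. 0 \<le> h i x \<and> h i x \<le> 1 \<and> (h i x \<noteq> 0 \<longrightarrow> dist x (p i) < d)))"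

text \<open>Tent functions of height \<open>d\<close> about a finite net, divided by their sum,
  which is positive because every point lies within \<open>d\<close> of the net.\<close>

lemma fine_partition_exists:
  fixes X :: "'x::metric_space set"
  assumes "compact X" "d > 0"
  shows "\<exists>I h. fine_partition X d I id h"
proof -
  have "X \<subseteq> (\<Union>x\<in>X. ball x d)" using \<open>d > 0\<close> by auto
  then obtain I where I: "I \<subseteq> X" "finite I" "X \<subseteq> (\<Union>x\<in>I. ball x d)"
    using compactE_image[OF \<open>compact X\<close>, of X "\<lambda>x. ball x d"] by auto
  define g where "g i x = max 0 (d - dist x i)" for i x :: 'x
  define G where "G x = (\<Sum>i\<in>I. g i x)" for x
  have G: "G x > 0" if "x \<in> X" for x
  proof -
    from that I obtain i where "i \<in> I" "dist x i < d" by (auto simp: dist_commute)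
    then show ?thesis
      unfolding G_def by (intro sum_pos2[OF \<open>finite I\<close>, of i]) (auto simp: g_def)
  qed
  have cg: "continuous_on X (g i)" for i unfolding g_def by (intro continuous_intros)
  have cG: "continuous_on X G" unfolding G_def by (intro continuous_intros cg)
  have "fine_partition X d I id (\<lambda>i x. g i x / G x)"
    unfolding fine_partition_def
  proof (intro conjI ballI impI)
    fix x assume "x \<in> X"
    then show "(\<Sum>i\<in>I. g i x / G x) = 1"
      using G[of x] by (simp add: sum_divide_distrib[symmetric] G_def[symmetric])
    fix i assume i: "i \<in> I"
    have "g i x \<le> G x" unfolding G_def using i I by (intro member_le_sum) (auto simp: g_def)
    then show "g i x / G x \<le> 1" using G[OF \<open>x \<in> X\<close>] by simp
    show "0 \<le> g i x / G x" using G[OF \<open>x \<in> X\<close>] by (auto simp: g_def)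
    assume "g i x / G x \<noteq> 0"
    then show "dist x (id i) < d" by (auto simp: g_def max_def split: if_splits)
  next
    fix i assume "i \<in> I"
    then show "id i \<in> X" using I by auto
    show "continuous_on X (\<lambda>x. g i x / G x)"
      using G by (intro continuous_intros cg cG) force
  qed (use I in auto)
  then show ?thesis by blast
qed

text \<open>The sum is a convex combination of values of \<open>f\<close> at centers that carry
  weight at \<open>x\<close>, and these lie within \<open>d\<close> of \<open>x\<close>.\<close>

lemma fine_partition_approx:
  fixes f :: "'x::metric_space \<Rightarrow> real"
  assumes P: "fine_partition X d I p h" and x: "x \<in> X"
    and f: "\<And>y. y \<in> X \<Longrightarrow> dist x y < d \<Longrightarrow> \<bar>f x - f y\<bar> \<le> e"
  shows "\<bar>f x - (\<Sum>i\<in>I. f (p i) * h i x)\<bar> \<le> e"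
proof -
  have s: "(\<Sum>i\<in>I. h i x) = 1" using P x by (auto simp: fine_partition_def)
  have "f x - (\<Sum>i\<in>I. f (p i) * h i x) = (\<Sum>i\<in>I. (f x - f (p i)) * h i x)"
    using s by (simp add: left_diff_distrib sum_subtractf sum_distrib_left[symmetric])
  also have "\<bar>\<dots>\<bar> \<le> (\<Sum>i\<in>I. e * h i x)"
  proof (rule order_trans[OF sum_abs], rule sum_mono)
    fix i assume i: "i \<in> I"
    then have *: "p i \<in> X" "0 \<le> h i x" "h i x \<noteq> 0 \<longrightarrow> dist x (p i) < d"
      using P x by (auto simp: fine_partition_def)
    show "\<bar>(f x - f (p i)) * h i x\<bar> \<le> e * h i x"
    proof (cases "h i x = 0")
      case False
      then show ?thesis using * f[of "p i"] by (simp add: abs_mult mult_right_mono)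
    qed simp
  qed
  also have "\<dots> = e" using s by (simp add: sum_distrib_left[symmetric])
  finally show ?thesis .
qed

lemma fine_partition_abs_le:
  fixes f :: "'x::metric_space \<Rightarrow> real"
  assumes P: "fine_partition X d I p h" and x: "x \<in> X" and f: "\<And>y. y \<in> X \<Longrightarrow> \<bar>f y\<bar> \<le> C"
  shows "\<bar>\<Sum>i\<in>I. f (p i) * h i x\<bar> \<le> C"
proof -
  have "\<bar>\<Sum>i\<in>I. f (p i) * h i x\<bar> \<le> (\<Sum>i\<in>I. C * h i x)"
    using P x f by (intro order_trans[OF sum_abs] sum_mono)
      (auto simp: fine_partition_def abs_mult intro!: mult_right_mono)
  also have "\<dots> = C" using P x by (simp add: sum_distrib_left[symmetric] fine_partition_def)
  finally show ?thesis .
qed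

text \<open>The distance on \<open>nat \<Rightarrow> 'x\<close> is a weighted series over the
  coordinates. Its tail is small by itself, its first terms are controlled coordinatewise, and
  coordinates from \<open>N\<close> on agree because both profiles are \<open>undefined\<close>
  there.\<close>

lemma fine_partition_PiE:
  fixes X :: "'x::metric_space set" and N :: nat
  assumes "d > 0"
  shows "\<exists>e>0. \<forall>I p h. fine_partition X e I p h \<longrightarrow>
    fine_partition (PiE {..<N} (\<lambda>_. X)) d (PiE {..<N} (\<lambda>_. I))
      (\<lambda>i. \<lambda>k\<in>{..<N}. p (i k)) (\<lambda>i u. \<Prod>k<N. h (i k) (u k))"
proof -
  obtain m where m: "(1/2) ^ m < d / 2"
    using real_arch_pow_inv[of "d/2" "1/2"] \<open>d > 0\<close> by auto
  \<comment> \<open>Twice \<open>d / 5\<close> from the first coordinates and less than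
    \<open>d / 2\<close> from the tail stay below \<open>d\<close>.\<close>
  let ?e = "d / 5"
  have "fine_partition (PiE {..<N} (\<lambda>_. X)) d (PiE {..<N} (\<lambda>_. I))
      (\<lambda>i. \<lambda>k\<in>{..<N}. p (i k)) (\<lambda>i u. \<Prod>k<N. h (i k) (u k))"
    if P: "fine_partition X ?e I p h" for I :: "'i set" and p h
    unfolding fine_partition_def
  proof (intro conjI ballI impI)
    show "finite (PiE {..<N} (\<lambda>_. I))" using P by (intro finite_PiE) (auto simp: fine_partition_def)
  next
    fix u assume u: "u \<in> PiE {..<N} (\<lambda>_. X)"
    have "(\<Sum>i\<in>PiE {..<N} (\<lambda>_. I). \<Prod>k<N. h (i k) (u k)) = (\<Prod>k<N. \<Sum>i\<in>I. h i (u k))"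
      using P by (subst prod_sum_PiE) (auto simp: fine_partition_def)
    also have "\<dots> = 1" using P u by (intro prod.neutral) (auto simp: fine_partition_def PiE_iff)
    finally show "(\<Sum>i\<in>PiE {..<N} (\<lambda>_. I). \<Prod>k<N. h (i k) (u k)) = 1" .
    fix i assume i: "i \<in> PiE {..<N} (\<lambda>_. I)"
    have hk: "0 \<le> h (i k) (u k)" "h (i k) (u k) \<le> 1" "h (i k) (u k) \<noteq> 0 \<Longrightarrow> dist (u k) (p (i k)) < ?e" if "k < N" for k
      using P i u that by (auto simp: fine_partition_def PiE_iff)
    show "0 \<le> (\<Prod>k<N. h (i k) (u k))" using hk by (intro prod_nonneg) auto
    show "(\<Prod>k<N. h (i k) (u k)) \<le> 1" using hk by (intro prod_le_1) auto
    assume ne: "(\<Prod>k<N. h (i k) (u k)) \<noteq> 0"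
    have c: "dist (u k) ((\<lambda>k\<in>{..<N}. p (i k)) k) \<le> ?e" for k
    proof (cases "k < N")
      case True
      then have "h (i k) (u k) \<noteq> 0" using ne by (metis finite_lessThan lessThan_iff prod_zero)
      then show ?thesis using hk(3)[OF True] True by simp
    next
      case False
      then show ?thesis using u \<open>d > 0\<close> by (simp add: PiE_iff extensional_def)
    qed
    have "dist u (\<lambda>k\<in>{..<N}. p (i k)) \<le>
       2 * Max {dist (u (from_nat n)) ((\<lambda>k\<in>{..<N}. p (i k)) (from_nat n)) |n. n \<le> m} + (1/2) ^ m"
      by (rule dist_fun_le_dist_first_terms)
    also have "Max {dist (u (from_nat n)) ((\<lambda>k\<in>{..<N}. p (i k)) (from_nat n)) |n. n \<le> m} \<le> ?e"
    proof (subst Max_le_iff)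
      show "\<forall>a\<in>{dist (u (from_nat n)) ((\<lambda>k\<in>{..<N}. p (i k)) (from_nat n)) |n. n \<le> m}. a \<le> ?e"
        using c by blast
    qed auto
    finally show "dist u (\<lambda>k\<in>{..<N}. p (i k)) < d" using m \<open>d > 0\<close> by linarith
  next
    fix i assume i: "i \<in> PiE {..<N} (\<lambda>_. I)"
    show "(\<lambda>k\<in>{..<N}. p (i k)) \<in> PiE {..<N} (\<lambda>_. X)"
      using P i by (auto simp: fine_partition_def PiE_iff)
    show "continuous_on (PiE {..<N} (\<lambda>_. X)) (\<lambda>u. \<Prod>k<N. h (i k) (u k))"
    proof (intro continuous_on_prod)
      fix k assume "k \<in> {..<N}"
      then have "continuous_on X (h (i k))" using P i by (auto simp: fine_partition_def PiE_iff)
      moreover have "continuous_on (PiE {..<N} (\<lambda>_. X)) (\<lambda>u. u k)"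
        by (rule continuous_on_product_then_coordinatewise[OF continuous_on_id])
      ultimately show "continuous_on (PiE {..<N} (\<lambda>_. X)) (\<lambda>u. h (i k) (u k))"
        using \<open>k \<in> _\<close> by (intro continuous_on_compose2[of X "h (i k)" _ "\<lambda>u. u k"]) (auto simp: PiE_iff)
    qed
  qed
  then show ?thesis using \<open>d > 0\<close> by (intro exI[of _ ?e]) auto
qed

text \<open>Half of \<open>d\<close> for each factor suffices, since the Euclidean distance of pairs
  is at most the sum of the two distances.\<close>

lemma fine_partition_Times:
  assumes "fine_partition X (d/2) I p h" "fine_partition X' (d/2) I' p' h'"
  shows "fine_partition (X \<times> X') d (I \<times> I') (\<lambda>(i, j). (p i, p' j)) (\<lambda>(i, j) (u, v). h i u * h' j v)"
  unfolding fine_partition_def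
proof (intro conjI ballI impI)
  note P = assms[unfolded fine_partition_def]
  show "finite (I \<times> I')" using P by auto
  fix x assume x: "x \<in> X \<times> X'"
  obtain u v where uv: "x = (u, v)" "u \<in> X" "v \<in> X'" using x by auto
  have "(\<Sum>(i,j)\<in>I \<times> I'. h i u * h' j v) = (\<Sum>i\<in>I. h i u) * (\<Sum>j\<in>I'. h' j v)"
    by (simp add: sum_product sum.cartesian_product)
  then show "(\<Sum>i\<in>I \<times> I'. (case i of (i, j) \<Rightarrow> \<lambda>(u, v). h i u * h' j v) x) = 1"
    using P uv by (simp add: split_beta)
  fix i assume "i \<in> I \<times> I'"
  then obtain a b where ab: "i = (a, b)" "a \<in> I" "b \<in> I'" by auto
  have 1: "0 \<le> h a u" "h a u \<le> 1" "h a u \<noteq> 0 \<Longrightarrow> dist u (p a) < d/2"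
    and 2: "0 \<le> h' b v" "h' b v \<le> 1" "h' b v \<noteq> 0 \<Longrightarrow> dist v (p' b) < d/2"
    using P uv ab by auto
  show "0 \<le> (case i of (i, j) \<Rightarrow> \<lambda>(u, v). h i u * h' j v) x" using 1 2 uv ab by auto
  show "(case i of (i, j) \<Rightarrow> \<lambda>(u, v). h i u * h' j v) x \<le> 1" using 1 2 uv ab by (auto intro: mult_le_one)
  assume "(case i of (i, j) \<Rightarrow> \<lambda>(u, v). h i u * h' j v) x \<noteq> 0"
  then have "dist u (p a) < d/2" "dist v (p' b) < d/2" using 1 2 uv ab by auto
  then show "dist x (case i of (i, j) \<Rightarrow> (p i, p' j)) < d"
    using uv ab sqrt_sum_squares_le_sum[of "dist u (p a)" "dist v (p' b)"] by (simp add: dist_Pair_Pair)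
next
  note P = assms[unfolded fine_partition_def]
  fix i assume "i \<in> I \<times> I'"
  then obtain a b where ab: "i = (a, b)" "a \<in> I" "b \<in> I'" by auto
  show "(case i of (i, j) \<Rightarrow> (p i, p' j)) \<in> X \<times> X'" using P ab by auto
  have "continuous_on X (h a)" "continuous_on X' (h' b)" using P ab by auto
  then show "continuous_on (X \<times> X') (case i of (i, j) \<Rightarrow> \<lambda>(u, v). h i u * h' j v)"
    unfolding ab split_beta
    by (auto intro!: continuous_on_mult continuous_on_compose2[of X "h a" _ fst] continuous_on_compose2[of X' "h' b" _ snd] continuous_intros)
qed

text \<open>Pushing \<open>K w\<close> forward along \<open>Pair w\<close> moves the dependence on
  \<open>w\<close> from the integrand into the kernel, so that only a fixed function is
  integrated.\<close>

lemma borel_measurable_integral_kernel: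
  fixes G :: "'w \<Rightarrow> 'x \<Rightarrow> real"
  assumes "K \<in> M \<rightarrow>\<^sub>M prob_algebra N" and G[measurable]: "(\<lambda>(w, x). G w x) \<in> borel_measurable (M \<Otimes>\<^sub>M N)"
  shows "(\<lambda>w. \<integral>x. G w x \<partial>K w) \<in> borel_measurable M"
proof -
  have K[measurable]: "K \<in> M \<rightarrow>\<^sub>M subprob_algebra N" using assms(1) by (rule measurable_prob_algebraD)
  have [measurable]: "(\<lambda>w. distr (K w) (M \<Otimes>\<^sub>M N) (Pair w)) \<in> M \<rightarrow>\<^sub>M subprob_algebra (M \<Otimes>\<^sub>M N)"
    by (rule measurable_distr2[OF _ K]) simp
  have "(\<lambda>w. \<integral>z. (case z of (w, x) \<Rightarrow> G w x) \<partial>distr (K w) (M \<Otimes>\<^sub>M N) (Pair w)) \<in> borel_measurable M"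
    by measurable
  then show ?thesis
  proof (rule measurable_cong[THEN iffD1, rotated])
    fix w assume w: "w \<in> space M"
    then have "sets (K w) = sets N" using measurable_space[OF K] by (auto simp: space_subprob_algebra)
    then have "Pair w \<in> K w \<rightarrow>\<^sub>M M \<Otimes>\<^sub>M N" using w by (simp add: measurable_Pair1' cong: measurable_cong_sets)
    then show "(\<integral>z. (case z of (w, x) \<Rightarrow> G w x) \<partial>distr (K w) (M \<Otimes>\<^sub>M N) (Pair w)) = (\<integral>x. G w x \<partial>K w)"
      using integral_distr[OF _ G, of "Pair w" "K w"] by simp
  qed
qed

lemma (in prob_space) integral_abs_le_const:
  fixes f :: "'a \<Rightarrow> real"
  assumes "\<And>x. x \<in> space M \<Longrightarrow> \<bar>f x\<bar> \<le> C"
  shows "\<bar>\<integral>x. f x \<partial>M\<bar> \<le> C"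
proof (cases "integrable M f")
  case True
  have "\<bar>\<integral>x. f x \<partial>M\<bar> \<le> (\<integral>x. \<bar>f x\<bar> \<partial>M)" by simp
  also have "\<dots> \<le> C" using True assms by (intro integral_le_const) auto
  finally show ?thesis .
next
  case False
  \<comment> \<open>Without integrability the integral is 0 by convention, so
    \<open>0 \<le> C\<close> is left to show, and a point of the nonempty space provides it.\<close>
  obtain x where "x \<in> space M" using not_empty by auto
  with assms[of x] False show ?thesis by (simp add: not_integrable_integral_eq)
qed

text \<open>The partition replaces the integrand by a sum of products of a function of
  \<open>w\<close> and a function of \<open>x\<close>. The error is bounded by \<open>e n w\<close>,
  free of \<open>t\<close>, and vanishes in the mean by dominated convergence; thus the
  approximation is uniform in \<open>t\<close> although \<open>G\<close> is only measurable in
  \<open>w\<close>.\<close>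

lemma (in uniform_algebra) integral_caratheodory:
  fixes X :: "'x::{metric_space,second_countable_topology} set"
  assumes \<mu>: "finite_measure \<mu>" and X: "compact X" "X \<noteq> {}" and N: "space N = X"
    and \<kappa>: "\<And>t. t \<in> T \<Longrightarrow> \<kappa> t \<in> \<mu> \<rightarrow>\<^sub>M prob_algebra N"
    and Gm[measurable]: "(\<lambda>(w, x). G w x) \<in> borel_measurable (\<mu> \<Otimes>\<^sub>M N)"
    and Gc: "\<And>w. w \<in> space \<mu> \<Longrightarrow> continuous_on X (G w)"
    and Gb: "\<And>w x. w \<in> space \<mu> \<Longrightarrow> x \<in> X \<Longrightarrow> \<bar>G w x\<bar> \<le> C"
    and P: "\<And>n::nat. fine_partition X (1 / Suc n) (I n) (p n) (h n)"
    and hm: "\<And>n i. i \<in> I n \<Longrightarrow> h n i \<in> borel_measurable N"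
    and base: "\<And>n i \<phi>. i \<in> I n \<Longrightarrow> \<phi> \<in> borel_measurable \<mu> \<Longrightarrow> (\<And>w. w \<in> space \<mu> \<Longrightarrow> \<bar>\<phi> w\<bar> \<le> C) \<Longrightarrow>
        (\<lambda>t. \<integral>w. \<phi> w * (\<integral>x. h n i x \<partial>\<kappa> t w) \<partial>\<mu>) \<in> F"
  shows "(\<lambda>t. \<integral>w. (\<integral>x. G w x \<partial>\<kappa> t w) \<partial>\<mu>) \<in> F"
proof -
  interpret finite_measure \<mu> by fact
  define Gn where "Gn n w x = (\<Sum>i\<in>I n. G w (p n i) * h n i x)" for n w x
  have p: "p n i \<in> X" "p n i \<in> space N" if "i \<in> I n" for n i using P[of n] that N by (auto simp: fine_partition_def)
  note [measurable] = hm
  have Gpm: "(\<lambda>w. G w (p n i)) \<in> borel_measurable \<mu>" if "i \<in> I n" for n i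
  proof -
    have "(\<lambda>w. case (w, p n i) of (w, x) \<Rightarrow> G w x) \<in> borel_measurable \<mu>"
      using p[OF that] by measurable
    then show ?thesis by simp
  qed
  have Gnm: "(\<lambda>(w, x). Gn n w x) \<in> borel_measurable (\<mu> \<Otimes>\<^sub>M N)" for n
    unfolding Gn_def split_beta
    by (intro borel_measurable_sum borel_measurable_times measurable_compose[OF measurable_fst Gpm] measurable_compose[OF measurable_snd hm])
  have Gnb: "\<bar>Gn n w x\<bar> \<le> C" if "w \<in> space \<mu>" "x \<in> X" for n w x
    unfolding Gn_def by (rule fine_partition_abs_le[OF P that(2) Gb[OF that(1)]])
  have Gnc: "continuous_on X (Gn n w)" if "w \<in> space \<mu>" for n w
    unfolding Gn_def using P[of n] by (intro continuous_intros) (auto simp: fine_partition_def)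
  \<comment> \<open>A countable dense set makes the supremum \<open>e n w\<close> measurable in
    \<open>w\<close>; continuity in \<open>x\<close> extends its bound to all of
    \<open>X\<close>.\<close>
  obtain D where D: "countable D" "D \<subseteq> X" "X \<subseteq> closure D" using separable by blast
  have clD: "closure D = X" using D X by (simp add: closure_minimal compact_imp_closed subset_antisym)
  have Dne: "D \<noteq> {}" using clD X by auto
  define e where "e n w = (SUP x\<in>D. \<bar>G w x - Gn n w x\<bar>)" for n w
  have bd: "\<bar>G w x - Gn n w x\<bar> \<le> 2 * C" if "w \<in> space \<mu>" "x \<in> X" for n w x
    using Gb[OF that] Gnb[OF that, of n] by linarith
  have bdd: "bdd_above ((\<lambda>x. \<bar>G w x - Gn n w x\<bar>) ` D)" if "w \<in> space \<mu>" for n w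
    using bd[OF that] D(2) by (auto intro!: bdd_aboveI2[where M="2 * C"])
  have em[measurable]: "e n \<in> borel_measurable \<mu>" for n
    unfolding e_def
  proof (rule borel_measurable_cSUP[OF D(1) _ bdd])
    fix x assume "x \<in> D"
    then have x: "x \<in> space N" using D N by auto
    have "(\<lambda>w. case (w, x) of (w, x) \<Rightarrow> G w x) \<in> borel_measurable \<mu>" using x by measurable
    moreover have "(\<lambda>w. case (w, x) of (w, x) \<Rightarrow> Gn n w x) \<in> borel_measurable \<mu>"
      by (rule measurable_compose[OF measurable_Pair2'[OF x] Gnm])
    ultimately show "(\<lambda>w. \<bar>G w x - Gn n w x\<bar>) \<in> borel_measurable \<mu>" by simp
  qed
  have le_e: "\<bar>G w x - Gn n w x\<bar> \<le> e n w" if w: "w \<in> space \<mu>" and x: "x \<in> X" for n w x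
  proof (rule continuous_le_on_closure[where S=D])
    show "continuous_on (closure D) (\<lambda>x. \<bar>G w x - Gn n w x\<bar>)"
      unfolding clD by (intro continuous_intros Gc Gnc w)
    show "x \<in> closure D" using x clD by simp
    show "\<And>x. x \<in> D \<Longrightarrow> \<bar>G w x - Gn n w x\<bar> \<le> e n w"
      unfolding e_def by (rule cSUP_upper[OF _ bdd[OF w]])
  qed
  have e0: "0 \<le> e n w" if "w \<in> space \<mu>" for n w
    using le_e[OF that, of _ n] X(2) by force
  have e_le: "e n w \<le> 2 * C" if "w \<in> space \<mu>" for n w
    unfolding e_def using bd[OF that] D Dne by (intro cSUP_least) auto
  \<comment> \<open>Pointwise in \<open>w\<close>: uniform continuity of \<open>G w\<close> on the
    compact \<open>X\<close> eventually beats the mesh \<open>1 / (n + 1)\<close>. The rate may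
    depend on \<open>w\<close>; the constant \<open>2 * C\<close> dominates.\<close>
  have e_lim: "(\<lambda>n. e n w) \<longlonglongrightarrow> 0" if w: "w \<in> space \<mu>" for w
  proof (rule tendstoI)
    fix r :: real assume r: "r > 0"
    have "uniformly_continuous_on X (G w)" using Gc[OF w] X by (intro compact_uniformly_continuous)
    then obtain d where d: "d > 0" "\<And>x y. x \<in> X \<Longrightarrow> y \<in> X \<Longrightarrow> dist y x < d \<Longrightarrow> dist (G w y) (G w x) < r / 2"
      unfolding uniformly_continuous_on_def using r by (metis half_gt_zero)
    have "\<forall>\<^sub>F n in sequentially. 1 / Suc n < d"
      using d(1) LIMSEQ_Suc[OF lim_1_over_n] by (rule order_tendstoD(2)[rotated])
    then show "\<forall>\<^sub>F n in sequentially. dist (e n w) 0 < r"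
    proof eventually_elim
      case (elim n)
      have "e n w \<le> r / 2"
        unfolding e_def Gn_def
      proof (intro cSUP_least Dne fine_partition_approx[OF P])
        fix x y assume "x \<in> D" "y \<in> X" "dist x y < 1 / Suc n"
        then show "\<bar>G w x - G w y\<bar> \<le> r / 2" using d(2)[of y x] D elim by (auto simp: dist_real_def)
      qed (use D in auto)
      then show ?case using e0[OF w, of n] r by (simp add: dist_real_def)
    qed
  qed
  have lim: "(\<lambda>n. \<integral>w. e n w \<partial>\<mu>) \<longlonglongrightarrow> 0"
  proof -
    have "(\<lambda>n. \<integral>w. e n w \<partial>\<mu>) \<longlonglongrightarrow> (\<integral>w. 0 \<partial>\<mu>)"
      by (rule integral_dominated_convergence[where w="\<lambda>_. 2 * C"]) (use e_lim e0 e_le in \<open>auto intro!: AE_I2\<close>)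
    then show ?thesis by simp
  qed
  have Fn: "(\<lambda>t. \<Sum>i\<in>I n. \<integral>w. G w (p n i) * (\<integral>x. h n i x \<partial>\<kappa> t w) \<partial>\<mu>) \<in> F" for n
    by (intro sum base Gpm Gb p)
  show ?thesis
  proof (rule limit[OF Fn lim])
    fix n t assume t: "t \<in> T"
    have \<kappa>w: "prob_space (\<kappa> t w)" "sets (\<kappa> t w) = sets N" if "w \<in> space \<mu>" for w
      using measurable_space[OF \<kappa>[OF t] that] by (auto simp: space_prob_algebra)
    have sp: "space (\<kappa> t w) = X" if "w \<in> space \<mu>" for w using sets_eq_imp_space_eq[OF \<kappa>w(2)[OF that]] N by simp
    have hb: "\<bar>h n i x\<bar> \<le> 1" if "i \<in> I n" "x \<in> X" for i x using P[of n] that by (auto simp: fine_partition_def)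
    have hint: "integrable (\<kappa> t w) (h n i)" if "w \<in> space \<mu>" "i \<in> I n" for w i
      using hb[OF that(2)] sp[OF that(1)] hm[OF that(2)] \<kappa>w[OF that(1)]
      by (intro finite_measure.integrable_const_bound[where B=1] prob_space.finite_measure AE_I2) (auto cong: measurable_cong_sets)
    have hkm: "(\<lambda>w. \<integral>x. h n i x \<partial>\<kappa> t w) \<in> borel_measurable \<mu>" if "i \<in> I n" for i
      using that by (intro borel_measurable_integral_kernel[OF \<kappa>[OF t]]) measurable
    have hkb: "\<bar>\<integral>x. h n i x \<partial>\<kappa> t w\<bar> \<le> 1" if "w \<in> space \<mu>" "i \<in> I n" for w i
      using hb[OF that(2)] sp[OF that(1)] by (intro prob_space.integral_abs_le_const \<kappa>w that) auto
    have int1: "integrable \<mu> (\<lambda>w. G w (p n i) * (\<integral>x. h n i x \<partial>\<kappa> t w))" if i: "i \<in> I n" for i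
    proof (rule integrable_const_bound[where B=C], rule AE_I2)
      fix w assume w: "w \<in> space \<mu>"
      show "norm (G w (p n i) * (\<integral>x. h n i x \<partial>\<kappa> t w)) \<le> C"
        using mult_mono[OF Gb[OF w p(1)[OF i]] hkb[OF w i]] Gb[OF w p(1)[OF i]] by (simp add: abs_mult)
    qed (intro borel_measurable_times Gpm hkm i)
    have GG: "integrable \<mu> (\<lambda>w. \<integral>x. G w x \<partial>\<kappa> t w)"
      using Gb sp by (intro integrable_const_bound[where B=C] AE_I2 borel_measurable_integral_kernel[OF \<kappa>[OF t] Gm])
        (auto intro!: prob_space.integral_abs_le_const \<kappa>w)
    have Gint: "integrable (\<kappa> t w) (f w)" if w: "w \<in> space \<mu>" and f: "\<And>w x. w \<in> space \<mu> \<Longrightarrow> x \<in> X \<Longrightarrow> \<bar>f w x\<bar> \<le> C"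
      "(\<lambda>(w, x). f w x) \<in> borel_measurable (\<mu> \<Otimes>\<^sub>M N)" for w f
    proof -
      have "f w \<in> borel_measurable N" using measurable_compose[OF measurable_Pair1'[OF w] f(2)] by simp
      then show ?thesis
        using f(1)[OF w] sp[OF w] \<kappa>w[OF w]
        by (intro finite_measure.integrable_const_bound[where B=C] prob_space.finite_measure AE_I2) (auto cong: measurable_cong_sets)
    qed
    have "(\<Sum>i\<in>I n. \<integral>w. G w (p n i) * (\<integral>x. h n i x \<partial>\<kappa> t w) \<partial>\<mu>) - (\<integral>w. (\<integral>x. G w x \<partial>\<kappa> t w) \<partial>\<mu>)
       = (\<integral>w. ((\<Sum>i\<in>I n. G w (p n i) * (\<integral>x. h n i x \<partial>\<kappa> t w)) - (\<integral>x. G w x \<partial>\<kappa> t w)) \<partial>\<mu>)"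
      by (simp add: Bochner_Integration.integral_sum int1 GG Bochner_Integration.integral_diff)
    also have "\<bar>\<dots>\<bar> \<le> (\<integral>w. e n w \<partial>\<mu>)"
    proof (intro integral_abs_bound[THEN order_trans] integral_mono integrable_abs Bochner_Integration.integrable_diff
        Bochner_Integration.integrable_sum int1 GG)
      show "integrable \<mu> (e n)" using e0 e_le by (intro integrable_const_bound[where B="2 * C"] AE_I2) auto
      fix w assume w: "w \<in> space \<mu>"
      have "(\<Sum>i\<in>I n. G w (p n i) * (\<integral>x. h n i x \<partial>\<kappa> t w)) = (\<integral>x. Gn n w x \<partial>\<kappa> t w)"
        unfolding Gn_def using hint[OF w] by (simp add: Bochner_Integration.integral_sum)
      also have "\<dots> - (\<integral>x. G w x \<partial>\<kappa> t w) = (\<integral>x. Gn n w x - G w x \<partial>\<kappa> t w)"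
        using Gint[OF w Gb Gm] Gint[OF w Gnb Gnm] by simp
      also have "\<bar>\<dots>\<bar> \<le> e n w"
        using le_e[OF w] sp[OF w] by (intro prob_space.integral_abs_le_const \<kappa>w w) (simp add: abs_minus_commute)
      finally show "\<bar>(\<Sum>i\<in>I n. G w (p n i) * (\<integral>x. h n i x \<partial>\<kappa> t w)) - (\<integral>x. G w x \<partial>\<kappa> t w)\<bar> \<le> e n w" .
    qed
    finally show "\<bar>(\<Sum>i\<in>I n. \<integral>w. G w (p n i) * (\<integral>x. h n i x \<partial>\<kappa> t w) \<partial>\<mu>) - (\<integral>w. (\<integral>x. G w x \<partial>\<kappa> t w) \<partial>\<mu>)\<bar> \<le> (\<integral>w. e n w \<partial>\<mu>)" .
  qed
qed

section \<open>Compact metric spaces as images of compact sets of reals\<close>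

text \<open>Even, of period 2, equal to 0 on \<open>[0, 1/3]\<close> and to 1 on
  \<open>[2/3, 1]\<close>: a clipped cosine in place of the usual piecewise linear wave. These
  properties let it read off ternary digits.\<close>

definition schoenberg_wave :: "real \<Rightarrow> real" where
  "schoenberg_wave t = max 0 (min 1 (1/2 - cos (pi * t)))"

lemma schoenberg_wave_continuous: "continuous_on A schoenberg_wave"
  unfolding schoenberg_wave_def by (intro continuous_intros)

lemma schoenberg_wave_bounds: "0 \<le> schoenberg_wave t" "schoenberg_wave t \<le> 1"
  by (auto simp: schoenberg_wave_def)

text \<open>Points of Cantor's set, given by digits 0 and 2. Integer parts after a shift are then
  even, which matches the period of the wave.\<close>

definition ternary :: "(nat \<Rightarrow> bool) \<Rightarrow> real" where
  "ternary b = (\<Sum>m. 2 * of_bool (b m) * (1/3) ^ Suc m)"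

lemma ternary_summable: "summable (\<lambda>m. 2 * of_bool (b m) * (1/3::real) ^ Suc m)"
  by (rule summable_comparison_test'[of "\<lambda>m. 2 * (1/3::real) ^ Suc m" 0])
    (auto intro!: summable_mult summable_Suc_iff[THEN iffD2] summable_geometric)

lemma ternary_bounds: "0 \<le> ternary b" "ternary b \<le> 1"
proof -
  show "0 \<le> ternary b" unfolding ternary_def by (intro suminf_nonneg ternary_summable) auto
  have s: "(\<lambda>m. 2 * (1/3::real) ^ Suc m) sums 1"
    using sums_mult[OF geometric_sums[of "1/3::real"], of "2/3"] by simp
  have "ternary b \<le> (\<Sum>m. 2 * (1/3::real) ^ Suc m)"
    unfolding ternary_def by (intro suminf_le ternary_summable sums_summable[OF s]) auto
  then show "ternary b \<le> 1" using sums_unique[OF s] by simp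
qed

lemma ternary_shift: "3 * ternary b = 2 * of_bool (b 0) + ternary (\<lambda>m. b (Suc m))"
proof -
  have "3 * ternary b = 2 * of_bool (b 0) + 3 * (\<Sum>m. 2 * of_bool (b (Suc m)) * (1/3) ^ Suc (Suc m))"
    unfolding ternary_def using suminf_split_head[OF ternary_summable[of b]] by simp
  also have "3 * (\<Sum>m. 2 * of_bool (b (Suc m)) * (1/3) ^ Suc (Suc m)) = ternary (\<lambda>m. b (Suc m))"
    unfolding ternary_def
    by (subst suminf_mult[symmetric])
      (use ternary_summable[of b, THEN summable_Suc_iff[THEN iffD2]] in \<open>simp_all add: mult.assoc\<close>)
  finally show ?thesis .
qed

lemma schoenberg_wave_add_even: "schoenberg_wave (2 * of_int k + t) = schoenberg_wave t"
proof -
  have "cos (pi * (2 * of_int k + t)) = cos (2 * pi * of_int k + pi * t)" by (simp add: algebra_simps)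
  also have "\<dots> = cos (pi * t)" by (simp add: cos_add)
  finally show ?thesis by (simp add: schoenberg_wave_def)
qed

lemma schoenberg_wave_ternary_0: "schoenberg_wave (ternary b) = of_bool (b 0)"
proof -
  have t: "ternary b = (2 * of_bool (b 0) + ternary (\<lambda>m. b (Suc m))) / 3" using ternary_shift[of b] by simp
  note bnd = ternary_bounds[of "\<lambda>m. b (Suc m)"]
  show ?thesis
  proof (cases "b 0")
    case True
    have "2/3 \<le> ternary b" "ternary b \<le> 1" using t True bnd by auto
    then have "cos (pi * ternary b) \<le> cos (pi * (2/3))"
      by (intro cos_monotone_0_pi_le) auto
    also have "\<dots> = - (1/2)" using cos_120' by (simp add: mult.commute)
    finally show ?thesis using True by (simp add: schoenberg_wave_def)
  next
    case False
    have "0 \<le> ternary b" "ternary b \<le> 1/3" using t False bnd by auto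
    then have "cos (pi * (1/3)) \<le> cos (pi * ternary b)"
      by (intro cos_monotone_0_pi_le) auto
    moreover have "cos (pi * (1/3)) = 1/2" using cos_60 by simp
    ultimately show ?thesis using False by (simp add: schoenberg_wave_def)
  qed
qed

text \<open>Multiplication by \<open>3 ^ m\<close> moves \<open>m\<close> digits in front of the
  point. As all digits are 0 or 2 these form an even integer, a period of the wave, and the rest has
  first digit given by \<open>b m\<close>.\<close>

lemma schoenberg_wave_ternary: "schoenberg_wave (3 ^ m * ternary b) = of_bool (b m)"
proof -
  have "\<exists>k::int. 3 ^ m * ternary b = 2 * of_int k + ternary (\<lambda>i. b (m + i))"
  proof (induction m)
    case 0 show ?case by (intro exI[of _ 0]) simp
  next
    case (Suc m)
    then obtain k :: int where "3 ^ m * ternary b = 2 * of_int k + ternary (\<lambda>i. b (m + i))" by blast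
    then have "3 ^ Suc m * ternary b = 2 * of_int (3 * k) + 3 * ternary (\<lambda>i. b (m + i))" by simp
    also have "\<dots> = 2 * of_int (3 * k + of_bool (b m)) + ternary (\<lambda>i. b (Suc m + i))"
      by (subst ternary_shift) simp
    finally show ?case by blast
  qed
  then obtain k :: int where "3 ^ m * ternary b = 2 * of_int k + ternary (\<lambda>i. b (m + i))" by blast
  then show ?thesis by (simp add: schoenberg_wave_add_even schoenberg_wave_ternary_0)
qed

text \<open>The coordinates of Schoenberg's curve, which maps \<open>{0..1}\<close> onto the Hilbert cube.\<close>

definition schoenberg :: "nat \<Rightarrow> real \<Rightarrow> real" where
  "schoenberg j t = (\<Sum>i. (1/2) ^ Suc i * schoenberg_wave (3 ^ prod_encode (j, i) * t))"

lemma schoenberg_continuous: "continuous_on A (schoenberg j)"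
proof -
  have "uniform_limit A (\<lambda>n t. \<Sum>i<n. (1/2) ^ Suc i * schoenberg_wave (3 ^ prod_encode (j, i) * t)) (schoenberg j) sequentially"
    unfolding schoenberg_def
  proof (rule Weierstrass_m_test)
    show "norm ((1/2) ^ Suc i * schoenberg_wave (3 ^ prod_encode (j, i) * t)) \<le> (1/2) ^ Suc i" for i t
      using schoenberg_wave_bounds[of "3 ^ prod_encode (j, i) * t"] by (simp add: abs_mult mult_left_le)
    show "summable (\<lambda>i. (1/2::real) ^ Suc i)" by (intro summable_Suc_iff[THEN iffD2] summable_geometric) simp
  qed
  then show ?thesis
    by (rule uniform_limit_theorem[rotated])
      (auto intro!: always_eventually continuous_intros continuous_on_compose2[OF schoenberg_wave_continuous[of UNIV]])
qed

lemma binary_expansion: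
  assumes "0 \<le> x" "x \<le> (1::real)"
  obtains b where "x = (\<Sum>i. (1/2) ^ Suc i * of_bool (b i))"
proof -
  \<comment> \<open>Greedy choice: the next power is added whenever \<open>x\<close> is not
    exceeded. The remainder is at most \<open>(1/2) ^ n\<close>, at the start because
    \<open>x \<le> 1\<close>.\<close>
  define s where "s = rec_nat 0 (\<lambda>n s. if s + (1/2) ^ Suc n \<le> x then s + (1/2) ^ Suc n else (s::real))"
  have s: "s 0 = 0" "s (Suc n) = (if s n + (1/2) ^ Suc n \<le> x then s n + (1/2) ^ Suc n else s n)" for n
    by (simp_all add: s_def)
  have inv: "s n \<le> x \<and> x \<le> s n + (1/2) ^ n" for n
    using assms by (induction n) (auto simp: s)
  define b where "b n \<longleftrightarrow> s n + (1/2) ^ Suc n \<le> x" for n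
  have sum: "(\<Sum>i<n. (1/2) ^ Suc i * of_bool (b i)) = s n" for n
    by (induction n) (auto simp: s b_def)
  have "s \<longlonglongrightarrow> x"
  proof (rule tendsto_sandwich[of "\<lambda>n. x - (1/2) ^ n" _ _ "\<lambda>_. x"])
    show "(\<lambda>n. x - (1/2) ^ n) \<longlonglongrightarrow> x"
      by (auto intro!: tendsto_eq_intros LIMSEQ_power_zero)
  qed (use inv in \<open>auto intro!: always_eventually simp: algebra_simps\<close>)
  then have "(\<lambda>i. (1/2) ^ Suc i * of_bool (b i)) sums x" unfolding sums_def sum .
  then show ?thesis using that sums_unique by blast
qed

text \<open>The binary digits of all coordinates are interleaved into one sequence by the pairing of
  naturals, and the wave recovers them from the corresponding point of Cantor's set.\<close>

lemma schoenberg_surj: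
  assumes "\<And>j. 0 \<le> x j \<and> x j \<le> 1"
  shows "\<exists>t. 0 \<le> t \<and> t \<le> 1 \<and> (\<forall>j. schoenberg j t = x j)"
proof -
  have "\<forall>j. \<exists>b. x j = (\<Sum>i. (1/2) ^ Suc i * of_bool (b i))" using binary_expansion assms by metis
  then obtain b where b: "\<And>j. x j = (\<Sum>i. (1/2) ^ Suc i * of_bool (b j i))" by metis
  show ?thesis
    by (rule exI[of _ "ternary (\<lambda>m. case prod_decode m of (j, i) \<Rightarrow> b j i)"])
      (simp add: ternary_bounds schoenberg_def schoenberg_wave_ternary b)
qed

text \<open>Truncated distances to a dense sequence embed \<open>K\<close> into the Hilbert cube.
  The pairs \<open>(t, x)\<close> for which Schoenberg's curve at \<open>t\<close> is the image of
  \<open>x\<close> form a compact set. It projects injectively to the real axis and onto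
  \<open>K\<close>, so \<open>K\<close> is a continuous image of its projection
  \<open>T\<close>.\<close>

lemma compact_image_of_real:
  fixes K :: "'x::{metric_space,second_countable_topology} set"
  assumes "compact K"
  shows "\<exists>T s. compact T \<and> T \<subseteq> {0..1::real} \<and> continuous_on T s \<and> s ` T = K"
proof (cases "K = {}")
  case True then show ?thesis by (intro exI[of _ "{}"]) auto
next
  case False
  obtain D where D: "countable D" "D \<subseteq> K" "K \<subseteq> closure D" using separable by blast
  have Dne: "D \<noteq> {}" using D False by auto
  define d where "d = from_nat_into D"
  define e where "e j x = min 1 (dist x (d j))" for j x
  have inj: "x = y" if "x \<in> K" "y \<in> K" "\<And>j. e j x = e j y" for x y
  proof (rule ccontr)
    assume "x \<noteq> y"
    \<comment> \<open>With a radius below 1 the truncation is invisible: equal truncated distances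
      to \<open>z\<close> are equal true distances, and \<open>z\<close> would be too close to both
      points.\<close>
    then have "min 1 (dist x y) / 2 > 0" by simp
    moreover have "x \<in> closure D" using that D by auto
    ultimately obtain z where z: "z \<in> D" "dist z x < min 1 (dist x y) / 2" unfolding closure_approachable by blast
    obtain j where j: "z = d j" using from_nat_into_surj[OF D(1) z(1)] by (auto simp: d_def)
    have "dist x z < 1" "dist x z < dist x y / 2" using z(2) by (auto simp: dist_commute min_def split: if_splits)
    moreover have "min 1 (dist x z) = min 1 (dist y z)" using that(3)[of j] by (simp add: e_def j)
    ultimately have "dist x z < dist x y / 2" "dist y z < dist x y / 2" by (auto simp: min_def split: if_splits)
    then show False using dist_triangle2[of x y z] by simp
  qed
  define C where "C = ({0..1} \<times> K) \<inter> (\<Inter>j. {(t, x). schoenberg j t = e j x})"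
  have "closed {(t, x). schoenberg j t = e j x}" for j
    unfolding split_beta e_def
    by (intro closed_Collect_eq continuous_intros continuous_on_compose2[OF schoenberg_continuous[of UNIV]]) auto
  then have C: "compact C"
    unfolding C_def by (intro compact_Int_closed compact_Times assms closed_INT) auto
  define T where "T = fst ` C"
  have T: "compact T" unfolding T_def by (intro compact_continuous_image C continuous_intros)
  have injC: "inj_on fst C" by (rule inj_onI) (auto simp: C_def intro!: inj)
  define g where "g = the_inv_into C fst"
  have g: "g (fst c) = c" if "c \<in> C" for c unfolding g_def using injC that by (rule the_inv_into_f_f)
  have cg: "continuous_on T g"
    unfolding T_def by (rule continuous_on_inv) (use C g in \<open>auto intro: continuous_intros\<close>)
  have "(snd \<circ> g) ` T = snd ` C" using g by (force simp: T_def image_image)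
  also have "\<dots> = K"
  proof
    show "K \<subseteq> snd ` C"
    proof
      fix x assume x: "x \<in> K"
      obtain t where "0 \<le> t" "t \<le> 1" "\<And>j. schoenberg j t = e j x"
        using schoenberg_surj[of "\<lambda>j. e j x"] by (auto simp: e_def)
      then have "(t, x) \<in> C" using x by (auto simp: C_def)
      then show "x \<in> snd ` C" by force
    qed
  qed (auto simp: C_def)
  finally have "(snd \<circ> g) ` T = K" .
  moreover have "continuous_on T (snd \<circ> g)" by (intro continuous_on_compose cg continuous_intros)
  ultimately show ?thesis using T by (intro exI[of _ T] exI[of _ "snd \<circ> g"]) (auto simp: T_def C_def)
qed

section \<open>Continuous games on compact sets of reals\<close>

text \<open>Brouwer's fixed point theorem for the cube, in the approximate form that follows from
  Kuhn's lemma. The dimension \<open>n\<close> is a number, not a type.\<close>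

lemma approx_fixed_point_cube:
  fixes F :: "(nat \<Rightarrow> real) \<Rightarrow> nat \<Rightarrow> real"
  assumes e: "e > 0"
    and F01: "\<And>x i. (\<And>j. j < n \<Longrightarrow> 0 \<le> x j \<and> x j \<le> 1) \<Longrightarrow> i < n \<Longrightarrow> 0 \<le> F x i \<and> F x i \<le> 1"
    and unif: "\<And>r. r > 0 \<Longrightarrow> \<exists>d>0. \<forall>x y. (\<forall>j<n. 0 \<le> x j \<and> x j \<le> 1) \<longrightarrow> (\<forall>j<n. 0 \<le> y j \<and> y j \<le> 1) \<longrightarrow>
        (\<forall>j<n. \<bar>x j - y j\<bar> \<le> d) \<longrightarrow> (\<forall>i<n. \<bar>F x i - F y i\<bar> \<le> r)"
  shows "\<exists>x. (\<forall>j<n. 0 \<le> x j \<and> x j \<le> 1) \<and> (\<forall>i<n. \<bar>F x i - x i\<bar> \<le> e)"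
proof -
  obtain d where d: "d > 0" "\<And>x y. (\<forall>j<n. 0 \<le> x j \<and> x j \<le> 1) \<Longrightarrow> (\<forall>j<n. 0 \<le> y j \<and> y j \<le> 1) \<Longrightarrow>
      (\<forall>j<n. \<bar>x j - y j\<bar> \<le> d) \<Longrightarrow> (\<forall>i<n. \<bar>F x i - F y i\<bar> \<le> e / 2)"
    using unif[of "e/2"] e by (auto simp del: le_divide_eq_numeral1)
  obtain p :: nat where p: "p > 0" "1 / p < min d (e / 2)"
    using d(1) e by (metis half_gt_zero min_less_iff_conj nat_approx_posE zero_less_Suc)
  define z :: "(nat \<Rightarrow> nat) \<Rightarrow> nat \<Rightarrow> real" where "z x i = x i / p" for x i
  \<comment> \<open>Label 0 says that \<open>F\<close> does not decrease coordinate
    \<open>i\<close>. On the upper face the second condition yields label 1, as Kuhn's lemma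
    requires; on the lower face \<open>0 \<le> F\<close> yields label 0.\<close>
  define label where "label x i = (if z x i \<le> F (z x) i \<and> x i \<noteq> p then 0 else 1::nat)" for x i
  have z01: "\<forall>j<n. 0 \<le> z x j \<and> z x j \<le> 1" if "\<forall>j<n. x j \<le> p" for x
    using that p(1) by (auto simp: z_def)
  obtain q where q: "\<forall>i<n. q i < p" "\<forall>i<n. \<exists>r s. (\<forall>j<n. q j \<le> r j \<and> r j \<le> q j + 1) \<and>
      (\<forall>j<n. q j \<le> s j \<and> s j \<le> q j + 1) \<and> label r i \<noteq> label s i"
  proof (rule kuhn_lemma[of p n label])
    show "\<forall>x. (\<forall>i<n. x i \<le> p) \<longrightarrow> (\<forall>i<n. x i = 0 \<longrightarrow> label x i = 0)"
    proof (intro allI impI)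
      fix x :: "nat \<Rightarrow> nat" and i assume "\<forall>i<n. x i \<le> p" "i < n" "x i = 0"
      then show "label x i = 0" using F01[of "z x" i] z01[of x] p(1) by (auto simp: label_def z_def)
    qed
  qed (use p in \<open>auto simp: label_def\<close>)
  \<comment> \<open>In coordinate \<open>i\<close> the cell at \<open>q\<close> has a corner with
    label 0 and one with label 1. Moving from either to \<open>q\<close> changes \<open>F\<close> by
    at most \<open>e / 2\<close> and the coordinate by less than \<open>e / 2\<close>.\<close>
  have "\<bar>F (z q) i - z q i\<bar> \<le> e" if i: "i < n" for i
  proof -
    have *: "\<exists>a. (\<forall>j<n. q j \<le> a j \<and> a j \<le> q j + 1) \<and> label a i = 0"
       "\<exists>b. (\<forall>j<n. q j \<le> b j \<and> b j \<le> q j + 1) \<and> label b i = 1"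
    proof -
      obtain r s where "\<forall>j<n. q j \<le> r j \<and> r j \<le> q j + 1" "\<forall>j<n. q j \<le> s j \<and> s j \<le> q j + 1" "label r i \<noteq> label s i"
        using q(2) i by blast
      then show "\<exists>a. (\<forall>j<n. q j \<le> a j \<and> a j \<le> q j + 1) \<and> label a i = 0"
        "\<exists>b. (\<forall>j<n. q j \<le> b j \<and> b j \<le> q j + 1) \<and> label b i = 1"
        by (auto simp: label_def split: if_splits)
    qed
    have close: "\<bar>z a j - z q j\<bar> \<le> 1 / p" if "\<forall>j<n. q j \<le> a j \<and> a j \<le> q j + 1" "j < n" for a j
    proof -
      have "real (a j) - real (q j) \<le> 1" "real (q j) \<le> real (a j)" using that by (auto simp: le_diff_eq of_nat_Suc[symmetric] simp del: of_nat_Suc)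
      then have "z a j - z q j \<le> 1 / p" "0 \<le> z a j - z q j"
        unfolding z_def by (auto simp: diff_divide_distrib[symmetric] divide_right_mono)
      then show ?thesis by simp
    qed
    have le: "\<forall>j<n. a j \<le> p" if "\<forall>j<n. q j \<le> a j \<and> a j \<le> q j + 1" for a
      using that q(1) by (metis Suc_eq_plus1 Suc_leI le_trans)
    have qp: "\<forall>j<n. q j \<le> p" using q(1) by (simp add: less_imp_le)
    have near: "\<bar>F (z a) i - F (z q) i\<bar> \<le> e / 2" if "\<forall>j<n. q j \<le> a j \<and> a j \<le> q j + 1" for a
      using d(2)[OF z01[OF le[OF that]] z01[OF qp]] close[OF that] p(2) i by (force intro: less_imp_le le_less_trans)
    obtain a where a: "\<forall>j<n. q j \<le> a j \<and> a j \<le> q j + 1" "label a i = 0" using * by blast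
    obtain b where b: "\<forall>j<n. q j \<le> b j \<and> b j \<le> q j + 1" "label b i = 1" using * by blast
    have "z a i \<le> F (z a) i" using a(2) by (auto simp: label_def split: if_splits)
    moreover have "F (z b) i \<le> z b i"
    proof (cases "b i = p")
      case True
      then have "z b i = 1" using p(1) by (simp add: z_def)
      then show ?thesis using F01[of "z b" i] z01[OF le[OF b(1)]] i by auto
    qed (use b(2) in \<open>auto simp: label_def split: if_splits\<close>)
    ultimately show ?thesis
      using near[OF a(1)] near[OF b(1)] close[OF a(1) i] close[OF b(1) i] p(2)
      unfolding abs_le_iff min_less_iff_conj by linarith
  qed
  then show ?thesis using z01[of q] q(1) by (intro exI[of _ "z q"]) (auto simp: less_imp_le)
qed

text \<open>Tychonoff: each coordinate from \<open>N\<close> on ranges over the compact singleton of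
  \<open>undefined\<close>.\<close>

lemma compact_PiE:
  fixes U :: "'u::metric_space set" and N :: nat
  assumes "compact U"
  shows "compact (PiE {..<N} (\<lambda>_. U))"
proof -
  have "compactin (product_topology (\<lambda>_::nat. euclidean :: 'u topology) UNIV) (PiE UNIV (\<lambda>i. if i < N then U else {undefined}))"
    using assms by (subst compactin_PiE) auto
  moreover have "PiE UNIV (\<lambda>i. if i < N then U else {undefined}) = PiE {..<N} (\<lambda>_. U)"
  proof (intro set_eqI iffI)
    fix x :: "nat \<Rightarrow> 'u" assume "x \<in> PiE UNIV (\<lambda>i. if i < N then U else {undefined})"
    then have *: "x i \<in> (if i < N then U else {undefined})" for i by (drule_tac PiE_mem[OF _ UNIV_I])
    show "x \<in> PiE {..<N} (\<lambda>_. U)"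
    proof (rule PiE_I)
      show "x i \<in> U" if "i \<in> {..<N}" for i using *[of i] that by simp
      show "x i = undefined" if "i \<notin> {..<N}" for i using *[of i] that by simp
    qed
  next
    fix x :: "nat \<Rightarrow> 'u" assume "x \<in> PiE {..<N} (\<lambda>_. U)"
    then show "x \<in> PiE UNIV (\<lambda>i. if i < N then U else {undefined})"
      by (intro PiE_I) (simp_all add: PiE_iff extensional_def)
  qed
  ultimately show ?thesis by (simp add: euclidean_product_topology)
qed

text \<open>Approximate fixed points with error \<open>1 / (m + 1)\<close> have a limit point in the
  compact cube. Arguments are restricted to \<open>{..<n}\<close> to stay inside the extensional
  product, and by \<open>dep\<close> this does not change \<open>F\<close>.\<close>

lemma fixed_point_cube:
  fixes F :: "(nat \<Rightarrow> real) \<Rightarrow> nat \<Rightarrow> real"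
  assumes F01: "\<And>x i. (\<And>j. j < n \<Longrightarrow> 0 \<le> x j \<and> x j \<le> 1) \<Longrightarrow> i < n \<Longrightarrow> 0 \<le> F x i \<and> F x i \<le> 1"
    and dep: "\<And>x y i. (\<And>j. j < n \<Longrightarrow> x j = y j) \<Longrightarrow> i < n \<Longrightarrow> F x i = F y i"
    and cont: "\<And>i. i < n \<Longrightarrow> continuous_on (PiE {..<n} (\<lambda>_. {0..1})) (\<lambda>x. F x i)"
  shows "\<exists>x. (\<forall>j<n. 0 \<le> x j \<and> x j \<le> 1) \<and> (\<forall>i<n. F x i = x i)"
proof -
  let ?K = "PiE {..<n} (\<lambda>_. {0..1::real})"
  have K: "compact ?K" by (intro compact_PiE compact_Icc)
  let ?r = "\<lambda>x. restrict x {..<n}"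
  have rK: "?r x \<in> ?K" if "\<forall>j<n. 0 \<le> x j \<and> x j \<le> 1" for x using that by auto
  have Fr: "F (?r x) i = F x i" if "i < n" for x i by (rule dep) (use that in auto)
  have "\<exists>x. (\<forall>j<n. 0 \<le> x j \<and> x j \<le> 1) \<and> (\<forall>i<n. \<bar>F x i - x i\<bar> \<le> 1 / Suc m)" for m
  proof (rule approx_fixed_point_cube[OF _ F01])
    fix r :: real assume "r > 0"
    have "\<exists>d>0. \<forall>x\<in>?K. \<forall>y\<in>?K. dist x y < d \<longrightarrow> \<bar>F x i - F y i\<bar> < r" if "i < n" for i
    proof -
      have "uniformly_continuous_on ?K (\<lambda>x. F x i)" by (intro compact_uniformly_continuous cont that K)
      then show ?thesis using \<open>r > 0\<close> unfolding uniformly_continuous_on_def dist_real_def by (metis dist_commute)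
    qed
    then obtain D where D: "\<And>i. i < n \<Longrightarrow> D i > 0"
      "\<And>i x y. i < n \<Longrightarrow> x \<in> ?K \<Longrightarrow> y \<in> ?K \<Longrightarrow> dist x y < D i \<Longrightarrow> \<bar>F x i - F y i\<bar> < r" by metis
    define d where "d = Min (insert 1 (D ` {..<n}))"
    have d: "d > 0" "\<And>i. i < n \<Longrightarrow> d \<le> D i" using D(1) by (auto simp: d_def)
    obtain m where m: "(1/2) ^ m < d / 2" using real_arch_pow_inv[of "d/2" "1/2"] d(1) by auto
    show "\<exists>d>0. \<forall>x y. (\<forall>j<n. 0 \<le> x j \<and> x j \<le> 1) \<longrightarrow> (\<forall>j<n. 0 \<le> y j \<and> y j \<le> 1) \<longrightarrow>
        (\<forall>j<n. \<bar>x j - y j\<bar> \<le> d) \<longrightarrow> (\<forall>i<n. \<bar>F x i - F y i\<bar> \<le> r)"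
    \<comment> \<open>As for partitions of products, twice \<open>d / 5\<close> and a tail below
      \<open>d / 2\<close> stay below \<open>d\<close>.\<close>
    proof (intro exI[of _ "d / 5"] conjI allI impI)
      fix x y :: "nat \<Rightarrow> real" and i
      assume x: "\<forall>j<n. 0 \<le> x j \<and> x j \<le> 1" and y: "\<forall>j<n. 0 \<le> y j \<and> y j \<le> 1"
        and xy: "\<forall>j<n. \<bar>x j - y j\<bar> \<le> d / 5" and i: "i < n"
      have c: "dist (?r x j) (?r y j) \<le> d / 5" for j using xy d(1) by (auto simp: dist_real_def)
      have "dist (?r x) (?r y) \<le> 2 * Max {dist (?r x (from_nat k)) (?r y (from_nat k)) |k. k \<le> m} + (1/2) ^ m"
        by (rule dist_fun_le_dist_first_terms)
      also have "Max {dist (?r x (from_nat k)) (?r y (from_nat k)) |k. k \<le> m} \<le> d / 5"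
      proof (subst Max_le_iff)
        show "\<forall>a\<in>{dist (?r x (from_nat k)) (?r y (from_nat k)) |k. k \<le> m}. a \<le> d / 5" using c by blast
      qed auto
      finally have "dist (?r x) (?r y) < D i" using m d(1) d(2)[OF i] by linarith
      then have "\<bar>F (?r x) i - F (?r y) i\<bar> < r" using D(2)[OF i rK[OF x] rK[OF y]] by blast
      then show "\<bar>F x i - F y i\<bar> \<le> r" using Fr[OF i] by simp
    qed (use d in auto)
  qed auto
  then obtain X where X: "\<And>m. \<forall>j<n. 0 \<le> X m j \<and> X m j \<le> 1" "\<And>m i. i < n \<Longrightarrow> \<bar>F (X m) i - X m i\<bar> \<le> 1 / Suc m" by metis
  have "\<forall>m. ?r (X m) \<in> ?K" using rK X(1) by blast
  then obtain x s where x: "x \<in> ?K" "strict_mono (s :: nat \<Rightarrow> nat)" "((\<lambda>m. ?r (X m)) \<circ> s) \<longlonglongrightarrow> x"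
    using K unfolding compact_eq_seq_compact_metric seq_compact_def by metis
  have "F x i = x i" if i: "i < n" for i
  proof -
    have 1: "(\<lambda>m. ?r (X (s m)) i) \<longlonglongrightarrow> x i"
      using continuous_on_tendsto_compose[OF continuous_on_product_coordinates[of i] x(3)] by simp
    have 2: "(\<lambda>m. F (?r (X (s m))) i) \<longlonglongrightarrow> F x i"
      using cont[OF i, unfolded continuous_on_sequentially] x \<open>\<forall>m. ?r (X m) \<in> ?K\<close> by (auto simp: o_def)
    have "(\<lambda>m. F (?r (X (s m))) i - ?r (X (s m)) i) \<longlonglongrightarrow> 0"
    proof (rule Lim_null_comparison[where g="\<lambda>m. 1 / Suc (s m)"])
      show "(\<lambda>m. 1 / real (Suc (s m))) \<longlonglongrightarrow> 0"
        using LIMSEQ_subseq_LIMSEQ[OF LIMSEQ_Suc[OF lim_1_over_n] x(2)] by (simp add: o_def)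
    qed (use X(2)[OF i] Fr[OF i] i in \<open>auto intro!: always_eventually\<close>)
    moreover have "(\<lambda>m. F (?r (X (s m))) i - ?r (X (s m)) i) \<longlonglongrightarrow> F x i - x i" by (intro tendsto_diff 1 2)
    ultimately show ?thesis using LIMSEQ_unique by fastforce
  qed
  then show ?thesis using x(1) by (intro exI[of _ x]) (auto simp: PiE_iff)
qed

text \<open>Nash's map lives on simplices, the fixed point theorem on a cube. This retraction
  bridges them: a deficit of the sum is spread evenly over the \<open>n\<close> entries, an excess
  is removed by scaling.\<close>

definition simplex_proj :: "nat \<Rightarrow> (nat \<Rightarrow> real) \<Rightarrow> nat \<Rightarrow> real" where
  "simplex_proj n z i = (z i + max 0 (1 - (\<Sum>i<n. z i)) / n) / max 1 (\<Sum>i<n. z i)"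

lemma simplex_proj:
  assumes "n > 0" "\<And>i. i < n \<Longrightarrow> 0 \<le> z i"
  shows "\<And>i. i < n \<Longrightarrow> 0 \<le> simplex_proj n z i" "(\<Sum>i<n. simplex_proj n z i) = 1"
    and "(\<Sum>i<n. z i) = 1 \<Longrightarrow> simplex_proj n z i = z i"
proof -
  show "\<And>i. i < n \<Longrightarrow> 0 \<le> simplex_proj n z i" using assms by (simp add: simplex_proj_def)
  have "(\<Sum>i<n. simplex_proj n z i) = ((\<Sum>i<n. z i) + max 0 (1 - (\<Sum>i<n. z i))) / max 1 (\<Sum>i<n. z i)"
    using assms by (simp add: simplex_proj_def sum_divide_distrib[symmetric] sum.distrib)
  then show "(\<Sum>i<n. simplex_proj n z i) = 1" by (auto simp: max_def)
qed (simp add: simplex_proj_def)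

text \<open>Nash's improvement map for costs: weight moves to actions that cost less than the
  current mixture, in proportion to the saving.\<close>

definition nash_step :: "nat \<Rightarrow> (nat \<Rightarrow> real) \<Rightarrow> (nat \<Rightarrow> real) \<Rightarrow> nat \<Rightarrow> real" where
  "nash_step n p v i = (p i + max 0 ((\<Sum>k<n. p k * v k) - v i)) / (1 + (\<Sum>j<n. max 0 ((\<Sum>k<n. p k * v k) - v j)))"

lemma nash_step:
  assumes "\<And>i. i < n \<Longrightarrow> 0 \<le> p i" "(\<Sum>i<n. p i) = 1"
  shows "\<And>i. i < n \<Longrightarrow> 0 \<le> nash_step n p v i" "(\<Sum>i<n. nash_step n p v i) = 1"
proof -
  have pos: "(\<Sum>j<n. max 0 ((\<Sum>k<n. p k * v k) - v j)) \<ge> 0" by (intro sum_nonneg) auto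
  show "\<And>i. i < n \<Longrightarrow> 0 \<le> nash_step n p v i" using assms pos by (simp add: nash_step_def)
  show "(\<Sum>i<n. nash_step n p v i) = 1"
    using assms pos by (simp add: nash_step_def sum_divide_distrib[symmetric] sum.distrib)
qed

text \<open>If \<open>g\<close> denotes the gains, a fixed point satisfies \<open>p i * sum g = g i\<close>. Multiplying with
  the difference between the mean cost and \<open>v i\<close> and summing gives \<open>0 = sum (g i)^2\<close>.\<close>

lemma nash_step_fixed:
  assumes p: "(\<Sum>i<n. p i) = 1" and fp: "\<And>i. i < n \<Longrightarrow> nash_step n p v i = p i" and i: "i < n"
  shows "(\<Sum>k<n. p k * v k) \<le> v i"
proof -
  define a where "a = (\<Sum>k<n. p k * v k)"
  define g where "g i = max 0 (a - v i)" for i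
  define G where "G = (\<Sum>j<n. g j)"
  have G: "G \<ge> 0" unfolding G_def g_def by (intro sum_nonneg) auto
  have "p i * G = g i" if "i < n" for i
    using fp[OF that] G unfolding nash_step_def a_def[symmetric] g_def[symmetric] G_def[symmetric]
    by (simp add: field_simps)
  then have "(\<Sum>i<n. g i * (a - v i)) = (\<Sum>i<n. p i * G * (a - v i))" by simp
  also have "\<dots> = G * (\<Sum>i<n. p i * (a - v i))" by (simp add: sum_distrib_left mult_ac)
  also have "(\<Sum>i<n. p i * (a - v i)) = a * (\<Sum>i<n. p i) - (\<Sum>k<n. p k * v k)"
    by (simp add: right_diff_distrib sum_subtractf sum_distrib_left mult.commute)
  also have "(\<Sum>k<n. p k * v k) = a" by (simp add: a_def)
  finally have "(\<Sum>i<n. g i * (a - v i)) = 0" using p by simp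
  moreover have "g i * (a - v i) = (g i)\<^sup>2" for i by (simp add: g_def power2_eq_square max_def)
  ultimately have "(\<Sum>i<n. (g i)\<^sup>2) = 0" by simp
  then have "g i = 0" using i by (simp add: sum_nonneg_eq_0_iff)
  then show ?thesis by (simp add: g_def a_def max_def split: if_splits)
qed

text \<open>Both mixed strategies are stored in one vector of length \<open>2 * n\<close>. The
  values of \<open>F\<close> are pairs of probability vectors, so at a fixed point the retraction
  acts as the identity and both improvement maps are fixed.\<close>

lemma finite_game_equilibrium:
  fixes A B :: "nat \<Rightarrow> nat \<Rightarrow> real"
  assumes n: "n > 0"
  shows "\<exists>p q. (\<forall>i<n. 0 \<le> p i) \<and> (\<Sum>i<n. p i) = 1 \<and> (\<forall>j<n. 0 \<le> q j) \<and> (\<Sum>j<n. q j) = 1 \<and>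
    (\<forall>i<n. (\<Sum>k<n. p k * (\<Sum>j<n. q j * A k j)) \<le> (\<Sum>j<n. q j * A i j)) \<and>
    (\<forall>j<n. (\<Sum>l<n. q l * (\<Sum>k<n. p k * B k l)) \<le> (\<Sum>k<n. p k * B k j))"
proof -
  define P where "P x = simplex_proj n x" for x :: "nat \<Rightarrow> real"
  define Q where "Q x = simplex_proj n (\<lambda>j. x (n + j))" for x :: "nat \<Rightarrow> real"
  define F where "F x i = (if i < n then nash_step n (P x) (\<lambda>k. \<Sum>j<n. Q x j * A k j) i
      else nash_step n (Q x) (\<lambda>l. \<Sum>k<n. P x k * B k l) (i - n))" for x i
  have simp: "(\<forall>i<n. 0 \<le> P x i)" "(\<Sum>i<n. P x i) = 1" "(\<forall>i<n. 0 \<le> Q x i)" "(\<Sum>i<n. Q x i) = 1"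
    if "\<And>j. j < 2 * n \<Longrightarrow> 0 \<le> x j" for x
    unfolding P_def Q_def using that n by (auto intro!: simplex_proj)
  have le1: "f i \<le> 1" if "\<And>i. i < n \<Longrightarrow> 0 \<le> f i" "(\<Sum>i<n. f i) = 1" "i < n" for f :: "nat \<Rightarrow> real" and i
    using member_le_sum[of i "{..<n}" f] that by auto
  have "\<exists>x. (\<forall>j<2*n. 0 \<le> x j \<and> x j \<le> 1) \<and> (\<forall>i<2*n. F x i = x i)"
  proof (rule fixed_point_cube)
    fix x :: "nat \<Rightarrow> real" and i assume x: "\<And>j. j < 2 * n \<Longrightarrow> 0 \<le> x j \<and> x j \<le> 1" and i: "i < 2 * n"
    have s: "(\<forall>i<n. 0 \<le> P x i)" "(\<Sum>i<n. P x i) = 1" "(\<forall>i<n. 0 \<le> Q x i)" "(\<Sum>i<n. Q x i) = 1"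
      using simp[of x] x by auto
    show "0 \<le> F x i \<and> F x i \<le> 1"
      unfolding F_def using i s by (auto intro!: nash_step le1)
  next
    fix x y :: "nat \<Rightarrow> real" and i assume xy: "\<And>j. j < 2 * n \<Longrightarrow> x j = y j" "i < 2 * n"
    have s: "(\<Sum>i<n. x i) = (\<Sum>i<n. y i)" "(\<Sum>i<n. x (n + i)) = (\<Sum>i<n. y (n + i))" using xy by auto
    have "P x i = P y i" "Q x i = Q y i" if "i < n" for i
      unfolding P_def Q_def simplex_proj_def s using xy that by auto
    then show "F x i = F y i" unfolding F_def nash_step_def using xy(2) by auto
  next
    fix i
    have c: "continuous_on S (\<lambda>x. x i)" for S :: "(nat \<Rightarrow> real) set" and i
      by (rule continuous_on_product_then_coordinatewise[OF continuous_on_id])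
    have cP: "continuous_on S (\<lambda>x. P x i)" for S i
      unfolding P_def simplex_proj_def by (intro continuous_intros c ballI; use n in \<open>simp add: max_def\<close>)
    have cQ: "continuous_on S (\<lambda>x. Q x i)" for S i
      unfolding Q_def simplex_proj_def by (intro continuous_intros c ballI; use n in \<open>simp add: max_def\<close>)
    have nz: "1 + (\<Sum>j<n. max 0 (f j)) \<noteq> 0" for f :: "nat \<Rightarrow> real"
      using sum_nonneg[of "{..<n}" "\<lambda>j. max 0 (f j)"] by fastforce
    show "continuous_on (PiE {..<2*n} (\<lambda>_. {0..1})) (\<lambda>x. F x i)"
      unfolding F_def nash_step_def
      by (cases "i < n"; simp only: if_True if_False; intro continuous_intros cP cQ ballI nz)
  qed
  then obtain x where x: "\<forall>j<2*n. 0 \<le> x j \<and> x j \<le> 1" "\<forall>i<2*n. F x i = x i" by blast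
  note s = simp[of x]
  have xs: "\<And>j. j < 2 * n \<Longrightarrow> 0 \<le> x j" using x by auto
  have f1: "nash_step n (P x) (\<lambda>k. \<Sum>j<n. Q x j * A k j) i = x i" if "i < n" for i
    using x(2)[rule_format, of i] that by (simp add: F_def)
  have f2: "nash_step n (Q x) (\<lambda>l. \<Sum>k<n. P x k * B k l) i = x (n + i)" if "i < n" for i
    using x(2)[rule_format, of "n + i"] that by (simp add: F_def)
  have "(\<Sum>i<n. x i) = (\<Sum>i<n. nash_step n (P x) (\<lambda>k. \<Sum>j<n. Q x j * A k j) i)" using f1 by simp
  also have "\<dots> = 1" using s xs by (intro nash_step) auto
  finally have Px: "P x i = x i" for i unfolding P_def using xs n by (intro simplex_proj) auto
  have "(\<Sum>i<n. x (n + i)) = (\<Sum>i<n. nash_step n (Q x) (\<lambda>l. \<Sum>k<n. P x k * B k l) i)" using f2 by simp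
  also have "\<dots> = 1" using s xs by (intro nash_step) auto
  finally have Qx: "Q x i = x (n + i)" for i unfolding Q_def using xs n by (intro simplex_proj) auto
  have fp: "nash_step n (P x) (\<lambda>k. \<Sum>j<n. Q x j * A k j) i = P x i"
    "nash_step n (Q x) (\<lambda>l. \<Sum>k<n. P x k * B k l) i = Q x i" if "i < n" for i
    using f1[OF that] f2[OF that] by (simp_all add: Px Qx)
  have "\<forall>i<n. (\<Sum>k<n. P x k * (\<Sum>j<n. Q x j * A k j)) \<le> (\<Sum>j<n. Q x j * A i j)"
    using nash_step_fixed[OF s(2)[OF xs] fp(1)] by blast
  moreover have "\<forall>j<n. (\<Sum>l<n. Q x l * (\<Sum>k<n. P x k * B k l)) \<le> (\<Sum>k<n. P x k * B k j)"
    using nash_step_fixed[OF s(4)[OF xs] fp(2)] by blast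
  ultimately show ?thesis using s[OF xs] by blast
qed

text \<open>Selection of a weak limit is possible because all laws live on one bounded set. The
  truncated distance to \<open>S\<close> is a continuous test that vanishes on \<open>S\<close>,
  which shows that the limit lives on \<open>S\<close> as well. Tietze's theorem extends test
  functions from \<open>S\<close> to the line.\<close>

lemma weak_limit_compact:
  fixes S :: "real set"
  assumes S: "compact S" "S \<noteq> {}"
    and \<mu>: "\<And>n. prob_space (\<mu> n)" "\<And>n. sets (\<mu> n) = sets (sborel S)"
  shows "\<exists>r M. strict_mono (r :: nat \<Rightarrow> nat) \<and> prob_space M \<and> sets M = sets (sborel S) \<and>
    (\<forall>f. continuous_on S f \<longrightarrow> (\<lambda>n. \<integral>x. f x \<partial>\<mu> (r n)) \<longlonglongrightarrow> (\<integral>x. f x \<partial>M :: real))"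
proof -
  have Sb[measurable]: "S \<in> sets borel" using S by (simp add: compact_imp_closed)
  have sp: "space (\<mu> n) = S" for n using sets_eq_imp_space_eq[OF \<mu>(2)] by (simp add: space_restrict_space)
  have id: "(\<lambda>x. x) \<in> \<mu> n \<rightarrow>\<^sub>M borel" for n
    using measurable_restrict_space1[of "\<lambda>x. x" borel borel S] \<mu>(2) by (simp cong: measurable_cong_sets)
  define \<nu> where "\<nu> n = distr (\<mu> n) borel (\<lambda>x. x)" for n
  have rd: "real_distribution (\<nu> n)" for n
    unfolding \<nu>_def real_distribution_def real_distribution_axioms_def
    by (auto intro!: prob_space.prob_space_distr \<mu> id)
  obtain b where b: "\<And>x. x \<in> S \<Longrightarrow> \<bar>x\<bar> \<le> b" using compact_imp_bounded[OF S(1)] by (auto simp: bounded_iff)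
  have "tight \<nu>"
    unfolding tight_def
  proof (intro conjI allI impI exI)
    fix e :: real and n assume "e > 0"
    \<comment> \<open>Tightness speaks of intervals open on the left, so the left end is moved by 1
      to keep \<open>- \<bar>b\<bar>\<close> inside.\<close>
    show "- \<bar>b\<bar> - 1 < \<bar>b\<bar>" by simp
    have "- \<bar>b\<bar> - 1 < x \<and> x \<le> \<bar>b\<bar>" if "x \<in> S" for x using b[OF that] by linarith
    then have "(\<lambda>x. x) -` {- \<bar>b\<bar> - 1<..\<bar>b\<bar>} \<inter> space (\<mu> n) = space (\<mu> n)" by (auto simp: sp)
    then have "measure (\<nu> n) {- \<bar>b\<bar> - 1<..\<bar>b\<bar>} = measure (\<mu> n) (space (\<mu> n))"
      unfolding \<nu>_def by (subst measure_distr[OF id]) simp_all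
    then show "1 - e < measure (\<nu> n) {- \<bar>b\<bar> - 1<..\<bar>b\<bar>}" using prob_space.prob_space[OF \<mu>(1)] \<open>e > 0\<close> by simp
  qed (rule rd)
  from tight_imp_convergent_subsubsequence[OF this strict_mono_id]
  obtain r M where r: "strict_mono r" and M: "real_distribution M" "weak_conv_m (\<nu> \<circ> id \<circ> r) M" by blast
  interpret M: real_distribution M by fact
  have conv: "(\<lambda>n. \<integral>x. g x \<partial>\<mu> (r n)) \<longlonglongrightarrow> (\<integral>x. g x \<partial>M)"
    if "continuous_on UNIV g" "\<And>x. \<bar>g x\<bar> \<le> B" for g :: "real \<Rightarrow> real" and B
  proof -
    have "(\<lambda>n. \<integral>x. g x \<partial>(\<nu> \<circ> id \<circ> r) n) \<longlonglongrightarrow> (\<integral>x. g x \<partial>M)"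
      using that by (intro weak_conv_imp_integral_bdd_continuous_conv[OF _ M(1) M(2), where B=B])
        (auto simp: rd continuous_on_eq_continuous_at)
    moreover have "(\<integral>x. g x \<partial>\<nu> n) = (\<integral>x. g x \<partial>\<mu> n)" for n
      unfolding \<nu>_def using that by (intro integral_distr id borel_measurable_continuous_onI)
    ultimately show ?thesis by simp
  qed
  have AE_S: "AE x in M. x \<in> S"
  proof -
    let ?\<phi> = "\<lambda>x. min 1 (infdist x S)"
    have c: "continuous_on UNIV ?\<phi>" by (intro continuous_intros)
    have "(\<integral>x. ?\<phi> x \<partial>\<mu> n) = (\<integral>x. 0 \<partial>\<mu> n)" for n by (intro Bochner_Integration.integral_cong) (auto simp: sp)
    then have "(\<integral>x. ?\<phi> x \<partial>M) = 0"
      using conv[OF c, of 1] LIMSEQ_unique[of "\<lambda>n. 0"] by (auto simp: infdist_nonneg)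
    moreover have "integrable M ?\<phi>"
      using borel_measurable_continuous_onI[OF c]
      by (intro M.integrable_const_bound[where B=1]) (auto simp: infdist_nonneg)
    ultimately have "AE x in M. ?\<phi> x = 0"
      by (subst (asm) integral_nonneg_eq_0_iff_AE) (auto simp: infdist_nonneg)
    then show ?thesis
      by eventually_elim (use S in \<open>auto simp: in_closed_iff_infdist_zero compact_imp_closed min_def split: if_splits\<close>)
  qed
  let ?R = "restrict_space M S"
  have "prob_space ?R"
    using AE_S by (intro prob_space_restrict_space) (auto simp: M.emeasure_eq_measure M.prob_eq_1)
  moreover have "sets ?R = sets (sborel S)" by (intro sets_restrict_space_cong) simp
  moreover have "(\<lambda>n. \<integral>x. f x \<partial>\<mu> (r n)) \<longlonglongrightarrow> (\<integral>x. f x \<partial>?R)" if f: "continuous_on S f" for f :: "real \<Rightarrow> real"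
  proof -
    obtain B where B: "\<And>x. x \<in> S \<Longrightarrow> norm (f x) \<le> B"
      using compact_imp_bounded[OF compact_continuous_image[OF f S(1)]] by (auto simp: bounded_iff)
    \<comment> \<open>Tietze's theorem is stated for a nonnegative bound; a point of
      \<open>S\<close> ensures this.\<close>
    have "0 \<le> B" using S(2) B by (meson ex_in_conv norm_ge_zero order_trans)
    then obtain g where g: "continuous_on UNIV g" "\<And>x. x \<in> S \<Longrightarrow> g x = f x" "\<And>x. norm (g x) \<le> B"
      using Tietze[OF f, of UNIV B] S B by (auto simp: compact_imp_closed)
    have 1: "(\<integral>x. g x \<partial>\<mu> n) = (\<integral>x. f x \<partial>\<mu> n)" for n
      using g(2) by (intro Bochner_Integration.integral_cong) (auto simp: sp)
    have "(\<integral>x. f x \<partial>?R) = (\<integral>x. g x \<partial>?R)"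
      using g(2) by (intro Bochner_Integration.integral_cong) (auto simp: space_restrict_space)
    also have "\<dots> = (\<integral>x. indicator S x *\<^sub>R g x \<partial>M)" by (rule integral_restrict_space) auto
    also have "\<dots> = (\<integral>x. g x \<partial>M)"
      using AE_S borel_measurable_continuous_onI[OF g(1)] by (intro integral_cong_AE) (auto elim: eventually_mono)
    finally show ?thesis using conv[OF g(1), of B] g(3) 1 by simp
  qed
  ultimately show ?thesis using r by blast
qed

lemma finite_mixture:
  fixes d :: "nat \<Rightarrow> 'x::topological_space"
  assumes p: "\<And>i. i < n \<Longrightarrow> 0 \<le> p i" "(\<Sum>i<n. p i) = 1" and d: "\<And>i. d i \<in> S"
  shows "\<exists>M. prob_space M \<and> sets M = sets (sborel S) \<and>
    (\<forall>f \<in> borel_measurable (sborel S). (\<integral>x. f x \<partial>M) = (\<Sum>i<n. p i * f (d i) :: real))"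
proof -
  let ?D = "density (count_space {..<n}) (\<lambda>i. ennreal (p i))"
  let ?M = "distr ?D (sborel S) d"
  have d': "d \<in> ?D \<rightarrow>\<^sub>M sborel S" using d by (auto simp: space_restrict_space)
  have "(\<Sum>i<n. ennreal (p i)) = ennreal (\<Sum>i<n. p i)" by (intro sum_ennreal) (use p in auto)
  then have "emeasure ?D (space ?D) = 1"
    using p by (simp add: emeasure_density nn_integral_count_space_finite)
  then have "prob_space ?D" by (rule prob_spaceI)
  then have "prob_space ?M" using d' by (rule prob_space.prob_space_distr)
  moreover have "(\<integral>x. f x \<partial>?M) = (\<Sum>i<n. p i * f (d i))" if "f \<in> borel_measurable (sborel S)" for f :: "'x \<Rightarrow> real"
  proof -
    have "(\<integral>x. f x \<partial>?M) = (\<integral>i. p i *\<^sub>R f (d i) \<partial>count_space {..<n})"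
      using p(1) by (subst integral_distr[OF d' that], subst integral_density) (auto intro!: AE_I2)
    then show ?thesis by (simp add: lebesgue_integral_count_space_finite)
  qed
  ultimately show ?thesis by (intro exI[of _ ?M]) auto
qed

section \<open>Integrals of continuous functions on compact products\<close>

lemma integrable_continuous_compact:
  fixes f :: "'x::topological_space \<Rightarrow> real"
  assumes "compact S" "continuous_on S f" "prob_space M" "sets M = sets (sborel S)"
  shows "integrable M f"
proof -
  interpret prob_space M by fact
  obtain B where "\<And>x. x \<in> S \<Longrightarrow> norm (f x) \<le> B"
    using compact_imp_bounded[OF compact_continuous_image[OF assms(2,1)]] by (auto simp: bounded_iff)
  moreover have "f \<in> borel_measurable M"
    using borel_measurable_continuous_on_restrict[OF assms(2)] assms(4) by (simp cong: measurable_cong_sets)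
  ultimately show ?thesis
    using sets_eq_imp_space_eq[OF assms(4)] by (intro integrable_const_bound[where B=B]) (auto simp: space_restrict_space)
qed

lemma continuous_on_sections:
  assumes "continuous_on (S1 \<times> S2) (\<lambda>(s, t). c s t)"
  shows "y \<in> S2 \<Longrightarrow> continuous_on S1 (\<lambda>x. c x y)" "x \<in> S1 \<Longrightarrow> continuous_on S2 (c x)"
proof -
  assume "y \<in> S2"
  then have "continuous_on S1 (\<lambda>x. (\<lambda>(s, t). c s t) (x, y))"
    by (intro continuous_on_compose2[OF assms] continuous_intros) auto
  then show "continuous_on S1 (\<lambda>x. c x y)" by simp
next
  assume "x \<in> S1"
  then have "continuous_on S2 (\<lambda>y. (\<lambda>(s, t). c s t) (x, y))"
    by (intro continuous_on_compose2[OF assms] continuous_intros) auto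
  then show "continuous_on S2 (c x)" by simp
qed

text \<open>Uniform continuity on the product and a partition of unity in \<open>y\<close> alone
  give a finite sum of products. Integrals against two laws then reduce to products of integrals in
  one variable.\<close>

lemma separable_approx:
  fixes c :: "'x::metric_space \<Rightarrow> 'y::metric_space \<Rightarrow> real"
  assumes S: "compact S1" "compact S2" and c: "continuous_on (S1 \<times> S2) (\<lambda>(s, t). c s t)" and e: "e > 0"
  shows "\<exists>I h. finite I \<and> (\<forall>i\<in>I. i \<in> S2 \<and> continuous_on S2 (h i)) \<and> (\<forall>x\<in>S1. \<forall>y\<in>S2. \<bar>c x y - (\<Sum>i\<in>I. c x i * h i y)\<bar> \<le> e)"
proof -
  have "uniformly_continuous_on (S1 \<times> S2) (\<lambda>(s, t). c s t)"
    by (intro compact_uniformly_continuous c compact_Times S)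
  then obtain \<delta> where \<delta>: "\<delta> > 0" "\<And>z z'. z \<in> S1 \<times> S2 \<Longrightarrow> z' \<in> S1 \<times> S2 \<Longrightarrow> dist z' z < \<delta> \<Longrightarrow> dist (case z' of (s, t) \<Rightarrow> c s t) (case z of (s, t) \<Rightarrow> c s t) < e"
    using e unfolding uniformly_continuous_on_def by metis
  obtain I h where P: "fine_partition S2 \<delta> I id h" using fine_partition_exists[OF S(2) \<delta>(1)] by blast
  have "\<bar>c x y - (\<Sum>i\<in>I. c x i * h i y)\<bar> \<le> e" if "x \<in> S1" "y \<in> S2" for x y
  proof -
    have "\<bar>c x y - (\<Sum>i\<in>I. c x (id i) * h i y)\<bar> \<le> e"
    proof (rule fine_partition_approx[OF P that(2)])
      fix z assume "z \<in> S2" "dist y z < \<delta>"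
      then show "\<bar>c x y - c x z\<bar> \<le> e"
        using \<delta>(2)[of "(x, z)" "(x, y)"] that by (simp add: dist_real_def dist_Pair_Pair)
    qed
    then show ?thesis by simp
  qed
  moreover have "finite I" "\<forall>i\<in>I. i \<in> S2 \<and> continuous_on S2 (h i)" using P by (auto simp: fine_partition_def)
  ultimately show ?thesis by blast
qed

lemma integral_separable_approx:
  fixes c :: "'x::metric_space \<Rightarrow> 'y::metric_space \<Rightarrow> real"
  assumes S: "compact S2" and c: "continuous_on S2 (c x)" and M: "prob_space M" "sets M = sets (sborel S2)"
    and h: "\<And>i. i \<in> I \<Longrightarrow> continuous_on S2 (h i)" and ap: "\<And>y. y \<in> S2 \<Longrightarrow> \<bar>c x y - (\<Sum>i\<in>I. c x i * h i y)\<bar> \<le> e"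
  shows "\<bar>(\<Sum>i\<in>I. c x i * (\<integral>y. h i y \<partial>M)) - (\<integral>y. c x y \<partial>M)\<bar> \<le> e"
proof -
  interpret prob_space M by fact
  have sp: "space M = S2" using sets_eq_imp_space_eq[OF M(2)] by (simp add: space_restrict_space)
  note int = integrable_continuous_compact[OF S _ M]
  have "(\<Sum>i\<in>I. c x i * (\<integral>y. h i y \<partial>M)) - (\<integral>y. c x y \<partial>M) = (\<integral>y. (\<Sum>i\<in>I. c x i * h i y) - c x y \<partial>M)"
    using int[OF h] int[OF c] by (simp add: Bochner_Integration.integral_sum Bochner_Integration.integral_diff)
  also have "\<bar>\<dots>\<bar> \<le> e"
    using ap by (intro integral_abs_le_const) (simp add: sp abs_minus_commute)
  finally show ?thesis .
qed

lemma continuous_on_integral: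
  fixes c :: "'x::metric_space \<Rightarrow> 'y::metric_space \<Rightarrow> real"
  assumes S: "compact S1" "compact S2" and c: "continuous_on (S1 \<times> S2) (\<lambda>(s, t). c s t)"
    and M: "prob_space M" "sets M = sets (sborel S2)"
  shows "continuous_on S1 (\<lambda>x. \<integral>y. c x y \<partial>M)"
proof -
  interpret uniform_algebra S1 "{f. continuous_on S1 f}" by (rule uniform_algebra_continuous)
  have "(\<lambda>x. \<integral>y. c x y \<partial>M) \<in> {f. continuous_on S1 f}"
  proof (rule approx)
    fix e :: real assume e: "e > 0"
    obtain I h where Ih: "finite I" "\<forall>i\<in>I. i \<in> S2 \<and> continuous_on S2 (h i)"
      "\<forall>x\<in>S1. \<forall>y\<in>S2. \<bar>c x y - (\<Sum>i\<in>I. c x i * h i y)\<bar> \<le> e"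
      using separable_approx[OF S c e] by blast
    have "\<bar>(\<Sum>i\<in>I. c x i * (\<integral>y. h i y \<partial>M)) - (\<integral>y. c x y \<partial>M)\<bar> \<le> e" if "x \<in> S1" for x
      by (rule integral_separable_approx[where c=c and x=x, OF S(2) continuous_on_sections(2)[OF c that] M]) (use Ih(2) in blast, rule Ih(3)[rule_format, OF that])
    moreover have "continuous_on S1 (\<lambda>x. \<Sum>i\<in>I. c x i * (\<integral>y. h i y \<partial>M))"
      using Ih(2) by (intro continuous_intros continuous_on_sections(1)[OF c]) blast
    ultimately show "\<exists>f\<in>{f. continuous_on S1 f}. \<forall>t\<in>S1. \<bar>f t - (\<integral>y. c t y \<partial>M)\<bar> \<le> e"
      by (intro bexI[of _ "\<lambda>x. \<Sum>i\<in>I. c x i * (\<integral>y. h i y \<partial>M)"]) (blast, simp)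
  qed
  then show ?thesis by simp
qed

theorem compact_real_game_equilibrium:
  fixes S1 S2 :: "real set" and c1 c2 :: "real \<Rightarrow> real \<Rightarrow> real"
  assumes S: "compact S1" "S1 \<noteq> {}" "compact S2" "S2 \<noteq> {}"
    and c: "continuous_on (S1 \<times> S2) (\<lambda>(s, t). c1 s t)" "continuous_on (S1 \<times> S2) (\<lambda>(s, t). c2 s t)"
  shows "\<exists>M1 M2. prob_space M1 \<and> sets M1 = sets (sborel S1) \<and> prob_space M2 \<and> sets M2 = sets (sborel S2) \<and>
    (\<forall>s\<in>S1. (\<integral>x. (\<integral>y. c1 x y \<partial>M2) \<partial>M1) \<le> (\<integral>y. c1 s y \<partial>M2)) \<and>
    (\<forall>t\<in>S2. (\<integral>x. (\<integral>y. c2 x y \<partial>M2) \<partial>M1) \<le> (\<integral>x. c2 x t \<partial>M1))"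
proof -
  obtain D1 where D1: "countable D1" "D1 \<subseteq> S1" "S1 \<subseteq> closure D1" using separable by blast
  obtain D2 where D2: "countable D2" "D2 \<subseteq> S2" "S2 \<subseteq> closure D2" using separable by blast
  have ne: "D1 \<noteq> {}" "D2 \<noteq> {}" using D1 D2 S by auto
  define d1 where "d1 = from_nat_into D1"
  define d2 where "d2 = from_nat_into D2"
  have d: "d1 i \<in> S1" "d2 i \<in> S2" for i
    using from_nat_into[OF ne(1), of i] from_nat_into[OF ne(2), of i] D1 D2 by (auto simp: d1_def d2_def)
  have r: "range d1 = D1" "range d2 = D2"
    unfolding d1_def d2_def by (simp_all add: range_from_nat_into D1 D2 ne)
  note cs = continuous_on_sections
  have "\<exists>M1 M2. prob_space M1 \<and> sets M1 = sets (sborel S1) \<and> prob_space M2 \<and> sets M2 = sets (sborel S2) \<and>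
     (\<forall>i<Suc n. (\<integral>x. (\<integral>y. c1 x y \<partial>M2) \<partial>M1) \<le> (\<integral>y. c1 (d1 i) y \<partial>M2)) \<and>
     (\<forall>j<Suc n. (\<integral>x. (\<integral>y. c2 x y \<partial>M2) \<partial>M1) \<le> (\<integral>x. c2 x (d2 j) \<partial>M1))" for n
  proof -
    obtain p q where pq: "\<forall>i<Suc n. 0 \<le> p i" "(\<Sum>i<Suc n. p i) = 1" "\<forall>j<Suc n. 0 \<le> q j" "(\<Sum>j<Suc n. q j) = 1"
      and eq: "\<forall>i<Suc n. (\<Sum>k<Suc n. p k * (\<Sum>j<Suc n. q j * c1 (d1 k) (d2 j))) \<le> (\<Sum>j<Suc n. q j * c1 (d1 i) (d2 j))"
        "\<forall>j<Suc n. (\<Sum>l<Suc n. q l * (\<Sum>k<Suc n. p k * c2 (d1 k) (d2 l))) \<le> (\<Sum>k<Suc n. p k * c2 (d1 k) (d2 j))"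
      using finite_game_equilibrium[of "Suc n" "\<lambda>i j. c1 (d1 i) (d2 j)" "\<lambda>i j. c2 (d1 i) (d2 j)"] by blast
    obtain M1 where M1: "prob_space M1" "sets M1 = sets (sborel S1)"
      "\<And>f. f \<in> borel_measurable (sborel S1) \<Longrightarrow> (\<integral>x. f x \<partial>M1) = (\<Sum>i<Suc n. p i * f (d1 i))"
      using finite_mixture[of "Suc n" p d1 S1] pq d by blast
    obtain M2 where M2: "prob_space M2" "sets M2 = sets (sborel S2)"
      "\<And>f. f \<in> borel_measurable (sborel S2) \<Longrightarrow> (\<integral>x. f x \<partial>M2) = (\<Sum>i<Suc n. q i * f (d2 i))"
      using finite_mixture[of "Suc n" q d2 S2] pq d by blast
    have I2: "(\<integral>y. c x y \<partial>M2) = (\<Sum>j<Suc n. q j * c x (d2 j))" if "continuous_on (S1 \<times> S2) (\<lambda>(s, t). c s t)" "x \<in> S1" for c x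
      using cs(2)[OF that] by (intro M2(3) borel_measurable_continuous_on_restrict) auto
    have I1: "(\<integral>x. c x y \<partial>M1) = (\<Sum>i<Suc n. p i * c (d1 i) y)" if "continuous_on (S1 \<times> S2) (\<lambda>(s, t). c s t)" "y \<in> S2" for c y
      using cs(1)[OF that] by (intro M1(3) borel_measurable_continuous_on_restrict) auto
    have I12: "(\<integral>x. (\<integral>y. c x y \<partial>M2) \<partial>M1) = (\<Sum>i<Suc n. p i * (\<Sum>j<Suc n. q j * c (d1 i) (d2 j)))"
      if "continuous_on (S1 \<times> S2) (\<lambda>(s, t). c s t)" for c
    proof -
      have "(\<integral>x. (\<integral>y. c x y \<partial>M2) \<partial>M1) = (\<integral>x. (\<Sum>j<Suc n. q j * c x (d2 j)) \<partial>M1)"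
        using I2[OF that] sets_eq_imp_space_eq[OF M1(2)] by (intro Bochner_Integration.integral_cong) (auto simp: space_restrict_space)
      also have "\<dots> = (\<Sum>i<Suc n. p i * (\<Sum>j<Suc n. q j * c (d1 i) (d2 j)))"
        using cs(1)[OF that] d by (intro M1(3) borel_measurable_continuous_on_restrict continuous_intros) blast
      finally show ?thesis .
    qed
    \<comment> \<open>The finite game evaluates the second cost with \<open>q\<close> outermost, so
      the order of summation is exchanged.\<close>
    have sw: "(\<Sum>i<Suc n. p i * (\<Sum>j<Suc n. q j * c2 (d1 i) (d2 j))) = (\<Sum>j<Suc n. q j * (\<Sum>i<Suc n. p i * c2 (d1 i) (d2 j)))"
      unfolding sum_distrib_left by (subst sum.swap) (simp only: mult.left_commute)
    show ?thesis
      using M1(1,2) M2(1,2) eq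
      by (intro exI[of _ M1] exI[of _ M2]) (simp only: I1[OF c(2) d(2)] I2[OF c(1) d(1)] I12[OF c(1)] I12[OF c(2)] sw simp_thms)
  qed
  then obtain \<mu>1 \<mu>2 where \<mu>1: "\<And>n. prob_space (\<mu>1 n)" "\<And>n. sets (\<mu>1 n) = sets (sborel S1)"
    and \<mu>2: "\<And>n. prob_space (\<mu>2 n)" "\<And>n. sets (\<mu>2 n) = sets (sborel S2)"
    and eq: "\<And>n i. i < Suc n \<Longrightarrow> (\<integral>x. (\<integral>y. c1 x y \<partial>\<mu>2 n) \<partial>\<mu>1 n) \<le> (\<integral>y. c1 (d1 i) y \<partial>\<mu>2 n)"
      "\<And>n j. j < Suc n \<Longrightarrow> (\<integral>x. (\<integral>y. c2 x y \<partial>\<mu>2 n) \<partial>\<mu>1 n) \<le> (\<integral>x. c2 x (d2 j) \<partial>\<mu>1 n)"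
    by metis
  obtain r1 M1 where r1: "strict_mono r1" and M1: "prob_space M1" "sets M1 = sets (sborel S1)"
    and lim1: "\<And>f. continuous_on S1 f \<Longrightarrow> (\<lambda>n. \<integral>x. f x \<partial>\<mu>1 (r1 n)) \<longlonglongrightarrow> (\<integral>x. f x \<partial>M1 :: real)"
    using weak_limit_compact[OF S(1,2), of \<mu>1] \<mu>1 by blast
  obtain r2 M2 where r2: "strict_mono r2" and M2: "prob_space M2" "sets M2 = sets (sborel S2)"
    and lim2: "\<And>f. continuous_on S2 f \<Longrightarrow> (\<lambda>n. \<integral>x. f x \<partial>\<mu>2 (r1 (r2 n))) \<longlonglongrightarrow> (\<integral>x. f x \<partial>M2 :: real)"
    using weak_limit_compact[OF S(3,4), of "\<lambda>n. \<mu>2 (r1 n)"] \<mu>2 by blast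
  define r where "r n = r1 (r2 n)" for n
  have rn: "n \<le> r n" for n using seq_suble[OF strict_mono_o[OF r1 r2], of n] by (simp add: r_def)
  \<comment> \<open>Index 0 holds the limit law, in the coding of
    \<open>uniform_algebra_LIMSEQ\<close>.\<close>
  define m1 where "m1 n = (case n of 0 \<Rightarrow> M1 | Suc k \<Rightarrow> \<mu>1 (r k))" for n
  define m2 where "m2 n = (case n of 0 \<Rightarrow> M2 | Suc k \<Rightarrow> \<mu>2 (r k))" for n
  have m1: "prob_space (m1 n)" "sets (m1 n) = sets (sborel S1)" for n by (auto simp: m1_def M1 \<mu>1 split: nat.split)
  have m2: "prob_space (m2 n)" "sets (m2 n) = sets (sborel S2)" for n by (auto simp: m2_def M2 \<mu>2 split: nat.split)
  have sp: "space (m1 n) = S1" "space (m2 n) = S2" for n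
    using sets_eq_imp_space_eq[OF m1(2)] sets_eq_imp_space_eq[OF m2(2)] by (auto simp: space_restrict_space)
  define F where "F = {f :: nat \<Rightarrow> real. (\<lambda>n. f (Suc n)) \<longlonglongrightarrow> f 0}"
  interpret F: uniform_algebra "UNIV :: nat set" F unfolding F_def by (rule uniform_algebra_LIMSEQ)
  have F1: "(\<lambda>n. \<integral>x. f x \<partial>m1 n) \<in> F" if "continuous_on S1 f" for f
    using LIMSEQ_subseq_LIMSEQ[OF lim1[OF that] r2] by (simp add: F_def m1_def r_def o_def)
  have F2: "(\<lambda>n. \<integral>x. f x \<partial>m2 n) \<in> F" if "continuous_on S2 f" for f
    using lim2[OF that] by (simp add: F_def m2_def r_def)
  \<comment> \<open>Weak convergence of both laws gives convergence of the double integral: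
    separation of variables turns it into sums of products, with one error \<open>e\<close> for all
    indices.\<close>
  have F12: "(\<lambda>n. \<integral>x. (\<integral>y. c x y \<partial>m2 n) \<partial>m1 n) \<in> F" if c: "continuous_on (S1 \<times> S2) (\<lambda>(s, t). c s t)" for c :: "real \<Rightarrow> real \<Rightarrow> real"
  proof (rule F.approx)
    fix e :: real assume e: "e > 0"
    obtain I h where Ih0: "finite I" "\<forall>i\<in>I. i \<in> S2 \<and> continuous_on S2 (h i)"
      "\<forall>x\<in>S1. \<forall>y\<in>S2. \<bar>c x y - (\<Sum>i\<in>I. c x i * h i y)\<bar> \<le> e"
      using separable_approx[OF S(1,3) c e] by blast
    have Ih: "\<And>i. i \<in> I \<Longrightarrow> i \<in> S2" "\<And>i. i \<in> I \<Longrightarrow> continuous_on S2 (h i)" using Ih0 by auto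
    have ap: "\<bar>(\<Sum>i\<in>I. c x i * (\<integral>y. h i y \<partial>m2 n)) - (\<integral>y. c x y \<partial>m2 n)\<bar> \<le> e" if "x \<in> S1" for x n
      by (rule integral_separable_approx[where c=c and x=x, OF S(3) cs(2)[OF c that] m2]) (use Ih0(2) in blast, rule Ih0(3)[rule_format, OF that])
    show "\<exists>f\<in>F. \<forall>t\<in>UNIV. \<bar>f t - (\<integral>x. (\<integral>y. c x y \<partial>m2 t) \<partial>m1 t)\<bar> \<le> e"
    proof (intro bexI ballI)
      show "(\<lambda>n. \<Sum>i\<in>I. (\<integral>x. c x i \<partial>m1 n) * (\<integral>y. h i y \<partial>m2 n)) \<in> F"
        by (intro F.sum F.mult F1 F2 cs(1)[OF c] Ih)
      fix n :: nat
      interpret m1: prob_space "m1 n" by (rule m1)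
      note int1 = integrable_continuous_compact[OF S(1) _ m1]
      have "(\<Sum>i\<in>I. (\<integral>x. c x i \<partial>m1 n) * (\<integral>y. h i y \<partial>m2 n)) = (\<integral>x. (\<Sum>i\<in>I. c x i * (\<integral>y. h i y \<partial>m2 n)) \<partial>m1 n)"
        using int1[OF cs(1)[OF c Ih(1)]] by (simp add: Bochner_Integration.integral_sum)
      also have "\<dots> - (\<integral>x. (\<integral>y. c x y \<partial>m2 n) \<partial>m1 n) = (\<integral>x. (\<Sum>i\<in>I. c x i * (\<integral>y. h i y \<partial>m2 n)) - (\<integral>y. c x y \<partial>m2 n) \<partial>m1 n)"
        by (intro Bochner_Integration.integral_diff[symmetric] int1 continuous_on_integral[OF S(1,3) c m2] continuous_intros cs(1)[OF c] Ih)
      also have "\<bar>\<dots>\<bar> \<le> e"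
        by (rule m1.integral_abs_le_const) (simp add: sp ap)
      finally show "\<bar>(\<Sum>i\<in>I. (\<integral>x. c x i \<partial>m1 n) * (\<integral>y. h i y \<partial>m2 n)) - (\<integral>x. (\<integral>y. c x y \<partial>m2 n) \<partial>m1 n)\<bar> \<le> e" .
    qed
  qed
  have m0: "m1 0 = M1" "m2 0 = M2" by (simp_all add: m1_def m2_def)
  have swap: "continuous_on (S2 \<times> S1) (\<lambda>(t, s). c2 s t)"
  proof -
    have "continuous_on (S2 \<times> S1) (\<lambda>z. (\<lambda>(s, t). c2 s t) (snd z, fst z))"
      by (intro continuous_on_compose2[OF c(2)] continuous_intros) auto
    then show ?thesis by (simp add: split_beta)
  qed
  have le1: "(\<integral>x. (\<integral>y. c1 x y \<partial>M2) \<partial>M1) \<le> (\<integral>y. c1 (d1 i) y \<partial>M2)" for i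
  proof (rule LIMSEQ_le)
    show "(\<lambda>n. \<integral>x. (\<integral>y. c1 x y \<partial>m2 (Suc n)) \<partial>m1 (Suc n)) \<longlonglongrightarrow> (\<integral>x. (\<integral>y. c1 x y \<partial>M2) \<partial>M1)"
      using F12[OF c(1)] m0 by (simp add: F_def)
    show "(\<lambda>n. \<integral>y. c1 (d1 i) y \<partial>m2 (Suc n)) \<longlonglongrightarrow> (\<integral>y. c1 (d1 i) y \<partial>M2)"
      using F2[OF cs(2)[OF c(1) d(1)]] m0 by (simp add: F_def)
    show "\<exists>N. \<forall>n\<ge>N. (\<integral>x. (\<integral>y. c1 x y \<partial>m2 (Suc n)) \<partial>m1 (Suc n)) \<le> (\<integral>y. c1 (d1 i) y \<partial>m2 (Suc n))"
    proof (intro exI[of _ i] allI impI)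
      fix n assume "i \<le> n"
      then have "i < Suc (r n)" using rn[of n] by linarith
      then show "(\<integral>x. (\<integral>y. c1 x y \<partial>m2 (Suc n)) \<partial>m1 (Suc n)) \<le> (\<integral>y. c1 (d1 i) y \<partial>m2 (Suc n))"
        using eq(1)[of i "r n"] by (simp add: m1_def m2_def)
    qed
  qed
  have le2: "(\<integral>x. (\<integral>y. c2 x y \<partial>M2) \<partial>M1) \<le> (\<integral>x. c2 x (d2 i) \<partial>M1)" for i
  proof (rule LIMSEQ_le)
    show "(\<lambda>n. \<integral>x. (\<integral>y. c2 x y \<partial>m2 (Suc n)) \<partial>m1 (Suc n)) \<longlonglongrightarrow> (\<integral>x. (\<integral>y. c2 x y \<partial>M2) \<partial>M1)"
      using F12[OF c(2)] m0 by (simp add: F_def)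
    show "(\<lambda>n. \<integral>x. c2 x (d2 i) \<partial>m1 (Suc n)) \<longlonglongrightarrow> (\<integral>x. c2 x (d2 i) \<partial>M1)"
      using F1[OF cs(1)[OF c(2) d(2)]] m0 by (simp add: F_def)
    show "\<exists>N. \<forall>n\<ge>N. (\<integral>x. (\<integral>y. c2 x y \<partial>m2 (Suc n)) \<partial>m1 (Suc n)) \<le> (\<integral>x. c2 x (d2 i) \<partial>m1 (Suc n))"
    proof (intro exI[of _ i] allI impI)
      fix n assume "i \<le> n"
      then have "i < Suc (r n)" using rn[of n] by linarith
      then show "(\<integral>x. (\<integral>y. c2 x y \<partial>m2 (Suc n)) \<partial>m1 (Suc n)) \<le> (\<integral>x. c2 x (d2 i) \<partial>m1 (Suc n))"
        using eq(2)[of i "r n"] by (simp add: m1_def m2_def)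
    qed
  qed
  have cl: "closure D1 = S1" "closure D2 = S2"
    using D1 D2 S by (simp_all add: closure_minimal compact_imp_closed subset_antisym)
  have "(\<integral>x. (\<integral>y. c1 x y \<partial>M2) \<partial>M1) \<le> (\<integral>y. c1 s y \<partial>M2)" if "s \<in> S1" for s
  proof (rule continuous_ge_on_closure[where S=D1 and f="\<lambda>s. \<integral>y. c1 s y \<partial>M2" and x=s])
    show "continuous_on (closure D1) (\<lambda>s. \<integral>y. c1 s y \<partial>M2)"
      unfolding cl by (rule continuous_on_integral[OF S(1,3) c(1) M2])
    fix s assume "s \<in> D1"
    then obtain i where "s = d1 i" using r by blast
    then show "(\<integral>x. (\<integral>y. c1 x y \<partial>M2) \<partial>M1) \<le> (\<integral>y. c1 s y \<partial>M2)" using le1 by simp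
  qed (simp add: cl that)
  moreover have "(\<integral>x. (\<integral>y. c2 x y \<partial>M2) \<partial>M1) \<le> (\<integral>x. c2 x t \<partial>M1)" if "t \<in> S2" for t
  proof (rule continuous_ge_on_closure[where S=D2 and f="\<lambda>t. \<integral>x. c2 x t \<partial>M1" and x=t])
    show "continuous_on (closure D2) (\<lambda>t. \<integral>x. c2 x t \<partial>M1)"
      unfolding cl by (rule continuous_on_integral[OF S(3,1) swap M1])
    fix t assume "t \<in> D2"
    then obtain i where "t = d2 i" using r by blast
    then show "(\<integral>x. (\<integral>y. c2 x y \<partial>M2) \<partial>M1) \<le> (\<integral>x. c2 x t \<partial>M1)" using le2 by simp
  qed (simp add: cl that)
  ultimately show ?thesis using M1 M2 by blast
qed

section \<open>Compactness of the set of kernels\<close>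

text \<open>Sequential compactness of the cube with countably many coordinates takes the place of a
  diagonal construction.\<close>

lemma bounded_diagonal_subsequence:
  fixes x :: "nat \<Rightarrow> 'i::countable \<Rightarrow> real"
  assumes "\<And>n k. 0 \<le> x n k \<and> x n k \<le> 1"
  shows "\<exists>r. strict_mono (r :: nat \<Rightarrow> nat) \<and> (\<forall>k. convergent (\<lambda>n. x (r n) k))"
proof -
  have "compactin (product_topology (\<lambda>_::nat. euclideanreal) UNIV) (PiE UNIV (\<lambda>i. {0..1}))"
    by (subst compactin_PiE) auto
  then have K: "compact (PiE (UNIV::nat set) (\<lambda>_. {0..1::real}))" by (simp add: euclidean_product_topology)
  let ?z = "\<lambda>n j. x n (from_nat j)"
  have "\<forall>n. ?z n \<in> PiE UNIV (\<lambda>_. {0..1})" using assms by auto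
  then obtain l r where r: "strict_mono (r :: nat \<Rightarrow> nat)" "(?z \<circ> r) \<longlonglongrightarrow> l"
    using K unfolding compact_eq_seq_compact_metric seq_compact_def by metis
  have "convergent (\<lambda>n. x (r n) k)" for k
    using continuous_on_tendsto_compose[OF continuous_on_product_coordinates[of "to_nat k"] r(2)]
    by (auto simp: convergent_def)
  then show ?thesis using r(1) by blast
qed

text \<open>The limiting set function is additive and lies between 0 and \<open>M\<close>.
  Domination by \<open>M\<close> makes it countably additive and absolutely continuous, so
  Radon-Nikodym gives a density, which is at most 1 almost everywhere.\<close>

lemma (in finite_measure) weak_limit_unit_interval:
  fixes g :: "nat \<Rightarrow> 'a \<Rightarrow> real"
  assumes g[measurable]: "\<And>n. g n \<in> borel_measurable M" and g01: "\<And>n y. y \<in> space M \<Longrightarrow> 0 \<le> g n y \<and> g n y \<le> 1"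
    and conv: "\<And>B. B \<in> sets M \<Longrightarrow> convergent (\<lambda>n. \<integral>y. indicator B y * g n y \<partial>M)"
  shows "\<exists>f \<in> borel_measurable M. (\<forall>y. 0 \<le> f y \<and> f y \<le> 1) \<and>
    (\<forall>B\<in>sets M. (\<lambda>n. \<integral>y. indicator B y * g n y \<partial>M) \<longlonglongrightarrow> (\<integral>y. indicator B y * f y \<partial>M))"
proof -
  define I where "I n B = (\<integral>y. indicator B y * g n y \<partial>M)" for n B
  define G where "G B = lim (\<lambda>n. I n B)" for B
  have int: "integrable M (\<lambda>y. indicator B y * g n y)" if [measurable]: "B \<in> sets M" for n B
    using g01[of _ n] by (intro integrable_const_bound[where B=1] AE_I2) (auto split: split_indicator)
  have lim: "(\<lambda>n. I n B) \<longlonglongrightarrow> G B" if "B \<in> sets M" for B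
    using conv[OF that] unfolding G_def I_def by (rule convergent_LIMSEQ_iff[THEN iffD1])
  have I0: "0 \<le> I n B" for n B
    unfolding I_def using g01[of _ n] by (intro Bochner_Integration.integral_nonneg_AE AE_I2) auto
  have I1: "I n B \<le> measure M B" if B: "B \<in> sets M" for n B
  proof -
    have "I n B \<le> (\<integral>y. indicator B y \<partial>M)"
      unfolding I_def using B g01[of _ n] by (intro integral_mono int) (auto simp: emeasure_eq_measure split: split_indicator)
    then show ?thesis using B sets.sets_into_space[OF B] by (simp add: Int_absorb2)
  qed
  have G0: "0 \<le> G B" "G B \<le> measure M B" if "B \<in> sets M" for B
    using LIMSEQ_le_const[OF lim[OF that]] LIMSEQ_le_const2[OF lim[OF that]] I0 I1[OF that] by auto
  have Iadd: "I n (A \<union> B) = I n A + I n B" if [measurable]: "A \<in> sets M" "B \<in> sets M" and "A \<inter> B = {}" for n A B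
  proof -
    have "I n (A \<union> B) = (\<integral>y. indicator A y * g n y + indicator B y * g n y \<partial>M)"
      unfolding I_def using that(3) by (intro Bochner_Integration.integral_cong) (auto split: split_indicator)
    then show ?thesis unfolding I_def by (simp add: int that)
  qed
  have Gadd: "G (A \<union> B) = G A + G B" if "A \<in> sets M" "B \<in> sets M" "A \<inter> B = {}" for A B
  proof (rule LIMSEQ_unique[OF lim])
    show "(\<lambda>n. I n (A \<union> B)) \<longlonglongrightarrow> G A + G B" unfolding Iadd[OF that] by (intro tendsto_add lim that)
  qed (use that in auto)
  have G_empty: "G {} = 0" using G0[of "{}"] by simp
  define N where "N = measure_of (space M) (sets M) (\<lambda>B. ennreal (G B))"
  have ca: "countably_additive (sets M) (\<lambda>B. ennreal (G B))"
  proof (rule countably_additiveI)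
    fix A :: "nat \<Rightarrow> 'a set" assume A: "range A \<subseteq> sets M" "disjoint_family A" "\<Union> (range A) \<in> sets M"
    have An: "A i \<in> sets M" for i using A by auto
    have fin: "(\<Sum>i<n. G (A i)) = G (\<Union>i<n. A i)" for n
    proof (induction n)
      case (Suc n)
      have "A n \<inter> A i = {}" if "i < n" for i using disjoint_family_onD[OF A(2), of n i] that by auto
      then have "A n \<inter> (\<Union>i<n. A i) = {}" by auto
      then have "G (A n \<union> (\<Union>i<n. A i)) = G (A n) + G (\<Union>i<n. A i)" using An by (intro Gadd) auto
      then show ?case using Suc by (simp add: lessThan_Suc add.commute)
    qed (simp add: G_empty)
    \<comment> \<open>Continuity along the remainders is inherited from \<open>M\<close>, since
      \<open>G\<close> is at most \<open>M\<close> on them.\<close>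
    have "(\<lambda>n. G (\<Union> (range A)) - G (\<Union>i<n. A i)) \<longlonglongrightarrow> 0"
    proof (rule Lim_null_comparison[OF always_eventually])
      show "\<forall>n. norm (G (\<Union> (range A)) - G (\<Union>i<n. A i)) \<le> measure M (\<Union> (range A) - (\<Union>i<n. A i))"
      proof
        fix n
        have s: "\<Union> (range A) - (\<Union>i<n. A i) \<in> sets M" "(\<Union>i<n. A i) \<in> sets M" using An A(3) by auto
        have "G ((\<Union> (range A) - (\<Union>i<n. A i)) \<union> (\<Union>i<n. A i)) = G (\<Union> (range A) - (\<Union>i<n. A i)) + G (\<Union>i<n. A i)"
          using s by (intro Gadd) auto
        moreover have "(\<Union> (range A) - (\<Union>i<n. A i)) \<union> (\<Union>i<n. A i) = \<Union> (range A)" by auto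
        ultimately show "norm (G (\<Union> (range A)) - G (\<Union>i<n. A i)) \<le> measure M (\<Union> (range A) - (\<Union>i<n. A i))"
          using G0[OF s(1)] by simp
      qed
      have "(\<lambda>n. measure M (\<Union> (range A) - (\<Union>i<n. A i))) \<longlonglongrightarrow> measure M (\<Inter>n. \<Union> (range A) - (\<Union>i<n. A i))"
        using An by (intro finite_Lim_measure_decseq) (auto simp: decseq_def intro!: sets.Diff sets.countable_UN'')
      also have "(\<Inter>n. \<Union> (range A) - (\<Union>i<n. A i)) = {}" by auto
      finally show "(\<lambda>n. measure M (\<Union> (range A) - (\<Union>i<n. A i))) \<longlonglongrightarrow> 0" by simp
    qed
    then have "(\<lambda>n. G (\<Union> (range A)) - (G (\<Union> (range A)) - G (\<Union>i<n. A i))) \<longlonglongrightarrow> G (\<Union> (range A)) - 0"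
      by (intro tendsto_diff tendsto_const)
    then have "(\<lambda>i. G (A i)) sums G (\<Union> (range A))" unfolding sums_def fin by simp
    then show "(\<Sum>i. ennreal (G (A i))) = ennreal (G (\<Union> (range A)))"
      using G0(1)[OF An] by (intro suminf_ennreal_eq) auto
  qed
  have setsN: "sets N = sets M" unfolding N_def by simp
  have emN: "emeasure N B = ennreal (G B)" if "B \<in> sets M" for B
    by (rule emeasure_measure_of[OF N_def])
      (use ca that in \<open>auto simp: positive_def G_empty setsN dest: sets.sets_into_space\<close>)
  have "absolutely_continuous M N"
    unfolding absolutely_continuous_def
  proof
    fix B assume "B \<in> null_sets M"
    then have "B \<in> sets M" "measure M B = 0" by (auto simp: null_sets_def measure_def)
    then show "B \<in> null_sets N" using G0[of B] by (auto simp: null_sets_def emN setsN)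
  qed
  then obtain f where f[measurable]: "f \<in> borel_measurable M" and fN: "density M f = N"
    using Radon_Nikodym[OF _ setsN] by blast
  have nf: "(\<integral>\<^sup>+y. f y * indicator B y \<partial>M) = ennreal (G B)" if "B \<in> sets M" for B
    using emeasure_density[OF f that] emN[OF that] fN by simp
  \<comment> \<open>If \<open>f\<close> exceeded 1 on a set of positive measure, its integral there
    would exceed the measure of the set, against the bound on \<open>G\<close>.\<close>
  have f1: "AE y in M. f y \<le> 1"
  proof -
    let ?B = "{y \<in> space M. 1 < f y}"
    have B[measurable]: "?B \<in> sets M" by measurable
    have fin: "(\<integral>\<^sup>+y. f y * indicator ?B y \<partial>M) \<le> (\<integral>\<^sup>+y. indicator ?B y \<partial>M)"
      using nf[OF B] G0[OF B] by (simp add: emeasure_eq_measure ennreal_leI)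
    have "(\<integral>\<^sup>+y. (f y - 1) * indicator ?B y \<partial>M) = (\<integral>\<^sup>+y. f y * indicator ?B y - indicator ?B y \<partial>M)"
      by (intro nn_integral_cong) (auto split: split_indicator)
    also have "\<dots> = (\<integral>\<^sup>+y. f y * indicator ?B y \<partial>M) - (\<integral>\<^sup>+y. indicator ?B y \<partial>M)"
      by (intro nn_integral_diff AE_I2) (auto simp: emeasure_eq_measure split: split_indicator intro: less_imp_le)
    also have "\<dots> = 0" using fin nf[OF B] by (simp only: diff_eq_0_iff_ennreal) simp
    finally have "AE y in M. (f y - 1) * indicator ?B y = 0" by (subst (asm) nn_integral_0_iff_AE) auto
    then show ?thesis
    proof (rule AE_mp, intro AE_I2 impI)
      fix y assume y: "y \<in> space M" "(f y - 1) * indicator ?B y = 0"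
      show "f y \<le> 1"
      proof (rule ccontr)
        assume "\<not> f y \<le> 1"
        then have "f y - 1 = 0" "1 < f y" using y by auto
        then show False by (auto simp: diff_eq_0_iff_ennreal dest: leD)
      qed
    qed
  qed
  \<comment> \<open>Truncation makes the bounds hold at every point; almost everywhere it changes
    nothing.\<close>
  define g' where "g' y = enn2real (min 1 (f y))" for y
  have [measurable]: "g' \<in> borel_measurable M" unfolding g'_def by measurable
  have g'01: "0 \<le> g' y \<and> g' y \<le> 1" for y
    unfolding g'_def using enn2real_mono[of "min 1 (f y)" 1] by auto
  have "(\<integral>y. indicator B y * g' y \<partial>M) = G B" if [measurable]: "B \<in> sets M" for B
  proof -
    have "(\<integral>\<^sup>+y. ennreal (indicator B y * g' y) \<partial>M) = (\<integral>\<^sup>+y. f y * indicator B y \<partial>M)"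
      using f1
    proof (intro nn_integral_cong_AE, eventually_elim)
      case (elim y)
      then have "ennreal (enn2real (f y)) = f y" by (intro ennreal_enn2real) (auto simp: le_less_trans)
      then show ?case using elim by (auto simp: g'_def min_absorb2 split: split_indicator)
    qed
    also have "\<dots> = ennreal (G B)" by (rule nf[OF that])
    finally show ?thesis using g'01 G0[OF that] by (subst integral_eq_nn_integral) auto
  qed
  then show ?thesis using lim g'01 by (intro bexI[of _ g']) (auto simp: I_def)
qed

lemma AE_le_of_integral_le:
  fixes f g :: "'a \<Rightarrow> real"
  assumes int: "integrable M f" "integrable M g"
    and le: "\<And>B. B \<in> sets M \<Longrightarrow> (\<integral>y. indicator B y * f y \<partial>M) \<le> (\<integral>y. indicator B y * g y \<partial>M)"
    and "sigma_finite_measure M"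
  shows "AE y in M. f y \<le> g y"
proof -
  interpret sigma_finite_measure M by fact
  have "AE y in M. g y - f y \<ge> 0"
  proof (rule density_nonneg)
    fix A assume A: "A \<in> sets M"
    have "integrable M (\<lambda>y. indicator A y * h y)" if "integrable M h" for h :: "'a \<Rightarrow> real"
      using integrable_mult_indicator[OF A that] by simp
    then show "0 \<le> (LINT y:A|M. g y - f y)"
      using le[OF A] int unfolding set_lebesgue_integral_def by (simp add: right_diff_distrib)
  qed (use int in auto)
  then show ?thesis by simp
qed


lemma integral_bind_kernel:
  fixes f :: "'x \<Rightarrow> real"
  assumes M: "prob_space M" and K: "K \<in> M \<rightarrow>\<^sub>M prob_algebra N" and f: "f \<in> borel_measurable N"
    and bd: "\<And>x. x \<in> space N \<Longrightarrow> \<bar>f x\<bar> \<le> C"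
  shows "(\<integral>x. f x \<partial>(M \<bind> K)) = (\<integral>y. (\<integral>x. f x \<partial>K y) \<partial>M)"
proof -
  interpret prob_space M by fact
  have Ky: "prob_space (K y)" "sets (K y) = sets N" if "y \<in> space M" for y
    using measurable_space[OF K that] by (auto simp: space_prob_algebra)
  show ?thesis
  proof (rule integral_bind[where K=N and B=C and B'=1])
    show "f \<in> borel_measurable N" by (rule f)
    show "K \<in> M \<rightarrow>\<^sub>M subprob_algebra N" using K by (rule measurable_prob_algebraD)
    show "AE y in M. emeasure (K y) (space (K y)) \<le> ennreal 1"
      using prob_space.emeasure_space_1[OF Ky(1)] by (intro AE_I2) simp
  qed (use bd in \<open>auto intro: finite_measure_axioms\<close>)
qed

text \<open>The section picks the smallest preimage. Its sublevel sets are the images under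
  \<open>s\<close> of the compact sets \<open>T \<inter> {..a}\<close>, hence closed.\<close>

lemma compact_measurable_section:
  fixes s :: "real \<Rightarrow> 'u::metric_space"
  assumes T: "compact T" and s: "continuous_on T s"
  shows "\<exists>\<rho> \<in> borel_measurable (sborel (s ` T)). \<forall>u \<in> s ` T. \<rho> u \<in> T \<and> s (\<rho> u) = u"
proof -
  define F where "F u = {t \<in> T. s t = u}" for u
  have F: "compact (F u)" for u
  proof -
    have "closed (T \<inter> s -` {u})"
      using continuous_closed_preimage[OF s compact_imp_closed[OF T] closed_singleton] by simp
    then have "compact (T \<inter> (T \<inter> s -` {u}))" using T by (intro compact_Int_closed)
    moreover have "T \<inter> (T \<inter> s -` {u}) = F u" by (auto simp: F_def)
    ultimately show ?thesis by simp
  qed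
  define \<rho> where "\<rho> u = Inf (F u)" for u
  have \<rho>: "\<rho> u \<in> F u" if "u \<in> s ` T" for u
    unfolding \<rho>_def using that F[of u]
    by (intro closed_contains_Inf) (auto simp: F_def compact_imp_closed intro!: bounded_imp_bdd_below compact_imp_bounded)
  have \<rho>_le: "\<rho> u \<le> t" if "t \<in> F u" for u t
    unfolding \<rho>_def using that F[of u] by (intro cInf_lower) (auto intro!: bounded_imp_bdd_below compact_imp_bounded)
  have "\<rho> \<in> borel_measurable (sborel (s ` T))"
  proof (subst borel_measurable_iff_le, intro allI)
    fix a
    have "{u \<in> space (sborel (s ` T)). \<rho> u \<le> a} = s ` (T \<inter> {..a})"
    proof (intro set_eqI iffI)
      fix u assume "u \<in> {u \<in> space (sborel (s ` T)). \<rho> u \<le> a}"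
      then have u: "u \<in> s ` T" "\<rho> u \<le> a" by (auto simp: space_restrict_space)
      show "u \<in> s ` (T \<inter> {..a})"
        using \<rho>[OF u(1)] u(2) by (intro image_eqI[of _ _ "\<rho> u"]) (simp_all add: F_def)
    next
      fix u assume "u \<in> s ` (T \<inter> {..a})"
      then obtain t where "t \<in> T" "t \<le> a" "u = s t" by auto
      then show "u \<in> {u \<in> space (sborel (s ` T)). \<rho> u \<le> a}"
        using \<rho>_le[of t u] by (auto simp: space_restrict_space F_def)
    qed
    moreover have "compact (s ` (T \<inter> {..a}))"
      using T s by (intro compact_continuous_image compact_Int_closed) (auto intro: continuous_on_subset)
    ultimately show "{u \<in> space (sborel (s ` T)). \<rho> u \<le> a} \<in> sets (sborel (s ` T))"
      by (auto simp: sets_restrict_space compact_imp_closed intro!: image_eqI[of _ _ "s ` (T \<inter> {..a})"])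
  qed
  then show ?thesis using \<rho> by (intro bexI[of _ \<rho>]) (auto simp: F_def)
qed

text \<open>Regularization of a family of functions that is, for almost every \<open>y\<close>, a distribution
  function on the rationals.\<close>

lemma kernel_of_rational_cdf:
  fixes F :: "rat \<Rightarrow> 'y \<Rightarrow> real"
  assumes F[measurable]: "\<And>q. F q \<in> borel_measurable Q" and F01: "\<And>q y. 0 \<le> F q y \<and> F q y \<le> 1"
    and mono: "\<And>p q. p \<le> q \<Longrightarrow> AE y in Q. F p y \<le> F q y"
    and lo: "\<And>q. q < 0 \<Longrightarrow> AE y in Q. F q y = 0" and hi: "\<And>q. q \<ge> 1 \<Longrightarrow> AE y in Q. F q y = 1"
  shows "\<exists>\<nu>. \<nu> \<in> Q \<rightarrow>\<^sub>M prob_algebra borel \<and>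
    (\<forall>(x::real) q. of_rat q \<le> x \<longrightarrow> (AE y in Q. F q y \<le> measure (\<nu> y) {..x})) \<and>
    (\<forall>(x::real) q. x < of_rat q \<longrightarrow> (AE y in Q. measure (\<nu> y) {..x} \<le> F q y))"
proof -
  define good where "good y \<longleftrightarrow> (\<forall>p q. p \<le> q \<longrightarrow> F p y \<le> F q y) \<and> (\<forall>q. q < 0 \<longrightarrow> F q y = 0) \<and> (\<forall>q. q \<ge> 1 \<longrightarrow> F q y = 1)" for y
  have [measurable]: "Measurable.pred Q good" unfolding good_def by measurable
  have AE_good: "AE y in Q. good y"
    unfolding good_def using mono lo hi by (simp add: AE_all_countable AE_conj_iff)
  \<comment> \<open>Off the good set any distribution function will do; this is the one of the point
    mass at 0, restricted to the rationals.\<close>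
  define E where "E q y = (if good y then F q y else of_bool (q \<ge> 0))" for q y
  have Em[measurable]: "E q \<in> borel_measurable Q" for q unfolding E_def by measurable
  have E: "\<And>p q. p \<le> q \<Longrightarrow> E p y \<le> E q y" "\<And>q. q < 0 \<Longrightarrow> E q y = 0" "\<And>q. q \<ge> 1 \<Longrightarrow> E q y = 1" "\<And>q. 0 \<le> E q y \<and> E q y \<le> 1" for y
    by (auto simp: E_def good_def F01)
  \<comment> \<open>The infimum over rationals strictly above \<open>x\<close> is right continuous
    in \<open>x\<close>. This explains the shape of the two comparisons in the conclusion: the one
    from below admits equality, the one from above is strict.\<close>
  define C where "C y x = (INF q\<in>{q. x < of_rat q}. E q y)" for y and x :: real
  have ne: "{q. x < of_rat q} \<noteq> {}" for x :: real using of_rat_dense[of x "x + 1"] by auto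
  have bdd: "bdd_below ((\<lambda>q. E q y) ` A)" for y A using E(4) by (intro bdd_belowI2[where m=0]) auto
  have C_le: "C y x \<le> E q y" if "x < of_rat q" for x q y unfolding C_def using that bdd by (intro cINF_lower) auto
  have C_ge: "E q y \<le> C y x" if "of_rat q \<le> x" for x q y
    unfolding C_def
  proof (rule cINF_greatest[OF ne])
    fix p assume "p \<in> {q. x < of_rat q}"
    then have "of_rat q < (of_rat p :: real)" using that by simp
    then have "q < p" by (simp add: of_rat_less)
    then show "E q y \<le> E p y" by (intro E(1)) simp
  qed
  have C_mono: "C y x \<le> C y x'" if "x \<le> x'" for x x' y
    unfolding C_def[of y x'] using that by (intro cINF_greatest[OF ne] C_le) auto
  have C_right: "continuous (at_right x) (C y)" for x y
    unfolding continuous_within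
  proof (rule order_tendstoI)
    fix a assume "a < C y x"
    then show "\<forall>\<^sub>F z in at_right x. a < C y z"
      using C_mono[of x _ y] by (auto intro!: eventually_at_right_less[THEN eventually_mono] less_le_trans[of a "C y x"])
  next
    fix a assume "C y x < a"
    then obtain q where q: "x < of_rat q" "E q y < a"
      unfolding C_def using cINF_less_iff[OF ne bdd] by auto
    have "\<forall>\<^sub>F z in at_right x. z < of_rat q" using q(1) by (rule eventually_at_rightI[rotated]) auto
    then show "\<forall>\<^sub>F z in at_right x. C y z < a"
    proof eventually_elim
      case (elim z)
      then show ?case using C_le[of z q y] q(2) by simp
    qed
  qed
  have C_neg: "C y x = 0" if neg: "x < 0" for x y
  proof -
    obtain q where "x < of_rat q" "of_rat q < (0::real)" using of_rat_dense[OF neg] by auto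
    then have "C y x \<le> 0" using C_le[of x q y] E(2)[of q y] by simp
    moreover have "0 \<le> C y x" unfolding C_def using E(4) by (intro cINF_greatest[OF ne]) auto
    ultimately show ?thesis by simp
  qed
  have C_one: "C y x = 1" if "x \<ge> 1" for x y
  proof (rule antisym)
    show "1 \<le> C y x" using C_ge[of 1 x y] E(3)[of 1 y] that by simp
    obtain q where "x < of_rat q" using ne[of x] by auto
    then show "C y x \<le> 1" using C_le[of x q y] E(4)[of q y] by simp
  qed
  have bot: "(C y \<longlongrightarrow> 0) at_bot" for y
    by (rule tendsto_eventually) (auto simp: eventually_at_bot_dense C_neg intro!: exI[of _ 0])
  have top: "(C y \<longlongrightarrow> 1) at_top" for y
    by (rule tendsto_eventually) (auto simp: eventually_at_top_linorder C_one intro!: exI[of _ 1])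
  define \<nu> where "\<nu> y = interval_measure (C y)" for y
  have rd: "real_distribution (\<nu> y)" for y
    unfolding \<nu>_def by (rule real_distribution_interval_measure[OF C_mono C_right bot top])
  have cdf: "measure (\<nu> y) {..x} = C y x" for y x
    unfolding \<nu>_def using cdf_interval_measure[OF C_mono C_right bot] by (simp add: cdf_def fun_eq_iff)
  have Cm: "(\<lambda>y. C y x) \<in> borel_measurable Q" for x
    unfolding C_def using bdd by (intro borel_measurable_cINF) auto
  have "\<nu> \<in> Q \<rightarrow>\<^sub>M prob_algebra borel"
  proof (rule measurable_prob_algebra_generated[where \<Omega>=UNIV and G="range (\<lambda>a. {..a})"])
    show "sets borel = sigma_sets UNIV (range (\<lambda>a::real. {..a}))" by (simp add: borel_eq_atMost)
    show "Int_stable (range (\<lambda>a::real. {..a}))" by (auto simp: Int_stable_def Int_atMost)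
    show "prob_space (\<nu> y)" "sets (\<nu> y) = sets borel" for y
      using rd[of y] by (auto simp: real_distribution_def real_distribution_axioms_def)
    fix A :: "real set" assume "A \<in> range (\<lambda>a. {..a})"
    then obtain a where A: "A = {..a}" by auto
    have "emeasure (\<nu> y) A = ennreal (C y a)" for y
      using rd[of y] cdf[of y a] by (simp add: A real_distribution_def prob_space.finite_measure finite_measure.emeasure_eq_measure)
    then show "(\<lambda>y. emeasure (\<nu> y) A) \<in> borel_measurable Q" using Cm[of a] by simp
  qed auto
  moreover have "AE y in Q. F q y \<le> measure (\<nu> y) {..x}" if "of_rat q \<le> x" for x q
    using AE_good by eventually_elim (use C_ge[OF that] in \<open>auto simp: cdf E_def split: if_splits, metis\<close>)
  moreover have "AE y in Q. measure (\<nu> y) {..x} \<le> F q y" if "x < of_rat q" for x q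
    using AE_good by eventually_elim (use C_le[OF that] in \<open>auto simp: cdf E_def split: if_splits, metis\<close>)
  ultimately show ?thesis by blast
qed

text \<open>A Borel section \<open>\<rho>\<close> carries the kernels to the line, where their
  distribution values at rationals are integrated over a countable generator. A subsequence
  converges for all of these, a Dynkin argument extends this to all \<open>B\<close>, and the limits
  assemble to a limit kernel. For each \<open>B\<close> the laws averaged over \<open>B\<close> then
  converge weakly, which brings in continuous functions, and \<open>s\<close> carries the result
  back to \<open>U\<close>.\<close>

theorem young_compactness:
  fixes U :: "'u::{metric_space,second_countable_topology} set" and \<gamma> :: "nat \<Rightarrow> 'y \<Rightarrow> 'u measure"
  assumes "prob_space Q"
    and E: "countable E" "Int_stable E" "E \<subseteq> Pow (space Q)" "sets Q = sigma_sets (space Q) E" "space Q \<in> E"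
    and U: "compact U" "U \<noteq> {}" and \<gamma>: "\<And>n. \<gamma> n \<in> Q \<rightarrow>\<^sub>M prob_algebra (sborel U)"
  shows "\<exists>r \<gamma>'. strict_mono (r :: nat \<Rightarrow> nat) \<and> \<gamma>' \<in> Q \<rightarrow>\<^sub>M prob_algebra (sborel U) \<and>
    (\<forall>B\<in>sets Q. \<forall>h. continuous_on U h \<longrightarrow>
       (\<lambda>n. \<integral>y. indicator B y * (\<integral>u. h u \<partial>\<gamma> (r n) y) \<partial>Q) \<longlonglongrightarrow> (\<integral>y. indicator B y * (\<integral>u. h u \<partial>\<gamma>' y) \<partial>Q :: real))"
proof -
  interpret Q: prob_space Q by fact
  obtain T and s :: "real \<Rightarrow> 'u" where T: "compact T" "T \<subseteq> {0..1}" and s: "continuous_on T s" "s ` T = U"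
    using compact_image_of_real[OF U(1)] by auto
  have Tne: "T \<noteq> {}" using s U by auto
  have [measurable]: "T \<in> sets borel" using T(1) by (simp add: compact_imp_closed)
  obtain \<rho> where \<rho>: "\<rho> \<in> borel_measurable (sborel U)" "\<And>u. u \<in> U \<Longrightarrow> \<rho> u \<in> T" "\<And>u. u \<in> U \<Longrightarrow> s (\<rho> u) = u"
    using compact_measurable_section[OF T(1) s(1)] unfolding s(2) by blast
  define \<delta> where "\<delta> n y = distr (\<gamma> n y) borel \<rho>" for n y
  have \<delta>: "\<delta> n \<in> Q \<rightarrow>\<^sub>M prob_algebra borel" for n
    unfolding \<delta>_def by (rule measurable_compose[OF \<gamma> measurable_distr_prob_space[OF \<rho>(1)]])
  have \<gamma>y: "prob_space (\<gamma> n y)" "sets (\<gamma> n y) = sets (sborel U)" "space (\<gamma> n y) = U" if "y \<in> space Q" for n y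
  proof -
    show "prob_space (\<gamma> n y)" and *: "sets (\<gamma> n y) = sets (sborel U)"
      using measurable_space[OF \<gamma> that] by (auto simp: space_prob_algebra)
    show "space (\<gamma> n y) = U" using sets_eq_imp_space_eq[OF *] by (simp add: space_restrict_space)
  qed
  have \<rho>m: "\<rho> \<in> \<gamma> n y \<rightarrow>\<^sub>M borel" if "y \<in> space Q" for n y
    using \<rho>(1) \<gamma>y(2)[OF that] by (simp cong: measurable_cong_sets)
  have \<delta>y: "prob_space (\<delta> n y)" "sets (\<delta> n y) = sets borel" if "y \<in> space Q" for n y
    using measurable_space[OF \<delta> that] by (auto simp: space_prob_algebra)
  have int_\<delta>: "(\<integral>x. g x \<partial>\<delta> n y) = (\<integral>u. g (\<rho> u) \<partial>\<gamma> n y)" if "y \<in> space Q" "g \<in> borel_measurable borel" for n y and g :: "real \<Rightarrow> real"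
    unfolding \<delta>_def using that \<rho>m by (intro integral_distr) auto
  define D where "D n q y = measure (\<delta> n y) {..of_rat q}" for n and q :: rat and y
  have Dm[measurable]: "D n q \<in> borel_measurable Q" for n q
    unfolding D_def by (rule measurable_compose[OF \<delta> measurable_measure_prob_algebra]) simp
  have D01: "0 \<le> D n q y \<and> D n q y \<le> 1" if "y \<in> space Q" for n q y
    unfolding D_def using prob_space.prob_le_1[OF \<delta>y(1)[OF that]] by simp
  have D_alt: "D n q y = measure (\<gamma> n y) {u \<in> U. \<rho> u \<le> of_rat q}" if "y \<in> space Q" for n q y
    unfolding D_def \<delta>_def using measure_distr[OF \<rho>m[OF that], of "{..of_rat q}" n] \<gamma>y(3)[OF that]
    by (simp add: vimage_def Int_def conj_commute)
  have D_mono: "D n p y \<le> D n q y" if "p \<le> q" "y \<in> space Q" for n p q y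
    unfolding D_def using prob_space.finite_measure[OF \<delta>y(1)[OF that(2)]] that(1) \<delta>y(2)[OF that(2)]
    by (intro finite_measure.finite_measure_mono) (auto simp: of_rat_less_eq)
  have D_lo: "D n q y = 0" if "q < 0" "y \<in> space Q" for n q y
  proof -
    have "\<rho> u > of_rat q" if "u \<in> U" for u
    proof -
      have "of_rat q < (0::real)" using \<open>q < 0\<close> by simp
      moreover have "0 \<le> \<rho> u" using \<rho>(2)[OF that] T(2) by auto
      ultimately show ?thesis by linarith
    qed
    then have "{u \<in> U. \<rho> u \<le> of_rat q} = {}" by force
    then show ?thesis unfolding D_alt[OF that(2)] by (simp only: measure_empty)
  qed
  have D_hi: "D n q y = 1" if "q \<ge> 1" "y \<in> space Q" for n q y
  proof -
    have "\<rho> u \<le> of_rat q" if "u \<in> U" for u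
    proof -
      have "(1::real) \<le> of_rat q" using \<open>q \<ge> 1\<close> by simp
      moreover have "\<rho> u \<le> 1" using \<rho>(2)[OF that] T(2) by auto
      ultimately show ?thesis by linarith
    qed
    then have "{u \<in> U. \<rho> u \<le> of_rat q} = space (\<gamma> n y)" using \<gamma>y(3)[OF that(2)] by auto
    then show ?thesis using D_alt[OF that(2)] prob_space.prob_space[OF \<gamma>y(1)[OF that(2)]] by simp
  qed
  have Dint: "integrable Q (\<lambda>y. indicator B y * D n q y)" if "B \<in> sets Q" for B n q
    using D01 that by (intro Q.integrable_const_bound[where B=1] AE_I2) (auto split: split_indicator)
  define e where "e = from_nat_into E"
  have e: "e i \<in> E" for i unfolding e_def using E(5) by (intro from_nat_into) auto
  have e_surj: "\<exists>i. B = e i" if "B \<in> E" for B unfolding e_def using from_nat_into_surj[OF E(1) that] by metis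
  obtain r where r: "strict_mono (r :: nat \<Rightarrow> nat)"
    and r_conv: "\<And>i q. convergent (\<lambda>n. \<integral>y. indicator (e i) y * D (r n) q y \<partial>Q)"
  proof -
    let ?x = "\<lambda>n (i, q). \<integral>y. indicator (e i) y * D n q y \<partial>Q"
    have "0 \<le> ?x n k \<and> ?x n k \<le> 1" for n and k :: "nat \<times> rat"
    proof (cases k)
      case (Pair i q)
      have B: "e i \<in> sets Q" using e[of i] E by auto
      have "(\<integral>y. indicator (e i) y * D n q y \<partial>Q) \<le> 1"
        using D01[of _ n q] by (intro Q.integral_le_const Dint B AE_I2) (auto split: split_indicator)
      moreover have "0 \<le> (\<integral>y. indicator (e i) y * D n q y \<partial>Q)"
        using D01[of _ n q] by (intro Bochner_Integration.integral_nonneg_AE AE_I2) auto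
      ultimately show ?thesis using Pair by simp
    qed
    then have "\<exists>r. strict_mono (r :: nat \<Rightarrow> nat) \<and> (\<forall>k. convergent (\<lambda>n. ?x (r n) k))"
      by (intro bounded_diagonal_subsequence) blast
    then obtain r where "strict_mono (r :: nat \<Rightarrow> nat)" and *: "\<forall>k. convergent (\<lambda>n. ?x (r n) k)" by blast
    then show ?thesis using that[of r] *[rule_format, of "(_, _)"] by simp
  qed
  interpret F: uniform_algebra "UNIV :: nat set" "{f. convergent f}" by (rule uniform_algebra_convergent)
  have conv: "convergent (\<lambda>n. \<integral>y. indicator B y * D (r n) q y \<partial>Q)" if "B \<in> sets Q" for B q
  proof -
    have "(\<lambda>n. \<integral>y. indicator B y * D (r n) q y \<partial>Q) \<in> {f. convergent f}"
    proof (rule F.integral_indicator_sigma[OF Q.finite_measure_axioms _ _ E(2-5) _ that])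
      show "\<bar>D (r n) q y\<bar> \<le> 1" if "y \<in> space Q" for n y using D01[OF that] by simp
      show "(\<lambda>n. \<integral>y. indicator B y * D (r n) q y \<partial>Q) \<in> {f. convergent f}" if "B \<in> E" for B
        using e_surj[OF that] r_conv by auto
    qed simp
    then show ?thesis by simp
  qed
  have "\<forall>q. \<exists>f \<in> borel_measurable Q. (\<forall>y. 0 \<le> f y \<and> f y \<le> 1) \<and>
    (\<forall>B\<in>sets Q. (\<lambda>n. \<integral>y. indicator B y * D (r n) q y \<partial>Q) \<longlonglongrightarrow> (\<integral>y. indicator B y * f y \<partial>Q))"
  proof
    fix q
    show "\<exists>f \<in> borel_measurable Q. (\<forall>y. 0 \<le> f y \<and> f y \<le> 1) \<and>
      (\<forall>B\<in>sets Q. (\<lambda>n. \<integral>y. indicator B y * D (r n) q y \<partial>Q) \<longlonglongrightarrow> (\<integral>y. indicator B y * f y \<partial>Q))"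
      by (rule Q.weak_limit_unit_interval[of "\<lambda>n. D (r n) q", OF Dm D01 conv])
  qed
  then obtain L where L0: "\<forall>q. L q \<in> borel_measurable Q \<and> (\<forall>y. 0 \<le> L q y \<and> L q y \<le> 1) \<and>
    (\<forall>B\<in>sets Q. (\<lambda>n. \<integral>y. indicator B y * D (r n) q y \<partial>Q) \<longlonglongrightarrow> (\<integral>y. indicator B y * L q y \<partial>Q))"
    unfolding Bex_def by (drule_tac choice) blast
  then have L[measurable]: "\<And>q. L q \<in> borel_measurable Q" and L01: "\<And>q y. 0 \<le> L q y \<and> L q y \<le> 1"
    by simp_all
  from L0 have lim: "\<And>q B. B \<in> sets Q \<Longrightarrow> (\<lambda>n. \<integral>y. indicator B y * D (r n) q y \<partial>Q) \<longlonglongrightarrow> (\<integral>y. indicator B y * L q y \<partial>Q)"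
    by simp
  have Lint: "integrable Q (L q)" for q using L01 by (intro Q.integrable_const_bound[where B=1]) auto
  \<comment> \<open>Order relations among the \<open>D n q\<close> pass to the limit in the
    integrals over every \<open>B\<close>, and these return them almost everywhere.\<close>
  have L_le: "AE y in Q. f y \<le> L q y" if f: "integrable Q f" "\<And>n y. y \<in> space Q \<Longrightarrow> f y \<le> D n q y" for f q
  proof (rule AE_le_of_integral_le[OF f(1) Lint _ Q.sigma_finite_measure_axioms])
    fix B assume B: "B \<in> sets Q"
    have "integrable Q (\<lambda>y. indicator B y * f y)" using integrable_mult_indicator[OF B f(1)] by simp
    then show "(\<integral>y. indicator B y * f y \<partial>Q) \<le> (\<integral>y. indicator B y * L q y \<partial>Q)"
      using f(2) by (intro LIMSEQ_le_const[OF lim[OF B]] exI allI impI integral_mono Dint B) (auto split: split_indicator)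
  qed
  have L_mono: "AE y in Q. L p y \<le> L q y" if "p \<le> q" for p q
  proof (rule AE_le_of_integral_le[OF Lint Lint _ Q.sigma_finite_measure_axioms])
    fix B assume B: "B \<in> sets Q"
    show "(\<integral>y. indicator B y * L p y \<partial>Q) \<le> (\<integral>y. indicator B y * L q y \<partial>Q)"
      using D_mono[OF that]
      by (intro LIMSEQ_le[OF lim[OF B] lim[OF B]] exI allI impI integral_mono Dint B) (auto split: split_indicator)
  qed
  have L_lo: "AE y in Q. L q y = 0" if "q < 0" for q
  proof -
    have "AE y in Q. L q y \<le> 0"
    proof (rule AE_le_of_integral_le[OF Lint _ _ Q.sigma_finite_measure_axioms])
      fix B assume B: "B \<in> sets Q"
      have "(\<integral>y. indicator B y * D (r n) q y \<partial>Q) = (\<integral>y. 0 \<partial>Q)" for n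
        using D_lo[OF that] by (intro Bochner_Integration.integral_cong) auto
      then show "(\<integral>y. indicator B y * L q y \<partial>Q) \<le> (\<integral>y. indicator B y * 0 \<partial>Q)"
        using LIMSEQ_unique[OF lim[OF B, of q], of 0] by simp
    qed simp
    then show ?thesis by eventually_elim (use L01 in \<open>auto intro: antisym\<close>)
  qed
  have L_hi: "AE y in Q. L q y = 1" if "q \<ge> 1" for q
  proof -
    have "AE y in Q. 1 \<le> L q y" using D_hi[OF that] by (intro L_le) auto
    then show ?thesis by eventually_elim (use L01 in \<open>auto intro: antisym\<close>)
  qed
  have "\<exists>\<nu>. \<nu> \<in> Q \<rightarrow>\<^sub>M prob_algebra borel \<and>
    (\<forall>(x::real) q. of_rat q \<le> x \<longrightarrow> (AE y in Q. L q y \<le> measure (\<nu> y) {..x})) \<and>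
    (\<forall>(x::real) q. x < of_rat q \<longrightarrow> (AE y in Q. measure (\<nu> y) {..x} \<le> L q y))"
    by (intro kernel_of_rational_cdf L L01 L_mono L_lo L_hi)
  then obtain \<nu> :: "'y \<Rightarrow> real measure" where \<nu>: "\<nu> \<in> Q \<rightarrow>\<^sub>M prob_algebra borel"
    and \<nu>_ge: "\<And>x q. of_rat q \<le> x \<Longrightarrow> AE y in Q. L q y \<le> measure (\<nu> y) {..x}"
    and \<nu>_le: "\<And>x q. x < of_rat q \<Longrightarrow> AE y in Q. measure (\<nu> y) {..x} \<le> L q y"
    by blast
  have \<nu>y: "prob_space (\<nu> y)" "sets (\<nu> y) = sets borel" "space (\<nu> y) = UNIV" if "y \<in> space Q" for y
  proof -
    show "prob_space (\<nu> y)" and *: "sets (\<nu> y) = sets borel"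
      using measurable_space[OF \<nu> that] by (auto simp: space_prob_algebra)
    show "space (\<nu> y) = UNIV" using sets_eq_imp_space_eq[OF *] by simp
  qed
  have \<nu>cm[measurable]: "(\<lambda>y. measure (\<nu> y) {..x}) \<in> borel_measurable Q" for x
    by (rule measurable_compose[OF \<nu> measurable_measure_prob_algebra]) simp
  have \<nu>01: "0 \<le> measure (\<nu> y) {..x} \<and> measure (\<nu> y) {..x} \<le> 1" if "y \<in> space Q" for x y
    using prob_space.prob_le_1[OF \<nu>y(1)[OF that]] by simp
  have avg: "(\<lambda>n. \<integral>y. indicator B y * (\<integral>x. g x \<partial>\<delta> (r n) y) \<partial>Q) \<longlonglongrightarrow> (\<integral>y. indicator B y * (\<integral>x. g x \<partial>\<nu> y) \<partial>Q)"
    if B: "B \<in> sets Q" and g: "continuous_on UNIV g" "\<And>x. \<bar>g x\<bar> \<le> K" for B K and g :: "real \<Rightarrow> real"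
  proof (cases "measure Q B = 0")
    case True
    then have "AE y in Q. y \<notin> B" using B by (intro AE_not_in) (auto simp: null_sets_def Q.emeasure_eq_measure)
    then have "(\<integral>y. indicator B y * f y \<partial>Q) = 0" for f :: "'y \<Rightarrow> real"
      by (intro integral_eq_zero_AE) (auto elim: eventually_mono)
    then show ?thesis by simp
  next
    case False
    then have pos: "measure Q B > 0" using zero_less_measure_iff by blast
    \<comment> \<open>Conditioning on \<open>B\<close> turns the averages over \<open>B\<close> into
      genuine probability laws on the line, to which the Helly-Bray theorem applies.\<close>
    define QB where "QB = uniform_measure Q B"
    have QB: "prob_space QB" "sets QB = sets Q" unfolding QB_def using False
      by (auto intro!: prob_space_uniform_measure simp: Q.emeasure_eq_measure)
    have int_QB: "(\<integral>y. f y \<partial>QB) = (\<integral>y. indicator B y * f y \<partial>Q) / measure Q B" if [measurable]: "f \<in> borel_measurable Q" for f :: "'y \<Rightarrow> real"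
    proof -
      have "QB = density Q (\<lambda>y. ennreal (indicator B y / measure Q B))"
        unfolding QB_def uniform_measure_def using pos
        by (intro arg_cong[where f="density Q"] ext) (auto simp: Q.emeasure_eq_measure divide_ennreal split: split_indicator simp flip: ennreal_1)
      then have "(\<integral>y. f y \<partial>QB) = (\<integral>y. (indicator B y / measure Q B) *\<^sub>R f y \<partial>Q)"
        using B pos by (simp add: integral_density)
      then show ?thesis by simp
    qed
    have meas: "K \<in> QB \<rightarrow>\<^sub>M prob_algebra borel" if "K \<in> Q \<rightarrow>\<^sub>M prob_algebra borel" for K :: "'y \<Rightarrow> real measure"
      using that QB(2) by (simp cong: measurable_cong_sets)
    define m where "m K = QB \<bind> K" for K :: "'y \<Rightarrow> real measure"
    have ne: "space Q \<noteq> {}" by (rule Q.not_empty)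
    have rd: "real_distribution (m K)" if K: "K \<in> Q \<rightarrow>\<^sub>M prob_algebra borel" for K
    proof -
      have "QB \<in> space (prob_algebra Q)" using QB by (simp add: space_prob_algebra)
      then have "m K \<in> space (prob_algebra borel)"
        unfolding m_def using measurable_space[OF measurable_bind_prob_space[OF measurable_ident K]] by simp
      then show ?thesis by (auto simp: space_prob_algebra real_distribution_def real_distribution_axioms_def)
    qed
    have int_m: "(\<integral>x. f x \<partial>m K) = (\<integral>y. indicator B y * (\<integral>x. f x \<partial>K y) \<partial>Q) / measure Q B"
      if K: "K \<in> Q \<rightarrow>\<^sub>M prob_algebra borel" and f: "f \<in> borel_measurable borel" "\<And>x. \<bar>f x\<bar> \<le> C" for K C and f :: "real \<Rightarrow> real"
    proof -
      have "(\<integral>x. f x \<partial>m K) = (\<integral>y. (\<integral>x. f x \<partial>K y) \<partial>QB)"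
        unfolding m_def by (rule integral_bind_kernel[OF QB(1) meas[OF K] f])
      then show ?thesis
        using int_QB[OF measurable_compose[OF measurable_prob_algebraD[OF K] integral_measurable_subprob_algebra[OF f(1)]]] by simp
    qed
    have cdf_m: "cdf (m K) x = (\<integral>y. indicator B y * measure (K y) {..x} \<partial>Q) / measure Q B"
      if K: "K \<in> Q \<rightarrow>\<^sub>M prob_algebra borel" for K x
    proof -
      have "(\<integral>z. indicator {..x} z \<partial>m K) = cdf (m K) x"
        using real_distribution.space_eq_univ[OF rd[OF K]] by (simp add: cdf_def)
      moreover have "(\<integral>z. indicator {..x} z \<partial>m K) = (\<integral>y. indicator B y * (\<integral>z. indicator {..x} z \<partial>K y) \<partial>Q) / measure Q B"
      proof (rule int_m[OF K])
        show "\<bar>indicat_real {..x} z\<bar> \<le> 1" for z by simp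
      qed simp
      moreover have "(\<integral>y. indicator B y * (\<integral>z. indicator {..x} z \<partial>K y) \<partial>Q) = (\<integral>y. indicator B y * measure (K y) {..x} \<partial>Q)"
      proof (rule Bochner_Integration.integral_cong)
        fix y assume "y \<in> space Q"
        then have "sets (K y) = sets borel" using measurable_space[OF K] by (auto simp: space_prob_algebra)
        then have "space (K y) = UNIV" using sets_eq_imp_space_eq[of "K y" borel] by simp
        then show "indicator B y * (\<integral>z. indicator {..x} z \<partial>K y) = indicator B y * measure (K y) {..x}" by simp
      qed simp
      ultimately show ?thesis by simp
    qed
    define I where "I f = (\<integral>y. indicator B y * f y \<partial>Q) / measure Q B" for f :: "'y \<Rightarrow> real"
    have I_mono: "I f \<le> I f'" if "f \<in> borel_measurable Q" "f' \<in> borel_measurable Q" "\<And>y. y \<in> space Q \<Longrightarrow> 0 \<le> f y \<and> f y \<le> 1"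
       "\<And>y. y \<in> space Q \<Longrightarrow> 0 \<le> f' y \<and> f' y \<le> 1" "AE y in Q. f y \<le> f' y" for f f'
    proof -
      have int: "integrable Q (\<lambda>y. indicator B y * k y)" if "k \<in> borel_measurable Q" "\<And>y. y \<in> space Q \<Longrightarrow> 0 \<le> k y \<and> k y \<le> 1" for k :: "'y \<Rightarrow> real"
        using that B by (intro Q.integrable_const_bound[where B=1] AE_I2) (auto split: split_indicator)
      show ?thesis unfolding I_def using pos that(5)
        by (intro divide_right_mono integral_mono_AE int that) (auto elim!: eventually_mono split: split_indicator)
    qed
    have cdf_\<delta>_m: "(\<lambda>y. measure (\<delta> n y) {..x}) \<in> borel_measurable Q" for n x
      by (rule measurable_compose[OF \<delta> measurable_measure_prob_algebra]) simp
    have cdf_\<delta>_01: "0 \<le> measure (\<delta> n y) {..x} \<and> measure (\<delta> n y) {..x} \<le> 1" if "y \<in> space Q" for n x y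
      using prob_space.prob_le_1[OF \<delta>y(1)[OF that]] by simp
    have cdf_\<delta>: "measure (\<delta> n y) {..x} \<le> measure (\<delta> n y) {..x'}" if "x \<le> x'" "y \<in> space Q" for n x x' y
      using prob_space.finite_measure[OF \<delta>y(1)[OF that(2)]] that(1) \<delta>y(2)[OF that(2)]
      by (intro finite_measure.finite_measure_mono) auto
    have limI: "(\<lambda>n. I (D (r n) q)) \<longlonglongrightarrow> I (L q)" for q
      unfolding I_def by (intro tendsto_divide lim[OF B] tendsto_const False)
    \<comment> \<open>At a continuity point \<open>x\<close> the strict bound still holds at some
      nearby \<open>z\<close>. A rational between \<open>z\<close> and \<open>x\<close> leaves room
      to compare the limit law with \<open>L\<close> on one side and the approximating laws with
      \<open>D\<close> on the other.\<close>
    have "weak_conv_m (\<lambda>n. m (\<delta> (r n))) (m \<nu>)"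
      unfolding weak_conv_m_def weak_conv_def
    proof (intro allI impI order_tendstoI)
      fix x a assume cont: "isCont (cdf (m \<nu>)) x" and a: "a < cdf (m \<nu>) x"
      have "\<forall>\<^sub>F z in at_left x. a < cdf (m \<nu>) z"
        using cont a by (intro order_tendstoD(1)) (auto simp: isCont_def filterlim_at_split)
      then have "\<exists>z<x. a < cdf (m \<nu>) z"
        by (metis eventually_at_left_field eventually_happens trivial_limit_at_left_real dense order_less_irrefl)
      then obtain z where z: "z < x" "a < cdf (m \<nu>) z" by blast
      obtain q where q: "z < of_rat q" "of_rat q < x" using of_rat_dense[OF z(1)] by auto
      have "cdf (m \<nu>) z \<le> I (L q)" unfolding cdf_m[OF \<nu>] I_def[symmetric]
        by (intro I_mono \<nu>cm L \<nu>01 L01 \<nu>_le q)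
      with z(2) have "a < I (L q)" by simp
      with limI[of q] have "\<forall>\<^sub>F n in sequentially. a < I (D (r n) q)" by (rule order_tendstoD(1))
      then show "\<forall>\<^sub>F n in sequentially. a < cdf (m (\<delta> (r n))) x"
      proof eventually_elim
        case (elim n)
        have "I (D (r n) q) \<le> cdf (m (\<delta> (r n))) x" unfolding cdf_m[OF \<delta>] I_def[symmetric]
          using q by (intro I_mono Dm D01 cdf_\<delta>_m cdf_\<delta>_01 AE_I2) (auto simp: D_def intro: cdf_\<delta>)
        with elim show ?case by simp
      qed
    next
      fix x a assume cont: "isCont (cdf (m \<nu>)) x" and a: "cdf (m \<nu>) x < a"
      have "\<forall>\<^sub>F z in at_right x. cdf (m \<nu>) z < a"
        using cont a by (intro order_tendstoD(2)) (auto simp: isCont_def filterlim_at_split)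
      then have "\<exists>z>x. cdf (m \<nu>) z < a"
        by (metis eventually_at_right_field dense)
      then obtain z where z: "x < z" "cdf (m \<nu>) z < a" by blast
      obtain q where q: "x < of_rat q" "of_rat q < z" using of_rat_dense[OF z(1)] by auto
      have "I (L q) \<le> cdf (m \<nu>) z" unfolding cdf_m[OF \<nu>] I_def[symmetric]
        using q by (intro I_mono \<nu>cm L \<nu>01 L01 \<nu>_ge) auto
      with z(2) have "I (L q) < a" by simp
      with limI[of q] have "\<forall>\<^sub>F n in sequentially. I (D (r n) q) < a" by (rule order_tendstoD(2))
      then show "\<forall>\<^sub>F n in sequentially. cdf (m (\<delta> (r n))) x < a"
      proof eventually_elim
        case (elim n)
        have "cdf (m (\<delta> (r n))) x \<le> I (D (r n) q)" unfolding cdf_m[OF \<delta>] I_def[symmetric]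
          using q by (intro I_mono Dm D01 cdf_\<delta>_m cdf_\<delta>_01 AE_I2) (auto simp: D_def intro: cdf_\<delta>)
        with elim show ?case by simp
      qed
    qed
    then have "(\<lambda>n. \<integral>x. g x \<partial>m (\<delta> (r n))) \<longlonglongrightarrow> (\<integral>x. g x \<partial>m \<nu>)"
      using rd[OF \<delta>] rd[OF \<nu>] g by (intro weak_conv_imp_integral_bdd_continuous_conv) (auto simp: continuous_on_eq_continuous_at)
    then have "(\<lambda>n. (\<integral>x. g x \<partial>m (\<delta> (r n))) * measure Q B) \<longlonglongrightarrow> (\<integral>x. g x \<partial>m \<nu>) * measure Q B"
      by (intro tendsto_mult tendsto_const)
    then show ?thesis
      using int_m[OF \<delta> borel_measurable_continuous_onI[OF g(1)] g(2)] int_m[OF \<nu> borel_measurable_continuous_onI[OF g(1)] g(2)] False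
      by simp
  qed
  \<comment> \<open>The approximating laws live on \<open>T\<close>, so the truncated distance to
    \<open>T\<close> integrates to 0 for them and therefore for the limit.\<close>
  have AE_T: "AE y in Q. AE x in \<nu> y. x \<in> T"
  proof -
    let ?\<phi> = "\<lambda>x. min 1 (infdist x T)"
    have c: "continuous_on UNIV ?\<phi>" by (intro continuous_intros)
    note c' = borel_measurable_continuous_onI[OF c]
    have b: "\<bar>?\<phi> x\<bar> \<le> 1" "0 \<le> ?\<phi> x" for x using infdist_nonneg[of x T] by auto
    have "(\<integral>y. indicator (space Q) y * (\<integral>x. ?\<phi> x \<partial>\<delta> n y) \<partial>Q) = (\<integral>y. 0 \<partial>Q)" for n
    proof (rule Bochner_Integration.integral_cong)
      fix y assume y: "y \<in> space Q"
      have "(\<integral>u. ?\<phi> (\<rho> u) \<partial>\<gamma> n y) = (\<integral>u. 0 \<partial>\<gamma> n y)"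
        using \<rho>(2) \<gamma>y(3)[OF y] by (intro Bochner_Integration.integral_cong) auto
      then show "indicator (space Q) y * (\<integral>x. ?\<phi> x \<partial>\<delta> n y) = 0" using int_\<delta>[OF y c'] by simp
    qed simp
    then have "(\<integral>y. indicator (space Q) y * (\<integral>x. ?\<phi> x \<partial>\<nu> y) \<partial>Q) = 0"
      using LIMSEQ_unique[OF avg[OF sets.top c b(1)], of 0] by simp
    moreover have "(\<integral>y. indicator (space Q) y * (\<integral>x. ?\<phi> x \<partial>\<nu> y) \<partial>Q) = (\<integral>y. (\<integral>x. ?\<phi> x \<partial>\<nu> y) \<partial>Q)"
      by (intro Bochner_Integration.integral_cong) auto
    ultimately have z: "(\<integral>y. (\<integral>x. ?\<phi> x \<partial>\<nu> y) \<partial>Q) = 0" by simp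
    have m: "(\<lambda>y. \<integral>x. ?\<phi> x \<partial>\<nu> y) \<in> borel_measurable Q"
      by (rule measurable_compose[OF measurable_prob_algebraD[OF \<nu>] integral_measurable_subprob_algebra[OF c']])
    have "integrable Q (\<lambda>y. \<integral>x. ?\<phi> x \<partial>\<nu> y)"
    proof (rule Q.integrable_const_bound[where B=1, OF AE_I2 m])
      fix y assume "y \<in> space Q"
      then show "norm (\<integral>x. ?\<phi> x \<partial>\<nu> y) \<le> 1"
        using prob_space.integral_abs_le_const[OF \<nu>y(1), of y ?\<phi> 1] b by simp
    qed
    then have "AE y in Q. (\<integral>x. ?\<phi> x \<partial>\<nu> y) = 0"
      using z by (subst (asm) integral_nonneg_eq_0_iff_AE) (auto intro!: AE_I2 Bochner_Integration.integral_nonneg_AE b)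
    then show ?thesis
    proof (rule AE_mp[OF _ AE_I2[OF impI]])
      fix y assume y: "y \<in> space Q" and 0: "(\<integral>x. ?\<phi> x \<partial>\<nu> y) = 0"
      interpret prob_space "\<nu> y" by (rule \<nu>y(1)[OF y])
      have "?\<phi> \<in> borel_measurable (\<nu> y)" using c' \<nu>y(2)[OF y] by (simp cong: measurable_cong_sets)
      then have "integrable (\<nu> y) ?\<phi>" using b by (intro integrable_const_bound[where B=1]) auto
      then have "AE x in \<nu> y. ?\<phi> x = 0"
        using 0 b by (subst (asm) integral_nonneg_eq_0_iff_AE) auto
      then show "AE x in \<nu> y. x \<in> T"
        by eventually_elim (use T(1) Tne in \<open>auto simp: in_closed_iff_infdist_zero compact_imp_closed min_def split: if_splits\<close>)
    qed
  qed
  obtain u0 where u0: "u0 \<in> U" using U(2) by auto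
  \<comment> \<open>\<open>s\<close> is continuous on \<open>T\<close> only. A fixed value off
    \<open>T\<close>, a null event for almost every limit law, makes it measurable on the whole
    line.\<close>
  define s' where "s' x = (if x \<in> T then s x else u0)" for x
  have s'm: "s' \<in> borel \<rightarrow>\<^sub>M sborel U"
  proof (rule measurable_restrict_space2)
    show "s' \<in> borel_measurable borel"
      unfolding s'_def by (intro borel_measurable_continuous_on_if s(1) continuous_on_const) auto
  qed (use s u0 in \<open>auto simp: s'_def\<close>)
  define \<gamma>' where "\<gamma>' y = distr (\<nu> y) (sborel U) s'" for y
  have \<gamma>': "\<gamma>' \<in> Q \<rightarrow>\<^sub>M prob_algebra (sborel U)"
    unfolding \<gamma>'_def by (rule measurable_compose[OF \<nu> measurable_distr_prob_space[OF s'm]])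
  have "(\<lambda>n. \<integral>y. indicator B y * (\<integral>u. h u \<partial>\<gamma> (r n) y) \<partial>Q) \<longlonglongrightarrow> (\<integral>y. indicator B y * (\<integral>u. h u \<partial>\<gamma>' y) \<partial>Q)"
    if B: "B \<in> sets Q" and h: "continuous_on U h" for B and h :: "'u \<Rightarrow> real"
  proof -
    have hm: "h \<in> borel_measurable (sborel U)" by (rule borel_measurable_continuous_on_restrict[OF h])
    have hs: "continuous_on T (\<lambda>x. h (s x))" using continuous_on_compose2[OF h s(1)] s(2) by simp
    obtain K where K: "\<And>x. x \<in> T \<Longrightarrow> norm (h (s x)) \<le> K"
      using compact_imp_bounded[OF compact_continuous_image[OF hs T(1)]] by (auto simp: bounded_iff)
    have "0 \<le> K" using Tne K by (meson ex_in_conv norm_ge_zero order_trans)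
    then obtain g where g: "continuous_on UNIV g" "\<And>x. x \<in> T \<Longrightarrow> g x = h (s x)" "\<And>x. norm (g x) \<le> K"
      using Tietze[OF hs, of UNIV K] T(1) K by (auto simp: compact_imp_closed)
    note gm = borel_measurable_continuous_onI[OF g(1)]
    have 1: "(\<integral>y. indicator B y * (\<integral>u. h u \<partial>\<gamma> n y) \<partial>Q) = (\<integral>y. indicator B y * (\<integral>x. g x \<partial>\<delta> n y) \<partial>Q)" for n
    proof (rule Bochner_Integration.integral_cong)
      fix y assume y: "y \<in> space Q"
      have "(\<integral>u. h u \<partial>\<gamma> n y) = (\<integral>u. g (\<rho> u) \<partial>\<gamma> n y)"
        using \<rho> \<gamma>y(3)[OF y] g(2) by (intro Bochner_Integration.integral_cong) auto
      then show "indicator B y * (\<integral>u. h u \<partial>\<gamma> n y) = indicator B y * (\<integral>x. g x \<partial>\<delta> n y)"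
        using int_\<delta>[OF y gm] by simp
    qed simp
    have 2: "(\<integral>y. indicator B y * (\<integral>u. h u \<partial>\<gamma>' y) \<partial>Q) = (\<integral>y. indicator B y * (\<integral>x. g x \<partial>\<nu> y) \<partial>Q)"
    proof (rule integral_cong_AE)
      show "AE y in Q. indicator B y * (\<integral>u. h u \<partial>\<gamma>' y) = indicator B y * (\<integral>x. g x \<partial>\<nu> y)"
        using AE_T
      proof (rule AE_mp, intro AE_I2 impI)
        fix y assume y: "y \<in> space Q" and T': "AE x in \<nu> y. x \<in> T"
        have s'\<nu>: "s' \<in> \<nu> y \<rightarrow>\<^sub>M sborel U" using s'm \<nu>y(2)[OF y] by (simp cong: measurable_cong_sets)
        have "(\<integral>u. h u \<partial>\<gamma>' y) = (\<integral>x. h (s' x) \<partial>\<nu> y)"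
          unfolding \<gamma>'_def by (rule integral_distr[OF s'\<nu> hm])
        also have "\<dots> = (\<integral>x. g x \<partial>\<nu> y)"
        proof (rule integral_cong_AE)
          show "(\<lambda>x. h (s' x)) \<in> borel_measurable (\<nu> y)" by (rule measurable_compose[OF s'\<nu> hm])
          show "g \<in> borel_measurable (\<nu> y)" using gm \<nu>y(2)[OF y] by (simp cong: measurable_cong_sets)
          show "AE x in \<nu> y. h (s' x) = g x" using T' by eventually_elim (simp add: s'_def g(2))
        qed
        finally show "indicator B y * (\<integral>u. h u \<partial>\<gamma>' y) = indicator B y * (\<integral>x. g x \<partial>\<nu> y)" by simp
      qed
      have "(\<lambda>y. \<integral>u. h u \<partial>\<gamma>' y) \<in> borel_measurable Q" "(\<lambda>y. \<integral>x. g x \<partial>\<nu> y) \<in> borel_measurable Q"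
        by (rule measurable_compose[OF measurable_prob_algebraD[OF \<gamma>'] integral_measurable_subprob_algebra[OF hm]],
            rule measurable_compose[OF measurable_prob_algebraD[OF \<nu>] integral_measurable_subprob_algebra[OF gm]])
      then show "(\<lambda>y. indicator B y * (\<integral>u. h u \<partial>\<gamma>' y)) \<in> borel_measurable Q"
        "(\<lambda>y. indicator B y * (\<integral>x. g x \<partial>\<nu> y)) \<in> borel_measurable Q" using B by auto
    qed
    show ?thesis using avg[OF B g(1), of K] g(3) by (simp add: 1 2)
  qed
  then show ?thesis using r \<gamma>' by blast
qed

section \<open>The cost as a function of the kernels\<close>

text \<open>The whole space is a member because the Dynkin argument for integrals takes complements
  relative to it, and products of generators recover each factor through it.\<close>

definition pi_generator :: "'x measure \<Rightarrow> 'x set set \<Rightarrow> bool" where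
  "pi_generator M E \<longleftrightarrow> Int_stable E \<and> E \<subseteq> Pow (space M) \<and> sets M = sigma_sets (space M) E \<and> space M \<in> E"

lemma pi_generatorD:
  assumes "pi_generator M E"
  shows "Int_stable E" "E \<subseteq> Pow (space M)" "sets M = sigma_sets (space M) E" "space M \<in> E"
    and "B \<in> E \<Longrightarrow> B \<in> sets M"
  using assms by (auto simp: pi_generator_def)

lemma pi_generator_sets: "pi_generator M (sets M)"
  by (auto simp: pi_generator_def Int_stable_def sets.sigma_sets_eq dest: sets.sets_into_space)

lemma pi_generator_PiM:
  assumes "finite I"
  shows "pi_generator (PiM I M) {PiE I B |B. \<forall>i\<in>I. B i \<in> sets (M i)}"
proof -
  have eq: "prod_algebra I M = {PiE I B |B. \<forall>i\<in>I. B i \<in> sets (M i)}"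
    unfolding prod_algebra_eq_finite[OF assms] by auto
  show ?thesis
    unfolding pi_generator_def
    using prod_algebra_sets_into_space[of I M] Int_stable_prod_algebra[of I M]
    by (auto simp: sets_PiM space_PiM eq[symmetric]) (auto simp: eq)
qed

text \<open>Cylinders over one factor are rectangles whose other side is the whole space, so both
  projections are measurable for the algebra generated by the rectangles.\<close>

lemma pi_generator_pair:
  assumes A: "pi_generator A EA" and B: "pi_generator B EB"
  shows "pi_generator (A \<Otimes>\<^sub>M B) {a \<times> b |a b. a \<in> EA \<and> b \<in> EB}"
proof -
  note A = pi_generatorD[OF A] and B = pi_generatorD[OF B]
  let ?E = "{a \<times> b |a b. a \<in> EA \<and> b \<in> EB}"
  let ?S = "sigma (space A \<times> space B) ?E"
  have E: "?E \<subseteq> Pow (space A \<times> space B)" using A(2) B(2) by blast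
  have "Int_stable ?E"
  proof (rule Int_stableI)
    fix x y assume "x \<in> ?E" "y \<in> ?E"
    then obtain a b a' b' where "x = a \<times> b" "y = a' \<times> b'" "a \<in> EA" "b \<in> EB" "a' \<in> EA" "b' \<in> EB" by blast
    then have "x \<inter> y = (a \<inter> a') \<times> (b \<inter> b')" "a \<inter> a' \<in> EA" "b \<inter> b' \<in> EB" using A(1) B(1) by (auto simp: Int_stable_def)
    then show "x \<inter> y \<in> ?E" by blast
  qed
  moreover have "sets (A \<Otimes>\<^sub>M B) = sigma_sets (space (A \<Otimes>\<^sub>M B)) ?E"
  proof
    have "fst \<in> ?S \<rightarrow>\<^sub>M A"
    proof (rule measurable_sigma_sets[OF A(3,2)])
      fix a assume "a \<in> EA"
      then have "a \<times> space B \<in> ?E" using B(4) by blast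
      moreover have "fst -` a \<inter> space ?S = a \<times> space B" using \<open>a \<in> EA\<close> A(2) E by auto
      ultimately show "fst -` a \<inter> space ?S \<in> sets ?S" using E by (simp add: sets_measure_of sigma_sets.Basic)
    qed (use E in auto)
    moreover have "snd \<in> ?S \<rightarrow>\<^sub>M B"
    proof (rule measurable_sigma_sets[OF B(3,2)])
      fix b assume "b \<in> EB"
      then have "space A \<times> b \<in> ?E" using A(4) by blast
      moreover have "snd -` b \<inter> space ?S = space A \<times> b" using \<open>b \<in> EB\<close> B(2) E by auto
      ultimately show "snd -` b \<inter> space ?S \<in> sets ?S" using E by (simp add: sets_measure_of sigma_sets.Basic)
    qed (use E in auto)
    ultimately have id: "(\<lambda>x. (fst x, snd x)) \<in> ?S \<rightarrow>\<^sub>M A \<Otimes>\<^sub>M B" by (rule measurable_Pair)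
    show "sets (A \<Otimes>\<^sub>M B) \<subseteq> sigma_sets (space (A \<Otimes>\<^sub>M B)) ?E"
    proof
      fix x assume x: "x \<in> sets (A \<Otimes>\<^sub>M B)"
      have "x \<subseteq> space A \<times> space B" using sets.sets_into_space[OF x] by (simp add: space_pair_measure)
      then have "(\<lambda>x. (fst x, snd x)) -` x \<inter> space ?S = x" using E by auto
      then show "x \<in> sigma_sets (space (A \<Otimes>\<^sub>M B)) ?E"
        using measurable_sets[OF id x] E by (simp add: sets_measure_of space_pair_measure)
    qed
    show "sigma_sets (space (A \<Otimes>\<^sub>M B)) ?E \<subseteq> sets (A \<Otimes>\<^sub>M B)"
      using A(5) B(5) by (intro sets.sigma_sets_subset) auto
  qed
  moreover have "space (A \<Otimes>\<^sub>M B) \<in> ?E" using A(4) B(4) by (auto simp: space_pair_measure)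
  ultimately show ?thesis using E by (simp add: pi_generator_def space_pair_measure)
qed

lemma pi_generator_cong: "pi_generator M E \<Longrightarrow> sets M = sets N \<Longrightarrow> pi_generator N E"
  using sets_eq_imp_space_eq[of M N] by (simp add: pi_generator_def)

lemma measure_eqI_pi_generator:
  assumes E: "pi_generator M E" and "finite_measure M" "sets N = sets M"
    and eq: "\<And>B. B \<in> E \<Longrightarrow> emeasure M B = emeasure N B"
  shows "M = N"
proof -
  interpret finite_measure M by fact
  show ?thesis
  proof (rule measure_eqI_generator_eq[OF pi_generatorD(1,2)[OF E] eq pi_generatorD(3)[OF E], where A="\<lambda>_. space M"])
    show "sets N = sigma_sets (space M) E" using pi_generatorD(3)[OF E] assms(3) by simp
  qed (use pi_generatorD(4)[OF E] emeasure_finite[of "space M"] in auto)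
qed

lemma
  assumes "finite I" "\<And>i. i \<in> I \<Longrightarrow> prob_space (M i)"
  shows emeasure_PiM_prob: "(\<And>i. i \<in> I \<Longrightarrow> A i \<in> sets (M i)) \<Longrightarrow> emeasure (PiM I M) (PiE I A) = (\<Prod>i\<in>I. emeasure (M i) (A i))"
    and integral_PiM_prod: "(\<And>i. i \<in> I \<Longrightarrow> integrable (M i) (f i)) \<Longrightarrow> (\<integral>x. (\<Prod>i\<in>I. f i (x i)) \<partial>PiM I M) = (\<Prod>i\<in>I. \<integral>x. f i x \<partial>M i :: real)"
proof -
  \<comment> \<open>\<open>product_prob_space\<close> constrains all indices; outside
    \<open>I\<close> a point mass is put in, which the product over \<open>I\<close> does not
    see.\<close>
  define M' where "M' i = (if i \<in> I then M i else return (count_space UNIV) undefined)" for i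
  have pM: "prob_space (M' i)" for i using assms(2) by (auto simp: M'_def intro: prob_space_return)
  interpret product_prob_space M' I
    using pM by (auto simp: product_prob_space_def product_prob_space_axioms_def product_sigma_finite_def
      intro: prob_space_imp_sigma_finite)
  have P: "PiM I M = PiM I M'" by (intro PiM_cong) (auto simp: M'_def)
  show "emeasure (PiM I M) (PiE I A) = (\<Prod>i\<in>I. emeasure (M i) (A i))" if "\<And>i. i \<in> I \<Longrightarrow> A i \<in> sets (M i)"
    unfolding P using that by (subst emeasure_PiM[OF assms(1)]) (auto simp: M'_def)
  show "(\<integral>x. (\<Prod>i\<in>I. f i (x i)) \<partial>PiM I M) = (\<Prod>i\<in>I. \<integral>x. f i x \<partial>M i)" if "\<And>i. i \<in> I \<Longrightarrow> integrable (M i) (f i)"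
    unfolding P using that by (subst product_integral_prod[OF assms(1)]) (auto simp: M'_def)
qed

text \<open>On the rectangles that generate the product algebra, the kernel is a finite product of
  measurable functions of one coordinate.\<close>

lemma measurable_PiM_kernel:
  assumes I: "finite I" and g: "\<And>k. k \<in> I \<Longrightarrow> g k \<in> A k \<rightarrow>\<^sub>M prob_algebra (B k)"
  shows "(\<lambda>y. PiM I (\<lambda>k. g k (y k))) \<in> PiM I A \<rightarrow>\<^sub>M prob_algebra (PiM I B)"
proof -
  have gy: "prob_space (g k (y k))" "sets (g k (y k)) = sets (B k)" if "y \<in> space (PiM I A)" "k \<in> I" for y k
    using measurable_space[OF g[OF that(2)], of "y k"] that by (auto simp: space_PiM space_prob_algebra)
  note G = pi_generatorD[OF pi_generator_PiM[OF I, of B]]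
  show ?thesis
  proof (rule measurable_prob_algebra_generated[OF G(3,1,2)])
    fix y assume y: "y \<in> space (PiM I A)"
    show "prob_space (PiM I (\<lambda>k. g k (y k)))" by (intro prob_space_PiM gy[OF y])
    show "sets (PiM I (\<lambda>k. g k (y k))) = sets (PiM I B)" by (intro sets_PiM_cong refl gy[OF y])
  next
    fix X assume "X \<in> {PiE I C |C. \<forall>i\<in>I. C i \<in> sets (B i)}"
    then obtain C where C: "X = PiE I C" "\<And>i. i \<in> I \<Longrightarrow> C i \<in> sets (B i)" by auto
    have "(\<lambda>y. \<Prod>k\<in>I. emeasure (g k (y k)) (C k)) \<in> borel_measurable (PiM I A)"
    proof (intro borel_measurable_prod_ennreal)
      fix k assume k: "k \<in> I"
      have "(\<lambda>y. g k (y k)) \<in> PiM I A \<rightarrow>\<^sub>M subprob_algebra (B k)"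
        by (rule measurable_compose[OF measurable_component_singleton[OF k, of A] measurable_prob_algebraD[OF g[OF k]]])
      then show "(\<lambda>y. emeasure (g k (y k)) (C k)) \<in> borel_measurable (PiM I A)"
        by (rule measurable_emeasure_kernel[OF _ C(2)[OF k]])
    qed
    then show "(\<lambda>y. emeasure (PiM I (\<lambda>k. g k (y k))) X) \<in> borel_measurable (PiM I A)"
    proof (rule measurable_cong[THEN iffD1, rotated])
      fix y assume y: "y \<in> space (PiM I A)"
      show "(\<Prod>k\<in>I. emeasure (g k (y k)) (C k)) = emeasure (PiM I (\<lambda>k. g k (y k))) X"
        unfolding C(1) using gy[OF y] C(2) by (intro emeasure_PiM_prob[symmetric] I) auto
    qed
  qed
qed

lemma measurable_pair_kernel:
  assumes f: "f \<in> M \<rightarrow>\<^sub>M prob_algebra A" and g: "g \<in> M \<rightarrow>\<^sub>M prob_algebra B"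
  shows "(\<lambda>x. f x \<Otimes>\<^sub>M g x) \<in> M \<rightarrow>\<^sub>M prob_algebra (A \<Otimes>\<^sub>M B)"
proof (rule measurable_prob_algebraI)
  fix x assume x: "x \<in> space M"
  interpret f: prob_space "f x" using measurable_space[OF f x] by (simp add: space_prob_algebra)
  interpret g: prob_space "g x" using measurable_space[OF g x] by (simp add: space_prob_algebra)
  interpret pair_prob_space "f x" "g x" ..
  show "prob_space (f x \<Otimes>\<^sub>M g x)" by (rule P.prob_space_axioms)
qed (intro measurable_pair_measure measurable_prob_algebraD f g)

lemma integral_pair_mult:
  fixes f :: "'x \<Rightarrow> real" and g :: "'y \<Rightarrow> real"
  assumes "prob_space A" "prob_space B" "integrable A f" "integrable B g"
  shows "(\<integral>(x, y). f x * g y \<partial>(A \<Otimes>\<^sub>M B)) = (\<integral>x. f x \<partial>A) * (\<integral>y. g y \<partial>B)"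
    and "integrable (A \<Otimes>\<^sub>M B) (\<lambda>(x, y). f x * g y)"
proof -
  interpret A: prob_space A by fact
  interpret B: prob_space B by fact
  interpret pair_sigma_finite A B ..
  have "AE x in A. integrable B (\<lambda>y. f x * g y)" using assms by simp
  moreover have "integrable A (\<lambda>x. \<integral>y. norm (f x * g y) \<partial>B)"
    using assms by (simp add: abs_mult)
  ultimately show int: "integrable (A \<Otimes>\<^sub>M B) (\<lambda>(x, y). f x * g y)"
    using assms by (intro Fubini_integrable) (auto simp: split_beta)
  show "(\<integral>(x, y). f x * g y \<partial>(A \<Otimes>\<^sub>M B)) = (\<integral>x. f x \<partial>A) * (\<integral>y. g y \<partial>B)"
    using integral_fst'[OF int] by simp
qed

text \<open>The counterpart of \<open>policy_cost\<close> for given kernels. The choice made by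
  \<open>kernel_of\<close> is left to the caller, so that versions can be compared and members
  permuted.\<close>

definition kernel_cost ::
  "nat \<Rightarrow> nat \<Rightarrow> ('o \<times> (nat \<Rightarrow> 'a) \<times> (nat \<Rightarrow> 'b)) measure \<Rightarrow> ('o \<Rightarrow> (nat \<Rightarrow> 'u) \<Rightarrow> (nat \<Rightarrow> 'v) \<Rightarrow> real)
    \<Rightarrow> (nat \<Rightarrow> 'a \<Rightarrow> 'u measure) \<Rightarrow> (nat \<Rightarrow> 'b \<Rightarrow> 'v measure) \<Rightarrow> real" where
  "kernel_cost N1 N2 \<mu> c g1 g2 =
     (\<integral>(w, y, z). (\<integral>(u, v). c w u v \<partial>(PiM {..<N1} (\<lambda>k. g1 k (y k)) \<Otimes>\<^sub>M PiM {..<N2} (\<lambda>k. g2 k (z k)))) \<partial>\<mu>)"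

section \<open>Closure of the cost under the operations on test integrals\<close>

lemma integrable_mult_bounded:
  fixes f g :: "'x \<Rightarrow> real"
  assumes f: "integrable M f" and g: "g \<in> borel_measurable M" "\<And>x. x \<in> space M \<Longrightarrow> \<bar>g x\<bar> \<le> C"
  shows "integrable M (\<lambda>x. f x * g x)"
proof (rule Bochner_Integration.integrable_bound[OF integrable_mult_left[OF f, of C]])
  show "AE x in M. norm (f x * g x) \<le> norm (f x * C)"
  proof (rule AE_I2)
    fix x assume "x \<in> space M"
    then have "\<bar>g x\<bar> \<le> \<bar>C\<bar>" using g(2) by force
    then show "norm (f x * g x) \<le> norm (f x * C)" by (simp add: abs_mult mult_left_mono)
  qed
qed (use f g in auto)

lemma borel_measurable_prod_components:
  fixes f :: "'i \<Rightarrow> 'x \<Rightarrow> real"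
  assumes "\<And>k. k \<in> I \<Longrightarrow> f k \<in> borel_measurable (M k)"
  shows "(\<lambda>x. \<Prod>k\<in>I. f k (x k)) \<in> borel_measurable (PiM I M)"
proof (intro borel_measurable_prod)
  fix k assume k: "k \<in> I"
  show "(\<lambda>x. f k (x k)) \<in> borel_measurable (PiM I M)"
    by (rule measurable_compose[OF measurable_component_singleton[OF k, of M] assms[OF k]])
qed

text \<open>A fine partition of \<open>U1\<^sup>N\<^sup>1 \<times> U2\<^sup>N\<^sup>2\<close> whose functions are products of functions of one action.\<close>

lemma fine_partition_profiles:
  fixes U1 :: "'u::metric_space set" and U2 :: "'v::metric_space set" and N1 N2 :: nat
  assumes U: "compact U1" "compact U2" and d: "d > 0"
  shows "\<exists>I1 h1 I2 h2 p. finite I1 \<and> finite I2 \<and>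
    (\<forall>i\<in>I1. continuous_on U1 (h1 i) \<and> (\<forall>u\<in>U1. 0 \<le> h1 i u \<and> h1 i u \<le> 1)) \<and>
    (\<forall>i\<in>I2. continuous_on U2 (h2 i) \<and> (\<forall>u\<in>U2. 0 \<le> h2 i u \<and> h2 i u \<le> 1)) \<and>
    fine_partition (PiE {..<N1} (\<lambda>_. U1) \<times> PiE {..<N2} (\<lambda>_. U2)) d (PiE {..<N1} (\<lambda>_. I1) \<times> PiE {..<N2} (\<lambda>_. I2)) p
      (\<lambda>(i, j) (u, v). (\<Prod>k<N1. (h1 (i k :: 'u) (u k) :: real)) * (\<Prod>k<N2. h2 (j k :: 'v) (v k)))"
proof -
  obtain e1 where e1: "e1 > 0" "\<And>I p h. fine_partition U1 e1 (I :: 'u set) p h \<Longrightarrow>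
      fine_partition (PiE {..<N1} (\<lambda>_. U1)) (d/2) (PiE {..<N1} (\<lambda>_. I)) (\<lambda>i. \<lambda>k\<in>{..<N1}. p (i k)) (\<lambda>i u. \<Prod>k<N1. h (i k) (u k))"
    using fine_partition_PiE[where d="d/2" and X=U1 and N=N1] d by auto
  obtain e2 where e2: "e2 > 0" "\<And>I p h. fine_partition U2 e2 (I :: 'v set) p h \<Longrightarrow>
      fine_partition (PiE {..<N2} (\<lambda>_. U2)) (d/2) (PiE {..<N2} (\<lambda>_. I)) (\<lambda>i. \<lambda>k\<in>{..<N2}. p (i k)) (\<lambda>i u. \<Prod>k<N2. h (i k) (u k))"
    using fine_partition_PiE[where d="d/2" and X=U2 and N=N2] d by auto
  obtain I1 h1 where 1: "fine_partition U1 e1 I1 id h1" using fine_partition_exists[OF U(1) e1(1)] by blast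
  obtain I2 h2 where 2: "fine_partition U2 e2 I2 id h2" using fine_partition_exists[OF U(2) e2(1)] by blast
  note P = fine_partition_Times[OF e1(2)[OF 1] e2(2)[OF 2]]
  have "finite I1 \<and> finite I2 \<and>
    (\<forall>i\<in>I1. continuous_on U1 (h1 i) \<and> (\<forall>u\<in>U1. 0 \<le> h1 i u \<and> h1 i u \<le> 1)) \<and>
    (\<forall>i\<in>I2. continuous_on U2 (h2 i) \<and> (\<forall>u\<in>U2. 0 \<le> h2 i u \<and> h2 i u \<le> 1))"
    using 1 2 by (simp add: fine_partition_def)
  with P show ?thesis by blast
qed

lemma kernelsD:
  assumes "g \<in> kernels Y U" "sets Q = sets (sborel Y)"
  shows "g \<in> Q \<rightarrow>\<^sub>M prob_algebra (sborel U)"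
    and "y \<in> Y \<Longrightarrow> prob_space (g y)" "y \<in> Y \<Longrightarrow> sets (g y) = sets (sborel U)" "y \<in> Y \<Longrightarrow> space (g y) = U"
proof -
  show "g \<in> Q \<rightarrow>\<^sub>M prob_algebra (sborel U)" using assms by (simp add: kernels_def cong: measurable_cong_sets)
  show "prob_space (g y)" and *: "sets (g y) = sets (sborel U)" if "y \<in> Y" for y
    using measurable_space[of g "sborel Y" "prob_algebra (sborel U)" y] assms(1) that
    by (auto simp: kernels_def space_restrict_space space_prob_algebra)
  show "space (g y) = U" if "y \<in> Y" for y
    using sets_eq_imp_space_eq[OF *[OF that]] by (simp add: space_restrict_space)
qed

lemma continuous_measurable_sborel:
  "continuous_on U h \<Longrightarrow> h \<in> borel_measurable (sborel U)"
  by (rule borel_measurable_continuous_on_restrict)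

text \<open>Separation of variables in the actions leaves products of functions of one action, and
  integrating these against the kernels leaves products of functions of one observation. The density
  and the coefficient \<open>\<phi>\<close> form an integrable weight, reduced to rectangles; there
  Fubini splits the integral into single tests, which are in \<open>F\<close> by assumption.\<close>

theorem (in uniform_algebra) kernel_cost_closed:
  fixes U1 :: "'u::{metric_space,second_countable_topology} set" and U2 :: "'v::{metric_space,second_countable_topology} set"
    and Y1 :: "'a::topological_space set" and Y2 :: "'b::topological_space set"
    and \<Omega>0 :: "'o::topological_space set"
    and N1 N2 :: nat
  assumes P0: "prob_space P0" "sets P0 = sets (sborel \<Omega>0)"
    and Q1: "\<And>k. k < N1 \<Longrightarrow> is_ref_measure Y1 (Q1 k)" and Q2: "\<And>k. k < N2 \<Longrightarrow> is_ref_measure Y2 (Q2 k)"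
    and \<mu>: "prob_space \<mu>" "\<mu> = density (P0 \<Otimes>\<^sub>M PiM {..<N1} Q1 \<Otimes>\<^sub>M PiM {..<N2} Q2) (\<lambda>x. ennreal (D x))"
    and D: "integrable (P0 \<Otimes>\<^sub>M PiM {..<N1} Q1 \<Otimes>\<^sub>M PiM {..<N2} Q2) D" "\<And>x. 0 \<le> D x"
    and U: "compact U1" "U1 \<noteq> {}" "compact U2" "U2 \<noteq> {}"
    and c: "is_cost \<Omega>0 U1 U2 N1 N2 c" "continuous_bounded_cost \<Omega>0 U1 U2 N1 N2 c"
    and g1: "\<And>t k. t \<in> T \<Longrightarrow> k < N1 \<Longrightarrow> g1 t k \<in> kernels Y1 U1"
    and g2: "\<And>t k. t \<in> T \<Longrightarrow> k < N2 \<Longrightarrow> g2 t k \<in> kernels Y2 U2"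
    and F1: "\<And>k B h. k < N1 \<Longrightarrow> B \<in> sets (sborel Y1) \<Longrightarrow> continuous_on U1 h \<Longrightarrow>
        (\<lambda>t. \<integral>y. indicator B y * (\<integral>u. h u \<partial>g1 t k y) \<partial>Q1 k) \<in> F"
    and F2: "\<And>k B h. k < N2 \<Longrightarrow> B \<in> sets (sborel Y2) \<Longrightarrow> continuous_on U2 h \<Longrightarrow>
        (\<lambda>t. \<integral>y. indicator B y * (\<integral>u. h u \<partial>g2 t k y) \<partial>Q2 k) \<in> F"
  shows "(\<lambda>t. kernel_cost N1 N2 \<mu> c (g1 t) (g2 t)) \<in> F"
proof -
  let ?R = "P0 \<Otimes>\<^sub>M PiM {..<N1} Q1 \<Otimes>\<^sub>M PiM {..<N2} Q2"
  let ?X = "PiE {..<N1} (\<lambda>_. U1) \<times> PiE {..<N2} (\<lambda>_. U2)"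
  let ?N = "prof_space U1 {..<N1} \<Otimes>\<^sub>M prof_space U2 {..<N2}"
  have sQ1: "sets (Q1 k) = sets (sborel Y1)" "prob_space (Q1 k)" "space (Q1 k) = Y1" if "k < N1" for k
    using Q1[OF that] sets_eq_imp_space_eq[of "Q1 k" "sborel Y1"] by (auto simp: is_ref_measure_def space_restrict_space)
  have sQ2: "sets (Q2 k) = sets (sborel Y2)" "prob_space (Q2 k)" "space (Q2 k) = Y2" if "k < N2" for k
    using Q2[OF that] sets_eq_imp_space_eq[of "Q2 k" "sborel Y2"] by (auto simp: is_ref_measure_def space_restrict_space)
  interpret P0: prob_space P0 by fact
  interpret A1: prob_space "PiM {..<N1} Q1" by (intro prob_space_PiM sQ1) simp
  interpret A2: prob_space "PiM {..<N2} Q2" by (intro prob_space_PiM sQ2) simp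
  interpret A12: pair_prob_space "PiM {..<N1} Q1" "PiM {..<N2} Q2" ..
  interpret R: pair_prob_space P0 "PiM {..<N1} Q1 \<Otimes>\<^sub>M PiM {..<N2} Q2" ..
  interpret \<mu>: prob_space \<mu> by fact
  have sets\<mu>: "sets \<mu> = sets ?R" unfolding \<mu>(2) by simp
  have space\<mu>: "space \<mu> = \<Omega>0 \<times> PiE {..<N1} (\<lambda>_. Y1) \<times> PiE {..<N2} (\<lambda>_. Y2)" "space ?R = \<Omega>0 \<times> PiE {..<N1} (\<lambda>_. Y1) \<times> PiE {..<N2} (\<lambda>_. Y2)"
  proof -
    have "space (PiM {..<N1} Q1) = PiE {..<N1} (\<lambda>_. Y1)" "space (PiM {..<N2} Q2) = PiE {..<N2} (\<lambda>_. Y2)"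
      unfolding space_PiM using sQ1(3) sQ2(3) by (auto intro!: PiE_cong)
    then show "space ?R = \<Omega>0 \<times> PiE {..<N1} (\<lambda>_. Y1) \<times> PiE {..<N2} (\<lambda>_. Y2)"
      using sets_eq_imp_space_eq[OF P0(2)] by (simp add: space_pair_measure space_restrict_space)
    then show "space \<mu> = \<Omega>0 \<times> PiE {..<N1} (\<lambda>_. Y1) \<times> PiE {..<N2} (\<lambda>_. Y2)"
      using sets_eq_imp_space_eq[OF sets\<mu>] by simp
  qed
  have spN: "space ?N = ?X" by (simp add: space_pair_measure space_PiM space_restrict_space)
  obtain C where C: "\<And>w u v. w \<in> \<Omega>0 \<Longrightarrow> u \<in> PiE {..<N1} (\<lambda>_. U1) \<Longrightarrow> v \<in> PiE {..<N2} (\<lambda>_. U2) \<Longrightarrow> \<bar>c w u v\<bar> \<le> C"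
    using c(2) unfolding continuous_bounded_cost_def by metis
  define \<kappa> where "\<kappa> t x = (case x of (w, y, z) \<Rightarrow> PiM {..<N1} (\<lambda>k. g1 t k (y k)) \<Otimes>\<^sub>M PiM {..<N2} (\<lambda>k. g2 t k (z k)))" for t and x :: "'o \<times> (nat \<Rightarrow> 'a) \<times> (nat \<Rightarrow> 'b)"
  define G where "G x z = (case x of (w, _, _) \<Rightarrow> case z of (u, v) \<Rightarrow> c w u v)" for x :: "'o \<times> (nat \<Rightarrow> 'a) \<times> (nat \<Rightarrow> 'b)" and z
  have PK1: "(\<lambda>y. PiM {..<N1} (\<lambda>k. g1 t k (y k))) \<in> PiM {..<N1} Q1 \<rightarrow>\<^sub>M prob_algebra (prof_space U1 {..<N1})" if "t \<in> T" for t
    by (rule measurable_PiM_kernel) (use kernelsD(1)[OF g1[OF that] sQ1(1)] in auto)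
  have PK2: "(\<lambda>y. PiM {..<N2} (\<lambda>k. g2 t k (y k))) \<in> PiM {..<N2} Q2 \<rightarrow>\<^sub>M prob_algebra (prof_space U2 {..<N2})" if "t \<in> T" for t
    by (rule measurable_PiM_kernel) (use kernelsD(1)[OF g2[OF that] sQ2(1)] in auto)
  have \<kappa>R: "\<kappa> t \<in> ?R \<rightarrow>\<^sub>M prob_algebra ?N" if "t \<in> T" for t
  proof -
    have "(\<lambda>x. PiM {..<N1} (\<lambda>k. g1 t k ((fst (snd x)) k)) \<Otimes>\<^sub>M PiM {..<N2} (\<lambda>k. g2 t k ((snd (snd x)) k))) \<in> ?R \<rightarrow>\<^sub>M prob_algebra ?N"
      by (intro measurable_pair_kernel measurable_compose[OF _ PK1[OF that]] measurable_compose[OF _ PK2[OF that]]) simp_all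
    then show ?thesis unfolding \<kappa>_def split_beta .
  qed
  then have \<kappa>: "\<kappa> t \<in> \<mu> \<rightarrow>\<^sub>M prob_algebra ?N" if "t \<in> T" for t
    using that sets\<mu> by (simp cong: measurable_cong_sets)
  have eq: "kernel_cost N1 N2 \<mu> c (g1 t) (g2 t) = (\<integral>x. (\<integral>z. G x z \<partial>\<kappa> t x) \<partial>\<mu>)" for t
    by (simp add: kernel_cost_def G_def \<kappa>_def case_prod_unfold)
  \<comment> \<open>One name for the list of properties, so that partitions for all \<open>n\<close>
    can be chosen at once.\<close>
  define PP where "PP n I1 h1 I2 h2 p \<longleftrightarrow> finite I1 \<and> finite I2 \<and>
    (\<forall>i\<in>I1. continuous_on U1 (h1 i) \<and> (\<forall>u\<in>U1. 0 \<le> h1 i u \<and> h1 i u \<le> 1)) \<and>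
    (\<forall>i\<in>I2. continuous_on U2 (h2 i) \<and> (\<forall>u\<in>U2. 0 \<le> h2 i u \<and> h2 i u \<le> 1)) \<and>
    fine_partition ?X (1 / real (Suc n)) (PiE {..<N1} (\<lambda>_. I1) \<times> PiE {..<N2} (\<lambda>_. I2)) p
      (\<lambda>(i, j) (u, v). (\<Prod>k<N1. (h1 (i k :: 'u) (u k) :: real)) * (\<Prod>k<N2. h2 (j k :: 'v) (v k)))" for n :: nat and I1 h1 I2 h2 p
  have "\<forall>n. \<exists>I1 h1 I2 h2 p. PP n I1 h1 I2 h2 p"
    unfolding PP_def by (intro allI fine_partition_profiles U) simp
  then obtain I1 h1 I2 h2 p where PP: "\<And>n. PP n (I1 n) (h1 n) (I2 n) (h2 n) (p n)" by metis
  have h1: "continuous_on U1 (h1 n i)" "\<And>u. u \<in> U1 \<Longrightarrow> 0 \<le> h1 n i u \<and> h1 n i u \<le> 1" if "i \<in> I1 n" for n i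
    using PP[of n] that by (auto simp: PP_def)
  have h2: "continuous_on U2 (h2 n i)" "\<And>u. u \<in> U2 \<Longrightarrow> 0 \<le> h2 n i u \<and> h2 n i u \<le> 1" if "i \<in> I2 n" for n i
    using PP[of n] that by (auto simp: PP_def)
  have P: "fine_partition ?X (1 / real (Suc n)) (PiE {..<N1} (\<lambda>_. I1 n) \<times> PiE {..<N2} (\<lambda>_. I2 n)) (p n)
      (\<lambda>(i, j) (u, v). (\<Prod>k<N1. (h1 n (i k :: 'u) (u k) :: real)) * (\<Prod>k<N2. h2 n (j k :: 'v) (v k)))" for n
    using PP[of n] unfolding PP_def by (elim conjE)
  have "(\<lambda>t. \<integral>x. (\<integral>z. G x z \<partial>\<kappa> t x) \<partial>\<mu>) \<in> F"
  proof (rule integral_caratheodory[OF \<mu>.finite_measure_axioms _ _ spN \<kappa> _ _ _ P])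
    show "compact ?X" by (intro compact_Times compact_PiE U)
    show "?X \<noteq> {}" using U by (auto simp: PiE_eq_empty_iff)
    show "(\<lambda>(x, z). G x z) \<in> borel_measurable (\<mu> \<Otimes>\<^sub>M ?N)"
    proof -
      have "(\<lambda>x. (\<lambda>(w, u, v). c w u v) (fst (fst x), fst (snd x), snd (snd x))) \<in> borel_measurable (?R \<Otimes>\<^sub>M ?N)"
      proof (rule measurable_compose[OF _ c(1)[unfolded is_cost_def, THEN conjunct1]])
        have "(\<lambda>x. (fst (fst x), fst (snd x), snd (snd x))) \<in> ?R \<Otimes>\<^sub>M ?N \<rightarrow>\<^sub>M P0 \<Otimes>\<^sub>M prof_space U1 {..<N1} \<Otimes>\<^sub>M prof_space U2 {..<N2}"
          by measurable
        then show "(\<lambda>x. (fst (fst x), fst (snd x), snd (snd x))) \<in> ?R \<Otimes>\<^sub>M ?N \<rightarrow>\<^sub>M sborel \<Omega>0 \<Otimes>\<^sub>M prof_space U1 {..<N1} \<Otimes>\<^sub>M prof_space U2 {..<N2}"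
          using P0(2) by (simp cong: measurable_cong_sets sets_pair_measure_cong)
      qed
      then show ?thesis using sets\<mu>
        by (simp add: G_def split_beta cong: measurable_cong_sets sets_pair_measure_cong)
    qed
    show "continuous_on ?X (G x)" if "x \<in> space \<mu>" for x
      using c(2) that unfolding space\<mu> continuous_bounded_cost_def by (auto simp: G_def)
    show "\<bar>G x z\<bar> \<le> C" if "x \<in> space \<mu>" "z \<in> ?X" for x z
      using C that unfolding space\<mu> by (auto simp: G_def)
  next
    fix n :: nat and i assume "i \<in> PiE {..<N1} (\<lambda>_. I1 n) \<times> PiE {..<N2} (\<lambda>_. I2 n)"
    then obtain i1 i2 where i: "i = (i1, i2)" "\<And>k. k < N1 \<Longrightarrow> i1 k \<in> I1 n" "\<And>k. k < N2 \<Longrightarrow> i2 k \<in> I2 n" by (auto simp: PiE_iff)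
    define k1 where "k1 k = h1 n (i1 k)" for k
    define k2 where "k2 k = h2 n (i2 k)" for k
    have k1: "continuous_on U1 (k1 k)" "k1 k \<in> borel_measurable (sborel U1)" "\<And>u. u \<in> U1 \<Longrightarrow> \<bar>k1 k u\<bar> \<le> 1" if "k < N1" for k
      using h1[OF i(2)[OF that]] continuous_measurable_sborel[of U1 "k1 k"] by (auto simp: k1_def)
    have k2: "continuous_on U2 (k2 k)" "k2 k \<in> borel_measurable (sborel U2)" "\<And>u. u \<in> U2 \<Longrightarrow> \<bar>k2 k u\<bar> \<le> 1" if "k < N2" for k
      using h2[OF i(3)[OF that]] continuous_measurable_sborel[of U2 "k2 k"] by (auto simp: k2_def)
    have m1: "(\<lambda>u. \<Prod>k<N1. k1 k (u k)) \<in> borel_measurable (prof_space U1 {..<N1})"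
      by (intro borel_measurable_prod_components k1(2)) auto
    have m2: "(\<lambda>u. \<Prod>k<N2. k2 k (u k)) \<in> borel_measurable (prof_space U2 {..<N2})"
      by (intro borel_measurable_prod_components k2(2)) auto
    have H: "(case i of (i, j) \<Rightarrow> \<lambda>(u, v). (\<Prod>k<N1. h1 n (i k) (u k)) * (\<Prod>k<N2. h2 n (j k) (v k)))
       = (\<lambda>(u, v). (\<Prod>k<N1. k1 k (u k)) * (\<Prod>k<N2. k2 k (v k)))"
      by (simp add: i k1_def k2_def)
    show "(case i of (i, j) \<Rightarrow> \<lambda>(u, v). (\<Prod>k<N1. h1 n (i k) (u k)) * (\<Prod>k<N2. h2 n (j k) (v k))) \<in> borel_measurable ?N"
      unfolding H unfolding split_beta
      by (intro borel_measurable_times measurable_compose[OF measurable_fst m1] measurable_compose[OF measurable_snd m2])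
    fix \<phi> :: "_ \<Rightarrow> real" assume \<phi>: "\<phi> \<in> borel_measurable \<mu>" "\<And>x. x \<in> space \<mu> \<Longrightarrow> \<bar>\<phi> x\<bar> \<le> C"
    define a1 where "a1 t k y = (\<integral>u. k1 k u \<partial>g1 t k y)" for t k y
    define a2 where "a2 t k y = (\<integral>u. k2 k u \<partial>g2 t k y)" for t k y
    have a1: "a1 t k \<in> borel_measurable (Q1 k)" "\<And>y. y \<in> Y1 \<Longrightarrow> \<bar>a1 t k y\<bar> \<le> 1" if "t \<in> T" "k < N1" for t k
    proof -
      note g = kernelsD[OF g1[OF that] sQ1(1)[OF that(2)]]
      show "a1 t k \<in> borel_measurable (Q1 k)" unfolding a1_def
        by (rule measurable_compose[OF measurable_prob_algebraD[OF g(1)] integral_measurable_subprob_algebra[OF k1(2)[OF that(2)]]])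
      show "\<bar>a1 t k y\<bar> \<le> 1" if "y \<in> Y1" for y
        unfolding a1_def using g(2-4)[OF that] k1(3)[OF \<open>k < N1\<close>] by (intro prob_space.integral_abs_le_const) auto
    qed
    have a2: "a2 t k \<in> borel_measurable (Q2 k)" "\<And>y. y \<in> Y2 \<Longrightarrow> \<bar>a2 t k y\<bar> \<le> 1" if "t \<in> T" "k < N2" for t k
    proof -
      note g = kernelsD[OF g2[OF that] sQ2(1)[OF that(2)]]
      show "a2 t k \<in> borel_measurable (Q2 k)" unfolding a2_def
        by (rule measurable_compose[OF measurable_prob_algebraD[OF g(1)] integral_measurable_subprob_algebra[OF k2(2)[OF that(2)]]])
      show "\<bar>a2 t k y\<bar> \<le> 1" if "y \<in> Y2" for y
        unfolding a2_def using g(2-4)[OF that] k2(3)[OF \<open>k < N2\<close>] by (intro prob_space.integral_abs_le_const) auto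
    qed
    define a where "a t x = (case x of (w, y, z) \<Rightarrow> (\<Prod>k<N1. a1 t k (y k)) * (\<Prod>k<N2. a2 t k (z k)))" for t and x :: "'o \<times> (nat \<Rightarrow> 'a) \<times> (nat \<Rightarrow> 'b)"
    have am: "a t \<in> borel_measurable ?R" if "t \<in> T" for t
    proof -
      have "(\<lambda>y. \<Prod>k<N1. a1 t k (y k)) \<in> borel_measurable (PiM {..<N1} Q1)"
        by (intro borel_measurable_prod_components a1(1)[OF that]) auto
      moreover have "(\<lambda>y. \<Prod>k<N2. a2 t k (y k)) \<in> borel_measurable (PiM {..<N2} Q2)"
        by (intro borel_measurable_prod_components a2(1)[OF that]) auto
      ultimately have "(\<lambda>x. (\<lambda>y. \<Prod>k<N1. a1 t k (y k)) (fst (snd x)) * (\<lambda>y. \<Prod>k<N2. a2 t k (y k)) (snd (snd x))) \<in> borel_measurable ?R"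
        by measurable
      then show ?thesis unfolding a_def split_beta .
    qed
    have prod_le: "\<bar>\<Prod>k<N. f k\<bar> \<le> 1" if "\<And>k. k < N \<Longrightarrow> \<bar>f k\<bar> \<le> 1" for N and f :: "nat \<Rightarrow> real"
      unfolding abs_prod using that by (intro prod_le_1) auto
    have ab: "\<bar>a t x\<bar> \<le> 1" if "t \<in> T" "x \<in> space ?R" for t x
    proof -
      obtain w y z where x: "x = (w, y, z)" by (rule prod_cases3[of x])
      have "\<bar>\<Prod>k<N1. a1 t k (y k)\<bar> \<le> 1" "\<bar>\<Prod>k<N2. a2 t k (z k)\<bar> \<le> 1"
        using that a1(2)[OF that(1)] a2(2)[OF that(1)] unfolding space\<mu> x by (auto intro!: prod_le simp: PiE_iff)
      then show ?thesis by (simp add: a_def x abs_mult mult_le_one)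
    qed
    have inner: "(\<integral>z. (\<lambda>(u, v). (\<Prod>k<N1. k1 k (u k)) * (\<Prod>k<N2. k2 k (v k))) z \<partial>\<kappa> t x) = a t x" if t: "t \<in> T" and x: "x \<in> space ?R" for t x
    proof -
      obtain w y z where xx: "x = (w, y, z)" by (rule prod_cases3[of x])
      have yz: "y k \<in> Y1" if "k < N1" for k using x that unfolding space\<mu> xx by (auto simp: PiE_iff)
      have zz: "z k \<in> Y2" if "k < N2" for k using x that unfolding space\<mu> xx by (auto simp: PiE_iff)
      note G1 = kernelsD[OF g1[OF t] sQ1(1)] and G2 = kernelsD[OF g2[OF t] sQ2(1)]
      have p1: "prob_space (PiM {..<N1} (\<lambda>k. g1 t k (y k)))" using G1(2) yz by (intro prob_space_PiM) auto
      have p2: "prob_space (PiM {..<N2} (\<lambda>k. g2 t k (z k)))" using G2(2) zz by (intro prob_space_PiM) auto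
      have s1: "sets (PiM {..<N1} (\<lambda>k. g1 t k (y k))) = sets (prof_space U1 {..<N1})" using G1(3) yz by (intro sets_PiM_cong) auto
      have s2: "sets (PiM {..<N2} (\<lambda>k. g2 t k (z k))) = sets (prof_space U2 {..<N2})" using G2(3) zz by (intro sets_PiM_cong) auto
      have i1: "integrable (g1 t k (y k)) (k1 k)" if "k < N1" for k
        using k1[OF that] G1(2-4)[OF that that yz[OF that]]
        by (intro finite_measure.integrable_const_bound[where B=1] prob_space.finite_measure AE_I2) (auto cong: measurable_cong_sets)
      have i2: "integrable (g2 t k (z k)) (k2 k)" if "k < N2" for k
        using k2[OF that] G2(2-4)[OF that that zz[OF that]]
        by (intro finite_measure.integrable_const_bound[where B=1] prob_space.finite_measure AE_I2) (auto cong: measurable_cong_sets)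
      have j1: "integrable (PiM {..<N1} (\<lambda>k. g1 t k (y k))) (\<lambda>u. \<Prod>k<N1. k1 k (u k))"
        using m1 s1 p1 sets_eq_imp_space_eq[OF s1] k1(3)
        by (intro finite_measure.integrable_const_bound[where B=1] prob_space.finite_measure AE_I2)
          (auto simp: space_PiM space_restrict_space PiE_iff intro!: prod_le cong: measurable_cong_sets)
      have j2: "integrable (PiM {..<N2} (\<lambda>k. g2 t k (z k))) (\<lambda>u. \<Prod>k<N2. k2 k (u k))"
        using m2 s2 p2 sets_eq_imp_space_eq[OF s2] k2(3)
        by (intro finite_measure.integrable_const_bound[where B=1] prob_space.finite_measure AE_I2)
          (auto simp: space_PiM space_restrict_space PiE_iff intro!: prod_le cong: measurable_cong_sets)
      have "(\<integral>u. (\<Prod>k<N1. k1 k (u k)) \<partial>PiM {..<N1} (\<lambda>k. g1 t k (y k))) = (\<Prod>k<N1. a1 t k (y k))"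
        unfolding a1_def using G1(2) yz i1 by (intro integral_PiM_prod) auto
      moreover have "(\<integral>u. (\<Prod>k<N2. k2 k (u k)) \<partial>PiM {..<N2} (\<lambda>k. g2 t k (z k))) = (\<Prod>k<N2. a2 t k (z k))"
        unfolding a2_def using G2(2) zz i2 by (intro integral_PiM_prod) auto
      ultimately show ?thesis
        unfolding \<kappa>_def a_def xx prod.case integral_pair_mult(1)[OF p1 p2 j1 j2] by simp
    qed
    \<comment> \<open>The product reference measure is essential here: on a rectangle the integral
      factors over the decision makers.\<close>
    have base: "(\<lambda>t. \<integral>x. indicator B x * a t x \<partial>?R) \<in> F" if B: "B \<in> sets ?R" for B
    proof -
      have gen: "pi_generator ?R {a \<times> b |a b. a \<in> P0.events \<and> b \<in> {a \<times> b |a b. a \<in> {PiE {..<N1} B |B. \<forall>i\<in>{..<N1}. B i \<in> sets (Q1 i)} \<and> b \<in> {PiE {..<N2} B |B. \<forall>i\<in>{..<N2}. B i \<in> sets (Q2 i)}}}"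
        by (intro pi_generator_pair pi_generator_sets pi_generator_PiM finite_lessThan)
      show ?thesis
      proof (rule integral_indicator_sigma[OF R.P.finite_measure_axioms am ab pi_generatorD(1-4)[OF gen] _ B])
        fix B assume "B \<in> {a \<times> b |a b. a \<in> P0.events \<and> b \<in> {a \<times> b |a b. a \<in> {PiE {..<N1} B |B. \<forall>i\<in>{..<N1}. B i \<in> sets (Q1 i)} \<and> b \<in> {PiE {..<N2} B |B. \<forall>i\<in>{..<N2}. B i \<in> sets (Q2 i)}}}"
        then obtain A B1 B2 where AB: "B = A \<times> PiE {..<N1} B1 \<times> PiE {..<N2} B2" "A \<in> sets P0"
          "\<And>i. i < N1 \<Longrightarrow> B1 i \<in> sets (Q1 i)" "\<And>i. i < N2 \<Longrightarrow> B2 i \<in> sets (Q2 i)" by auto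
        have int1: "integrable (Q1 k) (\<lambda>y. indicator (B1 k) y * a1 t k y)" if "t \<in> T" "k < N1" for t k
          using a1[OF that] AB(3)[OF that(2)] sQ1[OF that(2)]
          by (intro finite_measure.integrable_const_bound[where B=1] prob_space.finite_measure AE_I2) (auto split: split_indicator)
        have int2: "integrable (Q2 k) (\<lambda>y. indicator (B2 k) y * a2 t k y)" if "t \<in> T" "k < N2" for t k
          using a2[OF that] AB(4)[OF that(2)] sQ2[OF that(2)]
          by (intro finite_measure.integrable_const_bound[where B=1] prob_space.finite_measure AE_I2) (auto split: split_indicator)
        have intP1: "integrable (PiM {..<N1} Q1) (\<lambda>y. \<Prod>k<N1. indicator (B1 k) (y k) * a1 t k (y k))" if "t \<in> T" for t
        proof (rule A1.integrable_const_bound[where B=1], rule AE_I2)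
          fix y assume "y \<in> space (PiM {..<N1} Q1)"
          then show "norm (\<Prod>k<N1. indicator (B1 k) (y k) * a1 t k (y k)) \<le> 1"
            using a1(2)[OF that] sQ1(3) by (auto simp: space_PiM PiE_iff intro!: prod_le split: split_indicator)
        next
          show "(\<lambda>y. \<Prod>k<N1. indicator (B1 k) (y k) * a1 t k (y k)) \<in> borel_measurable (PiM {..<N1} Q1)"
            using int1[OF that] by (intro borel_measurable_prod_components[of _ "\<lambda>k y. indicator (B1 k) y * a1 t k y"] borel_measurable_integrable) auto
        qed
        have intP2: "integrable (PiM {..<N2} Q2) (\<lambda>y. \<Prod>k<N2. indicator (B2 k) (y k) * a2 t k (y k))" if "t \<in> T" for t
        proof (rule A2.integrable_const_bound[where B=1], rule AE_I2)
          fix y assume "y \<in> space (PiM {..<N2} Q2)"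
          then show "norm (\<Prod>k<N2. indicator (B2 k) (y k) * a2 t k (y k)) \<le> 1"
            using a2(2)[OF that] sQ2(3) by (auto simp: space_PiM PiE_iff intro!: prod_le split: split_indicator)
        next
          show "(\<lambda>y. \<Prod>k<N2. indicator (B2 k) (y k) * a2 t k (y k)) \<in> borel_measurable (PiM {..<N2} Q2)"
            using int2[OF that] by (intro borel_measurable_prod_components[of _ "\<lambda>k y. indicator (B2 k) y * a2 t k y"] borel_measurable_integrable) auto
        qed
        have ind: "indicator (PiE {..<N} B) y = (\<Prod>k<N. indicator (B k) (y k) :: real)" if "y \<in> extensional {..<N}" for N and y :: "nat \<Rightarrow> 'z" and B
          using that by (auto simp: indicator_def PiE_iff prod.neutral)
        have eqn: "(\<integral>x. indicator B x * a t x \<partial>?R) = measure P0 A * ((\<Prod>k<N1. \<integral>y. indicator (B1 k) y * a1 t k y \<partial>Q1 k) * (\<Prod>k<N2. \<integral>y. indicator (B2 k) y * a2 t k y \<partial>Q2 k))"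
          if t: "t \<in> T" for t
        proof -
          let ?f = "\<lambda>(y, z). (\<Prod>k<N1. indicator (B1 k) (y k) * a1 t k (y k)) * (\<Prod>k<N2. indicator (B2 k) (z k) * a2 t k (z k))"
          have "(\<integral>x. indicator B x * a t x \<partial>?R) = (\<integral>(w, x). indicator A w * ?f x \<partial>?R)"
          proof (rule Bochner_Integration.integral_cong)
            fix x assume x: "x \<in> space ?R"
            obtain w y z where xx: "x = (w, y, z)" by (rule prod_cases3[of x])
            have "y \<in> extensional {..<N1}" "z \<in> extensional {..<N2}" using x unfolding space\<mu> xx by (auto simp: PiE_iff)
            then show "indicator B x * a t x = (case x of (w, x) \<Rightarrow> indicator A w * ?f x)"
              unfolding AB(1) a_def xx by (simp add: indicator_times ind prod.distrib)
          qed simp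
          also have "\<dots> = (\<integral>w. indicator A w \<partial>P0) * (\<integral>x. ?f x \<partial>(PiM {..<N1} Q1 \<Otimes>\<^sub>M PiM {..<N2} Q2))"
            using AB(2) P0.emeasure_finite[of A] integral_pair_mult(2)[OF A1.prob_space_axioms A2.prob_space_axioms intP1[OF t] intP2[OF t]]
            by (intro integral_pair_mult(1) P0.prob_space_axioms A12.P.prob_space_axioms) (auto simp: P0.emeasure_eq_measure)
          also have "(\<integral>x. ?f x \<partial>(PiM {..<N1} Q1 \<Otimes>\<^sub>M PiM {..<N2} Q2)) =
             (\<integral>y. (\<Prod>k<N1. indicator (B1 k) (y k) * a1 t k (y k)) \<partial>PiM {..<N1} Q1) * (\<integral>z. (\<Prod>k<N2. indicator (B2 k) (z k) * a2 t k (z k)) \<partial>PiM {..<N2} Q2)"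
            by (rule integral_pair_mult(1)[OF A1.prob_space_axioms A2.prob_space_axioms intP1[OF t] intP2[OF t]])
          also have "(\<integral>y. (\<Prod>k<N1. indicator (B1 k) (y k) * a1 t k (y k)) \<partial>PiM {..<N1} Q1) = (\<Prod>k<N1. \<integral>y. indicator (B1 k) y * a1 t k y \<partial>Q1 k)"
            using sQ1(2) int1[OF t] by (intro integral_PiM_prod) auto
          also have "(\<integral>z. (\<Prod>k<N2. indicator (B2 k) (z k) * a2 t k (z k)) \<partial>PiM {..<N2} Q2) = (\<Prod>k<N2. \<integral>y. indicator (B2 k) y * a2 t k y \<partial>Q2 k)"
            using sQ2(2) int2[OF t] by (intro integral_PiM_prod) auto
          finally show ?thesis using sets.sets_into_space[OF AB(2)] by (simp add: Int_absorb2)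
        qed
        have "(\<lambda>t. measure P0 A * ((\<Prod>k<N1. \<integral>y. indicator (B1 k) y * a1 t k y \<partial>Q1 k) * (\<Prod>k<N2. \<integral>y. indicator (B2 k) y * a2 t k y \<partial>Q2 k))) \<in> F"
          unfolding a1_def a2_def using AB(3,4) sQ1(1) sQ2(1) k1(1) k2(1)
          by (intro scale mult prod F1 F2) auto
        then show "(\<lambda>t. \<integral>x. indicator B x * a t x \<partial>?R) \<in> F" by (rule cong) (simp add: eqn)
      qed
    qed
    have \<phi>R: "\<phi> \<in> borel_measurable ?R" using \<phi>(1) sets\<mu> by (simp cong: measurable_cong_sets)
    \<comment> \<open>Passing from \<open>\<mu>\<close> to the product measure turns the bounded
      coefficient \<open>\<phi>\<close> into the integrable weight
      \<open>D x * \<phi> x\<close>.\<close>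
    have "integrable ?R (\<lambda>x. D x * \<phi> x)"
      using \<phi>(2) by (intro integrable_mult_bounded[OF D(1) \<phi>R, of C]) (simp add: space\<mu>)
    then have "(\<lambda>t. \<integral>x. (D x * \<phi> x) * a t x \<partial>?R) \<in> F"
      by (intro integral_integrable[OF R.P.finite_measure_axioms am ab base])
    then show "(\<lambda>t. \<integral>x. \<phi> x * (\<integral>z. (case i of (i, j) \<Rightarrow> \<lambda>(u, v). (\<Prod>k<N1. h1 n (i k) (u k)) * (\<Prod>k<N2. h2 n (j k) (v k))) z \<partial>\<kappa> t x) \<partial>\<mu>) \<in> F"
    proof (rule cong)
      fix t assume t: "t \<in> T"
      have "(\<integral>x. \<phi> x * (\<integral>z. (case i of (i, j) \<Rightarrow> \<lambda>(u, v). (\<Prod>k<N1. h1 n (i k) (u k)) * (\<Prod>k<N2. h2 n (j k) (v k))) z \<partial>\<kappa> t x) \<partial>\<mu>) = (\<integral>x. \<phi> x * a t x \<partial>\<mu>)"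
        unfolding H using inner[OF t] space\<mu> by (intro Bochner_Integration.integral_cong) auto
      also have "\<dots> = (\<integral>x. D x *\<^sub>R (\<phi> x * a t x) \<partial>?R)"
        unfolding \<mu>(2) using D am[OF t] \<phi>R by (intro integral_density) auto
      finally show "(\<integral>x. (D x * \<phi> x) * a t x \<partial>?R) = (\<integral>x. \<phi> x * (\<integral>z. (case i of (i, j) \<Rightarrow> \<lambda>(u, v). (\<Prod>k<N1. h1 n (i k) (u k)) * (\<Prod>k<N2. h2 n (j k) (v k))) z \<partial>\<kappa> t x) \<partial>\<mu>)"
        by (simp add: mult.assoc)
    qed
  qed
  then show ?thesis unfolding eq .
qed

section \<open>Policies and their measurable structure\<close>

text \<open>Finite intersections of a countable basis, traced on \<open>Y\<close>. The empty
  intersection contributes \<open>Y\<close> itself, and openness of the members lets their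
  indicators be approximated by continuous functions.\<close>

lemma countable_pi_generator_sborel:
  fixes Y :: "'a::second_countable_topology set"
  assumes "Y \<in> sets borel"
  shows "\<exists>E. countable E \<and> pi_generator (sborel Y) E \<and> (\<forall>B\<in>E. \<exists>A. open A \<and> B = Y \<inter> A)"
proof -
  obtain B0 :: "'a set set" where B0: "countable B0" "topological_basis B0"
    using ex_countable_basis by blast
  define E0 where "E0 = (\<lambda>F. \<Inter>F) ` {F. finite F \<and> F \<subseteq> B0}"
  have cE: "countable E0" unfolding E0_def by (intro countable_image countable_Collect_finite_subset B0)
  have UE: "UNIV \<in> E0" unfolding E0_def by (auto intro!: image_eqI[of _ _ "{}"])
  have opE: "open A" if A: "A \<in> E0" for A
  proof -
    obtain F where "finite F" "F \<subseteq> B0" "A = \<Inter>F" using A unfolding E0_def by auto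
    then show ?thesis using topological_basis_open[OF B0(2)] by (auto intro!: open_Inter)
  qed
  have IE: "A \<inter> A' \<in> E0" if A: "A \<in> E0" "A' \<in> E0" for A A'
  proof -
    obtain F where "finite F" "F \<subseteq> B0" "A = \<Inter>F" using A(1) unfolding E0_def by auto
    moreover obtain F' where "finite F'" "F' \<subseteq> B0" "A' = \<Inter>F'" using A(2) unfolding E0_def by auto
    ultimately show ?thesis unfolding E0_def by (intro image_eqI[of _ _ "F \<union> F'"]) auto
  qed
  have BE: "B0 \<subseteq> E0"
  proof
    fix A assume "A \<in> B0"
    then show "A \<in> E0" unfolding E0_def by (intro image_eqI[of _ _ "{A}"]) auto
  qed
  have sb: "sets (borel :: 'a measure) = sigma_sets UNIV E0"
  proof
    have "sets (borel :: 'a measure) = sigma_sets UNIV B0"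
      using borel_eq_countable_basis[OF B0] by (metis Pow_UNIV sets_measure_of subset_UNIV)
    then show "sets (borel :: 'a measure) \<subseteq> sigma_sets UNIV E0" using sigma_sets_mono'[OF BE] by simp
    have "sigma_sets (space borel) E0 \<subseteq> sets (borel :: 'a measure)"
      using opE by (intro sets.sigma_sets_subset) auto
    then show "sigma_sets UNIV E0 \<subseteq> sets (borel :: 'a measure)" by simp
  qed
  have "sets (sborel Y) = (\<inter>) Y ` sigma_sets UNIV E0" by (simp add: sets_restrict_space sb)
  also have "\<dots> = sigma_sets Y ((\<inter>) Y ` E0)" using assms sb by (intro sigma_sets_Int) auto
  finally have "sets (sborel Y) = sigma_sets Y ((\<inter>) Y ` E0)" .
  moreover have "Int_stable ((\<inter>) Y ` E0)"
  proof (rule Int_stableI)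
    fix a b assume "a \<in> (\<inter>) Y ` E0" "b \<in> (\<inter>) Y ` E0"
    then obtain A A' where "A \<in> E0" "A' \<in> E0" "a = Y \<inter> A" "b = Y \<inter> A'" by auto
    then show "a \<inter> b \<in> (\<inter>) Y ` E0" using IE[of A A'] by (intro image_eqI[of _ _ "A \<inter> A'"]) auto
  qed
  ultimately have "pi_generator (sborel Y) ((\<inter>) Y ` E0)"
    using UE by (auto simp: pi_generator_def space_restrict_space intro!: image_eqI[of _ _ UNIV])
  then show ?thesis using cE opE by (intro exI[of _ "(\<inter>) Y ` E0"]) auto
qed

text \<open>Countably many pairs of a set and a function that determine all averages of a kernel: a
  generator for the sets, and for the functions partitions of unity of every mesh
  \<open>1 / (n + 1)\<close>. Numbering them makes policies comparable with real sequences.\<close>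

definition test_family :: "'a::topological_space set \<Rightarrow> 'u::metric_space set \<Rightarrow> (nat \<Rightarrow> 'a set) \<Rightarrow> (nat \<Rightarrow> 'u \<Rightarrow> real) \<Rightarrow> bool" where
  "test_family Y U BB hh \<longleftrightarrow>
     (\<forall>j. BB j \<in> sets (sborel Y) \<and> continuous_on U (hh j) \<and> (\<forall>u\<in>U. 0 \<le> hh j u \<and> hh j u \<le> 1)) \<and>
     (\<exists>E. pi_generator (sborel Y) E \<and>
        (\<forall>n. \<exists>I h. fine_partition U (1 / real (Suc n)) I id h \<and> (\<forall>B\<in>E. \<forall>i\<in>I. \<exists>j. BB j = B \<and> hh j = h i)))"

lemma test_family_exists:
  fixes Y :: "'a::second_countable_topology set" and U :: "'u::metric_space set"
  assumes Y: "Y \<in> sets borel" and U: "compact U"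
  shows "\<exists>BB hh. test_family Y U BB hh"
proof -
  obtain E where E: "countable E" "pi_generator (sborel Y) E" using countable_pi_generator_sborel[OF Y] by blast
  have "\<forall>n. \<exists>I h. fine_partition U (1 / real (Suc n)) I id h" using fine_partition_exists[OF U] by simp
  then obtain I h where P: "\<And>n. fine_partition U (1 / real (Suc n)) (I n) id (h n)" by metis
  \<comment> \<open>The extra pair keeps the set of tests nonempty, so that it is the range of a
    sequence.\<close>
  define W where "W = insert (Y, \<lambda>_. 0) (E \<times> (\<Union>n. h n ` I n))"
  have cW: "countable W" unfolding W_def
    using P E(1) by (intro countable_insert countable_SIGMA countable_UN) (auto simp: fine_partition_def intro: countable_finite)
  have "W \<noteq> {}" by (simp add: W_def)
  then obtain f :: "nat \<Rightarrow> 'a set \<times> ('u \<Rightarrow> real)" where f: "range f = W"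
    using range_from_nat_into[OF _ cW] by blast
  have fW: "f j \<in> W" for j using f by auto
  have "test_family Y U (\<lambda>j. fst (f j)) (\<lambda>j. snd (f j))"
    unfolding test_family_def
  proof (intro conjI allI exI[of _ E])
    fix j
    have *: "f j = (Y, \<lambda>_. 0) \<or> (\<exists>n i. fst (f j) \<in> E \<and> i \<in> I n \<and> snd (f j) = h n i)"
      using fW[of j] by (cases "f j") (auto simp: W_def)
    have "Y \<in> sets (sborel Y)" using sets.top[of "sborel Y"] by (simp add: space_restrict_space)
    then show "fst (f j) \<in> sets (sborel Y)" using * pi_generatorD(5)[OF E(2)] by auto
    show "continuous_on U (snd (f j))" using * P by (auto simp: fine_partition_def intro: continuous_on_const)
    show "\<forall>u\<in>U. 0 \<le> snd (f j) u \<and> snd (f j) u \<le> 1" using * P by (auto simp: fine_partition_def)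
  next
    fix n
    show "\<exists>I h. fine_partition U (1 / real (Suc n)) I id h \<and> (\<forall>B\<in>E. \<forall>i\<in>I. \<exists>j. fst (f j) = B \<and> snd (f j) = h i)"
    proof (intro exI[of _ "I n"] exI[of _ "h n"] conjI ballI P)
      fix B i assume "B \<in> E" "i \<in> I n"
      then have "(B, h n i) \<in> range f" unfolding f W_def by auto
      then obtain j where "(B, h n i) = f j" by blast
      then show "\<exists>j. fst (f j) = B \<and> snd (f j) = h n i" by (metis fst_conv snd_conv)
    qed
  qed (rule E)
  then show ?thesis by blast
qed

lemma kernel_integral_bound:
  assumes "g \<in> kernels Y U" "sets Q = sets (sborel Y)" "y \<in> Y" "\<And>u. u \<in> U \<Longrightarrow> \<bar>h u\<bar> \<le> C"
  shows "\<bar>\<integral>u. h u \<partial>g y :: real\<bar> \<le> C"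
  using kernelsD[OF assms(1,2)] assms(3,4) by (intro prob_space.integral_abs_le_const) auto

lemma kernel_integral_measurable:
  assumes "g \<in> kernels Y U" "sets Q = sets (sborel Y)" "h \<in> borel_measurable (sborel U)"
  shows "(\<lambda>y. \<integral>u. h u \<partial>g y :: real) \<in> borel_measurable Q"
  by (rule measurable_compose[OF measurable_prob_algebraD[OF kernelsD(1)[OF assms(1,2)]] integral_measurable_subprob_algebra[OF assms(3)]])

text \<open>Three widenings of the tests: from generating sets to all sets, from indicators to
  integrable weights, and from partition functions to integrands that are continuous in the
  action.\<close>

lemma (in uniform_algebra) caratheodory_closed:
  fixes U :: "'u::{metric_space,second_countable_topology} set" and Y :: "'a::topological_space set"
  assumes Q: "is_ref_measure Y Q" and U: "compact U" "U \<noteq> {}" and fam: "test_family Y U BB hh"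
    and g: "\<And>t. t \<in> T \<Longrightarrow> g t \<in> kernels Y U"
    and base: "\<And>j. (\<lambda>t. \<integral>y. indicator (BB j) y * (\<integral>u. hh j u \<partial>g t y) \<partial>Q) \<in> F"
    and \<psi>: "integrable Q \<psi>"
    and G: "(\<lambda>(y, u). G y u) \<in> borel_measurable (Q \<Otimes>\<^sub>M sborel U)" "\<And>y. y \<in> Y \<Longrightarrow> continuous_on U (G y)"
      "\<And>y u. y \<in> Y \<Longrightarrow> u \<in> U \<Longrightarrow> \<bar>G y u\<bar> \<le> C"
  shows "(\<lambda>t. \<integral>y. \<psi> y * (\<integral>u. G y u \<partial>g t y) \<partial>Q) \<in> F"
proof -
  have sQ: "sets Q = sets (sborel Y)" and "prob_space Q" using Q by (auto simp: is_ref_measure_def)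
  interpret prob_space Q by fact
  have spQ: "space Q = Y" using sets_eq_imp_space_eq[OF sQ] by (simp add: space_restrict_space)
  obtain E where E: "pi_generator (sborel Y) E" and
    "\<forall>n. \<exists>I h. fine_partition U (1 / real (Suc n)) I id h \<and> (\<forall>B\<in>E. \<forall>i\<in>I. \<exists>j. BB j = B \<and> hh j = h i)"
    using fam unfolding test_family_def by blast
  then obtain I h where P: "\<And>n. fine_partition U (1 / real (Suc n)) (I n) id (h n)"
    and EI: "\<And>n B i. B \<in> E \<Longrightarrow> i \<in> I n \<Longrightarrow> \<exists>j. BB j = B \<and> hh j = h n i" by metis
  have EQ: "pi_generator Q E" using pi_generator_cong[OF E sQ[symmetric]] .
  have h: "continuous_on U (h n i)" "\<And>u. u \<in> U \<Longrightarrow> \<bar>h n i u\<bar> \<le> 1" if "i \<in> I n" for n i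
    using P[of n] that by (auto simp: fine_partition_def)
  note hm = continuous_measurable_sborel[OF h(1)]
  have 1: "(\<lambda>t. \<integral>y. indicator B y * (\<integral>u. h n i u \<partial>g t y) \<partial>Q) \<in> F" if i: "i \<in> I n" and B: "B \<in> sets Q" for n i B
  proof (rule integral_indicator_sigma[OF finite_measure_axioms _ _ pi_generatorD(1-4)[OF EQ] _ B])
    show "(\<lambda>y. \<integral>u. h n i u \<partial>g t y) \<in> borel_measurable Q" if "t \<in> T" for t
      by (rule kernel_integral_measurable[OF g[OF that] sQ hm[OF i]])
    show "\<bar>\<integral>u. h n i u \<partial>g t y\<bar> \<le> 1" if "t \<in> T" "y \<in> space Q" for t y
      using that spQ by (intro kernel_integral_bound[OF g sQ _ h(2)[OF i]]) auto
    show "(\<lambda>t. \<integral>y. indicator B y * (\<integral>u. h n i u \<partial>g t y) \<partial>Q) \<in> F" if "B \<in> E" for B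
    proof -
      have "\<exists>j. BB j = B \<and> hh j = h n i" by (rule EI[OF that i])
      then obtain j where "BB j = B" "hh j = h n i" by blast
      then show ?thesis using base[of j] by simp
    qed
  qed
  have 2: "(\<lambda>t. \<integral>y. \<phi> y * (\<integral>u. h n i u \<partial>g t y) \<partial>Q) \<in> F" if i: "i \<in> I n" and \<phi>: "integrable Q \<phi>" for n i \<phi>
  proof (rule integral_integrable[OF finite_measure_axioms _ _ 1[OF i] \<phi>])
    show "(\<lambda>y. \<integral>u. h n i u \<partial>g t y) \<in> borel_measurable Q" if "t \<in> T" for t
      by (rule kernel_integral_measurable[OF g[OF that] sQ hm[OF i]])
    show "\<bar>\<integral>u. h n i u \<partial>g t y\<bar> \<le> 1" if "t \<in> T" "y \<in> space Q" for t y
      using that spQ by (intro kernel_integral_bound[OF g sQ _ h(2)[OF i]]) auto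
  qed
  have 3: "(\<lambda>t. \<integral>y. (\<integral>u. G' y u \<partial>g t y) \<partial>Q) \<in> F"
    if G': "(\<lambda>(y, u). G' y u) \<in> borel_measurable (Q \<Otimes>\<^sub>M sborel U)" "\<And>y. y \<in> Y \<Longrightarrow> continuous_on U (G' y)"
      "\<And>y u. y \<in> Y \<Longrightarrow> u \<in> U \<Longrightarrow> \<bar>G' y u\<bar> \<le> K" for G' K
  proof (rule integral_caratheodory[OF finite_measure_axioms U _ _ G'(1) _ _ P])
    show "space (sborel U) = U" by (simp add: space_restrict_space)
    show "g t \<in> Q \<rightarrow>\<^sub>M prob_algebra (sborel U)" if "t \<in> T" for t by (rule kernelsD(1)[OF g[OF that] sQ])
    fix n i \<phi> assume i: "i \<in> I n"
    show "h n i \<in> borel_measurable (sborel U)" by (rule hm[OF i])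
    assume "\<phi> \<in> borel_measurable Q" "\<And>w. w \<in> space Q \<Longrightarrow> \<bar>\<phi> w\<bar> \<le> K"
    then show "(\<lambda>t. \<integral>w. \<phi> w * (\<integral>x. h n i x \<partial>g t w) \<partial>Q) \<in> F"
      by (intro 2 i integrable_const_bound[where B=K]) auto
  qed (use G' spQ in auto)
  have Gm: "(\<lambda>y. \<integral>u. G y u \<partial>g t y) \<in> borel_measurable Q" if "t \<in> T" for t
    by (rule borel_measurable_integral_kernel[OF kernelsD(1)[OF g[OF that] sQ] G(1)])
  show ?thesis
  proof (rule integral_integrable[OF finite_measure_axioms Gm _ _ \<psi>])
    show "\<bar>\<integral>u. G y u \<partial>g t y\<bar> \<le> C" if "t \<in> T" "y \<in> space Q" for t y
      using that spQ G(3) by (intro kernel_integral_bound[OF g sQ]) auto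
    fix B assume B: "B \<in> sets Q"
    have eq: "indicator B y * (\<integral>u. G y u \<partial>g t y) = (\<integral>u. indicator B y * G y u \<partial>g t y)" for t y by simp
    show "(\<lambda>t. \<integral>y. indicator B y * (\<integral>u. G y u \<partial>g t y) \<partial>Q) \<in> F"
      unfolding eq
    proof (rule 3[of "\<lambda>y u. indicator B y * G y u" "\<bar>C\<bar>"])
      have "(\<lambda>x. indicator B (fst x) * (case x of (y, u) \<Rightarrow> G y u)) \<in> borel_measurable (Q \<Otimes>\<^sub>M sborel U)"
        using B G(1) by measurable
      then show "(\<lambda>(y, u). indicator B y * G y u) \<in> borel_measurable (Q \<Otimes>\<^sub>M sborel U)" by (simp add: split_beta')
      show "\<bar>indicator B y * G y u\<bar> \<le> \<bar>C\<bar>" if "y \<in> Y" "u \<in> U" for y u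
        using G(3)[OF that] by (auto split: split_indicator)
    qed (intro continuous_intros G)
  qed
qed

lemma (in uniform_algebra) test_closed:
  fixes U :: "'u::{metric_space,second_countable_topology} set" and Y :: "'a::topological_space set"
  assumes Q: "is_ref_measure Y Q" and U: "compact U" "U \<noteq> {}" and fam: "test_family Y U BB hh"
    and g: "\<And>t. t \<in> T \<Longrightarrow> g t \<in> kernels Y U"
    and base: "\<And>j. (\<lambda>t. \<integral>y. indicator (BB j) y * (\<integral>u. hh j u \<partial>g t y) \<partial>Q) \<in> F"
    and \<psi>: "integrable Q \<psi>" and h: "continuous_on U h"
  shows "(\<lambda>t. \<integral>y. \<psi> y * (\<integral>u. h u \<partial>g t y) \<partial>Q) \<in> F"
proof -
  obtain C where "\<And>x. x \<in> U \<Longrightarrow> norm (h x) \<le> C"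
    using compact_imp_bounded[OF compact_continuous_image[OF h U(1)]] by (auto simp: bounded_iff)
  then show ?thesis
    using measurable_compose[OF measurable_snd continuous_measurable_sborel[OF h], of Q]
    by (intro caratheodory_closed[OF Q U fam g base \<psi>, where G="\<lambda>y u. h u" and C=C]) (auto simp: h split_beta')
qed

lemma
  fixes Y :: "'a::second_countable_topology set" and U :: "'u::second_countable_topology set"
  assumes Q: "is_ref_measure Y Q" and g: "g \<in> kernels Y U"
  shows policy_measure_prob: "policy_measure Y U Q g \<in> space (prob_algebra (sborel (U \<times> Y)))"
    and integral_policy_measure: "f \<in> borel_measurable (sborel (U \<times> Y)) \<Longrightarrow> (\<And>x. x \<in> U \<times> Y \<Longrightarrow> \<bar>f x\<bar> \<le> C) \<Longrightarrow>
      (\<integral>x. f x \<partial>policy_measure Y U Q g) = (\<integral>y. (\<integral>u. f (u, y) \<partial>g y) \<partial>Q :: real)"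
proof -
  have sQ: "sets Q = sets (sborel Y)" and pQ: "prob_space Q" using Q by (auto simp: is_ref_measure_def)
  have spQ: "space Q = Y" using sets_eq_imp_space_eq[OF sQ] by (simp add: space_restrict_space)
  \<comment> \<open>A policy lists the action first, while the product formed with a kernel lists
    the observation first.\<close>
  have pair: "(\<lambda>(y, u). (u, y)) \<in> Q \<Otimes>\<^sub>M sborel U \<rightarrow>\<^sub>M sborel (U \<times> Y)"
  proof (rule measurable_restrict_space2)
    have "(\<lambda>x. x) \<in> sborel Y \<rightarrow>\<^sub>M borel" by (rule measurable_restrict_space1) simp
    then have idQ: "(\<lambda>x. x) \<in> Q \<rightarrow>\<^sub>M borel" using sQ by (simp cong: measurable_cong_sets)
    have idU: "(\<lambda>x. x) \<in> sborel U \<rightarrow>\<^sub>M borel" by (rule measurable_restrict_space1) simp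
    have "fst \<in> Q \<Otimes>\<^sub>M sborel U \<rightarrow>\<^sub>M borel" by (rule measurable_compose[OF measurable_fst idQ])
    moreover have "snd \<in> Q \<Otimes>\<^sub>M sborel U \<rightarrow>\<^sub>M borel" by (rule measurable_compose[OF measurable_snd idU])
    ultimately show "(\<lambda>(y, u). (u, y)) \<in> borel_measurable (Q \<Otimes>\<^sub>M sborel U)"
      unfolding split_beta' by (intro borel_measurable_Pair)
  qed (auto simp: space_pair_measure spQ space_restrict_space)
  have K: "(\<lambda>y. distr (g y) (sborel (U \<times> Y)) (\<lambda>u. (u, y))) \<in> Q \<rightarrow>\<^sub>M prob_algebra (sborel (U \<times> Y))"
    by (rule measurable_distr_prob_space2[OF kernelsD(1)[OF g sQ] pair])
  have "Q \<in> space (prob_algebra Q)" using pQ by (simp add: space_prob_algebra)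
  then show "policy_measure Y U Q g \<in> space (prob_algebra (sborel (U \<times> Y)))"
    unfolding policy_measure_def using measurable_space[OF measurable_bind_prob_space[OF measurable_ident K]] by simp
  assume f: "f \<in> borel_measurable (sborel (U \<times> Y))" "\<And>x. x \<in> U \<times> Y \<Longrightarrow> \<bar>f x\<bar> \<le> C"
  have "(\<integral>x. f x \<partial>policy_measure Y U Q g) = (\<integral>y. (\<integral>x. f x \<partial>distr (g y) (sborel (U \<times> Y)) (\<lambda>u. (u, y))) \<partial>Q)"
    unfolding policy_measure_def by (rule integral_bind_kernel[OF pQ K f(1)]) (use f(2) in \<open>auto simp: space_restrict_space\<close>)
  also have "\<dots> = (\<integral>y. (\<integral>u. f (u, y) \<partial>g y) \<partial>Q)"
  proof (rule Bochner_Integration.integral_cong)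
    fix y assume y: "y \<in> space Q"
    have "(\<lambda>u. (u, y)) \<in> sborel U \<rightarrow>\<^sub>M sborel (U \<times> Y)"
      using measurable_compose[OF measurable_Pair1'[OF y, of "sborel U"] pair] by simp
    then have "(\<lambda>u. (u, y)) \<in> g y \<rightarrow>\<^sub>M sborel (U \<times> Y)"
      using kernelsD(3)[OF g sQ, of y] y spQ by (simp cong: measurable_cong_sets)
    then show "(\<integral>x. f x \<partial>distr (g y) (sborel (U \<times> Y)) (\<lambda>u. (u, y))) = (\<integral>u. f (u, y) \<partial>g y)"
      by (rule integral_distr[OF _ f(1)])
  qed simp
  finally show "(\<integral>x. f x \<partial>policy_measure Y U Q g) = (\<integral>y. (\<integral>u. f (u, y) \<partial>g y) \<partial>Q)" .
qed

section \<open>Tests of policies and the Borel sets of the weak topology\<close>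

lemma kernel_of:
  assumes "m \<in> policies Y U Q"
  shows "kernel_of Y U Q m \<in> kernels Y U" "policy_measure Y U Q (kernel_of Y U Q m) = m"
proof -
  have "\<exists>g. g \<in> kernels Y U \<and> policy_measure Y U Q g = m" using assms by (auto simp: policies_def)
  from someI_ex[OF this] show "kernel_of Y U Q m \<in> kernels Y U" "policy_measure Y U Q (kernel_of Y U Q m) = m"
    unfolding kernel_of_def by auto
qed

text \<open>Formed from the measure and not from a kernel, so it is a function of the policy without
  any choice of version.\<close>

definition test_integral :: "('u \<times> 'a) measure \<Rightarrow> 'a set \<Rightarrow> ('u \<Rightarrow> real) \<Rightarrow> real" where
  "test_integral m B h = (\<integral>x. indicator B (snd x) * h (fst x) \<partial>m)"

lemma measurable_projections_sborel:
  shows "fst \<in> sborel (A \<times> B) \<rightarrow>\<^sub>M sborel A" "snd \<in> sborel (A \<times> B) \<rightarrow>\<^sub>M sborel B"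
proof -
  have "fst \<in> borel_measurable (sborel (A \<times> B))" "snd \<in> borel_measurable (sborel (A \<times> B))"
    by (intro measurable_restrict_space1 borel_measurable_continuous_onI continuous_intros)+
  then show "fst \<in> sborel (A \<times> B) \<rightarrow>\<^sub>M sborel A" "snd \<in> sborel (A \<times> B) \<rightarrow>\<^sub>M sborel B"
    by (auto intro!: measurable_restrict_space2 simp: space_restrict_space mem_Times_iff)
qed

lemma test_integral_policy_measure:
  fixes Y :: "'a::second_countable_topology set" and U :: "'u::second_countable_topology set"
  assumes Q: "is_ref_measure Y Q" and g: "g \<in> kernels Y U" and U: "compact U" and B: "B \<in> sets (sborel Y)" and h: "continuous_on U h"
  shows "test_integral (policy_measure Y U Q g) B h = (\<integral>y. indicator B y * (\<integral>u. h u \<partial>g y) \<partial>Q)"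
proof -
  obtain C where C: "\<And>x. x \<in> U \<Longrightarrow> norm (h x) \<le> C"
    using compact_imp_bounded[OF compact_continuous_image[OF h U]] by (auto simp: bounded_iff)
  note 1 = measurable_projections_sborel[of U Y]
  have "(\<lambda>x. indicator B (snd x) * h (fst x)) \<in> borel_measurable (sborel (U \<times> Y))"
    using B by (intro borel_measurable_times measurable_compose[OF 1(1) continuous_measurable_sborel[OF h]] measurable_compose[OF 1(2) borel_measurable_indicator])
  moreover have "\<bar>indicator B (snd x) * h (fst x)\<bar> \<le> \<bar>C\<bar>" if "x \<in> U \<times> Y" for x
    using C[of "fst x"] that by (auto split: split_indicator)
  ultimately have "test_integral (policy_measure Y U Q g) B h = (\<integral>y. (\<integral>u. indicator B (snd (u, y)) * h (fst (u, y)) \<partial>g y) \<partial>Q)"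
    unfolding test_integral_def by (rule integral_policy_measure[OF Q g])
  then show ?thesis by simp
qed


lemma test_integral_kernel_of:
  fixes Y :: "'a::second_countable_topology set" and U :: "'u::second_countable_topology set"
  assumes "is_ref_measure Y Q" "m \<in> policies Y U Q" "compact U" "B \<in> sets (sborel Y)" "continuous_on U h"
  shows "(\<integral>y. indicator B y * (\<integral>u. h u \<partial>kernel_of Y U Q m y) \<partial>Q) = test_integral m B h"
  using test_integral_policy_measure[OF assms(1) kernel_of(1)[OF assms(2)] assms(3-5)] kernel_of(2)[OF assms(2)] by simp

lemma topspace_policy_topology:
  fixes Y :: "'a::second_countable_topology set" and U :: "'u::second_countable_topology set"
  assumes "is_ref_measure Y Q"
  shows "topspace (policy_topology Y U Q) = policies Y U Q"
    and "policies Y U Q \<subseteq> space (prob_algebra (sborel (U \<times> Y)))"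
proof -
  show p: "policies Y U Q \<subseteq> space (prob_algebra (sborel (U \<times> Y)))"
    using policy_measure_prob[OF assms] by (auto simp: policies_def)
  have "space (prob_algebra (sborel (U \<times> Y))) \<subseteq> topspace (weak_topology (U \<times> Y))"
  proof -
    let ?S = "{{m \<in> space (prob_algebra (sborel (U \<times> Y))). (\<integral>z. g z \<partial>m) \<in> V} | (g :: _ \<Rightarrow> real) V.
        continuous_on (U \<times> Y) g \<and> bounded (g ` (U \<times> Y)) \<and> open V}"
    \<comment> \<open>The constant function with the open set \<open>UNIV\<close> shows that the
      subbasis covers the whole space.\<close>
    have "{m \<in> space (prob_algebra (sborel (U \<times> Y))). (\<integral>z. (\<lambda>_. 0::real) z \<partial>m) \<in> UNIV} \<in> ?S"
      by (intro CollectI exI[of _ "\<lambda>_. 0::real"] exI[of _ UNIV] conjI refl) (auto simp: bounded_iff)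
    then have "\<Union>?S \<supseteq> space (prob_algebra (sborel (U \<times> Y)))" by auto
    then show ?thesis by (simp add: weak_topology_def topology_generated_by_topspace)
  qed
  then show "topspace (policy_topology Y U Q) = policies Y U Q"
    using p by (auto simp: policy_topology_def topspace_subtopology)
qed

lemma openin_policy_topology:
  fixes f :: "_ \<Rightarrow> real"
  assumes "continuous_on (U \<times> Y) f" "bounded (f ` (U \<times> Y))" "open V"
    and "policies Y U Q \<subseteq> space (prob_algebra (sborel (U \<times> Y)))"
  shows "openin (policy_topology Y U Q) {m \<in> policies Y U Q. (\<integral>x. f x \<partial>m) \<in> V}"
proof -
  have "openin (weak_topology (U \<times> Y)) {m \<in> space (prob_algebra (sborel (U \<times> Y))). (\<integral>x. f x \<partial>m) \<in> V}"
    unfolding weak_topology_def by (rule topology_generated_by_Basis) (use assms in blast)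
  then show ?thesis
    unfolding policy_topology_def openin_subtopology using assms(4) by blast
qed

lemma sets_borel_of: "sets (borel_of T) = sigma_sets (topspace T) {V. openin T V}"
  and space_borel_of: "space (borel_of T) = topspace T"
  unfolding borel_of_def using openin_subset by (auto simp: space_measure_of_conv intro!: sets_measure_of)

lemma measurable_integral_policy:
  fixes Y :: "'a::second_countable_topology set" and U :: "'u::second_countable_topology set" and f :: "_ \<Rightarrow> real"
  assumes Q: "is_ref_measure Y Q" and f: "continuous_on (U \<times> Y) f" "bounded (f ` (U \<times> Y))"
  shows "(\<lambda>m. \<integral>x. f x \<partial>m) \<in> borel_measurable (borel_of (policy_topology Y U Q))"
proof (rule borel_measurableI)
  fix V :: "real set" assume "open V"
  have "(\<lambda>m. \<integral>x. f x \<partial>m) -` V \<inter> space (borel_of (policy_topology Y U Q)) = {m \<in> policies Y U Q. (\<integral>x. f x \<partial>m) \<in> V}"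
    by (auto simp: space_borel_of topspace_policy_topology[OF Q])
  then show "(\<lambda>m. \<integral>x. f x \<partial>m) -` V \<inter> space (borel_of (policy_topology Y U Q)) \<in> sets (borel_of (policy_topology Y U Q))"
    using openin_policy_topology[OF f \<open>open V\<close> topspace_policy_topology(2)[OF Q]] by (simp add: sets_borel_of)
qed

text \<open>The indicator of an observation set is in general not continuous, so a test need not be
  weakly continuous in the policy. For relatively open sets it is a pointwise limit of weakly
  continuous functions, and the Dynkin argument reaches the other Borel sets.\<close>

lemma measurable_test_integral:
  fixes Y :: "'a::{metric_space,second_countable_topology} set" and U :: "'u::second_countable_topology set"
  assumes Y: "Y \<in> sets borel" and Q: "is_ref_measure Y Q" and U: "compact U"
    and B: "B \<in> sets (sborel Y)" and h: "continuous_on U h"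
  shows "(\<lambda>m. test_integral m B h) \<in> borel_measurable (borel_of (policy_topology Y U Q))"
proof -
  let ?P = "borel_of (policy_topology Y U Q)"
  interpret uniform_algebra "space ?P" "borel_measurable ?P" by (rule uniform_algebra_measurable)
  have sp: "space ?P = policies Y U Q" by (simp add: space_borel_of topspace_policy_topology[OF Q])
  have sQ: "sets Q = sets (sborel Y)" and pQ: "prob_space Q" using Q by (auto simp: is_ref_measure_def)
  interpret Q: prob_space Q by fact
  have spQ: "space Q = Y" using sets_eq_imp_space_eq[OF sQ] by (simp add: space_restrict_space)
  obtain E where E: "pi_generator (sborel Y) E" "\<And>B. B \<in> E \<Longrightarrow> \<exists>A. open A \<and> B = Y \<inter> A"
    using countable_pi_generator_sborel[OF Y] by blast
  have EQ: "pi_generator Q E" using pi_generator_cong[OF E(1) sQ[symmetric]] .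
  obtain C where C: "\<And>x. x \<in> U \<Longrightarrow> norm (h x) \<le> C"
    using compact_imp_bounded[OF compact_continuous_image[OF h U]] by (auto simp: bounded_iff)
  have base: "(\<lambda>m. test_integral m B h) \<in> borel_measurable ?P" if "B \<in> E" for B
  proof -
    have "\<exists>A. open A \<and> B = Y \<inter> A" by (rule E(2)[OF that])
    then obtain A where A: "open A" "B = Y \<inter> A" by blast
    \<comment> \<open>These functions increase to the indicator of \<open>A\<close>. The distance to
      the empty set is 0 by convention, so \<open>A = UNIV\<close> is treated apart.\<close>
    define f where "f n y = min 1 (real n * (if A = UNIV then 1 else infdist y (- A)))" for n y
    have f01: "0 \<le> f n y" "f n y \<le> 1" for n y by (auto simp: f_def infdist_nonneg)
    have fc: "continuous_on S (f n)" for S n unfolding f_def by (cases "A = UNIV") (auto intro!: continuous_intros)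
    have lim: "(\<lambda>n. f n y) \<longlonglongrightarrow> indicator A y" for y
    proof (cases "y \<in> A")
      case True
      define d where "d = (if A = UNIV then 1 else infdist y (- A))"
      have "d > 0"
      proof (cases "A = UNIV")
        case False
        then have "infdist y (- A) \<noteq> 0" using in_closed_iff_infdist_zero[of "- A" y] A(1) True by (auto simp: open_closed)
        then show ?thesis using False infdist_nonneg[of y "- A"] by (simp add: d_def)
      qed (simp add: d_def)
      then obtain N :: nat where N: "1 \<le> real N * d" by (metis less_imp_le reals_Archimedean3)
      have "\<forall>\<^sub>F n in sequentially. f n y = 1"
      proof (rule eventually_sequentiallyI[of N])
        fix n assume "N \<le> n"
        then have "real N * d \<le> real n * d" using \<open>d > 0\<close> by (intro mult_right_mono) auto
        then show "f n y = 1" using N by (simp add: f_def d_def[symmetric])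
      qed
      then show ?thesis using True by (simp add: tendsto_eventually)
    next
      case False
      then have "f n y = 0" for n by (auto simp: f_def)
      then show ?thesis using False by simp
    qed
    show ?thesis
    proof (rule borel_measurable_LIMSEQ_real)
      fix m assume "m \<in> space ?P"
      then have m: "m \<in> space (prob_algebra (sborel (U \<times> Y)))" using sp topspace_policy_topology(2)[OF Q] by auto
      then have sm: "sets m = sets (sborel (U \<times> Y))" and "prob_space m" by (auto simp: space_prob_algebra)
      interpret m: prob_space m by fact
      have spm: "space m = U \<times> Y" using sets_eq_imp_space_eq[OF sm] by (simp add: space_restrict_space)
      have fm: "f \<in> borel_measurable m" if "continuous_on (U \<times> Y) f" for f :: "'u \<times> 'a \<Rightarrow> real"
        using continuous_measurable_sborel[OF that] sm by (simp cong: measurable_cong_sets)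
      have hc: "continuous_on (U \<times> Y) (\<lambda>x. h (fst x))"
        by (rule continuous_on_compose2[OF h]) (auto intro!: continuous_intros)
      have c: "continuous_on (U \<times> Y) (\<lambda>x. f n (snd x) * h (fst x))" for n
        by (intro continuous_on_mult hc continuous_on_compose2[OF fc[of UNIV]] continuous_intros) auto
      show "(\<lambda>n. \<integral>x. f n (snd x) * h (fst x) \<partial>m) \<longlonglongrightarrow> test_integral m B h"
        unfolding test_integral_def
      proof (rule integral_dominated_convergence[where w="\<lambda>_. \<bar>C\<bar>"])
        show "AE x in m. norm (f n (snd x) * h (fst x)) \<le> \<bar>C\<bar>" for n
        proof (rule AE_I2)
          fix x assume "x \<in> space m"
          then have "\<bar>h (fst x)\<bar> \<le> \<bar>C\<bar>" using C spm by force
          moreover have "\<bar>f n (snd x) * h (fst x)\<bar> \<le> \<bar>h (fst x)\<bar>" using f01[of n "snd x"] by (simp add: abs_mult mult_left_le_one_le)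
          ultimately show "norm (f n (snd x) * h (fst x)) \<le> \<bar>C\<bar>" by simp
        qed
        show lim': "AE x in m. (\<lambda>n. f n (snd x) * h (fst x)) \<longlonglongrightarrow> indicator B (snd x) * h (fst x)"
        proof (rule AE_I2)
          fix x assume "x \<in> space m"
          then have "snd x \<in> B \<longleftrightarrow> snd x \<in> A" using spm A(2) by (simp add: mem_Times_iff)
          then have "indicator B (snd x) = (indicator A (snd x) :: real)" by (simp add: indicator_def)
          then show "(\<lambda>n. f n (snd x) * h (fst x)) \<longlonglongrightarrow> indicator B (snd x) * h (fst x)"
            using lim by (auto intro!: tendsto_intros)
        qed
        show "(\<lambda>x. f n (snd x) * h (fst x)) \<in> borel_measurable m" for n by (rule fm[OF c])
        have "snd \<in> m \<rightarrow>\<^sub>M sborel Y" using measurable_projections_sborel(2)[of U Y] sm by (simp cong: measurable_cong_sets)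
        moreover have "B \<in> sets (sborel Y)" using pi_generatorD(5)[OF E(1) that] .
        ultimately have "(\<lambda>x. indicator B (snd x) :: real) \<in> borel_measurable m"
          by (intro measurable_compose[OF _ borel_measurable_indicator])
        then show "(\<lambda>x. indicator B (snd x) * h (fst x)) \<in> borel_measurable m" using fm[OF hc] by simp
      qed simp
    next
      fix n
      have "bounded ((\<lambda>x. f n (snd x) * h (fst x)) ` (U \<times> Y))"
        unfolding bounded_iff
      proof (intro exI[of _ "\<bar>C\<bar>"] ballI)
        fix r assume "r \<in> (\<lambda>x. f n (snd x) * h (fst x)) ` (U \<times> Y)"
        then obtain u y where r: "r = f n y * h u" "u \<in> U" by auto
        have "\<bar>h u\<bar> \<le> \<bar>C\<bar>" using C[OF r(2)] by simp
        moreover have "\<bar>f n y * h u\<bar> \<le> \<bar>h u\<bar>" using f01[of n y] by (simp add: abs_mult mult_left_le_one_le)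
        ultimately show "norm r \<le> \<bar>C\<bar>" using r by simp
      qed
      moreover have "continuous_on (U \<times> Y) (\<lambda>x. h (fst x))"
        by (rule continuous_on_compose2[OF h]) (auto intro!: continuous_intros)
      then have "continuous_on (U \<times> Y) (\<lambda>x. f n (snd x) * h (fst x))"
        by (intro continuous_on_mult continuous_on_compose2[OF fc[of UNIV]] continuous_intros) auto
      ultimately show "(\<lambda>m. \<integral>x. f n (snd x) * h (fst x) \<partial>m) \<in> borel_measurable ?P"
        by (intro measurable_integral_policy Q)
    qed
  qed
  \<comment> \<open>Written through kernels, the test is an integral over the observation, the form
    that \<open>integral_indicator_sigma\<close> handles.\<close>
  have "(\<lambda>m. \<integral>y. indicator B y * (\<integral>u. h u \<partial>kernel_of Y U Q m y) \<partial>Q) \<in> borel_measurable ?P"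
  proof (rule integral_indicator_sigma[OF Q.finite_measure_axioms _ _ pi_generatorD(1-4)[OF EQ]])
    show "(\<lambda>y. \<integral>u. h u \<partial>kernel_of Y U Q m y) \<in> borel_measurable Q" if "m \<in> space ?P" for m
      using that sp by (intro kernel_integral_measurable[OF kernel_of(1) sQ continuous_measurable_sborel[OF h]]) auto
    show "\<bar>\<integral>u. h u \<partial>kernel_of Y U Q m y\<bar> \<le> C" if "m \<in> space ?P" "y \<in> space Q" for m y
      using that sp spQ C by (intro kernel_integral_bound[OF kernel_of(1) sQ]) auto
    show "(\<lambda>m. \<integral>y. indicator B y * (\<integral>u. h u \<partial>kernel_of Y U Q m y) \<partial>Q) \<in> borel_measurable ?P" if "B \<in> E" for B
      by (rule cong[OF base[OF that]])
        (use test_integral_kernel_of[OF Q _ U pi_generatorD(5)[OF E(1) that] h] sp in auto)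
    show "B \<in> sets Q" using B sQ by simp
  qed
  then show ?thesis
    by (rule cong) (use test_integral_kernel_of[OF Q _ U B h] sp in auto)
qed

text \<open>Each open set is the preimage of an open set of real sequences, namely of the complement
  of the closure of the image of its complement: a point of the open set mapped into that closure
  would be a limit of points outside. Hence the coordinates \<open>e j\<close> generate the Borel
  sets.\<close>

lemma measurable_into_borel_of:
  fixes e :: "nat \<Rightarrow> 'x \<Rightarrow> real"
  assumes lim: "\<And>s l. range s \<subseteq> topspace X \<Longrightarrow> l \<in> topspace X \<Longrightarrow> (\<And>j. (\<lambda>n. e j (s n)) \<longlonglongrightarrow> e j l) \<Longrightarrow> limitin X s l sequentially"
    and f: "f \<in> space M \<rightarrow> topspace X" and m: "\<And>j. (\<lambda>x. e j (f x)) \<in> borel_measurable M"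
  shows "f \<in> M \<rightarrow>\<^sub>M borel_of X"
  unfolding borel_of_def
proof (rule measurable_measure_of)
  show "{V. openin X V} \<subseteq> Pow (topspace X)" using openin_subset by auto
  show "f \<in> space M \<rightarrow> topspace X" by (rule f)
  fix V assume "V \<in> {V. openin X V}"
  then have V: "openin X V" by simp
  define e' where "e' x j = e j x" for x j
  define W where "W = - closure (e' ` (topspace X - V))"
  have "x \<in> V \<longleftrightarrow> e' x \<in> W" if x: "x \<in> topspace X" for x
  proof
    assume xV: "x \<in> V"
    show "e' x \<in> W"
    proof (rule ccontr)
      assume "e' x \<notin> W"
      then have "e' x \<in> closure (e' ` (topspace X - V))" by (simp add: W_def)
      then obtain z where z: "\<And>n. z n \<in> e' ` (topspace X - V)" "z \<longlonglongrightarrow> e' x" unfolding closure_sequential by blast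
      then have "\<forall>n. \<exists>s. s \<in> topspace X - V \<and> z n = e' s" by blast
      then obtain s where s: "\<And>n. s n \<in> topspace X - V" "\<And>n. z n = e' (s n)" by metis
      have "limitin X s x sequentially"
      proof (rule lim)
        show "range s \<subseteq> topspace X" using s(1) by auto
        fix j
        have "(\<lambda>n. (z n) j) \<longlonglongrightarrow> (e' x) j"
          using continuous_on_tendsto_compose[OF continuous_on_product_coordinates[of j] z(2)] by simp
        then show "(\<lambda>n. e j (s n)) \<longlonglongrightarrow> e j x" by (simp add: s(2) e'_def)
      qed (rule x)
      then obtain n where "s n \<in> V" using V xV by (auto simp: limitin_sequentially)
      then show False using s(1)[of n] by simp
    qed
  next
    assume "e' x \<in> W"
    then have "e' x \<notin> closure (e' ` (topspace X - V))" by (simp add: W_def)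
    then have "e' x \<notin> e' ` (topspace X - V)" by (rule contra_subsetD[OF closure_subset])
    then show "x \<in> V" using x by blast
  qed
  then have "f -` V \<inter> space M = (\<lambda>x. e' (f x)) -` W \<inter> space M" using f by auto
  moreover have "(\<lambda>x. e' (f x)) \<in> borel_measurable M"
    by (rule measurable_coordinatewise_then_product) (use m in \<open>simp add: e'_def\<close>)
  then have "(\<lambda>x. e' (f x)) -` W \<inter> space M \<in> sets M"
    by (rule measurable_sets) (auto simp: W_def intro!: borel_open)
  ultimately show "f -` V \<inter> space M \<in> sets M" by simp
qed

lemma limitin_topology_generated_by:
  assumes l: "l \<in> topspace (topology_generated_by S)"
    and S: "\<And>V. V \<in> S \<Longrightarrow> l \<in> V \<Longrightarrow> eventually (\<lambda>n. s n \<in> V) F"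
  shows "limitin (topology_generated_by S) s l F"
  unfolding limitin_def
proof (intro conjI allI impI l)
  fix V assume "openin (topology_generated_by S) V \<and> l \<in> V"
  then have V: "generate_topology_on S V" "l \<in> V" by (auto simp: openin_topology_generated_by_iff)
  then show "eventually (\<lambda>n. s n \<in> V) F"
  proof (induction V rule: generate_topology_on.induct)
    case (Int a b)
    then show ?case by (auto intro: eventually_conj)
  next
    case (UN K)
    then obtain k where "k \<in> K" "l \<in> k" by auto
    then have "eventually (\<lambda>n. s n \<in> k) F" using UN by blast
    then show ?case by eventually_elim (use \<open>k \<in> K\<close> in auto)
  qed (use S in auto)
qed

text \<open>For the sequence with its limit at index 0, \<open>caratheodory_closed\<close> passes
  from the tests to all bounded continuous functions of action and observation, which define the
  weak topology.\<close>

lemma limitin_policy_topology: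
  fixes U :: "'u::{metric_space,second_countable_topology} set" and Y :: "'a::second_countable_topology set"
  assumes Q: "is_ref_measure Y Q" and U: "compact U" "U \<noteq> {}" and fam: "test_family Y U BB hh"
    and s: "range s \<subseteq> policies Y U Q" and l: "l \<in> policies Y U Q"
    and conv: "\<And>j. (\<lambda>n. test_integral (s n) (BB j) (hh j)) \<longlonglongrightarrow> test_integral l (BB j) (hh j)"
  shows "limitin (policy_topology Y U Q) s l sequentially"
proof -
  interpret uniform_algebra "UNIV :: nat set" "{f. (\<lambda>n. f (Suc n)) \<longlonglongrightarrow> f 0}" by (rule uniform_algebra_LIMSEQ)
  have sQ: "sets Q = sets (sborel Y)" and pQ: "prob_space Q" using Q by (auto simp: is_ref_measure_def)
  interpret Q: prob_space Q by fact
  define m where "m i = (case i of 0 \<Rightarrow> l | Suc n \<Rightarrow> s n)" for i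
  have m: "m i \<in> policies Y U Q" for i using s l by (auto simp: m_def split: nat.split)
  define g where "g i = kernel_of Y U Q (m i)" for i
  have g: "g i \<in> kernels Y U" "policy_measure Y U Q (g i) = m i" for i using kernel_of[OF m] by (auto simp: g_def)
  have BB: "BB j \<in> sets (sborel Y)" "continuous_on U (hh j)" for j using fam by (auto simp: test_family_def)
  have base: "(\<lambda>i. \<integral>y. indicator (BB j) y * (\<integral>u. hh j u \<partial>g i y) \<partial>Q) \<in> {f. (\<lambda>n. f (Suc n)) \<longlonglongrightarrow> f 0}" for j
    unfolding g_def test_integral_kernel_of[OF Q m U(1) BB] using conv by (simp add: m_def)
  have f: "(\<lambda>n. \<integral>x. f x \<partial>s n) \<longlonglongrightarrow> (\<integral>x. f x \<partial>l)"
    if f: "continuous_on (U \<times> Y) f" "bounded (f ` (U \<times> Y))" for f :: "'u \<times> 'a \<Rightarrow> real"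
  proof -
    obtain C where C: "\<And>x. x \<in> U \<times> Y \<Longrightarrow> \<bar>f x\<bar> \<le> C" using f(2) by (auto simp: bounded_iff)
    note fm = continuous_measurable_sborel[OF f(1)]
    have eq: "(\<integral>x. f x \<partial>m i) = (\<integral>y. 1 * (\<integral>u. f (u, y) \<partial>g i y) \<partial>Q)" for i
      using integral_policy_measure[OF Q g(1)[of i] fm C] g(2)[of i] by simp
    have "(\<lambda>i. \<integral>y. 1 * (\<integral>u. f (u, y) \<partial>g i y) \<partial>Q) \<in> {f. (\<lambda>n. f (Suc n)) \<longlonglongrightarrow> f 0}"
    proof (rule caratheodory_closed[OF Q U fam g(1) base])
      have "(\<lambda>x. x) \<in> sborel Y \<rightarrow>\<^sub>M borel" by (rule measurable_restrict_space1) simp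
      then have idQ: "(\<lambda>x. x) \<in> Q \<rightarrow>\<^sub>M borel" using sQ by (simp cong: measurable_cong_sets)
      have idU: "(\<lambda>x. x) \<in> sborel U \<rightarrow>\<^sub>M borel" by (rule measurable_restrict_space1) simp
      have spQ: "space Q = Y" using sets_eq_imp_space_eq[OF sQ] by (simp add: space_restrict_space)
      have "(\<lambda>x. (snd x, fst x)) \<in> Q \<Otimes>\<^sub>M sborel U \<rightarrow>\<^sub>M sborel (U \<times> Y)"
        by (intro measurable_restrict_space2 borel_measurable_Pair measurable_compose[OF measurable_snd idU] measurable_compose[OF measurable_fst idQ])
          (auto simp: space_pair_measure spQ space_restrict_space)
      then have "(\<lambda>x. f (snd x, fst x)) \<in> borel_measurable (Q \<Otimes>\<^sub>M sborel U)" by (rule measurable_compose[OF _ fm])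
      then show "(\<lambda>(y, u). f (u, y)) \<in> borel_measurable (Q \<Otimes>\<^sub>M sborel U)" by (simp add: split_beta')
      show "continuous_on U (\<lambda>u. f (u, y))" if "y \<in> Y" for y
        using that by (intro continuous_on_compose2[OF f(1)] continuous_intros) auto
    qed (use C in auto)
    then show ?thesis unfolding eq[symmetric] by (simp add: m_def)
  qed
  have lW: "l \<in> topspace (weak_topology (U \<times> Y))"
    using l topspace_policy_topology(1)[OF Q, of U] by (auto simp: policy_topology_def topspace_subtopology)
  have "limitin (weak_topology (U \<times> Y)) s l sequentially"
    unfolding weak_topology_def
  proof (rule limitin_topology_generated_by)
    show "l \<in> topspace (topology_generated_by {{m \<in> space (prob_algebra (sborel (U \<times> Y))). (\<integral>z. g z \<partial>m) \<in> V} | (g :: _ \<Rightarrow> real) V.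
        continuous_on (U \<times> Y) g \<and> bounded (g ` (U \<times> Y)) \<and> open V})"
      using lW unfolding weak_topology_def .
    fix W assume "W \<in> {{m \<in> space (prob_algebra (sborel (U \<times> Y))). (\<integral>z. g z \<partial>m) \<in> V} | (g :: _ \<Rightarrow> real) V.
        continuous_on (U \<times> Y) g \<and> bounded (g ` (U \<times> Y)) \<and> open V}" "l \<in> W"
    then obtain f :: "'u \<times> 'a \<Rightarrow> real" and V where W: "W = {m \<in> space (prob_algebra (sborel (U \<times> Y))). (\<integral>z. f z \<partial>m) \<in> V}"
      "continuous_on (U \<times> Y) f" "bounded (f ` (U \<times> Y))" "open V" "(\<integral>x. f x \<partial>l) \<in> V" by auto
    have "\<forall>\<^sub>F n in sequentially. (\<integral>x. f x \<partial>s n) \<in> V"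
      by (rule topological_tendstoD[OF f[OF W(2,3)] W(4,5)])
    then show "\<forall>\<^sub>F n in sequentially. s n \<in> W"
      by eventually_elim (use W(1) s topspace_policy_topology(2)[OF Q, of U] in auto)
  qed
  then show ?thesis
    using s l by (auto simp: policy_topology_def limitin_subtopology intro!: always_eventually)
qed

lemma measurable_into_policy_topology:
  fixes U :: "'u::{metric_space,second_countable_topology} set" and Y :: "'a::second_countable_topology set"
  assumes Q: "is_ref_measure Y Q" and U: "compact U" "U \<noteq> {}" and fam: "test_family Y U BB hh"
    and f: "f \<in> space M \<rightarrow> policies Y U Q" and m: "\<And>j. (\<lambda>x. test_integral (f x) (BB j) (hh j)) \<in> borel_measurable M"
  shows "f \<in> M \<rightarrow>\<^sub>M borel_of (policy_topology Y U Q)"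
  using f m limitin_policy_topology[OF Q U fam]
  by (intro measurable_into_borel_of[where e="\<lambda>j m. test_integral m (BB j) (hh j)"])
    (auto simp: topspace_policy_topology[OF Q])

lemma space_team_policy_algebra:
  fixes U :: "'u::second_countable_topology set" and Y :: "'a::second_countable_topology set"
  assumes Q: "\<And>k. k < N \<Longrightarrow> is_ref_measure Y (Q k)"
  shows "space (team_policy_algebra Y U N Q) = PiE {..<N} (\<lambda>k. policies Y U (Q k))"
  unfolding team_policy_algebra_def space_borel_of topspace_product_topology
  using topspace_policy_topology(1)[OF Q] by (intro PiE_cong) auto

text \<open>Convergence in the product topology is coordinatewise, so the tests of all members,
  numbered by \<open>prod_encode\<close>, are coordinates in the sense of
  \<open>measurable_into_borel_of\<close>. This reaches the Borel sets of the product topology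
  directly.\<close>

lemma measurable_into_team:
  fixes U :: "'u::{metric_space,second_countable_topology} set" and Y :: "'a::second_countable_topology set"
  assumes Q: "\<And>k. k < N \<Longrightarrow> is_ref_measure Y (Q k)" and U: "compact U" "U \<noteq> {}" and fam: "test_family Y U BB hh"
    and f: "\<And>x. x \<in> space M \<Longrightarrow> f x \<in> PiE {..<N} (\<lambda>k. policies Y U (Q k))"
    and m: "\<And>k j. k < N \<Longrightarrow> (\<lambda>x. test_integral (f x k) (BB j) (hh j)) \<in> borel_measurable M"
  shows "f \<in> M \<rightarrow>\<^sub>M team_policy_algebra Y U N Q"
proof -
  let ?X = "product_topology (\<lambda>k. policy_topology Y U (Q k)) {..<N}"
  have tX: "topspace ?X = PiE {..<N} (\<lambda>k. policies Y U (Q k))"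
    unfolding topspace_product_topology using topspace_policy_topology(1)[OF Q] by (intro PiE_cong) auto
  define e where "e j x = (case prod_decode j of (k, i) \<Rightarrow> if k < N then test_integral (x k) (BB i) (hh i) else 0)" for j and x :: "nat \<Rightarrow> ('u \<times> 'a) measure"
  show ?thesis
    unfolding team_policy_algebra_def
  proof (rule measurable_into_borel_of[where e=e])
    fix s l assume s: "range s \<subseteq> topspace ?X" and l: "l \<in> topspace ?X" and conv: "\<And>j. (\<lambda>n. e j (s n)) \<longlonglongrightarrow> e j l"
    show "limitin ?X s l sequentially"
      unfolding limitin_componentwise
    proof (intro conjI ballI)
      show "l \<in> extensional {..<N}" using l by (auto simp: tX PiE_iff)
      show "\<forall>\<^sub>F a in sequentially. s a \<in> topspace ?X" using s by (auto intro!: always_eventually)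
      fix k assume k: "k \<in> {..<N}"
      show "limitin (policy_topology Y U (Q k)) (\<lambda>c. s c k) (l k) sequentially"
      proof (rule limitin_policy_topology[OF Q U fam])
        show "k < N" using k by simp
        have "s n \<in> PiE {..<N} (\<lambda>k. policies Y U (Q k))" for n using s[unfolded tX] by auto
        then show "range (\<lambda>c. s c k) \<subseteq> policies Y U (Q k)" using k by (auto simp: PiE_iff)
        show "l k \<in> policies Y U (Q k)" using l[unfolded tX] k by (auto simp: PiE_iff)
        show "(\<lambda>n. test_integral (s n k) (BB j) (hh j)) \<longlonglongrightarrow> test_integral (l k) (BB j) (hh j)" for j
          using conv[of "prod_encode (k, j)"] k by (simp add: e_def)
      qed
    qed
  next
    show "f \<in> space M \<rightarrow> topspace ?X" unfolding tX using f by blast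
    show "(\<lambda>x. e j (f x)) \<in> borel_measurable M" for j
    proof (cases "prod_decode j")
      case (Pair k i)
      then show ?thesis using m[of k i] by (cases "k < N") (simp_all add: e_def)
    qed
  qed
qed

lemma measurable_team_component:
  fixes U :: "'u::second_countable_topology set" and Y :: "'a::second_countable_topology set"
  assumes "k < N"
  shows "(\<lambda>m. m k) \<in> team_policy_algebra Y U N Q \<rightarrow>\<^sub>M borel_of (policy_topology Y U (Q k))"
proof -
  let ?X = "product_topology (\<lambda>k. policy_topology Y U (Q k)) {..<N}"
  have c: "continuous_map ?X (policy_topology Y U (Q k)) (\<lambda>m. m k)"
    using assms by (intro continuous_map_product_projection) simp
  show ?thesis
    unfolding team_policy_algebra_def borel_of_def[of "policy_topology Y U (Q k)"]
  proof (rule measurable_measure_of)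
    show "(\<lambda>m. m k) \<in> space (borel_of ?X) \<rightarrow> topspace (policy_topology Y U (Q k))"
      using continuous_map_image_subset_topspace[OF c] by (auto simp: space_borel_of)
    fix V assume "V \<in> {V. openin (policy_topology Y U (Q k)) V}"
    then have "openin ?X {m \<in> topspace ?X. m k \<in> V}" using c by (auto simp: continuous_map)
    moreover have "(\<lambda>m. m k) -` V \<inter> space (borel_of ?X) = {m \<in> topspace ?X. m k \<in> V}" by (auto simp: space_borel_of)
    ultimately show "(\<lambda>m. m k) -` V \<inter> space (borel_of ?X) \<in> sets (borel_of ?X)" by (simp add: sets_borel_of sigma_sets.Basic)
  qed (use openin_subset in auto)
qed

lemma space_kernel_algebra: "space (kernel_algebra Y U N Q) = kernels Y U"
  unfolding kernel_algebra_def by (rule space_measure_of) auto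

text \<open>The events of \<open>kernel_algebra\<close> come from the policy spaces of all members,
  so a kernel is tested against every reference measure.\<close>

lemma measurable_into_kernel_algebra:
  fixes U :: "'u::{metric_space,second_countable_topology} set" and Y :: "'a::second_countable_topology set"
  assumes Q: "\<And>k. k < N \<Longrightarrow> is_ref_measure Y (Q k)" and U: "compact U" "U \<noteq> {}" and fam: "test_family Y U BB hh"
    and f: "f \<in> space M \<rightarrow> kernels Y U"
    and m: "\<And>k j. k < N \<Longrightarrow> (\<lambda>x. test_integral (policy_measure Y U (Q k) (f x)) (BB j) (hh j)) \<in> borel_measurable M"
  shows "f \<in> M \<rightarrow>\<^sub>M kernel_algebra Y U N Q"
  unfolding kernel_algebra_def
proof (rule measurable_measure_of)
  fix W assume "W \<in> {{\<gamma> \<in> kernels Y U. policy_measure Y U (Q k) \<gamma> \<in> A} | k A.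
        k < N \<and> A \<in> sets (borel_of (policy_topology Y U (Q k)))}"
  then obtain k A where W: "W = {\<gamma> \<in> kernels Y U. policy_measure Y U (Q k) \<gamma> \<in> A}" "k < N" "A \<in> sets (borel_of (policy_topology Y U (Q k)))"
    by blast
  have "(\<lambda>x. policy_measure Y U (Q k) (f x)) \<in> M \<rightarrow>\<^sub>M borel_of (policy_topology Y U (Q k))"
    using f by (intro measurable_into_policy_topology[OF Q[OF W(2)] U fam _ m[OF W(2)]]) (auto simp: policies_def)
  from measurable_sets[OF this W(3)]
  have "(\<lambda>x. policy_measure Y U (Q k) (f x)) -` A \<inter> space M \<in> sets M" .
  moreover have "f -` W \<inter> space M = (\<lambda>x. policy_measure Y U (Q k) (f x)) -` A \<inter> space M" using f by (auto simp: W(1))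
  ultimately show "f -` W \<inter> space M \<in> sets M" by simp
qed (use f in auto)

lemma measurable_policy_measure_kernel_algebra:
  fixes U :: "'u::second_countable_topology set" and Y :: "'a::second_countable_topology set"
  assumes Q: "is_ref_measure Y (Q k)" and k: "k < N"
  shows "policy_measure Y U (Q k) \<in> kernel_algebra Y U N Q \<rightarrow>\<^sub>M borel_of (policy_topology Y U (Q k))"
proof (rule measurableI)
  fix g assume "g \<in> space (kernel_algebra Y U N Q)"
  then show "policy_measure Y U (Q k) g \<in> space (borel_of (policy_topology Y U (Q k)))"
    by (auto simp: space_kernel_algebra space_borel_of topspace_policy_topology[OF Q] policies_def)
next
  fix A assume A: "A \<in> sets (borel_of (policy_topology Y U (Q k)))"
  have "{\<gamma> \<in> kernels Y U. policy_measure Y U (Q k) \<gamma> \<in> A} \<in> sets (kernel_algebra Y U N Q)"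
    unfolding kernel_algebra_def using A k by (subst sets_measure_of) (auto intro!: sigma_sets.Basic)
  then show "policy_measure Y U (Q k) -` A \<inter> space (kernel_algebra Y U N Q) \<in> sets (kernel_algebra Y U N Q)"
    by (simp add: space_kernel_algebra vimage_def Int_def conj_commute)
qed

lemma measurable_kernels_to_team:
  fixes U :: "'u::{metric_space,second_countable_topology} set" and Y :: "'a::{metric_space,second_countable_topology} set"
  assumes Y: "Y \<in> sets borel" and Q: "\<And>k. k < N \<Longrightarrow> is_ref_measure Y (Q k)" and U: "compact U" "U \<noteq> {}"
  shows "(\<lambda>\<gamma>. \<lambda>k\<in>{..<N}. policy_measure Y U (Q k) (\<gamma> k)) \<in> PiM {..<N} (\<lambda>_. kernel_algebra Y U N Q) \<rightarrow>\<^sub>M team_policy_algebra Y U N Q"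
proof -
  obtain BB hh where fam: "test_family Y U BB hh" using test_family_exists[OF Y U(1)] by blast
  then have BB: "BB j \<in> sets (sborel Y)" "continuous_on U (hh j)" for j by (auto simp: test_family_def)
  show ?thesis
  proof (rule measurable_into_team[OF Q U fam])
    fix \<gamma> assume "\<gamma> \<in> space (PiM {..<N} (\<lambda>_. kernel_algebra Y U N Q))"
    then show "(\<lambda>k\<in>{..<N}. policy_measure Y U (Q k) (\<gamma> k)) \<in> PiE {..<N} (\<lambda>k. policies Y U (Q k))"
      by (auto simp: space_PiM space_kernel_algebra policies_def PiE_iff)
  next
    fix k j assume k: "k < N"
    have "(\<lambda>\<gamma>. policy_measure Y U (Q k) (\<gamma> k)) \<in> PiM {..<N} (\<lambda>_. kernel_algebra Y U N Q) \<rightarrow>\<^sub>M borel_of (policy_topology Y U (Q k))"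
      by (rule measurable_compose[OF measurable_component_singleton[of k "{..<N}" "\<lambda>_. kernel_algebra Y U N Q"]
        measurable_policy_measure_kernel_algebra[where Q=Q and k=k, OF Q[OF k] k]]) (simp add: k)
    from measurable_compose[OF this measurable_test_integral[OF Y Q[OF k] U(1) BB]]
    show "(\<lambda>\<gamma>. test_integral ((\<lambda>k\<in>{..<N}. policy_measure Y U (Q k) (\<gamma> k)) k) (BB j) (hh j)) \<in> borel_measurable (PiM {..<N} (\<lambda>_. kernel_algebra Y U N Q))"
      using k by simp
  qed
qed

section \<open>A real parameter for the kernels of a team\<close>

lemma tendsto_product_coordinates:
  fixes f :: "nat \<Rightarrow> 'i \<Rightarrow> 'a::topological_space"
  assumes "\<And>i. (\<lambda>n. f n i) \<longlonglongrightarrow> l i"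
  shows "f \<longlonglongrightarrow> l"
proof -
  have "limitin (product_topology (\<lambda>_. euclidean) UNIV) f l sequentially"
    unfolding limitin_componentwise using assms by (simp add: limitin_canonical_iff)
  then show ?thesis by (simp add: euclidean_product_topology limitin_canonical_iff)
qed

text \<open>The average of the \<open>Q k\<close>, written as a mixture over a uniformly chosen
  member, has only null sets common to all of them; Radon-Nikodym supplies the densities.\<close>

lemma dominating_ref_measure:
  fixes Q :: "nat \<Rightarrow> 'a::topological_space measure"
  assumes N: "N > 0" and Q: "\<And>k. k < N \<Longrightarrow> is_ref_measure Y (Q k)"
  shows "\<exists>Q0. is_ref_measure Y Q0 \<and> (\<forall>k<N. \<exists>D. integrable Q0 D \<and> (\<forall>x. 0 \<le> D x) \<and> Q k = density Q0 (\<lambda>x. ennreal (D x)))"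
proof -
  have sQ: "sets (Q k) = sets (sborel Y)" "prob_space (Q k)" if "k < N" for k using Q[OF that] by (auto simp: is_ref_measure_def)
  let ?M = "uniform_count_measure {..<N}"
  have pM: "prob_space ?M" using N by (intro prob_space_uniform_count_measure) auto
  have K: "Q \<in> ?M \<rightarrow>\<^sub>M prob_algebra (sborel Y)"
    using sQ by (auto simp: space_prob_algebra space_uniform_count_measure sets_uniform_count_measure intro!: measurableI)
  define Q0 where "Q0 = ?M \<bind> Q"
  have "?M \<in> space (prob_algebra ?M)" using pM by (simp add: space_prob_algebra)
  then have "Q0 \<in> space (prob_algebra (sborel Y))"
    unfolding Q0_def using measurable_space[OF measurable_bind_prob_space[OF measurable_ident K]] by simp
  then have Q0: "is_ref_measure Y Q0" by (auto simp: space_prob_algebra is_ref_measure_def)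
  then have sQ0: "sets Q0 = sets (sborel Y)" and "prob_space Q0" by (auto simp: is_ref_measure_def)
  interpret Q0: prob_space Q0 by fact
  have "\<exists>D. integrable Q0 D \<and> (\<forall>x. 0 \<le> D x) \<and> Q k = density Q0 (\<lambda>x. ennreal (D x))" if k: "k < N" for k
  proof -
    interpret Qk: prob_space "Q k" by (rule sQ[OF k])
    have s: "sets (Q k) = sets Q0" using sQ(1)[OF k] sQ0 by simp
    have ac: "absolutely_continuous Q0 (Q k)"
      unfolding absolutely_continuous_def
    proof
      fix A assume "A \<in> null_sets Q0"
      then have A: "A \<in> sets Q0" "emeasure Q0 A = 0" by auto
      have Am: "(\<lambda>k. emeasure (Q k) A) \<in> borel_measurable ?M"
        by (rule measurable_emeasure_kernel[OF measurable_prob_algebraD[OF K]]) (use A sQ0 in simp)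
      have "emeasure Q0 A = (\<integral>\<^sup>+k. emeasure (Q k) A \<partial>?M)"
        unfolding Q0_def using A sQ0 N by (intro emeasure_bind[OF _ measurable_prob_algebraD[OF K]]) (auto simp: space_uniform_count_measure)
      then have "AE k in ?M. emeasure (Q k) A = 0" using A(2) nn_integral_0_iff_AE[OF Am] by simp
      then have "emeasure (Q k) A = 0" using k unfolding uniform_count_measure_def AE_point_measure by (auto simp: divide_pos_pos)
      then show "A \<in> null_sets (Q k)" using A(1) s by auto
    qed
    obtain D where D: "D \<in> borel_measurable Q0" "AE x in Q0. RN_deriv Q0 (Q k) x = ennreal (D x)" "\<And>x. 0 \<le> D x"
      using Q0.real_RN_deriv[OF Qk.finite_measure_axioms ac s] by metis
    have "density Q0 (\<lambda>x. ennreal (D x)) = density Q0 (RN_deriv Q0 (Q k))"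
      using D by (intro density_cong) auto
    also have "\<dots> = Q k" by (rule Q0.density_RN_deriv[OF ac s])
    finally have eq: "density Q0 (\<lambda>x. ennreal (D x)) = Q k" .
    have "(\<integral>\<^sup>+x. ennreal (D x) \<partial>Q0) = emeasure (density Q0 (\<lambda>x. ennreal (D x))) (space Q0)"
      using D(1) by (simp add: emeasure_density cong: nn_integral_cong)
    also have "\<dots> = 1" using Qk.emeasure_space_1 sets_eq_imp_space_eq[OF s] by (simp add: eq)
    finally have "integrable Q0 D" using D by (intro integrableI_nonneg) auto
    then show ?thesis using D eq by auto
  qed
  then show ?thesis using Q0 by blast
qed

lemma integral_density_test:
  fixes Y :: "'a::topological_space set"
  assumes D: "integrable Q0 D" "\<And>x. 0 \<le> D x" and Q: "Q = density Q0 (\<lambda>x. ennreal (D x))"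
    and Q0: "is_ref_measure Y Q0" and g: "g \<in> kernels Y U" and B: "B \<in> sets (sborel Y)" and h: "h \<in> borel_measurable (sborel U)"
  shows "(\<integral>y. indicator B y * (\<integral>u. h u \<partial>g y) \<partial>Q) = (\<integral>y. (D y * indicator B y) * (\<integral>u. h u \<partial>g y) \<partial>Q0 :: real)"
proof -
  have sQ0: "sets Q0 = sets (sborel Y)" using Q0 by (auto simp: is_ref_measure_def)
  have "(\<lambda>y. indicator B y * (\<integral>u. h u \<partial>g y)) \<in> borel_measurable Q0"
    using B sQ0 by (intro borel_measurable_times kernel_integral_measurable[OF g sQ0 h] borel_measurable_indicator) simp
  then show ?thesis unfolding Q using D by (subst integral_density) (auto simp: mult.assoc)
qed

text \<open>A test under \<open>Q\<close> is a test under the dominating measure with the density as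
  part of the weight, and \<open>test_closed\<close> admits integrable weights.\<close>

lemma (in uniform_algebra) test_closed_density:
  fixes U :: "'u::{metric_space,second_countable_topology} set" and Y :: "'a::topological_space set"
  assumes Q0: "is_ref_measure Y Q0" and U: "compact U" "U \<noteq> {}" and fam: "test_family Y U BB hh"
    and D: "\<exists>D. integrable Q0 D \<and> (\<forall>x. 0 \<le> D x) \<and> Q = density Q0 (\<lambda>x. ennreal (D x))"
    and g: "\<And>t. t \<in> T \<Longrightarrow> g t \<in> kernels Y U"
    and base: "\<And>j. (\<lambda>t. \<integral>y. indicator (BB j) y * (\<integral>u. hh j u \<partial>g t y) \<partial>Q0) \<in> F"
    and B: "B \<in> sets (sborel Y)" and h: "continuous_on U h"
  shows "(\<lambda>t. \<integral>y. indicator B y * (\<integral>u. h u \<partial>g t y) \<partial>Q) \<in> F"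
proof -
  obtain D where D: "integrable Q0 D" "\<And>x. 0 \<le> D x" "Q = density Q0 (\<lambda>x. ennreal (D x))" using D by blast
  have "B \<in> sets Q0" using B Q0 by (simp add: is_ref_measure_def)
  then have "integrable Q0 (\<lambda>y. D y * indicator B y)" using D(1) by (intro integrable_real_mult_indicator)
  then have "(\<lambda>t. \<integral>y. (D y * indicator B y) * (\<integral>u. h u \<partial>g t y) \<partial>Q0) \<in> F"
    using test_closed[OF Q0 U fam g base _ h, of "\<lambda>y. D y * indicator B y"] by simp
  then show ?thesis
    by (rule cong) (simp add: integral_density_test[OF D Q0 g B continuous_measurable_sborel[OF h]])
qed

lemma constant_kernel:
  assumes "u0 \<in> U"
  shows "(\<lambda>_. return (sborel U) u0) \<in> kernels Y U"
  unfolding kernels_def using assms by (auto simp: space_prob_algebra space_restrict_space intro!: prob_space_return)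

text \<open>The tests run over all \<open>Q l\<close>, not only \<open>Q k\<close>, because the kernels of two decision makers will
  be exchanged, while a kernel is determined by its policy only up to a null set of its own \<open>Q k\<close>.\<close>

definition team_parameters ::
  "'a::topological_space set \<Rightarrow> 'u::topological_space set \<Rightarrow> nat \<Rightarrow> (nat \<Rightarrow> 'a measure) \<Rightarrow> real set \<Rightarrow> (real \<Rightarrow> nat \<Rightarrow> 'a \<Rightarrow> 'u measure) \<Rightarrow> bool" where
  "team_parameters Y U N Q S \<Gamma> \<longleftrightarrow> compact S \<and> S \<noteq> {} \<and> (\<forall>\<theta>\<in>S. \<forall>k<N. \<Gamma> \<theta> k \<in> kernels Y U) \<and>
    (\<forall>k<N. \<forall>l<N. \<forall>B\<in>sets (sborel Y). \<forall>h. continuous_on U h \<longrightarrow>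
       continuous_on S (\<lambda>\<theta>. \<integral>y. indicator B y * (\<integral>u. h u \<partial>\<Gamma> \<theta> k y) \<partial>Q l :: real)) \<and>
    (\<forall>\<gamma>. (\<forall>k<N. \<gamma> k \<in> kernels Y U) \<longrightarrow> (\<exists>\<theta>\<in>S. \<forall>k<N. \<forall>l<N. \<forall>B\<in>sets (sborel Y). \<forall>h. continuous_on U h \<longrightarrow>
       (\<integral>y. indicator B y * (\<integral>u. h u \<partial>\<Gamma> \<theta> k y) \<partial>Q l) = (\<integral>y. indicator B y * (\<integral>u. h u \<partial>\<gamma> k y) \<partial>Q l :: real)))"

text \<open>By \<open>young_compactness\<close> the vectors of tests under the dominating measure
  form a compact set, an image of a set of reals \<open>T\<close>; profiles of \<open>N\<close>
  elements of \<open>T\<close> are again an image of a set of reals. The tests under the dominating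
  measure determine those under each \<open>Q l\<close> and control them continuously.\<close>

theorem team_parametrization:
  fixes Y :: "'a::{metric_space,second_countable_topology} set" and U :: "'u::{metric_space,second_countable_topology} set"
    and Q :: "nat \<Rightarrow> 'a measure"
  assumes N: "N > 0" and Y: "Y \<in> sets borel" and Q: "\<And>k. k < N \<Longrightarrow> is_ref_measure Y (Q k)" and U: "compact U" "U \<noteq> {}"
  shows "\<exists>S \<Gamma>. team_parameters Y U N Q S \<Gamma>"
proof -
  obtain Q0 where Q0: "is_ref_measure Y Q0" and
    Dex: "\<forall>k<N. \<exists>D. integrable Q0 D \<and> (\<forall>x. 0 \<le> D x) \<and> Q k = density Q0 (\<lambda>x. ennreal (D x))"
    using dominating_ref_measure[of N Y Q, OF N Q] by blast
  then have sQ0: "sets Q0 = sets (sborel Y)" and pQ0: "prob_space Q0" by (auto simp: is_ref_measure_def)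
  obtain E where E: "countable E" "pi_generator (sborel Y) E" using countable_pi_generator_sborel[OF Y] by blast
  have EQ: "pi_generator Q0 E" using pi_generator_cong[OF E(2) sQ0[symmetric]] .
  obtain BB hh where fam: "test_family Y U BB hh" using test_family_exists[OF Y U(1)] by blast
  then have BB: "BB j \<in> sets (sborel Y)" "continuous_on U (hh j)" for j by (auto simp: test_family_def)
  define lev where "lev g j = (\<integral>y. indicator (BB j) y * (\<integral>u. hh j u \<partial>g y) \<partial>Q0)" for g :: "'a \<Rightarrow> 'u measure" and j
  define X where "X = lev ` kernels Y U"
  obtain u0 where "u0 \<in> U" using U by auto
  then have Xne: "X \<noteq> {}" using constant_kernel[of u0 U Y] by (auto simp: X_def)
  have cX: "compact X"
    unfolding compact_eq_seq_compact_metric seq_compact_def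
  proof (intro allI impI)
    fix x :: "nat \<Rightarrow> nat \<Rightarrow> real" assume "\<forall>n. x n \<in> X"
    then have "\<forall>n. \<exists>g. g \<in> kernels Y U \<and> x n = lev g" by (auto simp: X_def)
    then obtain g where g: "\<And>n. g n \<in> kernels Y U" "\<And>n. x n = lev (g n)" by metis
    obtain r \<gamma>' where r: "strict_mono (r :: nat \<Rightarrow> nat)" and \<gamma>': "\<gamma>' \<in> Q0 \<rightarrow>\<^sub>M prob_algebra (sborel U)"
      and lim: "\<forall>B\<in>sets Q0. \<forall>h. continuous_on U h \<longrightarrow>
       (\<lambda>n. \<integral>y. indicator B y * (\<integral>u. h u \<partial>g (r n) y) \<partial>Q0) \<longlonglongrightarrow> (\<integral>y. indicator B y * (\<integral>u. h u \<partial>\<gamma>' y) \<partial>Q0 :: real)"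
      using young_compactness[OF pQ0 E(1) pi_generatorD(1-4)[OF EQ] U, of g] kernelsD(1)[OF g(1) sQ0] by blast
    have "(x \<circ> r) \<longlonglongrightarrow> lev \<gamma>'"
    proof (rule tendsto_product_coordinates)
      fix j
      show "(\<lambda>n. (x \<circ> r) n j) \<longlonglongrightarrow> lev \<gamma>' j"
        using lim BB sQ0 by (simp add: g(2) lev_def)
    qed
    moreover have "\<gamma>' \<in> kernels Y U" using \<gamma>' sQ0 by (simp add: kernels_def cong: measurable_cong_sets)
    ultimately show "\<exists>l\<in>X. \<exists>r. strict_mono r \<and> (x \<circ> r) \<longlonglongrightarrow> l" using r by (auto simp: X_def)
  qed
  obtain T and s :: "real \<Rightarrow> nat \<Rightarrow> real" where T: "compact T" and s: "continuous_on T s" "s ` T = X"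
    using compact_image_of_real[OF cX] by blast
  \<comment> \<open>The second passage to the reals merges the \<open>N\<close> parameters of the
    members into one.\<close>
  obtain S and s2 :: "real \<Rightarrow> nat \<Rightarrow> real" where S: "compact S" and s2: "continuous_on S s2" "s2 ` S = PiE {..<N} (\<lambda>_. T)"
    using compact_image_of_real[OF compact_PiE[OF T, of N]] by blast
  have s2T: "s2 \<theta> k \<in> T" if "\<theta> \<in> S" "k < N" for \<theta> k using s2(2) that by (auto simp: PiE_iff)
  have "T \<noteq> {}" using s Xne by auto
  then have "PiE {..<N} (\<lambda>_. T) \<noteq> {}" by (simp add: PiE_eq_empty_iff)
  then have Sne: "S \<noteq> {}" unfolding s2(2)[symmetric] by blast
  \<comment> \<open>An arbitrary right inverse of \<open>lev\<close>. Everything later depends on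
    the chosen kernel through its tests, and those are continuous in \<open>x\<close>.\<close>
  define sel where "sel x = (SOME g. g \<in> kernels Y U \<and> lev g = x)" for x
  have sel: "sel x \<in> kernels Y U" "lev (sel x) = x" if "x \<in> X" for x
  proof -
    have "\<exists>g. g \<in> kernels Y U \<and> lev g = x" using that by (auto simp: X_def)
    from someI_ex[OF this] show "sel x \<in> kernels Y U" "lev (sel x) = x" by (auto simp: sel_def)
  qed
  define \<Gamma> where "\<Gamma> \<theta> k = sel (s (s2 \<theta> k))" for \<theta> k
  have sX: "s (s2 \<theta> k) \<in> X" if "\<theta> \<in> S" "k < N" for \<theta> k using s2T[OF that] s(2) by auto
  have \<Gamma>: "\<Gamma> \<theta> k \<in> kernels Y U" "lev (\<Gamma> \<theta> k) = s (s2 \<theta> k)" if "\<theta> \<in> S" "k < N" for \<theta> k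
    using sel[OF sX[OF that]] by (auto simp: \<Gamma>_def)
  have cont: "continuous_on S (\<lambda>\<theta>. \<integral>y. indicator B y * (\<integral>u. h u \<partial>\<Gamma> \<theta> k y) \<partial>Q l)"
    if k: "k < N" and l: "l < N" and B: "B \<in> sets (sborel Y)" and h: "continuous_on U h" for k l B and h :: "'u \<Rightarrow> real"
  proof -
    have "(\<lambda>\<theta>. \<integral>y. indicator B y * (\<integral>u. h u \<partial>\<Gamma> \<theta> k y) \<partial>Q l) \<in> {f. continuous_on S f}"
    proof (rule uniform_algebra.test_closed_density[OF uniform_algebra_continuous Q0 U fam Dex[rule_format, OF l] \<Gamma>(1)[OF _ k] _ B h])
      fix j
      have "continuous_on S (\<lambda>\<theta>. s2 \<theta> k)" by (rule continuous_on_product_then_coordinatewise[OF s2(1)])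
      then have "continuous_on S (\<lambda>\<theta>. s (s2 \<theta> k))"
        by (rule continuous_on_compose2[OF s(1)]) (use s2T[OF _ k] in auto)
      then have "continuous_on S (\<lambda>\<theta>. s (s2 \<theta> k) j)" by (rule continuous_on_product_then_coordinatewise)
      then show "(\<lambda>\<theta>. \<integral>y. indicator (BB j) y * (\<integral>u. hh j u \<partial>\<Gamma> \<theta> k y) \<partial>Q0) \<in> {f. continuous_on S f}"
        using \<Gamma>(2)[OF _ k] by (simp add: lev_def[symmetric] cong: continuous_on_cong)
    qed
    then show ?thesis by simp
  qed
  have surj: "\<exists>\<theta>\<in>S. \<forall>k<N. \<forall>l<N. \<forall>B\<in>sets (sborel Y). \<forall>h. continuous_on U h \<longrightarrow>
       (\<integral>y. indicator B y * (\<integral>u. h u \<partial>\<Gamma> \<theta> k y) \<partial>Q l) = (\<integral>y. indicator B y * (\<integral>u. h u \<partial>\<gamma> k y) \<partial>Q l :: real)"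
    if \<gamma>: "\<forall>k<N. \<gamma> k \<in> kernels Y U" for \<gamma>
  proof -
    have "\<forall>k. k < N \<longrightarrow> (\<exists>t\<in>T. s t = lev (\<gamma> k))" using \<gamma> s(2) unfolding X_def by (metis (no_types, lifting) imageE imageI)
    then obtain t where t: "\<And>k. k < N \<Longrightarrow> t k \<in> T \<and> s (t k) = lev (\<gamma> k)" by metis
    have "restrict t {..<N} \<in> s2 ` S" unfolding s2(2) using t by auto
    then obtain \<theta> where \<theta>: "\<theta> \<in> S" "s2 \<theta> = restrict t {..<N}" by (auto simp: image_iff)
    have "(\<integral>y. indicator B y * (\<integral>u. h u \<partial>\<Gamma> \<theta> k y) \<partial>Q l) = (\<integral>y. indicator B y * (\<integral>u. h u \<partial>\<gamma> k y) \<partial>Q l)"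
      if k: "k < N" and l: "l < N" and B: "B \<in> sets (sborel Y)" and h: "continuous_on U h" for k l B and h :: "'u \<Rightarrow> real"
    proof -
      \<comment> \<open>The two kernels form a family over \<open>bool\<close>;
        \<open>uniform_algebra_eq\<close> turns equality of the coded tests into equality of all
        tests.\<close>
      define g where "g b = (if b then \<Gamma> \<theta> k else \<gamma> k)" for b
      have "(\<lambda>b. \<integral>y. indicator B y * (\<integral>u. h u \<partial>g b y) \<partial>Q l) \<in> {f. f True = f False}"
      proof (rule uniform_algebra.test_closed_density[OF uniform_algebra_eq Q0 U fam Dex[rule_format, OF l] _ _ B h])
        show "g b \<in> kernels Y U" for b using \<Gamma>(1)[OF \<theta>(1) k] \<gamma> k by (simp add: g_def)
        show "(\<lambda>b. \<integral>y. indicator (BB j) y * (\<integral>u. hh j u \<partial>g b y) \<partial>Q0) \<in> {f. f True = f False}" for j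
          using \<Gamma>(2)[OF \<theta>(1) k] \<theta>(2) t[OF k] k by (simp add: lev_def[symmetric] g_def)
      qed
      then show ?thesis by (simp add: g_def)
    qed
    then show ?thesis using \<theta>(1) by blast
  qed
  have "team_parameters Y U N Q S \<Gamma>"
    unfolding team_parameters_def
    by (intro conjI allI ballI impI S Sne \<Gamma>(1) cont surj) auto
  then show ?thesis by blast
qed

section \<open>Density and symmetry of the joint law\<close>

lemma dms_enat [simp]: "dms (enat N) = {..<N}"
  by (auto simp: dms_def)

lemma cond_dist_emeasure:
  assumes "prob_space Pr" and X: "X \<in> Pr \<rightarrow>\<^sub>M S" and Z: "Z \<in> Pr \<rightarrow>\<^sub>M T"
    and cd: "is_cond_dist Pr S X T Z \<kappa>" and A: "A \<in> sets S" and B: "B \<in> sets T"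
  shows "emeasure (distr Pr (S \<Otimes>\<^sub>M T) (\<lambda>\<omega>. (X \<omega>, Z \<omega>))) (A \<times> B) = (\<integral>\<^sup>+w. indicator A w * emeasure (\<kappa> w) B \<partial>distr Pr S X)"
proof -
  interpret prob_space Pr by fact
  have \<kappa>: "\<kappa> \<in> S \<rightarrow>\<^sub>M prob_algebra T"
    and eq: "measure Pr {\<omega> \<in> space Pr. X \<omega> \<in> A \<and> Z \<omega> \<in> B} = (\<integral>\<omega>. indicator A (X \<omega>) * measure (\<kappa> (X \<omega>)) B \<partial>Pr)"
    using cd A B by (auto simp: is_cond_dist_def)
  have \<kappa>w: "prob_space (\<kappa> w)" if "w \<in> space S" for w
    using measurable_space[OF \<kappa> that] by (simp add: space_prob_algebra)
  have m: "(\<lambda>w. measure (\<kappa> w) B) \<in> borel_measurable S"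
    by (rule measurable_compose[OF \<kappa> measurable_measure_prob_algebra[OF B]])
  have "emeasure (distr Pr (S \<Otimes>\<^sub>M T) (\<lambda>\<omega>. (X \<omega>, Z \<omega>))) (A \<times> B) = emeasure Pr ((\<lambda>\<omega>. (X \<omega>, Z \<omega>)) -` (A \<times> B) \<inter> space Pr)"
    using X Z A B by (intro emeasure_distr) auto
  also have "(\<lambda>\<omega>. (X \<omega>, Z \<omega>)) -` (A \<times> B) \<inter> space Pr = {\<omega> \<in> space Pr. X \<omega> \<in> A \<and> Z \<omega> \<in> B}" by auto
  also have "emeasure Pr {\<omega> \<in> space Pr. X \<omega> \<in> A \<and> Z \<omega> \<in> B} = ennreal (\<integral>\<omega>. indicator A (X \<omega>) * measure (\<kappa> (X \<omega>)) B \<partial>Pr)"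
    by (simp add: emeasure_eq_measure eq)
  also have "\<dots> = (\<integral>\<^sup>+\<omega>. ennreal (indicator A (X \<omega>) * measure (\<kappa> (X \<omega>)) B) \<partial>Pr)"
  proof (rule nn_integral_eq_integral[symmetric])
    show "integrable Pr (\<lambda>\<omega>. indicator A (X \<omega>) * measure (\<kappa> (X \<omega>)) B)"
    proof (rule integrable_const_bound[where B=1], rule AE_I2)
      fix \<omega> assume "\<omega> \<in> space Pr"
      then show "norm (indicator A (X \<omega>) * measure (\<kappa> (X \<omega>)) B) \<le> 1"
        using prob_space.prob_le_1[OF \<kappa>w[OF measurable_space[OF X]]] by (auto split: split_indicator)
    next
      show "(\<lambda>\<omega>. indicator A (X \<omega>) * measure (\<kappa> (X \<omega>)) B) \<in> borel_measurable Pr"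
        using A by (intro borel_measurable_times measurable_compose[OF X m] measurable_compose[OF X borel_measurable_indicator])
    qed
  qed auto
  also have "\<dots> = (\<integral>\<^sup>+\<omega>. indicator A (X \<omega>) * emeasure (\<kappa> (X \<omega>)) B \<partial>Pr)"
  proof (rule nn_integral_cong)
    fix \<omega> assume "\<omega> \<in> space Pr"
    then interpret k: prob_space "\<kappa> (X \<omega>)" using \<kappa>w measurable_space[OF X] by blast
    show "ennreal (indicator A (X \<omega>) * measure (\<kappa> (X \<omega>)) B) = indicator A (X \<omega>) * emeasure (\<kappa> (X \<omega>)) B"
      by (simp add: k.emeasure_eq_measure split: split_indicator)
  qed
  also have "\<dots> = (\<integral>\<^sup>+w. indicator A w * emeasure (\<kappa> w) B \<partial>distr Pr S X)"
  proof (rule nn_integral_distr[symmetric, OF X])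
    have "(\<lambda>w. emeasure (\<kappa> w) B) \<in> borel_measurable S"
      by (rule measurable_emeasure_kernel[OF measurable_prob_algebraD[OF \<kappa>] B])
    then show "(\<lambda>w. indicator A w * emeasure (\<kappa> w) B) \<in> borel_measurable (distr Pr S X)" using A by simp
  qed
  finally show ?thesis .
qed

lemma borel_measurable_factor:
  fixes Y :: "'a::topological_space set" and Y' :: "'b::topological_space set" and \<Omega>0 :: "'o::topological_space set"
  assumes f: "bounded_factors \<Omega>0 Y Y' (enat M) (enat M') f" and k: "k < M"
  shows "(\<lambda>(w, x, z). factor (enat M) f w x z k) \<in> borel_measurable (sborel \<Omega>0 \<Otimes>\<^sub>M prof_space Y {..<M} \<Otimes>\<^sub>M prof_space Y' {..<M'})"
proof -
  let ?R = "sborel \<Omega>0 \<Otimes>\<^sub>M prof_space Y {..<M} \<Otimes>\<^sub>M prof_space Y' {..<M'}"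
  let ?T = "sborel Y \<Otimes>\<^sub>M sborel \<Omega>0 \<Otimes>\<^sub>M prof_space Y ({..<M} - {k}) \<Otimes>\<^sub>M prof_space Y' {..<M'}"
  have m: "(\<lambda>(y, w, x, z). f k y w x z) \<in> borel_measurable ?T" using f k by (auto simp: bounded_factors_def)
  have 1: "(\<lambda>p. (fst (snd p)) k) \<in> ?R \<rightarrow>\<^sub>M sborel Y"
    by (rule measurable_compose[OF _ measurable_component_singleton[of k "{..<M}" "\<lambda>_. sborel Y"]]) (use k in auto)
  have 2: "(\<lambda>p. restrict (fst (snd p)) ({..<M} - {k})) \<in> ?R \<rightarrow>\<^sub>M prof_space Y ({..<M} - {k})"
    by (rule measurable_compose[OF _ measurable_restrict_subset[of "{..<M} - {k}" "{..<M}"]]) auto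
  have "(\<lambda>p. ((fst (snd p)) k, fst p, restrict (fst (snd p)) ({..<M} - {k}), snd (snd p))) \<in> ?R \<rightarrow>\<^sub>M ?T"
    by (intro measurable_Pair 1 2) simp_all
  from measurable_compose[OF this m] show ?thesis by (simp add: factor_def split_beta')
qed

lemma factor_bound:
  assumes f: "bounded_factors \<Omega>0 Y Y' (enat M) (enat M') f"
  shows "\<exists>C\<ge>0. \<forall>k<M. \<forall>w\<in>\<Omega>0. \<forall>x\<in>PiE {..<M} (\<lambda>_. Y). \<forall>z\<in>PiE {..<M'} (\<lambda>_. Y').
    0 \<le> factor (enat M) f w x z k \<and> factor (enat M) f w x z k \<le> C"
proof -
  have "\<forall>k\<in>{..<M}. \<exists>C. \<forall>y\<in>Y. \<forall>w\<in>\<Omega>0. \<forall>x \<in> PiE ({..<M} - {k}) (\<lambda>_. Y). \<forall>z \<in> PiE {..<M'} (\<lambda>_. Y').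
           0 \<le> f k y w x z \<and> f k y w x z \<le> C"
    using f by (auto simp: bounded_factors_def)
  then obtain C where C: "\<forall>k\<in>{..<M}. \<forall>y\<in>Y. \<forall>w\<in>\<Omega>0. \<forall>x \<in> PiE ({..<M} - {k}) (\<lambda>_. Y). \<forall>z \<in> PiE {..<M'} (\<lambda>_. Y').
           0 \<le> f k y w x z \<and> f k y w x z \<le> C k"
    by (drule_tac bchoice) blast
  show ?thesis
  proof (intro exI[of _ "\<Sum>k<M. \<bar>C k\<bar>"] conjI allI impI ballI)
    fix k w x z assume k: "k < M" and w: "w \<in> \<Omega>0" and x: "x \<in> PiE {..<M} (\<lambda>_. Y)" and z: "z \<in> PiE {..<M'} (\<lambda>_. Y')"
    have "x k \<in> Y" "restrict x ({..<M} - {k}) \<in> PiE ({..<M} - {k}) (\<lambda>_. Y)" using x k by (auto simp: PiE_iff)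
    then have *: "0 \<le> factor (enat M) f w x z k" "factor (enat M) f w x z k \<le> C k" using C k w z by (auto simp: factor_def)
    show "0 \<le> factor (enat M) f w x z k" by fact
    have "\<bar>C k\<bar> \<le> (\<Sum>k<M. \<bar>C k\<bar>)" using k by (intro member_le_sum) auto
    then show "factor (enat M) f w x z k \<le> (\<Sum>k<M. \<bar>C k\<bar>)" using *(2) by linarith
  qed (auto intro: sum_nonneg)
qed

text \<open>On rectangles the joint law integrates the conditional law, whose density for almost
  every \<open>w\<close> is the product of the factors. For finite teams this product is bounded and
  jointly measurable, so a single function \<open>D\<close> serves for all \<open>w\<close>.\<close>

lemma joint_law_density:
  fixes Y1 :: "'a::topological_space set" and Y2 :: "'b::topological_space set" and \<Omega>0 :: "'o::topological_space set" and N1 N2 :: nat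
    and Pr :: "'w measure"
  defines "T \<equiv> prof_space Y1 {..<N1} \<Otimes>\<^sub>M prof_space Y2 {..<N2}"
  assumes Pr: "prob_space Pr" and X: "X \<in> Pr \<rightarrow>\<^sub>M sborel \<Omega>0" and Z: "Z \<in> Pr \<rightarrow>\<^sub>M T"
    and cd: "is_cond_dist Pr (sborel \<Omega>0) X T Z \<kappa>"
    and Q1: "\<And>k. k < N1 \<Longrightarrow> is_ref_measure Y1 (Q1 k)" and Q2: "\<And>k. k < N2 \<Longrightarrow> is_ref_measure Y2 (Q2 k)"
    and f: "bounded_factors \<Omega>0 Y1 Y2 (enat N1) (enat N2) f1" "bounded_factors \<Omega>0 Y2 Y1 (enat N2) (enat N1) f2"
    and ac: "AE w in distr Pr (sborel \<Omega>0) X. has_product_density Y1 Y2 (enat N1) (enat N2) Q1 Q2 f1 f2 w (\<kappa> w)"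
  shows "\<exists>D. integrable (distr Pr (sborel \<Omega>0) X \<Otimes>\<^sub>M PiM {..<N1} Q1 \<Otimes>\<^sub>M PiM {..<N2} Q2) D \<and> (\<forall>x. 0 \<le> D x) \<and>
    distr Pr (sborel \<Omega>0 \<Otimes>\<^sub>M T) (\<lambda>\<omega>. (X \<omega>, Z \<omega>)) =
      density (distr Pr (sborel \<Omega>0) X \<Otimes>\<^sub>M PiM {..<N1} Q1 \<Otimes>\<^sub>M PiM {..<N2} Q2) (\<lambda>x. ennreal (D x))"
proof -
  let ?P0 = "distr Pr (sborel \<Omega>0) X"
  let ?QQ = "PiM {..<N1} Q1 \<Otimes>\<^sub>M PiM {..<N2} Q2"
  let ?R = "?P0 \<Otimes>\<^sub>M ?QQ"
  interpret Pr: prob_space Pr by fact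
  have sQ1: "sets (Q1 k) = sets (sborel Y1)" "prob_space (Q1 k)" "space (Q1 k) = Y1" if "k < N1" for k
    using Q1[OF that] sets_eq_imp_space_eq[of "Q1 k" "sborel Y1"] by (auto simp: is_ref_measure_def space_restrict_space)
  have sQ2: "sets (Q2 k) = sets (sborel Y2)" "prob_space (Q2 k)" "space (Q2 k) = Y2" if "k < N2" for k
    using Q2[OF that] sets_eq_imp_space_eq[of "Q2 k" "sborel Y2"] by (auto simp: is_ref_measure_def space_restrict_space)
  interpret P0: prob_space ?P0 by (rule Pr.prob_space_distr[OF X])
  interpret A1: prob_space "PiM {..<N1} Q1" by (intro prob_space_PiM sQ1) simp
  interpret A2: prob_space "PiM {..<N2} Q2" by (intro prob_space_PiM sQ2) simp
  interpret A12: pair_prob_space "PiM {..<N1} Q1" "PiM {..<N2} Q2" ..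
  interpret R: pair_prob_space ?P0 ?QQ ..
  have s1: "sets (PiM {..<N1} Q1) = sets (prof_space Y1 {..<N1})" by (intro sets_PiM_cong) (auto simp: sQ1)
  have s2: "sets (PiM {..<N2} Q2) = sets (prof_space Y2 {..<N2})" by (intro sets_PiM_cong) (auto simp: sQ2)
  have sR: "sets ?R = sets (sborel \<Omega>0 \<Otimes>\<^sub>M prof_space Y1 {..<N1} \<Otimes>\<^sub>M prof_space Y2 {..<N2})"
    by (intro sets_pair_measure_cong s1 s2) simp
  have spR: "space ?R = \<Omega>0 \<times> PiE {..<N1} (\<lambda>_. Y1) \<times> PiE {..<N2} (\<lambda>_. Y2)"
    using sets_eq_imp_space_eq[OF sR] by (simp add: space_pair_measure space_PiM space_restrict_space)
  define D0 where "D0 = (\<lambda>(w, x, z). dm_prod (enat N1) (factor (enat N1) f1 w x z) * dm_prod (enat N2) (factor (enat N2) f2 w z x))"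
  \<comment> \<open>The factors are known to be nonnegative on the space only; the truncation makes
    \<open>D\<close> nonnegative everywhere.\<close>
  define D where "D p = max 0 (D0 p)" for p
  have D0m: "D0 \<in> borel_measurable ?R"
  proof -
    have m1: "(\<lambda>(w, x, z). factor (enat N1) f1 w x z k) \<in> borel_measurable ?R" if "k < N1" for k
      using borel_measurable_factor[OF f(1) that] sR by (simp cong: measurable_cong_sets)
    have m2: "(\<lambda>(w, x, z). factor (enat N2) f2 w z x k) \<in> borel_measurable ?R" if "k < N2" for k
    proof -
      have "(\<lambda>p. (fst p, snd (snd p), fst (snd p))) \<in> ?R \<rightarrow>\<^sub>M ?P0 \<Otimes>\<^sub>M PiM {..<N2} Q2 \<Otimes>\<^sub>M PiM {..<N1} Q1" by measurable
      moreover have "(\<lambda>(w, x, z). factor (enat N2) f2 w x z k) \<in> borel_measurable (?P0 \<Otimes>\<^sub>M PiM {..<N2} Q2 \<Otimes>\<^sub>M PiM {..<N1} Q1)"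
      proof -
        have "sets (?P0 \<Otimes>\<^sub>M PiM {..<N2} Q2 \<Otimes>\<^sub>M PiM {..<N1} Q1) = sets (sborel \<Omega>0 \<Otimes>\<^sub>M prof_space Y2 {..<N2} \<Otimes>\<^sub>M prof_space Y1 {..<N1})"
          by (intro sets_pair_measure_cong s1 s2) simp
        then show ?thesis using borel_measurable_factor[OF f(2) that] by (simp cong: measurable_cong_sets)
      qed
      ultimately have "(\<lambda>p. (\<lambda>(w, x, z). factor (enat N2) f2 w x z k) (fst p, snd (snd p), fst (snd p))) \<in> borel_measurable ?R"
        by (rule measurable_compose)
      then show ?thesis by (simp add: split_beta')
    qed
    have "D0 = (\<lambda>p. (\<Prod>k<N1. (\<lambda>(w, x, z). factor (enat N1) f1 w x z k) p) * (\<Prod>k<N2. (\<lambda>(w, x, z). factor (enat N2) f2 w z x k) p))"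
      by (auto simp: D0_def dm_prod_def split_beta')
    then show ?thesis using m1 m2 by (simp only:) (intro borel_measurable_times borel_measurable_prod, auto)
  qed
  then have Dm: "D \<in> borel_measurable ?R" unfolding D_def by simp
  obtain C1 where C1: "C1 \<ge> 0" "\<forall>k<N1. \<forall>w\<in>\<Omega>0. \<forall>x\<in>PiE {..<N1} (\<lambda>_. Y1). \<forall>z\<in>PiE {..<N2} (\<lambda>_. Y2).
    0 \<le> factor (enat N1) f1 w x z k \<and> factor (enat N1) f1 w x z k \<le> C1" using factor_bound[OF f(1)] by blast
  obtain C2 where C2: "C2 \<ge> 0" "\<forall>k<N2. \<forall>w\<in>\<Omega>0. \<forall>x\<in>PiE {..<N2} (\<lambda>_. Y2). \<forall>z\<in>PiE {..<N1} (\<lambda>_. Y1).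
    0 \<le> factor (enat N2) f2 w x z k \<and> factor (enat N2) f2 w x z k \<le> C2" using factor_bound[OF f(2)] by blast
  have D0b: "0 \<le> D0 p \<and> D0 p \<le> C1 ^ N1 * C2 ^ N2" if "p \<in> space ?R" for p
  proof -
    obtain w x z where p: "p = (w, x, z)" by (metis prod.collapse)
    then have w: "w \<in> \<Omega>0" "x \<in> PiE {..<N1} (\<lambda>_. Y1)" "z \<in> PiE {..<N2} (\<lambda>_. Y2)" using that spR by auto
    have 1: "0 \<le> (\<Prod>k<N1. factor (enat N1) f1 w x z k)" using C1 w by (intro prod_nonneg) auto
    have 2: "0 \<le> (\<Prod>k<N2. factor (enat N2) f2 w z x k)" using C2 w by (intro prod_nonneg) auto
    have 3: "(\<Prod>k<N1. factor (enat N1) f1 w x z k) \<le> (\<Prod>k<N1. C1)" by (rule prod_mono) (use C1 w in auto)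
    have 4: "(\<Prod>k<N2. factor (enat N2) f2 w z x k) \<le> (\<Prod>k<N2. C2)" by (rule prod_mono) (use C2 w in auto)
    have "(\<Prod>k<N1. factor (enat N1) f1 w x z k) * (\<Prod>k<N2. factor (enat N2) f2 w z x k) \<le> C1 ^ N1 * C2 ^ N2"
      by (rule mult_mono) (use 2 3 4 C1(1) in auto)
    then show ?thesis using 1 2 by (simp add: D0_def dm_prod_def p)
  qed
  then have DD: "D p = D0 p" if "p \<in> space ?R" for p using that by (simp add: D_def)
  have "integrable ?R D"
    by (rule R.P.integrable_const_bound[where B="C1 ^ N1 * C2 ^ N2", OF AE_I2 Dm]) (use D0b DD in auto)
  moreover have "distr Pr (sborel \<Omega>0 \<Otimes>\<^sub>M T) (\<lambda>\<omega>. (X \<omega>, Z \<omega>)) = density ?R (\<lambda>x. ennreal (D x))"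
  proof -
    have gen: "pi_generator (sborel \<Omega>0 \<Otimes>\<^sub>M T) {a \<times> b |a b. a \<in> sets (sborel \<Omega>0) \<and> b \<in> {a \<times> b |a b.
       a \<in> {PiE {..<N1} B |B. \<forall>i\<in>{..<N1}. B i \<in> sets (sborel Y1)} \<and> b \<in> {PiE {..<N2} B |B. \<forall>i\<in>{..<N2}. B i \<in> sets (sborel Y2)}}}"
      unfolding T_def by (intro pi_generator_pair pi_generator_sets pi_generator_PiM finite_lessThan)
    have XZ: "(\<lambda>\<omega>. (X \<omega>, Z \<omega>)) \<in> Pr \<rightarrow>\<^sub>M sborel \<Omega>0 \<Otimes>\<^sub>M T" using X Z by simp
    show ?thesis
    proof (rule measure_eqI_pi_generator[OF pi_generator_cong[OF gen]])
      show "finite_measure (distr Pr (sborel \<Omega>0 \<Otimes>\<^sub>M T) (\<lambda>\<omega>. (X \<omega>, Z \<omega>)))"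
        using Pr.prob_space_distr[OF XZ] by (rule prob_space.finite_measure)
      show "sets (density ?R (\<lambda>x. ennreal (D x))) = sets (distr Pr (sborel \<Omega>0 \<Otimes>\<^sub>M T) (\<lambda>\<omega>. (X \<omega>, Z \<omega>)))"
        using sR by (simp add: T_def)
      fix G assume "G \<in> {a \<times> b |a b. a \<in> sets (sborel \<Omega>0) \<and> b \<in> {a \<times> b |a b.
       a \<in> {PiE {..<N1} B |B. \<forall>i\<in>{..<N1}. B i \<in> sets (sborel Y1)} \<and> b \<in> {PiE {..<N2} B |B. \<forall>i\<in>{..<N2}. B i \<in> sets (sborel Y2)}}}"
      then obtain A B1 B2 where G: "G = A \<times> (PiE {..<N1} B1 \<times> PiE {..<N2} B2)" "A \<in> sets (sborel \<Omega>0)"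
        "\<And>i. i < N1 \<Longrightarrow> B1 i \<in> sets (sborel Y1)" "\<And>i. i < N2 \<Longrightarrow> B2 i \<in> sets (sborel Y2)" by auto
      let ?E = "PiE {..<N1} B1 \<times> PiE {..<N2} B2"
      have E1: "PiE {..<N1} B1 \<in> sets (prof_space Y1 {..<N1})" "PiE {..<N2} B2 \<in> sets (prof_space Y2 {..<N2})"
        using G(3,4) by (auto intro!: sets_PiM_I_finite)
      then have E: "?E \<in> sets T" "?E \<in> sets ?QQ" unfolding T_def using s1 s2 by auto
      have "emeasure (distr Pr (sborel \<Omega>0 \<Otimes>\<^sub>M T) (\<lambda>\<omega>. (X \<omega>, Z \<omega>))) G = (\<integral>\<^sup>+w. indicator A w * emeasure (\<kappa> w) ?E \<partial>?P0)"
        unfolding G(1) by (rule cond_dist_emeasure[OF Pr X Z cd G(2) E(1)])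
      also have "\<dots> = (\<integral>\<^sup>+w. \<integral>\<^sup>+x. ennreal (D (w, x)) * indicator G (w, x) \<partial>?QQ \<partial>?P0)"
      proof (rule nn_integral_cong_AE, rule AE_mp[OF ac AE_I2], rule impI)
        fix w assume w: "w \<in> space ?P0" and h: "has_product_density Y1 Y2 (enat N1) (enat N2) Q1 Q2 f1 f2 w (\<kappa> w)"
        have "emeasure (\<kappa> w) ?E = (\<integral>\<^sup>+(x, z) \<in> ?E. ennreal (dm_prod (enat N1) (factor (enat N1) f1 w x z) * dm_prod (enat N2) (factor (enat N2) f2 w z x)) \<partial>?QQ)"
          using h G(3,4) unfolding has_product_density_def by (simp del: mult_eq_0_iff)
        also have "\<dots> = (\<integral>\<^sup>+x. ennreal (D (w, x)) * indicator ?E x \<partial>?QQ)"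
        proof (rule nn_integral_cong, goal_cases)
          case (1 x)
          then have "(w, x) \<in> space ?R" using w by (simp add: space_pair_measure)
          then have "D (w, x) = D0 (w, x)" by (rule DD)
          then show ?case by (cases x) (simp add: D0_def)
        qed
        finally have "indicator A w * emeasure (\<kappa> w) ?E = indicator A w * (\<integral>\<^sup>+x. ennreal (D (w, x)) * indicator ?E x \<partial>?QQ)" by simp
        also have "\<dots> = (\<integral>\<^sup>+x. indicator A w * (ennreal (D (w, x)) * indicator ?E x) \<partial>?QQ)"
          using E(2) measurable_compose[OF measurable_Pair1'[OF w] Dm] by (intro nn_integral_cmult[symmetric]) auto
        also have "\<dots> = (\<integral>\<^sup>+x. ennreal (D (w, x)) * indicator G (w, x) \<partial>?QQ)"
          by (intro nn_integral_cong) (simp add: G(1) indicator_times mult_ac)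
        finally show "indicator A w * emeasure (\<kappa> w) ?E = (\<integral>\<^sup>+x. ennreal (D (w, x)) * indicator G (w, x) \<partial>?QQ)" .
      qed
      also have "\<dots> = (\<integral>\<^sup>+p. ennreal (D p) * indicator G p \<partial>?R)"
        using Dm G(2) E(2) by (intro A12.P.nn_integral_fst) (auto simp: G(1))
      also have "\<dots> = emeasure (density ?R (\<lambda>x. ennreal (D x))) G"
        using Dm G(2) E(2) by (intro emeasure_density[symmetric]) (auto simp: G(1))
      finally show "emeasure (distr Pr (sborel \<Omega>0 \<Otimes>\<^sub>M T) (\<lambda>\<omega>. (X \<omega>, Z \<omega>))) G = emeasure (density ?R (\<lambda>x. ennreal (D x))) G" .
    qed simp
  qed
  ultimately show ?thesis by (intro exI[of _ D]) (auto simp: D_def)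
qed

section \<open>Invariance of the joint law under permutations of the decision makers\<close>

abbreviation permuted :: "nat \<Rightarrow> (nat \<Rightarrow> nat) \<Rightarrow> (nat \<Rightarrow> 'x) \<Rightarrow> nat \<Rightarrow> 'x" where
  "permuted N \<sigma> x \<equiv> (\<lambda>k\<in>{..<N}. x (\<sigma> k))"

lemma measurable_permuted:
  assumes "\<sigma> permutes {..<N}"
  shows "permuted N \<sigma> \<in> PiM {..<N} (\<lambda>_. S) \<rightarrow>\<^sub>M PiM {..<N} (\<lambda>_. S)"
proof (rule measurable_restrict)
  fix k assume "k \<in> {..<N}"
  then have "\<sigma> k \<in> {..<N}" using permutes_in_image[OF assms] by blast
  then show "(\<lambda>x. x (\<sigma> k)) \<in> PiM {..<N} (\<lambda>_. S) \<rightarrow>\<^sub>M S"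
    by (rule measurable_component_singleton[of "\<sigma> k" "{..<N}" "\<lambda>_. S"])
qed

lemma permuted_in_PiE: "\<sigma> permutes {..<N} \<Longrightarrow> x \<in> PiE {..<N} (\<lambda>_. A) \<Longrightarrow> permuted N \<sigma> x \<in> PiE {..<N} (\<lambda>_. A)"
  using permutes_in_image[of \<sigma> "{..<N}"] by (auto simp: PiE_iff)

text \<open>Independence splits the measure of a rectangle, and exchangeability of each team moves
  its own side. It is independence that upgrades exchangeability within each team to invariance
  under separate permutations of both.\<close>

lemma exchangeable_rectangle:
  fixes Y1 :: "'a::topological_space set" and Y2 :: "'b::topological_space set" and N1 N2 :: nat
  assumes \<nu>: "prob_space \<nu>" "sets \<nu> = sets (prof_space Y1 {..<N1} \<Otimes>\<^sub>M prof_space Y2 {..<N2})"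
    and ex: "exchangeable_vars \<nu> N1 (sborel Y1) (\<lambda>k (x, z). x k)" "exchangeable_vars \<nu> N2 (sborel Y2) (\<lambda>k (x, z). z k)"
    and ind: "independent_vars \<nu> (prof_space Y1 {..<N1}) fst (prof_space Y2 {..<N2}) snd"
    and \<sigma>: "\<sigma> permutes {..<N1}" and \<tau>: "\<tau> permutes {..<N2}"
    and E: "E1 \<in> sets (prof_space Y1 {..<N1})" "E2 \<in> sets (prof_space Y2 {..<N2})"
  shows "emeasure \<nu> ((permuted N1 \<sigma> -` E1 \<inter> space (prof_space Y1 {..<N1})) \<times> (permuted N2 \<tau> -` E2 \<inter> space (prof_space Y2 {..<N2})))
    = emeasure \<nu> (E1 \<times> E2)"
proof -
  interpret prob_space \<nu> by fact
  let ?S1 = "prof_space Y1 {..<N1}" and ?S2 = "prof_space Y2 {..<N2}"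
  have sp: "space \<nu> = space ?S1 \<times> space ?S2" using sets_eq_imp_space_eq[OF \<nu>(2)] by (simp add: space_pair_measure)
  have m: "fst \<in> \<nu> \<rightarrow>\<^sub>M ?S1" "snd \<in> \<nu> \<rightarrow>\<^sub>M ?S2"
    using measurable_fst[of ?S1 ?S2] measurable_snd[of ?S1 ?S2] \<nu>(2) by (simp_all cong: measurable_cong_sets)
  have split: "prob (A \<times> B) = prob (fst -` A \<inter> space \<nu>) * prob (snd -` B \<inter> space \<nu>)" if "A \<in> sets ?S1" "B \<in> sets ?S2" for A B
  proof -
    have "A \<subseteq> space ?S1" "B \<subseteq> space ?S2" using that sets.sets_into_space by auto
    then have "A \<times> B = (fst -` A \<inter> space \<nu>) \<inter> (snd -` B \<inter> space \<nu>)" unfolding sp by auto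
    then show ?thesis using indep_setD[OF ind[unfolded independent_vars_def], of "fst -` A \<inter> space \<nu>" "snd -` B \<inter> space \<nu>"] that by auto
  qed
  have 1: "prob (fst -` (permuted N1 \<sigma> -` E1 \<inter> space ?S1) \<inter> space \<nu>) = prob (fst -` E1 \<inter> space \<nu>)"
  proof -
    \<comment> \<open>The unpermuted variables are written with \<open>id\<close>, so that one
      computation of the distribution covers both sides.\<close>
    have "distr \<nu> ?S1 (\<lambda>p. permuted N1 \<sigma> (fst p)) = distr \<nu> ?S1 (\<lambda>p. permuted N1 id (fst p))"
      using ex(1) \<sigma> by (auto simp: exchangeable_vars_def split_beta')
    then have "measure (distr \<nu> ?S1 (\<lambda>p. permuted N1 \<sigma> (fst p))) E1 = measure (distr \<nu> ?S1 (\<lambda>p. permuted N1 id (fst p))) E1" by simp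
    moreover have "measure (distr \<nu> ?S1 (\<lambda>p. permuted N1 s (fst p))) E1 = prob ((\<lambda>p. permuted N1 s (fst p)) -` E1 \<inter> space \<nu>)" if "s permutes {..<N1}" for s
      by (rule measure_distr[OF measurable_compose[OF m(1) measurable_permuted[OF that]] E(1)])
    moreover have "(\<lambda>p. permuted N1 \<sigma> (fst p)) -` E1 \<inter> space \<nu> = fst -` (permuted N1 \<sigma> -` E1 \<inter> space ?S1) \<inter> space \<nu>" unfolding sp by auto
    moreover have "(\<lambda>p. permuted N1 id (fst p)) -` E1 \<inter> space \<nu> = fst -` E1 \<inter> space \<nu>" unfolding sp
      by (auto simp: space_PiM PiE_def extensional_restrict)
    ultimately show ?thesis using \<sigma> permutes_id[of "{..<N1}"] by metis
  qed
  have 2: "prob (snd -` (permuted N2 \<tau> -` E2 \<inter> space ?S2) \<inter> space \<nu>) = prob (snd -` E2 \<inter> space \<nu>)"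
  proof -
    have "distr \<nu> ?S2 (\<lambda>p. permuted N2 \<tau> (snd p)) = distr \<nu> ?S2 (\<lambda>p. permuted N2 id (snd p))"
      using ex(2) \<tau> by (auto simp: exchangeable_vars_def split_beta')
    then have "measure (distr \<nu> ?S2 (\<lambda>p. permuted N2 \<tau> (snd p))) E2 = measure (distr \<nu> ?S2 (\<lambda>p. permuted N2 id (snd p))) E2" by simp
    moreover have "measure (distr \<nu> ?S2 (\<lambda>p. permuted N2 s (snd p))) E2 = prob ((\<lambda>p. permuted N2 s (snd p)) -` E2 \<inter> space \<nu>)" if "s permutes {..<N2}" for s
      by (rule measure_distr[OF measurable_compose[OF m(2) measurable_permuted[OF that]] E(2)])
    moreover have "(\<lambda>p. permuted N2 \<tau> (snd p)) -` E2 \<inter> space \<nu> = snd -` (permuted N2 \<tau> -` E2 \<inter> space ?S2) \<inter> space \<nu>" unfolding sp by auto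
    moreover have "(\<lambda>p. permuted N2 id (snd p)) -` E2 \<inter> space \<nu> = snd -` E2 \<inter> space \<nu>" unfolding sp
      by (auto simp: space_PiM PiE_def extensional_restrict)
    ultimately show ?thesis using \<tau> permutes_id[of "{..<N2}"] by metis
  qed
  show ?thesis unfolding emeasure_eq_measure
    using split[OF measurable_sets[OF measurable_permuted[OF \<sigma>] E(1)] measurable_sets[OF measurable_permuted[OF \<tau>] E(2)]] split[OF E] 1 2 by simp
qed

text \<open>Almost every conditional law gives a rectangle and its permuted preimage the same
  measure. Integrating over \<open>w\<close> compares the joint laws on a generator.\<close>

lemma joint_law_permuted:
  fixes Y1 :: "'a::topological_space set" and Y2 :: "'b::topological_space set" and N1 N2 :: nat and Pr :: "'w measure" and S :: "'o measure"
  defines "T \<equiv> prof_space Y1 {..<N1} \<Otimes>\<^sub>M prof_space Y2 {..<N2}"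
  assumes Pr: "prob_space Pr" and X: "X \<in> Pr \<rightarrow>\<^sub>M S" and Z: "Z \<in> Pr \<rightarrow>\<^sub>M T"
    and cd: "is_cond_dist Pr S X T Z \<kappa>"
    and ex: "AE w in distr Pr S X. exchangeable_vars (\<kappa> w) N1 (sborel Y1) (\<lambda>k (x, z). x k) \<and> exchangeable_vars (\<kappa> w) N2 (sborel Y2) (\<lambda>k (x, z). z k)"
    and ind: "AE w in distr Pr S X. independent_vars (\<kappa> w) (prof_space Y1 {..<N1}) fst (prof_space Y2 {..<N2}) snd"
    and \<sigma>: "\<sigma> permutes {..<N1}" and \<tau>: "\<tau> permutes {..<N2}"
  shows "(\<lambda>(w, y, z). (w, permuted N1 \<sigma> y, permuted N2 \<tau> z)) \<in> S \<Otimes>\<^sub>M T \<rightarrow>\<^sub>M S \<Otimes>\<^sub>M T"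
    and "distr (distr Pr (S \<Otimes>\<^sub>M T) (\<lambda>\<omega>. (X \<omega>, Z \<omega>))) (S \<Otimes>\<^sub>M T) (\<lambda>(w, y, z). (w, permuted N1 \<sigma> y, permuted N2 \<tau> z))
      = distr Pr (S \<Otimes>\<^sub>M T) (\<lambda>\<omega>. (X \<omega>, Z \<omega>))"
proof -
  let ?\<mu> = "distr Pr (S \<Otimes>\<^sub>M T) (\<lambda>\<omega>. (X \<omega>, Z \<omega>))"
  let ?\<Phi> = "\<lambda>(w :: 'o, y :: nat \<Rightarrow> 'a, z :: nat \<Rightarrow> 'b). (w, permuted N1 \<sigma> y, permuted N2 \<tau> z)"
  interpret Pr: prob_space Pr by fact
  show \<Phi>: "?\<Phi> \<in> S \<Otimes>\<^sub>M T \<rightarrow>\<^sub>M S \<Otimes>\<^sub>M T"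
    unfolding T_def split_beta'
    by (intro measurable_Pair measurable_compose[OF _ measurable_permuted[OF \<sigma>]] measurable_compose[OF _ measurable_permuted[OF \<tau>]]) simp_all
  have XZ: "(\<lambda>\<omega>. (X \<omega>, Z \<omega>)) \<in> Pr \<rightarrow>\<^sub>M S \<Otimes>\<^sub>M T" using X Z by simp
  interpret \<mu>: prob_space ?\<mu> by (rule Pr.prob_space_distr[OF XZ])
  have \<kappa>: "\<kappa> \<in> S \<rightarrow>\<^sub>M prob_algebra T" using cd by (simp add: is_cond_dist_def)
  have gen: "pi_generator (S \<Otimes>\<^sub>M T) {a \<times> b |a b. a \<in> sets S \<and> b \<in> {a \<times> b |a b. a \<in> sets (prof_space Y1 {..<N1}) \<and> b \<in> sets (prof_space Y2 {..<N2})}}"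
    unfolding T_def by (intro pi_generator_pair pi_generator_sets)
  show "distr ?\<mu> (S \<Otimes>\<^sub>M T) ?\<Phi> = ?\<mu>"
  proof (rule measure_eqI_pi_generator[OF pi_generator_cong[OF gen], symmetric])
    show "finite_measure ?\<mu>" by (rule \<mu>.finite_measure_axioms)
    fix G assume "G \<in> {a \<times> b |a b. a \<in> sets S \<and> b \<in> {a \<times> b |a b. a \<in> sets (prof_space Y1 {..<N1}) \<and> b \<in> sets (prof_space Y2 {..<N2})}}"
    then obtain A E1 E2 where G: "G = A \<times> (E1 \<times> E2)" "A \<in> sets S" "E1 \<in> sets (prof_space Y1 {..<N1})" "E2 \<in> sets (prof_space Y2 {..<N2})" by auto
    let ?F1 = "permuted N1 \<sigma> -` E1 \<inter> space (prof_space Y1 {..<N1})" and ?F2 = "permuted N2 \<tau> -` E2 \<inter> space (prof_space Y2 {..<N2})"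
    have E: "E1 \<times> E2 \<in> sets T" "?F1 \<times> ?F2 \<in> sets T"
      unfolding T_def using G(3,4) measurable_sets[OF measurable_permuted[OF \<sigma>] G(3)] measurable_sets[OF measurable_permuted[OF \<tau>] G(4)] by auto
    have "emeasure ?\<mu> G = (\<integral>\<^sup>+w. indicator A w * emeasure (\<kappa> w) (E1 \<times> E2) \<partial>distr Pr S X)"
      unfolding G(1) by (rule cond_dist_emeasure[OF Pr X Z cd G(2) E(1)])
    also have "\<dots> = (\<integral>\<^sup>+w. indicator A w * emeasure (\<kappa> w) (?F1 \<times> ?F2) \<partial>distr Pr S X)"
    proof (rule nn_integral_cong_AE, rule AE_mp[OF AE_conjI[OF ex ind] AE_I2], rule impI)
      fix w assume "w \<in> space (distr Pr S X)"
        and h: "(exchangeable_vars (\<kappa> w) N1 (sborel Y1) (\<lambda>k (x, z). x k) \<and> exchangeable_vars (\<kappa> w) N2 (sborel Y2) (\<lambda>k (x, z). z k)) \<and>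
          independent_vars (\<kappa> w) (prof_space Y1 {..<N1}) fst (prof_space Y2 {..<N2}) snd"
      then have "prob_space (\<kappa> w)" "sets (\<kappa> w) = sets T" using measurable_space[OF \<kappa>, of w] by (auto simp: space_prob_algebra)
      then have "emeasure (\<kappa> w) (?F1 \<times> ?F2) = emeasure (\<kappa> w) (E1 \<times> E2)"
        unfolding T_def using h by (intro exchangeable_rectangle \<sigma> \<tau> G(3,4)) auto
      then show "indicator A w * emeasure (\<kappa> w) (E1 \<times> E2) = indicator A w * emeasure (\<kappa> w) (?F1 \<times> ?F2)" by simp
    qed
    also have "\<dots> = emeasure ?\<mu> (A \<times> (?F1 \<times> ?F2))"
      by (rule cond_dist_emeasure[OF Pr X Z cd G(2) E(2), symmetric])
    also have "A \<times> (?F1 \<times> ?F2) = ?\<Phi> -` G \<inter> space ?\<mu>"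
      using sets.sets_into_space[OF G(2)] by (auto simp: G(1) T_def space_pair_measure)
    also have "emeasure ?\<mu> (?\<Phi> -` G \<inter> space ?\<mu>) = emeasure (distr ?\<mu> (S \<Otimes>\<^sub>M T) ?\<Phi>) G"
      using \<Phi> G(2) E(1) by (intro emeasure_distr[symmetric]) (auto simp: G(1))
    finally show "emeasure ?\<mu> G = emeasure (distr ?\<mu> (S \<Otimes>\<^sub>M T) ?\<Phi>) G" .
  qed simp_all
qed

section \<open>Measurability, boundedness and symmetry of the cost of kernels\<close>

lemma profile_kernelD:
  assumes g: "\<And>k. k < N \<Longrightarrow> g k \<in> kernels Y U" and y: "y \<in> PiE {..<N} (\<lambda>_. Y)"
  shows "prob_space (PiM {..<N} (\<lambda>k. g k (y k)))" "sets (PiM {..<N} (\<lambda>k. g k (y k))) = sets (prof_space U {..<N})"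
    "space (PiM {..<N} (\<lambda>k. g k (y k))) = PiE {..<N} (\<lambda>_. U)"
proof -
  have yY: "y k \<in> Y" if "k < N" for k using y that by (auto simp: PiE_iff)
  note G = kernelsD[OF g refl]
  show "prob_space (PiM {..<N} (\<lambda>k. g k (y k)))" using G(2) yY by (intro prob_space_PiM) auto
  show s: "sets (PiM {..<N} (\<lambda>k. g k (y k))) = sets (prof_space U {..<N})" using G(3) yY by (intro sets_PiM_cong) auto
  show "space (PiM {..<N} (\<lambda>k. g k (y k))) = PiE {..<N} (\<lambda>_. U)"
    using sets_eq_imp_space_eq[OF s] by (simp add: space_PiM space_restrict_space)
qed

lemma borel_measurable_cost_integral:
  fixes N1 N2 :: nat
  assumes c: "is_cost \<Omega>0 U1 U2 N1 N2 c"
    and g1: "\<And>k. k < N1 \<Longrightarrow> g1 k \<in> kernels Y1 U1" and g2: "\<And>k. k < N2 \<Longrightarrow> g2 k \<in> kernels Y2 U2"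
  shows "(\<lambda>(w, y, z). \<integral>(u, v). c w u v \<partial>(PiM {..<N1} (\<lambda>k. g1 k (y k)) \<Otimes>\<^sub>M PiM {..<N2} (\<lambda>k. g2 k (z k))))
    \<in> borel_measurable (sborel \<Omega>0 \<Otimes>\<^sub>M prof_space Y1 {..<N1} \<Otimes>\<^sub>M prof_space Y2 {..<N2})"
proof -
  let ?R = "sborel \<Omega>0 \<Otimes>\<^sub>M prof_space Y1 {..<N1} \<Otimes>\<^sub>M prof_space Y2 {..<N2}"
  let ?N = "prof_space U1 {..<N1} \<Otimes>\<^sub>M prof_space U2 {..<N2}"
  have PK1: "(\<lambda>y. PiM {..<N1} (\<lambda>k. g1 k (y k))) \<in> prof_space Y1 {..<N1} \<rightarrow>\<^sub>M prob_algebra (prof_space U1 {..<N1})"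
    by (rule measurable_PiM_kernel) (use g1 in \<open>auto simp: kernels_def\<close>)
  have PK2: "(\<lambda>y. PiM {..<N2} (\<lambda>k. g2 k (y k))) \<in> prof_space Y2 {..<N2} \<rightarrow>\<^sub>M prob_algebra (prof_space U2 {..<N2})"
    by (rule measurable_PiM_kernel) (use g2 in \<open>auto simp: kernels_def\<close>)
  have K: "(\<lambda>x. PiM {..<N1} (\<lambda>k. g1 k ((fst (snd x)) k)) \<Otimes>\<^sub>M PiM {..<N2} (\<lambda>k. g2 k ((snd (snd x)) k))) \<in> ?R \<rightarrow>\<^sub>M prob_algebra ?N"
    by (intro measurable_pair_kernel measurable_compose[OF _ PK1] measurable_compose[OF _ PK2]) simp_all
  have "(\<lambda>x. (\<lambda>(w, u, v). c w u v) (fst (fst x), fst (snd x), snd (snd x))) \<in> borel_measurable (?R \<Otimes>\<^sub>M ?N)"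
    by (rule measurable_compose[OF _ c[unfolded is_cost_def, THEN conjunct1]]) measurable
  then have "(\<lambda>(x, uv). c (fst x) (fst uv) (snd uv)) \<in> borel_measurable (?R \<Otimes>\<^sub>M ?N)" by (simp add: split_beta')
  from borel_measurable_integral_kernel[OF K this] show ?thesis by (simp add: split_beta')
qed

lemma kernel_cost_bound:
  fixes N1 N2 :: nat
  assumes \<mu>: "prob_space \<mu>" "sets \<mu> = sets (sborel \<Omega>0 \<Otimes>\<^sub>M prof_space Y1 {..<N1} \<Otimes>\<^sub>M prof_space Y2 {..<N2})"
    and c: "\<And>w u v. w \<in> \<Omega>0 \<Longrightarrow> u \<in> PiE {..<N1} (\<lambda>_. U1) \<Longrightarrow> v \<in> PiE {..<N2} (\<lambda>_. U2) \<Longrightarrow> \<bar>c w u v\<bar> \<le> C"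
    and g1: "\<And>k. k < N1 \<Longrightarrow> g1 k \<in> kernels Y1 U1" and g2: "\<And>k. k < N2 \<Longrightarrow> g2 k \<in> kernels Y2 U2"
  shows "\<bar>kernel_cost N1 N2 \<mu> c g1 g2\<bar> \<le> C"
  unfolding kernel_cost_def
proof (rule prob_space.integral_abs_le_const[OF \<mu>(1)], clarify)
  fix w y z assume "(w, y, z) \<in> space \<mu>"
  then have s: "w \<in> \<Omega>0" "y \<in> PiE {..<N1} (\<lambda>_. Y1)" "z \<in> PiE {..<N2} (\<lambda>_. Y2)"
    using sets_eq_imp_space_eq[OF \<mu>(2)] by (auto simp: space_pair_measure space_PiM space_restrict_space)
  note p1 = profile_kernelD[OF g1 s(2)] and p2 = profile_kernelD[OF g2 s(3)]
  interpret A: prob_space "PiM {..<N1} (\<lambda>k. g1 k (y k))" by (rule p1(1))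
  interpret B: prob_space "PiM {..<N2} (\<lambda>k. g2 k (z k))" by (rule p2(1))
  interpret AB: pair_prob_space "PiM {..<N1} (\<lambda>k. g1 k (y k))" "PiM {..<N2} (\<lambda>k. g2 k (z k))" ..
  show "\<bar>\<integral>(u, v). c w u v \<partial>(PiM {..<N1} (\<lambda>k. g1 k (y k)) \<Otimes>\<^sub>M PiM {..<N2} (\<lambda>k. g2 k (z k)))\<bar> \<le> C"
    by (rule AB.P.integral_abs_le_const) (use c s(1) p1(3) p2(3) in \<open>auto simp: space_pair_measure\<close>)
qed

text \<open>A renumbering of the kernels is undone by the same renumbering of observations and
  actions: the joint law does not notice the former, the cost function does not notice the
  latter.\<close>

lemma kernel_cost_permuted:
  fixes Y1 :: "'a::topological_space set" and Y2 :: "'b::topological_space set" and \<Omega>0 :: "'o::topological_space set"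
    and U1 :: "'u::topological_space set" and U2 :: "'v::topological_space set" and N1 N2 :: nat
    and g1 :: "nat \<Rightarrow> 'a \<Rightarrow> 'u measure" and g2 :: "nat \<Rightarrow> 'b \<Rightarrow> 'v measure"
  assumes sets\<mu>: "sets \<mu> = sets (sborel \<Omega>0 \<Otimes>\<^sub>M prof_space Y1 {..<N1} \<Otimes>\<^sub>M prof_space Y2 {..<N2})"
    and inv: "distr \<mu> (sborel \<Omega>0 \<Otimes>\<^sub>M prof_space Y1 {..<N1} \<Otimes>\<^sub>M prof_space Y2 {..<N2})
      (\<lambda>(w, y, z). (w, permuted N1 \<sigma> y, permuted N2 \<tau> z)) = \<mu>"
    and c: "is_cost \<Omega>0 U1 U2 N1 N2 c" "exchangeable_cost \<Omega>0 U1 U2 N1 N2 c"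
    and g1: "\<And>k. k < N1 \<Longrightarrow> g1 k \<in> kernels Y1 U1" and g2: "\<And>k. k < N2 \<Longrightarrow> g2 k \<in> kernels Y2 U2"
    and \<sigma>: "\<sigma> permutes {..<N1}" and \<tau>: "\<tau> permutes {..<N2}"
  shows "kernel_cost N1 N2 \<mu> c (\<lambda>k. g1 (\<sigma> k)) (\<lambda>k. g2 (\<tau> k)) = kernel_cost N1 N2 \<mu> c g1 g2"
proof -
  let ?R = "sborel \<Omega>0 \<Otimes>\<^sub>M prof_space Y1 {..<N1} \<Otimes>\<^sub>M prof_space Y2 {..<N2}"
  let ?\<Phi> = "\<lambda>(w :: 'o, y :: nat \<Rightarrow> 'a, z :: nat \<Rightarrow> 'b). (w, permuted N1 \<sigma> y, permuted N2 \<tau> z)"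
  define H where "H g1 g2 = (\<lambda>(w :: 'o, y, z). \<integral>(u, v). c w u v \<partial>(PiM {..<N1} (\<lambda>k. g1 k (y k)) \<Otimes>\<^sub>M PiM {..<N2} (\<lambda>k. g2 k (z k))))"
    for g1 :: "nat \<Rightarrow> 'a \<Rightarrow> 'u measure" and g2 :: "nat \<Rightarrow> 'b \<Rightarrow> 'v measure"
  have \<sigma>k: "\<sigma> k < N1" if "k < N1" for k using permutes_in_image[OF \<sigma>, of k] that by simp
  have \<tau>k: "\<tau> k < N2" if "k < N2" for k using permutes_in_image[OF \<tau>, of k] that by simp
  have cm: "(\<lambda>(w, u, v). c w u v) \<in> borel_measurable (sborel \<Omega>0 \<Otimes>\<^sub>M prof_space U1 {..<N1} \<Otimes>\<^sub>M prof_space U2 {..<N2})"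
    using c(1) by (simp add: is_cost_def)
  have \<Phi>: "?\<Phi> \<in> \<mu> \<rightarrow>\<^sub>M ?R"
  proof -
    have "?\<Phi> \<in> ?R \<rightarrow>\<^sub>M ?R" unfolding split_beta'
      by (intro measurable_Pair measurable_compose[OF _ measurable_permuted[OF \<sigma>]] measurable_compose[OF _ measurable_permuted[OF \<tau>]]) simp_all
    then show ?thesis using sets\<mu> by (simp cong: measurable_cong_sets)
  qed
  \<comment> \<open>At renumbered observations each kernel meets its own old observation, so the
    action laws are the old product laws reindexed.\<close>
  have eq: "H (\<lambda>k. g1 (\<sigma> k)) (\<lambda>k. g2 (\<tau> k)) (?\<Phi> x) = H g1 g2 x" if "x \<in> space \<mu>" for x
  proof -
    obtain w y z where x: "x = (w, y, z)" by (metis prod.collapse)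
    then have s: "w \<in> \<Omega>0" "y \<in> PiE {..<N1} (\<lambda>_. Y1)" "z \<in> PiE {..<N2} (\<lambda>_. Y2)"
      using that sets_eq_imp_space_eq[OF sets\<mu>] by (auto simp: space_pair_measure space_PiM space_restrict_space)
    have s': "permuted N1 \<sigma> y \<in> PiE {..<N1} (\<lambda>_. Y1)" "permuted N2 \<tau> z \<in> PiE {..<N2} (\<lambda>_. Y2)"
      using permuted_in_PiE[OF \<sigma> s(2)] permuted_in_PiE[OF \<tau> s(3)] .
    let ?A = "PiM {..<N1} (\<lambda>k. g1 k (y k))" and ?B = "PiM {..<N2} (\<lambda>k. g2 k (z k))"
    let ?A' = "PiM {..<N1} (\<lambda>k. g1 (\<sigma> k) (permuted N1 \<sigma> y k))" and ?B' = "PiM {..<N2} (\<lambda>k. g2 (\<tau> k) (permuted N2 \<tau> z k))"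
    note A = profile_kernelD[OF g1 s(2)] and B = profile_kernelD[OF g2 s(3)]
    note A' = profile_kernelD[where g="\<lambda>k. g1 (\<sigma> k)", OF g1[OF \<sigma>k] s'(1)] and B' = profile_kernelD[where g="\<lambda>k. g2 (\<tau> k)", OF g2[OF \<tau>k] s'(2)]
    have yk: "y k \<in> Y1" if "k < N1" for k using s(2) that by (auto simp: PiE_iff)
    have zk: "z k \<in> Y2" if "k < N2" for k using s(3) that by (auto simp: PiE_iff)
    have eA: "?A' = PiM {..<N1} (\<lambda>k. g1 (\<sigma> k) (y (\<sigma> k)))" by (intro PiM_cong) auto
    have eB: "?B' = PiM {..<N2} (\<lambda>k. g2 (\<tau> k) (z (\<tau> k)))" by (intro PiM_cong) auto
    have dA: "distr ?A ?A' (permuted N1 \<sigma>) = ?A'"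
      unfolding eA
    proof (rule distr_PiM_reindex)
      show "prob_space (g1 k (y k))" if "k \<in> {..<N1}" for k using kernelsD(2)[OF g1 refl] yk that by auto
      show "inj_on \<sigma> {..<N1}" using permutes_inj_on[OF \<sigma>] .
      show "\<sigma> \<in> {..<N1} \<rightarrow> {..<N1}" using \<sigma>k by auto
    qed
    have dB: "distr ?B ?B' (permuted N2 \<tau>) = ?B'"
      unfolding eB
    proof (rule distr_PiM_reindex)
      show "prob_space (g2 k (z k))" if "k \<in> {..<N2}" for k using kernelsD(2)[OF g2 refl] zk that by auto
      show "inj_on \<tau> {..<N2}" using permutes_inj_on[OF \<tau>] .
      show "\<tau> \<in> {..<N2} \<rightarrow> {..<N2}" using \<tau>k by auto
    qed
    have mA: "permuted N1 \<sigma> \<in> ?A \<rightarrow>\<^sub>M ?A'"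
      using measurable_permuted[OF \<sigma>, of "sborel U1"] A(2) A'(2) by (simp cong: measurable_cong_sets)
    have mB: "permuted N2 \<tau> \<in> ?B \<rightarrow>\<^sub>M ?B'"
      using measurable_permuted[OF \<tau>, of "sborel U2"] B(2) B'(2) by (simp cong: measurable_cong_sets)
    interpret B': prob_space ?B' by (rule B'(1))
    have AB': "?A' \<Otimes>\<^sub>M ?B' = distr (?A \<Otimes>\<^sub>M ?B) (?A' \<Otimes>\<^sub>M ?B') (\<lambda>(u, v). (permuted N1 \<sigma> u, permuted N2 \<tau> v))"
      using pair_measure_distr[OF mA mB] B'.sigma_finite_measure_axioms unfolding dA dB by simp
    have cw: "(\<lambda>(u, v). c w u v) \<in> borel_measurable (?A' \<Otimes>\<^sub>M ?B')"
    proof -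
      have "w \<in> space (sborel \<Omega>0)" using s(1) by (simp add: space_restrict_space)
      from measurable_compose[OF measurable_Pair1'[OF this] cm]
      have "(\<lambda>(u, v). c w u v) \<in> borel_measurable (prof_space U1 {..<N1} \<Otimes>\<^sub>M prof_space U2 {..<N2})" by simp
      then show ?thesis using sets_pair_measure_cong[OF A'(2) B'(2)] by (simp cong: measurable_cong_sets)
    qed
    have pm: "(\<lambda>(u, v). (permuted N1 \<sigma> u, permuted N2 \<tau> v)) \<in> ?A \<Otimes>\<^sub>M ?B \<rightarrow>\<^sub>M ?A' \<Otimes>\<^sub>M ?B'"
      unfolding split_beta' by (intro measurable_Pair measurable_compose[OF _ mA] measurable_compose[OF _ mB]) simp_all
    have "H (\<lambda>k. g1 (\<sigma> k)) (\<lambda>k. g2 (\<tau> k)) (?\<Phi> x) = (\<integral>p. (\<lambda>(u, v). c w u v) p \<partial>(?A' \<Otimes>\<^sub>M ?B'))"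
      by (simp add: H_def x)
    also have "\<dots> = (\<integral>p. (\<lambda>(u, v). c w u v) ((\<lambda>(u, v). (permuted N1 \<sigma> u, permuted N2 \<tau> v)) p) \<partial>(?A \<Otimes>\<^sub>M ?B))"
      using integral_distr[OF pm cw] AB' by metis
    also have "\<dots> = (\<integral>p. (\<lambda>(u, v). c w u v) p \<partial>(?A \<Otimes>\<^sub>M ?B))"
    proof (rule Bochner_Integration.integral_cong[OF refl])
      fix p assume "p \<in> space (?A \<Otimes>\<^sub>M ?B)"
      then have "fst p \<in> PiE {..<N1} (\<lambda>_. U1)" "snd p \<in> PiE {..<N2} (\<lambda>_. U2)" using A(3) B(3) by (auto simp: space_pair_measure)
      then have "c w (fst p) (snd p) = c w (permuted N1 \<sigma> (fst p)) (permuted N2 \<tau> (snd p))"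
        using c(2) \<sigma> \<tau> s(1) unfolding exchangeable_cost_def by blast
      then show "(\<lambda>(u, v). c w u v) ((\<lambda>(u, v). (permuted N1 \<sigma> u, permuted N2 \<tau> v)) p) = (\<lambda>(u, v). c w u v) p"
        by (simp add: split_beta)
    qed
    finally show ?thesis by (simp add: H_def x)
  qed
  have "kernel_cost N1 N2 \<mu> c (\<lambda>k. g1 (\<sigma> k)) (\<lambda>k. g2 (\<tau> k)) = (\<integral>x. H (\<lambda>k. g1 (\<sigma> k)) (\<lambda>k. g2 (\<tau> k)) x \<partial>distr \<mu> ?R ?\<Phi>)"
    by (simp add: kernel_cost_def H_def inv)
  also have "\<dots> = (\<integral>x. H (\<lambda>k. g1 (\<sigma> k)) (\<lambda>k. g2 (\<tau> k)) (?\<Phi> x) \<partial>\<mu>)"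
    by (rule integral_distr[OF \<Phi>])
      (use borel_measurable_cost_integral[OF c(1), of "\<lambda>k. g1 (\<sigma> k)" _ "\<lambda>k. g2 (\<tau> k)"] g1 g2 \<sigma>k \<tau>k in \<open>simp add: H_def\<close>)
  also have "\<dots> = (\<integral>x. H g1 g2 x \<partial>\<mu>)" by (rule Bochner_Integration.integral_cong[OF refl eq])
  finally show ?thesis by (simp add: kernel_cost_def H_def)
qed

section \<open>Symmetrization and equilibrium\<close>

text \<open>Both integrals equal that of \<open>F \<circ> p\<close> over \<open>W\<close>. In the
  applications \<open>W\<close> carries a random permutation besides a mixed strategy,
  \<open>p\<close> gives the resulting policies, and \<open>q\<close> forgets the
  permutation.\<close>

lemma integral_mixture:
  fixes F :: "'n \<Rightarrow> real"
  assumes F: "F \<in> borel_measurable B" and p: "p \<in> W \<rightarrow>\<^sub>M B" and q: "q \<in> W \<rightarrow>\<^sub>M M" "distr W M q = M"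
    and G: "G \<in> borel_measurable M" and eq: "\<And>y. y \<in> space W \<Longrightarrow> F (p y) = G (q y)"
  shows "(\<integral>n. F n \<partial>distr W B p) = (\<integral>t. G t \<partial>M)"
proof -
  have "(\<integral>n. F n \<partial>distr W B p) = (\<integral>y. F (p y) \<partial>W)" by (rule integral_distr[OF p F])
  also have "\<dots> = (\<integral>y. G (q y) \<partial>W)" by (rule Bochner_Integration.integral_cong[OF refl eq])
  also have "\<dots> = (\<integral>t. G t \<partial>distr W M q)" by (rule integral_distr[OF q(1) G, symmetric])
  finally show ?thesis by (simp add: q(2))
qed

lemma integral_pair_iterated:
  fixes F :: "'m \<Rightarrow> 'n \<Rightarrow> real"
  assumes F: "(\<lambda>(m, n). F m n) \<in> borel_measurable (A \<Otimes>\<^sub>M B)" and bound: "\<And>m n. m \<in> space A \<Longrightarrow> n \<in> space B \<Longrightarrow> \<bar>F m n\<bar> \<le> C"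
    and P: "P \<in> space (prob_algebra A)" and R: "R \<in> space (prob_algebra B)"
  shows "integrable (P \<Otimes>\<^sub>M R) (\<lambda>(m, n). F m n)" "(\<integral>(m, n). F m n \<partial>(P \<Otimes>\<^sub>M R)) = (\<integral>m. (\<integral>n. F m n \<partial>R) \<partial>P)"
    "(\<integral>(m, n). F m n \<partial>(P \<Otimes>\<^sub>M R)) = (\<integral>(n, m). F m n \<partial>(R \<Otimes>\<^sub>M P))"
    "integrable P (\<lambda>m. \<integral>n. F m n \<partial>R)"
proof -
  have s: "sets P = sets A" "sets R = sets B" "prob_space P" "prob_space R" using P R by (auto simp: space_prob_algebra)
  interpret P: prob_space P by fact
  interpret R: prob_space R by fact
  interpret PR: pair_prob_space P R ..
  have Fm: "(\<lambda>(m, n). F m n) \<in> borel_measurable (P \<Otimes>\<^sub>M R)"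
    using F sets_pair_measure_cong[OF s(1,2)] by (simp cong: measurable_cong_sets)
  show int: "integrable (P \<Otimes>\<^sub>M R) (\<lambda>(m, n). F m n)"
    by (rule PR.P.integrable_const_bound[where B=C, OF AE_I2 Fm])
      (use bound sets_eq_imp_space_eq[OF s(1)] sets_eq_imp_space_eq[OF s(2)] in \<open>auto simp: space_pair_measure\<close>)
  show "(\<integral>(m, n). F m n \<partial>(P \<Otimes>\<^sub>M R)) = (\<integral>m. (\<integral>n. F m n \<partial>R) \<partial>P)"
    using PR.integral_fst'[OF int] by simp
  show "(\<integral>(m, n). F m n \<partial>(P \<Otimes>\<^sub>M R)) = (\<integral>(n, m). F m n \<partial>(R \<Otimes>\<^sub>M P))"
    using PR.integral_product_swap[OF Fm] by simp
  show "integrable P (\<lambda>m. \<integral>n. F m n \<partial>R)" using PR.integrable_fst'[OF int] by simp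
qed

definition permutation_measure :: "nat \<Rightarrow> (nat \<Rightarrow> nat) measure" where
  "permutation_measure N = uniform_count_measure {\<sigma>. \<sigma> permutes {..<N}}"

lemma permutation_measure:
  "prob_space (permutation_measure N)" "space (permutation_measure N) = {\<sigma>. \<sigma> permutes {..<N}}"
  "sets (permutation_measure N) = Pow {\<sigma>. \<sigma> permutes {..<N}}"
proof -
  have "id \<in> {\<sigma>. \<sigma> permutes {..<N}}" using permutes_id by blast
  then show "prob_space (permutation_measure N)"
    unfolding permutation_measure_def by (intro prob_space_uniform_count_measure finite_permutations) (simp, blast)
qed (simp_all add: permutation_measure_def space_uniform_count_measure sets_uniform_count_measure)

text \<open>Right translation by \<open>\<rho>\<close> is a bijection of the group, so every point
  has exactly one preimage, of the same mass.\<close>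

lemma permutation_measure_comp:
  assumes \<rho>: "\<rho> permutes {..<N}"
  shows "distr (permutation_measure N) (permutation_measure N) (\<lambda>\<sigma>. \<sigma> \<circ> \<rho>) = permutation_measure N"
proof (rule measure_eqI_finite)
  let ?A = "{\<sigma>. \<sigma> permutes {..<N}}"
  show fin: "finite ?A" by (rule finite_permutations) simp
  show "sets (distr (permutation_measure N) (permutation_measure N) (\<lambda>\<sigma>. \<sigma> \<circ> \<rho>)) = Pow ?A" "sets (permutation_measure N) = Pow ?A"
    by (simp_all add: permutation_measure)
  fix a assume a: "a \<in> ?A"
  have m: "(\<lambda>\<sigma>. \<sigma> \<circ> \<rho>) \<in> permutation_measure N \<rightarrow>\<^sub>M permutation_measure N"
    using permutes_compose[OF \<rho>] by (auto simp: permutation_measure intro!: measurableI)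
  have "(\<lambda>\<sigma>. \<sigma> \<circ> \<rho>) -` {a} \<inter> ?A = {a \<circ> inv \<rho>}"
  proof (intro set_eqI iffI)
    fix \<sigma> assume "\<sigma> \<in> (\<lambda>\<sigma>. \<sigma> \<circ> \<rho>) -` {a} \<inter> ?A"
    then have "\<sigma> \<circ> (\<rho> \<circ> inv \<rho>) = a \<circ> inv \<rho>" by (auto simp: o_assoc)
    then show "\<sigma> \<in> {a \<circ> inv \<rho>}" by (simp add: permutes_inv_o(1)[OF \<rho>])
  next
    fix \<sigma> assume "\<sigma> \<in> {a \<circ> inv \<rho>}"
    then show "\<sigma> \<in> (\<lambda>\<sigma>. \<sigma> \<circ> \<rho>) -` {a} \<inter> ?A"
      using permutes_compose[OF permutes_inv[OF \<rho>]] a by (auto simp: o_assoc[symmetric] permutes_inv_o(2)[OF \<rho>])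
  qed
  moreover have "a \<circ> inv \<rho> \<in> ?A" using permutes_compose[OF permutes_inv[OF \<rho>]] a by auto
  ultimately have "emeasure (distr (permutation_measure N) (permutation_measure N) (\<lambda>\<sigma>. \<sigma> \<circ> \<rho>)) {a} = emeasure (permutation_measure N) {a \<circ> inv \<rho>}"
    using a by (subst emeasure_distr[OF m]) (auto simp: permutation_measure)
  also have "\<dots> = emeasure (permutation_measure N) {a}"
    using a \<open>a \<circ> inv \<rho> \<in> ?A\<close> fin by (simp add: permutation_measure_def emeasure_uniform_count_measure)
  finally show "emeasure (distr (permutation_measure N) (permutation_measure N) (\<lambda>\<sigma>. \<sigma> \<circ> \<rho>)) {a} = emeasure (permutation_measure N) {a}" .
qed

text \<open>The first factor is finite and discrete, so measurability is checked for each
  permutation separately.\<close>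

lemma measurable_permutation_pair:
  assumes "\<And>\<sigma>. \<sigma> permutes {..<N} \<Longrightarrow> (\<lambda>\<theta>. f (\<sigma>, \<theta>)) \<in> M \<rightarrow>\<^sub>M K"
  shows "f \<in> permutation_measure N \<Otimes>\<^sub>M M \<rightarrow>\<^sub>M K"
proof -
  have "f \<in> count_space {\<sigma>. \<sigma> permutes {..<N}} \<Otimes>\<^sub>M M \<rightarrow>\<^sub>M K"
    by (rule measurable_pair_measure_countable1) (auto intro: assms countable_finite finite_permutations)
  moreover have "sets (permutation_measure N \<Otimes>\<^sub>M M) = sets (count_space {\<sigma>. \<sigma> permutes {..<N}} \<Otimes>\<^sub>M M)"
    by (intro sets_pair_measure_cong) (simp_all add: permutation_measure)
  ultimately show ?thesis by (simp cong: measurable_cong_sets)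
qed

text \<open>The permutation acts on kernels, before the reference measure of the member who plays
  them is applied; policies could not be exchanged between members whose reference measures have
  different null sets.\<close>

definition permuted_policies ::
  "'a::topological_space set \<Rightarrow> 'u::topological_space set \<Rightarrow> nat \<Rightarrow> (nat \<Rightarrow> 'a measure) \<Rightarrow> (real \<Rightarrow> nat \<Rightarrow> 'a \<Rightarrow> 'u measure)
    \<Rightarrow> (nat \<Rightarrow> nat) \<times> real \<Rightarrow> nat \<Rightarrow> ('u \<times> 'a) measure" where
  "permuted_policies Y U N Q \<Gamma> = (\<lambda>(\<sigma>, \<theta>). \<lambda>k\<in>{..<N}. policy_measure Y U (Q k) (\<Gamma> \<theta> (\<sigma> k)))"

text \<open>The witness for exchangeability is the law of the randomly permuted kernels
  \<open>K\<close>. Permuting them further by \<open>\<rho>\<close> replaces \<open>\<sigma>\<close>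
  by \<open>\<sigma> \<circ> \<rho>\<close>, which is again uniformly distributed.\<close>

lemma symmetrized_policy:
  fixes U :: "'u::{metric_space,second_countable_topology} set" and Y :: "'a::{metric_space,second_countable_topology} set"
  assumes Y: "Y \<in> sets borel" and Q: "\<And>k. k < N \<Longrightarrow> is_ref_measure Y (Q k)" and U: "compact U" "U \<noteq> {}"
    and par: "team_parameters Y U N Q S \<Gamma>" and M: "prob_space M" "sets M = sets (sborel S)"
  defines "W \<equiv> permutation_measure N \<Otimes>\<^sub>M M"
  shows "prob_space W" "distr W M snd = M"
    and "permuted_policies Y U N Q \<Gamma> \<in> W \<rightarrow>\<^sub>M team_policy_algebra Y U N Q"
    and "distr W (team_policy_algebra Y U N Q) (permuted_policies Y U N Q \<Gamma>) \<in> exchangeable_policies Y U N Q"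
proof -
  interpret M: prob_space M by fact
  interpret Pm: prob_space "permutation_measure N" by (rule permutation_measure)
  interpret W: pair_prob_space "permutation_measure N" M ..
  interpret W': prob_space W unfolding W_def by (rule W.P.prob_space_axioms)
  show "prob_space W" by (rule W'.prob_space_axioms)
  have spM: "space M = S" using sets_eq_imp_space_eq[OF M(2)] by (simp add: space_restrict_space)
  show "distr W M snd = M"
  proof (rule measure_eqI)
    fix A assume "A \<in> sets (distr W M snd)"
    then have A: "A \<in> sets M" by simp
    have "emeasure (distr W M snd) A = emeasure W (snd -` A \<inter> space W)" using A by (intro emeasure_distr) (auto simp: W_def)
    also have "snd -` A \<inter> space W = space (permutation_measure N) \<times> A"
      using sets.sets_into_space[OF A] by (auto simp: W_def space_pair_measure)
    also have "emeasure W \<dots> = emeasure M A" using A by (simp add: W_def M.emeasure_pair_measure_Times Pm.emeasure_space_1)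
    finally show "emeasure (distr W M snd) A = emeasure M A" .
  qed simp
  have \<Gamma>: "\<Gamma> \<theta> k \<in> kernels Y U" if "\<theta> \<in> S" "k < N" for \<theta> k using par that by (auto simp: team_parameters_def)
  have cont: "continuous_on S (\<lambda>\<theta>. \<integral>y. indicator B y * (\<integral>u. h u \<partial>\<Gamma> \<theta> k y) \<partial>Q l :: real)"
    if "k < N" "l < N" "B \<in> sets (sborel Y)" "continuous_on U h" for k l B h using par that by (auto simp: team_parameters_def)
  obtain BB hh where fam: "test_family Y U BB hh" using test_family_exists[OF Y U(1)] by blast
  then have BB: "BB j \<in> sets (sborel Y)" "continuous_on U (hh j)" for j by (auto simp: test_family_def)
  have \<Gamma>m: "(\<lambda>\<theta>. \<Gamma> \<theta> k) \<in> M \<rightarrow>\<^sub>M kernel_algebra Y U N Q" if k: "k < N" for k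
  proof (rule measurable_into_kernel_algebra[OF Q U fam])
    show "(\<lambda>\<theta>. \<Gamma> \<theta> k) \<in> space M \<rightarrow> kernels Y U" using \<Gamma> k by (auto simp: spM)
    fix l j assume l: "l < N"
    have "(\<lambda>\<theta>. \<integral>y. indicator (BB j) y * (\<integral>u. hh j u \<partial>\<Gamma> \<theta> k y) \<partial>Q l :: real) \<in> borel_measurable M"
      using borel_measurable_continuous_on_restrict[OF cont[OF k l BB]] M(2) by (simp cong: measurable_cong_sets)
    then show "(\<lambda>\<theta>. test_integral (policy_measure Y U (Q l) (\<Gamma> \<theta> k)) (BB j) (hh j)) \<in> borel_measurable M"
      by (subst measurable_cong[OF test_integral_policy_measure[OF Q[OF l] \<Gamma>[OF _ k] U(1) BB]]) (simp_all add: spM)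
  qed
  define K where "K = (\<lambda>(\<sigma> :: nat \<Rightarrow> nat, \<theta>). \<lambda>k\<in>{..<N}. \<Gamma> \<theta> (\<sigma> k))"
  let ?KA = "PiM {..<N} (\<lambda>_. kernel_algebra Y U N Q)"
  have Km: "K \<in> W \<rightarrow>\<^sub>M ?KA"
    unfolding W_def
  proof (rule measurable_permutation_pair)
    fix \<sigma> assume \<sigma>: "\<sigma> permutes {..<N}"
    show "(\<lambda>\<theta>. K (\<sigma>, \<theta>)) \<in> M \<rightarrow>\<^sub>M ?KA"
      unfolding K_def prod.case
    proof (rule measurable_restrict)
      fix k assume "k \<in> {..<N}"
      then show "(\<lambda>\<theta>. \<Gamma> \<theta> (\<sigma> k)) \<in> M \<rightarrow>\<^sub>M kernel_algebra Y U N Q"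
        using permutes_in_image[OF \<sigma>, of k] by (intro \<Gamma>m) simp
    qed
  qed
  note pm = measurable_kernels_to_team[OF Y Q U]
  have p: "permuted_policies Y U N Q \<Gamma> = (\<lambda>\<gamma>. \<lambda>k\<in>{..<N}. policy_measure Y U (Q k) (\<gamma> k)) \<circ> K"
    by (auto simp: permuted_policies_def K_def fun_eq_iff)
  show pW: "permuted_policies Y U N Q \<Gamma> \<in> W \<rightarrow>\<^sub>M team_policy_algebra Y U N Q"
    unfolding p by (rule measurable_comp[OF Km pm])
  show "distr W (team_policy_algebra Y U N Q) (permuted_policies Y U N Q \<Gamma>) \<in> exchangeable_policies Y U N Q"
    unfolding exchangeable_policies_def
  proof (intro CollectI conjI bexI[of _ "distr W ?KA K"] allI impI)
    show "distr W (team_policy_algebra Y U N Q) (permuted_policies Y U N Q \<Gamma>) \<in> randomized_policies Y U N Q"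
      using W'.prob_space_distr[OF pW] by (simp add: randomized_policies_def space_prob_algebra)
    show "distr W ?KA K \<in> space (prob_algebra ?KA)" using W'.prob_space_distr[OF Km] by (simp add: space_prob_algebra)
    show "distr W (team_policy_algebra Y U N Q) (permuted_policies Y U N Q \<Gamma>) =
      distr (distr W ?KA K) (team_policy_algebra Y U N Q) (\<lambda>\<gamma>. \<lambda>k\<in>{..<N}. policy_measure Y U (Q k) (\<gamma> k))"
      unfolding p by (rule distr_distr[OF pm Km, symmetric])
    fix \<rho> A assume \<rho>: "\<rho> permutes {..<N}" and A: "\<forall>k<N. A k \<in> sets (kernel_algebra Y U N Q)"
    let ?T = "\<lambda>(\<sigma> :: nat \<Rightarrow> nat, \<theta> :: real). (\<sigma> \<circ> \<rho>, \<theta>)"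
    have c: "(\<lambda>\<sigma>. \<sigma> \<circ> \<rho>) \<in> permutation_measure N \<rightarrow>\<^sub>M permutation_measure N"
      using permutes_compose[OF \<rho>] by (auto simp: permutation_measure intro!: measurableI)
    have T: "?T \<in> W \<rightarrow>\<^sub>M W" unfolding W_def split_beta' by (intro measurable_Pair measurable_compose[OF measurable_fst c] measurable_snd)
    have "distr M M (\<lambda>x. x) = M" by (rule distr_id)
    then have "distr W W ?T = W"
      using pair_measure_distr[OF c measurable_ident_sets[OF refl], of M] M.sigma_finite_measure_axioms
      unfolding W_def permutation_measure_comp[OF \<rho>] by simp
    have m: "{\<gamma> \<in> space ?KA. \<forall>k<N. \<gamma> (s k) \<in> A k} \<in> sets ?KA" if "s permutes {..<N}" for s
    proof -
      have "(\<lambda>\<gamma>. \<gamma> (s k)) -` A k \<inter> space ?KA \<in> sets ?KA" if "k < N" for k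
        using permutes_in_image[OF \<open>s permutes {..<N}\<close>, of k] A that
        by (intro measurable_sets[OF measurable_component_singleton[of "s k" "{..<N}" "\<lambda>_. kernel_algebra Y U N Q"]]) auto
      then have "{\<gamma> \<in> space ?KA. \<forall>k\<in>{..<N}. \<gamma> (s k) \<in> A k} \<in> sets ?KA"
        by (intro sets.sets_Collect_finite_All) (auto simp: vimage_def Int_def conj_commute)
      then show ?thesis unfolding Ball_def lessThan_iff .
    qed
    have e: "measure (distr W ?KA K) {\<gamma> \<in> space (distr W ?KA K). \<forall>k<N. \<gamma> (s k) \<in> A k} = measure W {x \<in> space W. \<forall>k<N. K x (s k) \<in> A k}"
      if "s permutes {..<N}" for s
    proof -
      have "measure (distr W ?KA K) {\<gamma> \<in> space ?KA. \<forall>k<N. \<gamma> (s k) \<in> A k} = measure W (K -` {\<gamma> \<in> space ?KA. \<forall>k<N. \<gamma> (s k) \<in> A k} \<inter> space W)"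
        by (rule measure_distr[OF Km m[OF that]])
      also have "K -` {\<gamma> \<in> space ?KA. \<forall>k<N. \<gamma> (s k) \<in> A k} \<inter> space W = {x \<in> space W. \<forall>k<N. K x (s k) \<in> A k}"
        using measurable_space[OF Km] by auto
      finally show ?thesis by simp
    qed
    have "measure W {x \<in> space W. \<forall>k<N. K x k \<in> A k} = measure (distr W W ?T) {x \<in> space W. \<forall>k<N. K x k \<in> A k}"
      by (simp add: \<open>distr W W ?T = W\<close>)
    also have "\<dots> = measure W (?T -` {x \<in> space W. \<forall>k<N. K x k \<in> A k} \<inter> space W)"
    proof (rule measure_distr[OF T])
      have "K -` {\<gamma> \<in> space ?KA. \<forall>k<N. \<gamma> (id k) \<in> A k} \<inter> space W \<in> sets W"
        by (rule measurable_sets[OF Km m[OF permutes_id]])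
      also have "K -` {\<gamma> \<in> space ?KA. \<forall>k<N. \<gamma> (id k) \<in> A k} \<inter> space W = {x \<in> space W. \<forall>k<N. K x k \<in> A k}"
        using measurable_space[OF Km] by auto
      finally show "{x \<in> space W. \<forall>k<N. K x k \<in> A k} \<in> sets W" .
    qed
    also have "?T -` {x \<in> space W. \<forall>k<N. K x k \<in> A k} \<inter> space W = {x \<in> space W. \<forall>k<N. K x (\<rho> k) \<in> A k}"
      using measurable_space[OF T] permutes_in_image[OF \<rho>] by (auto simp: K_def)
    finally show "measure (distr W ?KA K) {\<gamma> \<in> space (distr W ?KA K). \<forall>k<N. \<gamma> k \<in> A k} =
      measure (distr W ?KA K) {\<gamma> \<in> space (distr W ?KA K). \<forall>k<N. \<gamma> (\<rho> k) \<in> A k}"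
      using e[OF \<rho>] e[OF permutes_id] by simp
  qed
qed

lemma permuted_policies_test:
  fixes Y :: "'a::second_countable_topology set" and U :: "'u::second_countable_topology set"
  assumes Q: "\<And>k. k < N \<Longrightarrow> is_ref_measure Y (Q k)" and U: "compact U" and \<Gamma>: "\<And>k. k < N \<Longrightarrow> \<Gamma> \<theta> k \<in> kernels Y U"
    and \<sigma>: "\<sigma> permutes {..<N}"
    and k: "k < N" and B: "B \<in> sets (sborel Y)" and h: "continuous_on U h"
  shows "test_integral (permuted_policies Y U N Q \<Gamma> (\<sigma>, \<theta>) k) B h = (\<integral>y. indicator B y * (\<integral>u. h u \<partial>\<Gamma> \<theta> (\<sigma> k) y) \<partial>Q k)"
proof -
  have "\<sigma> k < N" using permutes_in_image[OF \<sigma>, of k] k by simp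
  from test_integral_policy_measure[OF Q[OF k] \<Gamma>[OF this] U B h] show ?thesis using k by (simp add: permuted_policies_def)
qed

text \<open>Keeps the tests of each member under its own reference measure, through which alone the
  cost depends on the kernels.\<close>

lemma team_parameters_surjective:
  assumes par: "team_parameters Y U N Q S \<Gamma>" and \<gamma>: "\<And>k. k < N \<Longrightarrow> \<gamma> k \<in> kernels Y U"
  shows "\<exists>\<theta>\<in>S. \<forall>k B h. k < N \<longrightarrow> B \<in> sets (sborel Y) \<longrightarrow> continuous_on U h \<longrightarrow>
    (\<integral>y. indicator B y * (\<integral>u. h u \<partial>\<Gamma> \<theta> k y) \<partial>Q k) = (\<integral>y. indicator B y * (\<integral>u. h u \<partial>\<gamma> k y) \<partial>Q k :: real)"
proof -
  have "\<exists>\<theta>\<in>S. \<forall>k<N. \<forall>l<N. \<forall>B\<in>sets (sborel Y). \<forall>h. continuous_on U h \<longrightarrow>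
       (\<integral>y. indicator B y * (\<integral>u. h u \<partial>\<Gamma> \<theta> k y) \<partial>Q l) = (\<integral>y. indicator B y * (\<integral>u. h u \<partial>\<gamma> k y) \<partial>Q l :: real)"
    by (rule par[unfolded team_parameters_def, THEN conjunct2, THEN conjunct2, THEN conjunct2, THEN conjunct2, THEN spec, THEN mp])
      (simp add: \<gamma>)
  then obtain \<theta> where \<theta>: "\<theta> \<in> S" and eq: "\<forall>k<N. \<forall>l<N. \<forall>B\<in>sets (sborel Y). \<forall>h. continuous_on U h \<longrightarrow>
       (\<integral>y. indicator B y * (\<integral>u. h u \<partial>\<Gamma> \<theta> k y) \<partial>Q l) = (\<integral>y. indicator B y * (\<integral>u. h u \<partial>\<gamma> k y) \<partial>Q l :: real)"
    by (rule bexE) (rule that)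
  show ?thesis by (intro bexI[OF _ \<theta>] allI impI eq[rule_format])
qed

text \<open>What the rest of the proof sees of the information structure: a joint law with a density
  against a product measure, invariant under permutations within each team. Conditional
  distributions have been absorbed.\<close>

locale two_teams =
  fixes \<Omega>0 :: "'o::topological_space set"
    and Y1 :: "'a::{metric_space,second_countable_topology} set" and Y2 :: "'b::{metric_space,second_countable_topology} set"
    and U1 :: "'u::{metric_space,second_countable_topology} set" and U2 :: "'v::{metric_space,second_countable_topology} set"
    and N1 N2 :: nat and Q1 :: "nat \<Rightarrow> 'a measure" and Q2 :: "nat \<Rightarrow> 'b measure"
    and P0 :: "'o measure" and D :: "'o \<times> (nat \<Rightarrow> 'a) \<times> (nat \<Rightarrow> 'b) \<Rightarrow> real" and \<mu> :: "('o \<times> (nat \<Rightarrow> 'a) \<times> (nat \<Rightarrow> 'b)) measure"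
  assumes Y: "Y1 \<in> sets borel" "Y2 \<in> sets borel"
    and U: "compact U1" "U1 \<noteq> {}" "compact U2" "U2 \<noteq> {}"
    and Q1: "\<And>k. k < N1 \<Longrightarrow> is_ref_measure Y1 (Q1 k)" and Q2: "\<And>k. k < N2 \<Longrightarrow> is_ref_measure Y2 (Q2 k)"
    and P0: "prob_space P0" "sets P0 = sets (sborel \<Omega>0)"
    and \<mu>: "prob_space \<mu>" "\<mu> = density (P0 \<Otimes>\<^sub>M PiM {..<N1} Q1 \<Otimes>\<^sub>M PiM {..<N2} Q2) (\<lambda>x. ennreal (D x))"
    and D: "integrable (P0 \<Otimes>\<^sub>M PiM {..<N1} Q1 \<Otimes>\<^sub>M PiM {..<N2} Q2) D" "\<And>x. 0 \<le> D x"
    and invariant: "\<And>\<sigma> \<tau>. \<sigma> permutes {..<N1} \<Longrightarrow> \<tau> permutes {..<N2} \<Longrightarrow>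
      distr \<mu> (sborel \<Omega>0 \<Otimes>\<^sub>M prof_space Y1 {..<N1} \<Otimes>\<^sub>M prof_space Y2 {..<N2})
        (\<lambda>(w, y, z). (w, permuted N1 \<sigma> y, permuted N2 \<tau> z)) = \<mu>"
begin

definition good_cost :: "('o \<Rightarrow> (nat \<Rightarrow> 'u) \<Rightarrow> (nat \<Rightarrow> 'v) \<Rightarrow> real) \<Rightarrow> bool" where
  "good_cost c \<longleftrightarrow> is_cost \<Omega>0 U1 U2 N1 N2 c \<and> exchangeable_cost \<Omega>0 U1 U2 N1 N2 c \<and> continuous_bounded_cost \<Omega>0 U1 U2 N1 N2 c"

lemma good_costD:
  assumes "good_cost c"
  shows "is_cost \<Omega>0 U1 U2 N1 N2 c" "exchangeable_cost \<Omega>0 U1 U2 N1 N2 c" "continuous_bounded_cost \<Omega>0 U1 U2 N1 N2 c"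
  using assms by (auto simp: good_cost_def)

abbreviation "A1 \<equiv> team_policy_algebra Y1 U1 N1 Q1"
abbreviation "A2 \<equiv> team_policy_algebra Y2 U2 N2 Q2"
abbreviation "\<Pi>1 \<equiv> PiE {..<N1} (\<lambda>k. policies Y1 U1 (Q1 k))"
abbreviation "\<Pi>2 \<equiv> PiE {..<N2} (\<lambda>k. policies Y2 U2 (Q2 k))"
abbreviation "kcost c \<equiv> kernel_cost N1 N2 \<mu> c"
abbreviation "pcost c \<equiv> policy_cost Y1 Y2 U1 U2 N1 N2 Q1 Q2 \<mu> c"

lemmas cost_closed = uniform_algebra.kernel_cost_closed[OF _ P0 Q1 Q2 \<mu> D U]

lemma sets_\<mu>: "sets \<mu> = sets (sborel \<Omega>0 \<Otimes>\<^sub>M prof_space Y1 {..<N1} \<Otimes>\<^sub>M prof_space Y2 {..<N2})"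
proof -
  have "sets (PiM {..<N1} Q1) = sets (prof_space Y1 {..<N1})" using Q1 by (intro sets_PiM_cong) (auto simp: is_ref_measure_def)
  moreover have "sets (PiM {..<N2} Q2) = sets (prof_space Y2 {..<N2})" using Q2 by (intro sets_PiM_cong) (auto simp: is_ref_measure_def)
  ultimately have "sets (P0 \<Otimes>\<^sub>M PiM {..<N1} Q1 \<Otimes>\<^sub>M PiM {..<N2} Q2) = sets (sborel \<Omega>0 \<Otimes>\<^sub>M prof_space Y1 {..<N1} \<Otimes>\<^sub>M prof_space Y2 {..<N2})"
    by (intro sets_pair_measure_cong P0(2))
  then show ?thesis unfolding \<mu>(2) sets_density .
qed

text \<open>The closure theorem for a family over \<open>bool\<close>, with equality of the two
  values as the closed property.\<close>

lemma kernel_cost_eqI: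
  assumes c: "good_cost c"
    and g1: "\<And>k. k < N1 \<Longrightarrow> g1 k \<in> kernels Y1 U1" "\<And>k. k < N1 \<Longrightarrow> g1' k \<in> kernels Y1 U1"
    and g2: "\<And>k. k < N2 \<Longrightarrow> g2 k \<in> kernels Y2 U2" "\<And>k. k < N2 \<Longrightarrow> g2' k \<in> kernels Y2 U2"
    and eq1: "\<And>k B h. k < N1 \<Longrightarrow> B \<in> sets (sborel Y1) \<Longrightarrow> continuous_on U1 h \<Longrightarrow>
        (\<integral>y. indicator B y * (\<integral>u. h u \<partial>g1 k y) \<partial>Q1 k) = (\<integral>y. indicator B y * (\<integral>u. h u \<partial>g1' k y) \<partial>Q1 k :: real)"
    and eq2: "\<And>k B h. k < N2 \<Longrightarrow> B \<in> sets (sborel Y2) \<Longrightarrow> continuous_on U2 h \<Longrightarrow>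
        (\<integral>y. indicator B y * (\<integral>u. h u \<partial>g2 k y) \<partial>Q2 k) = (\<integral>y. indicator B y * (\<integral>u. h u \<partial>g2' k y) \<partial>Q2 k :: real)"
  shows "kcost c g1 g2 = kcost c g1' g2'"
proof -
  have "(\<lambda>t. kcost c ((\<lambda>t. if t then g1 else g1') t) ((\<lambda>t. if t then g2 else g2') t)) \<in> {f :: bool \<Rightarrow> real. f True = f False}"
    by (rule cost_closed[OF uniform_algebra_eq _ _ good_costD(1,3)[OF c]]) (use g1 g2 eq1 eq2 in auto)
  then show ?thesis by simp
qed

text \<open>Removes the choice in \<open>kernel_of\<close>: kernels may be substituted for policies
  as soon as their tests agree.\<close>

lemma policy_cost_eqI:
  assumes c: "good_cost c" and m1: "m1 \<in> \<Pi>1" and m2: "m2 \<in> \<Pi>2"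
    and g1: "\<And>k. k < N1 \<Longrightarrow> g1 k \<in> kernels Y1 U1" and g2: "\<And>k. k < N2 \<Longrightarrow> g2 k \<in> kernels Y2 U2"
    and eq1: "\<And>k B h. k < N1 \<Longrightarrow> B \<in> sets (sborel Y1) \<Longrightarrow> continuous_on U1 h \<Longrightarrow>
        test_integral (m1 k) B h = (\<integral>y. indicator B y * (\<integral>u. h u \<partial>g1 k y) \<partial>Q1 k)"
    and eq2: "\<And>k B h. k < N2 \<Longrightarrow> B \<in> sets (sborel Y2) \<Longrightarrow> continuous_on U2 h \<Longrightarrow>
        test_integral (m2 k) B h = (\<integral>y. indicator B y * (\<integral>u. h u \<partial>g2 k y) \<partial>Q2 k)"
  shows "pcost c m1 m2 = kcost c g1 g2"
proof -
  have m: "k < N1 \<Longrightarrow> m1 k \<in> policies Y1 U1 (Q1 k)" "k < N2 \<Longrightarrow> m2 k \<in> policies Y2 U2 (Q2 k)" for k using m1 m2 by (auto simp: PiE_iff)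
  have "pcost c m1 m2 = kcost c (\<lambda>k. kernel_of Y1 U1 (Q1 k) (m1 k)) (\<lambda>k. kernel_of Y2 U2 (Q2 k) (m2 k))"
    by (simp add: policy_cost_def kernel_cost_def)
  also have "\<dots> = kcost c g1 g2"
    by (rule kernel_cost_eqI[OF c])
      (use g1 g2 kernel_of(1)[OF m(1)] kernel_of(1)[OF m(2)] eq1 eq2 test_integral_kernel_of[OF Q1 m(1) U(1)] test_integral_kernel_of[OF Q2 m(2) U(3)] in auto)
  finally show ?thesis .
qed

text \<open>The choice in \<open>kernel_of\<close> may be wild, but the cost sees it only through
  tests, which are measurable functions of the policies.\<close>

lemma borel_measurable_policy_cost:
  assumes c: "good_cost c"
  shows "(\<lambda>(m1, m2). pcost c m1 m2) \<in> borel_measurable (A1 \<Otimes>\<^sub>M A2)"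
proof -
  have sp: "space (A1 \<Otimes>\<^sub>M A2) = \<Pi>1 \<times> \<Pi>2"
    by (simp add: space_pair_measure space_team_policy_algebra[OF Q1] space_team_policy_algebra[OF Q2])
  have m: "t \<in> space (A1 \<Otimes>\<^sub>M A2) \<Longrightarrow> k < N1 \<Longrightarrow> fst t k \<in> policies Y1 U1 (Q1 k)"
    "t \<in> space (A1 \<Otimes>\<^sub>M A2) \<Longrightarrow> k < N2 \<Longrightarrow> snd t k \<in> policies Y2 U2 (Q2 k)" for t k
    unfolding sp by (auto simp: PiE_iff)
  have "(\<lambda>t. kcost c ((\<lambda>t k. kernel_of Y1 U1 (Q1 k) (fst t k)) t) ((\<lambda>t k. kernel_of Y2 U2 (Q2 k) (snd t k)) t)) \<in> borel_measurable (A1 \<Otimes>\<^sub>M A2)"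
  proof (rule cost_closed[OF uniform_algebra_measurable _ _ good_costD(1,3)[OF c]])
    fix k B and h :: "'u \<Rightarrow> real" assume k: "k < N1" and B: "B \<in> sets (sborel Y1)" and h: "continuous_on U1 h"
    have "(\<lambda>t. test_integral (fst t k) B h) \<in> borel_measurable (A1 \<Otimes>\<^sub>M A2)"
      by (rule measurable_compose[OF measurable_compose[OF measurable_fst measurable_team_component[OF k, where Q=Q1]] measurable_test_integral[OF Y(1) Q1[OF k] U(1) B h]])
    then show "(\<lambda>t. \<integral>y. indicator B y * (\<integral>u. h u \<partial>kernel_of Y1 U1 (Q1 k) (fst t k) y) \<partial>Q1 k) \<in> borel_measurable (A1 \<Otimes>\<^sub>M A2)"
      by (subst measurable_cong[OF test_integral_kernel_of[OF Q1[OF k] m(1)[OF _ k] U(1) B h]])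
  next
    fix k B and h :: "'v \<Rightarrow> real" assume k: "k < N2" and B: "B \<in> sets (sborel Y2)" and h: "continuous_on U2 h"
    have "(\<lambda>t. test_integral (snd t k) B h) \<in> borel_measurable (A1 \<Otimes>\<^sub>M A2)"
      by (rule measurable_compose[OF measurable_compose[OF measurable_snd measurable_team_component[OF k, where Q=Q2]] measurable_test_integral[OF Y(2) Q2[OF k] U(3) B h]])
    then show "(\<lambda>t. \<integral>y. indicator B y * (\<integral>u. h u \<partial>kernel_of Y2 U2 (Q2 k) (snd t k) y) \<partial>Q2 k) \<in> borel_measurable (A1 \<Otimes>\<^sub>M A2)"
      by (subst measurable_cong[OF test_integral_kernel_of[OF Q2[OF k] m(2)[OF _ k] U(3) B h]])
  qed (use kernel_of(1)[OF m(1)] kernel_of(1)[OF m(2)] in auto)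
  then show ?thesis by (simp add: policy_cost_def kernel_cost_def split_beta')
qed

lemma policy_cost_bounded:
  assumes c: "good_cost c"
  shows "\<exists>C. \<forall>m1\<in>space A1. \<forall>m2\<in>space A2. \<bar>pcost c m1 m2\<bar> \<le> C"
proof -
  obtain C where C: "\<And>w u v. w \<in> \<Omega>0 \<Longrightarrow> u \<in> PiE {..<N1} (\<lambda>_. U1) \<Longrightarrow> v \<in> PiE {..<N2} (\<lambda>_. U2) \<Longrightarrow> \<bar>c w u v\<bar> \<le> C"
    using good_costD(3)[OF c] unfolding continuous_bounded_cost_def by metis
  show ?thesis
  proof (intro exI ballI)
    fix m1 m2 assume "m1 \<in> space A1" "m2 \<in> space A2"
    then have m: "k < N1 \<Longrightarrow> m1 k \<in> policies Y1 U1 (Q1 k)" "k < N2 \<Longrightarrow> m2 k \<in> policies Y2 U2 (Q2 k)" for k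
      by (auto simp: space_team_policy_algebra[OF Q1] space_team_policy_algebra[OF Q2] PiE_iff)
    have "\<bar>kcost c (\<lambda>k. kernel_of Y1 U1 (Q1 k) (m1 k)) (\<lambda>k. kernel_of Y2 U2 (Q2 k) (m2 k))\<bar> \<le> C"
      by (rule kernel_cost_bound[where ?U1.0=U1 and ?U2.0=U2, OF \<mu>(1) sets_\<mu> C]) (use kernel_of(1)[OF m(1)] kernel_of(1)[OF m(2)] in auto)
    then show "\<bar>pcost c m1 m2\<bar> \<le> C" by (simp add: policy_cost_def kernel_cost_def)
  qed
qed

end

text \<open>\<open>M1\<close> and \<open>M2\<close> are arbitrary laws on the parameters, not yet an
  equilibrium; \<open>P1\<close> and \<open>P2\<close> will be their symmetrizations as randomized
  policies.\<close>

locale two_teams_parametrized = two_teams \<Omega>0 Y1 Y2 U1 U2 N1 N2 Q1 Q2 P0 D \<mu>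
  for \<Omega>0 :: "'o::topological_space set"
    and Y1 :: "'a::{metric_space,second_countable_topology} set" and Y2 :: "'b::{metric_space,second_countable_topology} set"
    and U1 :: "'u::{metric_space,second_countable_topology} set" and U2 :: "'v::{metric_space,second_countable_topology} set"
    and N1 N2 Q1 Q2 P0 D \<mu> +
  fixes S1 S2 :: "real set" and \<Gamma>1 :: "real \<Rightarrow> nat \<Rightarrow> 'a \<Rightarrow> 'u measure" and \<Gamma>2 :: "real \<Rightarrow> nat \<Rightarrow> 'b \<Rightarrow> 'v measure"
    and M1 M2 :: "real measure"
  assumes par: "team_parameters Y1 U1 N1 Q1 S1 \<Gamma>1" "team_parameters Y2 U2 N2 Q2 S2 \<Gamma>2"
    and M1: "prob_space M1" "sets M1 = sets (sborel S1)" and M2: "prob_space M2" "sets M2 = sets (sborel S2)"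
begin

abbreviation "W1 \<equiv> permutation_measure N1 \<Otimes>\<^sub>M M1"
abbreviation "W2 \<equiv> permutation_measure N2 \<Otimes>\<^sub>M M2"
abbreviation "p1 \<equiv> permuted_policies Y1 U1 N1 Q1 \<Gamma>1"
abbreviation "p2 \<equiv> permuted_policies Y2 U2 N2 Q2 \<Gamma>2"
abbreviation "P1 \<equiv> distr W1 A1 p1"
abbreviation "P2 \<equiv> distr W2 A2 p2"
abbreviation "pair_cost c s t \<equiv> kcost c (\<Gamma>1 s) (\<Gamma>2 t)"

lemma sym1: "prob_space W1" "distr W1 M1 snd = M1" "p1 \<in> W1 \<rightarrow>\<^sub>M A1" "P1 \<in> exchangeable_policies Y1 U1 N1 Q1"
proof -
  note * = symmetrized_policy[OF Y(1) Q1 U(1,2) par(1) M1]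
  show "prob_space W1" by (rule *(1))
  show "distr W1 M1 snd = M1" by (rule *(2))
  show "p1 \<in> W1 \<rightarrow>\<^sub>M A1" by (rule *(3))
  show "P1 \<in> exchangeable_policies Y1 U1 N1 Q1" by (rule *(4))
qed

lemma sym2: "prob_space W2" "distr W2 M2 snd = M2" "p2 \<in> W2 \<rightarrow>\<^sub>M A2" "P2 \<in> exchangeable_policies Y2 U2 N2 Q2"
proof -
  note * = symmetrized_policy[OF Y(2) Q2 U(3,4) par(2) M2]
  show "prob_space W2" by (rule *(1))
  show "distr W2 M2 snd = M2" by (rule *(2))
  show "p2 \<in> W2 \<rightarrow>\<^sub>M A2" by (rule *(3))
  show "P2 \<in> exchangeable_policies Y2 U2 N2 Q2" by (rule *(4))
qed


lemma \<Gamma>: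
  "s \<in> S1 \<Longrightarrow> k < N1 \<Longrightarrow> \<Gamma>1 s k \<in> kernels Y1 U1" "t \<in> S2 \<Longrightarrow> k < N2 \<Longrightarrow> \<Gamma>2 t k \<in> kernels Y2 U2"
  using par by (auto simp: team_parameters_def)

lemma S: "compact S1" "compact S2" using par by (auto simp: team_parameters_def)

lemma space_M: "space M1 = S1" "space M2 = S2"
  using sets_eq_imp_space_eq[OF M1(2)] sets_eq_imp_space_eq[OF M2(2)] by (simp_all add: space_restrict_space)

lemma continuous_pair_cost:
  assumes c: "good_cost c"
  shows "continuous_on (S1 \<times> S2) (\<lambda>(s, t). pair_cost c s t)"
proof -
  have 1: "continuous_on S1 (\<lambda>\<theta>. \<integral>y. indicator B y * (\<integral>u. h u \<partial>\<Gamma>1 \<theta> k y) \<partial>Q1 k :: real)"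
    if "k < N1" "B \<in> sets (sborel Y1)" "continuous_on U1 h" for k B h using par(1) that by (auto simp: team_parameters_def)
  have 2: "continuous_on S2 (\<lambda>\<theta>. \<integral>y. indicator B y * (\<integral>u. h u \<partial>\<Gamma>2 \<theta> k y) \<partial>Q2 k :: real)"
    if "k < N2" "B \<in> sets (sborel Y2)" "continuous_on U2 h" for k B h using par(2) that by (auto simp: team_parameters_def)
  have "(\<lambda>t. kcost c ((\<lambda>t. \<Gamma>1 (fst t)) t) ((\<lambda>t. \<Gamma>2 (snd t)) t)) \<in> {f. continuous_on (S1 \<times> S2) f}"
  proof (rule cost_closed[OF uniform_algebra_continuous _ _ good_costD(1,3)[OF c]])
    fix k B and h :: "'u \<Rightarrow> real" assume "k < N1" "B \<in> sets (sborel Y1)" "continuous_on U1 h"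
    from continuous_on_compose2[OF 1[OF this] continuous_on_fst[OF continuous_on_id], of "S1 \<times> S2"]
    show "(\<lambda>t. \<integral>y. indicator B y * (\<integral>u. h u \<partial>\<Gamma>1 (fst t) k y) \<partial>Q1 k) \<in> {f. continuous_on (S1 \<times> S2) f}" by auto
  next
    fix k B and h :: "'v \<Rightarrow> real" assume "k < N2" "B \<in> sets (sborel Y2)" "continuous_on U2 h"
    from continuous_on_compose2[OF 2[OF this] continuous_on_snd[OF continuous_on_id], of "S1 \<times> S2"]
    show "(\<lambda>t. \<integral>y. indicator B y * (\<integral>u. h u \<partial>\<Gamma>2 (snd t) k y) \<partial>Q2 k) \<in> {f. continuous_on (S1 \<times> S2) f}" by auto
  qed (auto intro: \<Gamma>)
  then show ?thesis by (simp add: split_beta')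
qed

text \<open>The permutations of both teams are undone by \<open>kernel_cost_permuted\<close>, so
  only the parameters count.\<close>

lemma policy_cost_permuted:
  assumes c: "good_cost c" and "x \<in> space W1" "y \<in> space W2"
  shows "pcost c (p1 x) (p2 y) = pair_cost c (snd x) (snd y)"
proof -
  obtain \<sigma> s \<tau> t where xy: "x = (\<sigma>, s)" "y = (\<tau>, t)" by (metis prod.collapse)
  then have *: "\<sigma> permutes {..<N1}" "s \<in> S1" "\<tau> permutes {..<N2}" "t \<in> S2"
    using assms(2,3) by (auto simp: space_pair_measure space_M permutation_measure)
  have \<sigma>k: "\<sigma> k < N1" if "k < N1" for k using permutes_in_image[OF *(1), of k] that by simp
  have \<tau>k: "\<tau> k < N2" if "k < N2" for k using permutes_in_image[OF *(3), of k] that by simp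
  have "pcost c (p1 x) (p2 y) = kcost c (\<lambda>k. \<Gamma>1 s (\<sigma> k)) (\<lambda>k. \<Gamma>2 t (\<tau> k))"
    unfolding xy
  proof (rule policy_cost_eqI[OF c])
    show "p1 (\<sigma>, s) \<in> \<Pi>1" "p2 (\<tau>, t) \<in> \<Pi>2"
      using measurable_space[OF sym1(3) assms(2)] measurable_space[OF sym2(3) assms(3)]
      by (simp_all add: xy space_team_policy_algebra[OF Q1] space_team_policy_algebra[OF Q2])
  qed (use \<Gamma> \<sigma>k \<tau>k * permuted_policies_test[OF Q1 U(1) \<Gamma>(1)] permuted_policies_test[OF Q2 U(3) \<Gamma>(2)] in auto)
  also have "\<dots> = pair_cost c s t"
    by (rule kernel_cost_permuted[OF sets_\<mu> invariant good_costD(1,2)[OF c]]) (use * \<Gamma> in auto)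
  finally show ?thesis by (simp add: xy)
qed

text \<open>Surjectivity of the parametrization gives a parameter with the tests of the deviating
  policy, and the permutation of the other team is undone while this team is left as it is. Hence a
  pure deviation costs the same as one in the game of parameters.\<close>

lemma deviation1:
  assumes c: "good_cost c" and m: "m \<in> space A1"
  shows "\<exists>s\<in>S1. \<forall>y\<in>space W2. pcost c m (p2 y) = pair_cost c s (snd y)"
proof -
  have mk: "m k \<in> policies Y1 U1 (Q1 k)" if "k < N1" for k using m that by (auto simp: space_team_policy_algebra[OF Q1] PiE_iff)
  let ?g = "\<lambda>k. kernel_of Y1 U1 (Q1 k) (m k)"
  have "\<exists>s\<in>S1. \<forall>k B h. k < N1 \<longrightarrow> B \<in> sets (sborel Y1) \<longrightarrow> continuous_on U1 h \<longrightarrow>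
    (\<integral>y. indicator B y * (\<integral>u. h u \<partial>\<Gamma>1 s k y) \<partial>Q1 k) = (\<integral>y. indicator B y * (\<integral>u. h u \<partial>?g k y) \<partial>Q1 k :: real)"
    by (rule team_parameters_surjective[OF par(1) kernel_of(1)[OF mk]])
  then obtain s where s: "s \<in> S1" "\<forall>k B h. k < N1 \<longrightarrow> B \<in> sets (sborel Y1) \<longrightarrow> continuous_on U1 h \<longrightarrow>
    (\<integral>y. indicator B y * (\<integral>u. h u \<partial>\<Gamma>1 s k y) \<partial>Q1 k) = (\<integral>y. indicator B y * (\<integral>u. h u \<partial>?g k y) \<partial>Q1 k :: real)"
    by (rule bexE) (rule that)
  show ?thesis
  proof (intro bexI[OF _ s(1)] ballI)
    fix y assume y: "y \<in> space W2"
    obtain \<tau> t where yy: "y = (\<tau>, t)" by (metis prod.collapse)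
    then have *: "\<tau> permutes {..<N2}" "t \<in> S2" using y by (auto simp: space_pair_measure space_M permutation_measure)
    have \<tau>k: "\<tau> k < N2" if "k < N2" for k using permutes_in_image[OF *(1), of k] that by simp
    have "pcost c m (p2 y) = kcost c (\<Gamma>1 s) (\<lambda>k. \<Gamma>2 t (\<tau> k))"
      unfolding yy
    proof (rule policy_cost_eqI[OF c])
      show "m \<in> \<Pi>1" using m by (simp add: space_team_policy_algebra[OF Q1])
      show "p2 (\<tau>, t) \<in> \<Pi>2" using measurable_space[OF sym2(3) y] by (simp add: yy space_team_policy_algebra[OF Q2])
      fix k B and h :: "'u \<Rightarrow> real" assume "k < N1" "B \<in> sets (sborel Y1)" "continuous_on U1 h"
      then show "test_integral (m k) B h = (\<integral>y. indicator B y * (\<integral>u. h u \<partial>\<Gamma>1 s k y) \<partial>Q1 k)"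
        using s(2) test_integral_kernel_of[OF Q1 mk U(1)] by auto
    qed (use \<Gamma> s(1) \<tau>k * permuted_policies_test[OF Q2 U(3) \<Gamma>(2)] in auto)
    \<comment> \<open>Inserting \<open>id\<close> for the team that is not permuted gives the form
      of \<open>kernel_cost_permuted\<close>.\<close>
    also have "\<dots> = kcost c (\<lambda>k. \<Gamma>1 s (id k)) (\<lambda>k. \<Gamma>2 t (\<tau> k))" by simp
    also have "\<dots> = pair_cost c s t"
      by (rule kernel_cost_permuted[where \<sigma>=id, OF sets_\<mu> invariant good_costD(1,2)[OF c]]) (use * s(1) \<Gamma> in \<open>auto intro: permutes_id[unfolded id_def]\<close>)
    finally show "pcost c m (p2 y) = pair_cost c s (snd y)" by (simp add: yy)
  qed
qed

lemma deviation2: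
  assumes c: "good_cost c" and m: "m \<in> space A2"
  shows "\<exists>t\<in>S2. \<forall>x\<in>space W1. pcost c (p1 x) m = pair_cost c (snd x) t"
proof -
  have mk: "m k \<in> policies Y2 U2 (Q2 k)" if "k < N2" for k using m that by (auto simp: space_team_policy_algebra[OF Q2] PiE_iff)
  let ?g = "\<lambda>k. kernel_of Y2 U2 (Q2 k) (m k)"
  have "\<exists>t\<in>S2. \<forall>k B h. k < N2 \<longrightarrow> B \<in> sets (sborel Y2) \<longrightarrow> continuous_on U2 h \<longrightarrow>
    (\<integral>y. indicator B y * (\<integral>u. h u \<partial>\<Gamma>2 t k y) \<partial>Q2 k) = (\<integral>y. indicator B y * (\<integral>u. h u \<partial>?g k y) \<partial>Q2 k :: real)"
    by (rule team_parameters_surjective[OF par(2) kernel_of(1)[OF mk]])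
  then obtain t where t: "t \<in> S2" "\<forall>k B h. k < N2 \<longrightarrow> B \<in> sets (sborel Y2) \<longrightarrow> continuous_on U2 h \<longrightarrow>
    (\<integral>y. indicator B y * (\<integral>u. h u \<partial>\<Gamma>2 t k y) \<partial>Q2 k) = (\<integral>y. indicator B y * (\<integral>u. h u \<partial>?g k y) \<partial>Q2 k :: real)"
    by (rule bexE) (rule that)
  show ?thesis
  proof (intro bexI[OF _ t(1)] ballI)
    fix x assume x: "x \<in> space W1"
    obtain \<sigma> s where xx: "x = (\<sigma>, s)" by (metis prod.collapse)
    then have *: "\<sigma> permutes {..<N1}" "s \<in> S1" using x by (auto simp: space_pair_measure space_M permutation_measure)
    have \<sigma>k: "\<sigma> k < N1" if "k < N1" for k using permutes_in_image[OF *(1), of k] that by simp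
    have "pcost c (p1 x) m = kcost c (\<lambda>k. \<Gamma>1 s (\<sigma> k)) (\<Gamma>2 t)"
      unfolding xx
    proof (rule policy_cost_eqI[OF c])
      show "m \<in> \<Pi>2" using m by (simp add: space_team_policy_algebra[OF Q2])
      show "p1 (\<sigma>, s) \<in> \<Pi>1" using measurable_space[OF sym1(3) x] by (simp add: xx space_team_policy_algebra[OF Q1])
      fix k B and h :: "'v \<Rightarrow> real" assume "k < N2" "B \<in> sets (sborel Y2)" "continuous_on U2 h"
      then show "test_integral (m k) B h = (\<integral>y. indicator B y * (\<integral>u. h u \<partial>\<Gamma>2 t k y) \<partial>Q2 k)"
        using t(2) test_integral_kernel_of[OF Q2 mk U(3)] by auto
    qed (use \<Gamma> t(1) \<sigma>k * permuted_policies_test[OF Q1 U(1) \<Gamma>(1)] in auto)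
    also have "\<dots> = kcost c (\<lambda>k. \<Gamma>1 s (\<sigma> k)) (\<lambda>k. \<Gamma>2 t (id k))" by simp
    also have "\<dots> = pair_cost c s t"
      by (rule kernel_cost_permuted[where \<tau>=id, OF sets_\<mu> invariant good_costD(1,2)[OF c]]) (use * t(1) \<Gamma> in \<open>auto intro: permutes_id[unfolded id_def]\<close>)
    finally show "pcost c (p1 x) m = pair_cost c (snd x) t" by (simp add: xx)
  qed
qed

lemma P_prob: "P1 \<in> space (prob_algebra A1)" "P2 \<in> space (prob_algebra A2)"
  using prob_space.prob_space_distr[OF sym1(1,3)] prob_space.prob_space_distr[OF sym2(1,3)] by (simp_all add: space_prob_algebra)

lemma pair_cost_measurable:
  assumes c: "good_cost c"
  shows "s \<in> S1 \<Longrightarrow> (\<lambda>t. pair_cost c s t) \<in> borel_measurable M2" "t \<in> S2 \<Longrightarrow> (\<lambda>s. pair_cost c s t) \<in> borel_measurable M1"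
    "(\<lambda>s. \<integral>t. pair_cost c s t \<partial>M2) \<in> borel_measurable M1"
  unfolding measurable_cong_sets[OF M1(2) refl] measurable_cong_sets[OF M2(2) refl]
  by (intro continuous_measurable_sborel continuous_on_sections[OF continuous_pair_cost[OF c]]
      continuous_on_integral[OF S continuous_pair_cost[OF c] M2]; assumption)+

lemma policy_cost_sections:
  assumes c: "good_cost c"
  shows "m \<in> space A1 \<Longrightarrow> pcost c m \<in> borel_measurable A2" "n \<in> space A2 \<Longrightarrow> (\<lambda>m. pcost c m n) \<in> borel_measurable A1"
  using measurable_compose[OF measurable_Pair1' borel_measurable_policy_cost[OF c]]
    measurable_compose[OF measurable_Pair2' borel_measurable_policy_cost[OF c]] by simp_all

text \<open>Two uses of \<open>integral_mixture\<close>, one for each team, forget both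
  permutations.\<close>

lemma expected_cost_value:
  assumes c: "good_cost c"
  shows "(\<integral>(m1, m2). pcost c m1 m2 \<partial>(P1 \<Otimes>\<^sub>M P2)) = (\<integral>s. (\<integral>t. pair_cost c s t \<partial>M2) \<partial>M1)"
proof -
  obtain C where C: "\<And>m1 m2. m1 \<in> space A1 \<Longrightarrow> m2 \<in> space A2 \<Longrightarrow> \<bar>pcost c m1 m2\<bar> \<le> C" using policy_cost_bounded[OF c] by blast
  note F = integral_pair_iterated[OF borel_measurable_policy_cost[OF c] C P_prob]
  have "(\<integral>(m1, m2). pcost c m1 m2 \<partial>(P1 \<Otimes>\<^sub>M P2)) = (\<integral>m1. (\<integral>m2. pcost c m1 m2 \<partial>P2) \<partial>P1)" by (rule F(2))
  also have "\<dots> = (\<integral>s. (\<integral>t. pair_cost c s t \<partial>M2) \<partial>M1)"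
  proof (rule integral_mixture[OF _ sym1(3) measurable_snd sym1(2) pair_cost_measurable(3)[OF c]])
    show "(\<lambda>m1. \<integral>m2. pcost c m1 m2 \<partial>P2) \<in> borel_measurable A1" using borel_measurable_integrable[OF F(4)] by simp
    fix x assume x: "x \<in> space W1"
    then have "p1 x \<in> space A1" "snd x \<in> S1" using measurable_space[OF sym1(3)] by (auto simp: space_pair_measure space_M)
    then show "(\<integral>m2. pcost c (p1 x) m2 \<partial>P2) = (\<integral>t. pair_cost c (snd x) t \<partial>M2)"
      by (intro integral_mixture[OF policy_cost_sections(1)[OF c] sym2(3) measurable_snd sym2(2) pair_cost_measurable(1)[OF c]] policy_cost_permuted[OF c x])
  qed
  finally show ?thesis .
qed

text \<open>A randomized deviation averages pure ones, each of which costs at least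
  \<open>v\<close>.\<close>

lemma deviation_cost1:
  assumes c: "good_cost c" and P: "P \<in> space (prob_algebra A1)" and v: "\<And>s. s \<in> S1 \<Longrightarrow> v \<le> (\<integral>t. pair_cost c s t \<partial>M2)"
  shows "v \<le> (\<integral>(m1, m2). pcost c m1 m2 \<partial>(P \<Otimes>\<^sub>M P2))"
proof -
  obtain C where C: "\<And>m1 m2. m1 \<in> space A1 \<Longrightarrow> m2 \<in> space A2 \<Longrightarrow> \<bar>pcost c m1 m2\<bar> \<le> C" using policy_cost_bounded[OF c] by blast
  note F = integral_pair_iterated[OF borel_measurable_policy_cost[OF c] C P P_prob(2)]
  interpret P: prob_space P using P by (simp add: space_prob_algebra)
  have sP: "space P = space A1" using P sets_eq_imp_space_eq by (auto simp: space_prob_algebra)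
  have "v = (\<integral>m1. v \<partial>P)" by (simp add: P.prob_space)
  also have "\<dots> \<le> (\<integral>m1. (\<integral>m2. pcost c m1 m2 \<partial>P2) \<partial>P)"
  proof (rule integral_mono[OF _ F(4)])
    fix m assume "m \<in> space P"
    then have m: "m \<in> space A1" by (simp add: sP)
    obtain s where s: "s \<in> S1" "\<forall>y\<in>space W2. pcost c m (p2 y) = pair_cost c s (snd y)" using deviation1[OF c m] by blast
    have "(\<integral>m2. pcost c m m2 \<partial>P2) = (\<integral>t. pair_cost c s t \<partial>M2)"
      by (rule integral_mixture[OF policy_cost_sections(1)[OF c m] sym2(3) measurable_snd sym2(2) pair_cost_measurable(1)[OF c s(1)]])
        (use s(2) in auto)
    then show "v \<le> (\<integral>m2. pcost c m m2 \<partial>P2)" using v[OF s(1)] by simp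
  qed simp
  finally show ?thesis by (simp add: F(2))
qed

text \<open>The deviating policy is now the second variable, so the order of integration is reversed
  to make it the outer one.\<close>

lemma deviation_cost2:
  assumes c: "good_cost c" and P: "P \<in> space (prob_algebra A2)" and v: "\<And>t. t \<in> S2 \<Longrightarrow> v \<le> (\<integral>s. pair_cost c s t \<partial>M1)"
  shows "v \<le> (\<integral>(m1, m2). pcost c m1 m2 \<partial>(P1 \<Otimes>\<^sub>M P))"
proof -
  obtain C where C: "\<And>m1 m2. m1 \<in> space A1 \<Longrightarrow> m2 \<in> space A2 \<Longrightarrow> \<bar>pcost c m1 m2\<bar> \<le> C" using policy_cost_bounded[OF c] by blast
  note F = integral_pair_iterated[OF borel_measurable_policy_cost[OF c] C P_prob(1) P]
  have "(\<lambda>(n, m). pcost c m n) \<in> borel_measurable (A2 \<Otimes>\<^sub>M A1)"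
    using measurable_compose[OF measurable_pair_swap' borel_measurable_policy_cost[OF c]] by (simp add: split_beta')
  note F' = integral_pair_iterated[OF this C P P_prob(1)]
  interpret P: prob_space P using P by (simp add: space_prob_algebra)
  have sP: "space P = space A2" using P sets_eq_imp_space_eq by (auto simp: space_prob_algebra)
  have "v = (\<integral>m2. v \<partial>P)" by (simp add: P.prob_space)
  also have "\<dots> \<le> (\<integral>m2. (\<integral>m1. pcost c m1 m2 \<partial>P1) \<partial>P)"
  proof (rule integral_mono[OF _ F'(4)])
    fix m assume "m \<in> space P"
    then have m: "m \<in> space A2" by (simp add: sP)
    obtain t where t: "t \<in> S2" "\<forall>x\<in>space W1. pcost c (p1 x) m = pair_cost c (snd x) t" using deviation2[OF c m] by blast
    have "(\<integral>m1. pcost c m1 m \<partial>P1) = (\<integral>s. pair_cost c s t \<partial>M1)"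
      by (rule integral_mixture[OF policy_cost_sections(2)[OF c m] sym1(3) measurable_snd sym1(2) pair_cost_measurable(2)[OF c t(1)]])
        (use t(2) in auto)
    then show "v \<le> (\<integral>m1. pcost c m1 m \<partial>P1)" using v[OF t(1)] by simp
  qed simp
  also have "\<dots> = (\<integral>(n, m). pcost c m n \<partial>(P \<Otimes>\<^sub>M P1))" by (rule F'(2)[symmetric])
  also have "\<dots> = (\<integral>(m1, m2). pcost c m1 m2 \<partial>(P1 \<Otimes>\<^sub>M P))" by (rule F(3)[symmetric])
  finally show ?thesis .
qed

end

theorem (in two_teams) exchangeable_equilibrium:
  assumes N: "N1 > 0" "N2 > 0" and c: "good_cost c1" "good_cost c2"
  shows "\<exists>P1\<in>exchangeable_policies Y1 U1 N1 Q1. \<exists>P2\<in>exchangeable_policies Y2 U2 N2 Q2.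
    (\<forall>P\<in>randomized_policies Y1 U1 N1 Q1. expected_cost Y1 Y2 U1 U2 N1 N2 Q1 Q2 \<mu> c1 P1 P2 \<le> expected_cost Y1 Y2 U1 U2 N1 N2 Q1 Q2 \<mu> c1 P P2) \<and>
    (\<forall>P\<in>randomized_policies Y2 U2 N2 Q2. expected_cost Y1 Y2 U1 U2 N1 N2 Q1 Q2 \<mu> c2 P1 P2 \<le> expected_cost Y1 Y2 U1 U2 N1 N2 Q1 Q2 \<mu> c2 P1 P)"
proof -
  obtain S1 \<Gamma>1 where 1: "team_parameters Y1 U1 N1 Q1 S1 \<Gamma>1" using team_parametrization[where Q=Q1, OF N(1) Y(1) Q1 U(1,2)] by blast
  obtain S2 \<Gamma>2 where 2: "team_parameters Y2 U2 N2 Q2 S2 \<Gamma>2" using team_parametrization[where Q=Q2, OF N(2) Y(2) Q2 U(3,4)] by blast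
  have S: "compact S1" "S1 \<noteq> {}" "compact S2" "S2 \<noteq> {}" using 1 2 by (auto simp: team_parameters_def)
  have cont: "continuous_on (S1 \<times> S2) (\<lambda>(s, t). kcost c (\<Gamma>1 s) (\<Gamma>2 t))" if "good_cost c" for c
  proof -
    \<comment> \<open>The locale asks for laws on the parameters before an equilibrium is known.
      Point masses give access to the continuity of the cost, from which the equilibrium is then
      obtained.\<close>
    obtain s t where "s \<in> S1" "t \<in> S2" using S by blast
    then interpret two_teams_parametrized \<Omega>0 Y1 Y2 U1 U2 N1 N2 Q1 Q2 P0 D \<mu> S1 S2 \<Gamma>1 \<Gamma>2 "return (sborel S1) s" "return (sborel S2) t"
      by (intro two_teams_parametrized.intro two_teams_parametrized_axioms.intro two_teams_axioms 1 2 prob_space_return)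
        (auto simp: space_restrict_space)
    show ?thesis by (rule continuous_pair_cost[OF that])
  qed
  obtain M1 M2 where M: "prob_space M1" "sets M1 = sets (sborel S1)" "prob_space M2" "sets M2 = sets (sborel S2)"
    and eq: "\<forall>s\<in>S1. (\<integral>x. (\<integral>y. kcost c1 (\<Gamma>1 x) (\<Gamma>2 y) \<partial>M2) \<partial>M1) \<le> (\<integral>y. kcost c1 (\<Gamma>1 s) (\<Gamma>2 y) \<partial>M2)"
      "\<forall>t\<in>S2. (\<integral>x. (\<integral>y. kcost c2 (\<Gamma>1 x) (\<Gamma>2 y) \<partial>M2) \<partial>M1) \<le> (\<integral>x. kcost c2 (\<Gamma>1 x) (\<Gamma>2 t) \<partial>M1)"
    using compact_real_game_equilibrium[OF S cont[OF c(1)] cont[OF c(2)]] by blast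
  interpret two_teams_parametrized \<Omega>0 Y1 Y2 U1 U2 N1 N2 Q1 Q2 P0 D \<mu> S1 S2 \<Gamma>1 \<Gamma>2 M1 M2
    by (intro two_teams_parametrized.intro two_teams_parametrized_axioms.intro two_teams_axioms 1 2 M)
  show ?thesis
  proof (intro bexI[of _ P1] bexI[of _ P2] conjI ballI)
    fix P assume "P \<in> randomized_policies Y1 U1 N1 Q1"
    then show "expected_cost Y1 Y2 U1 U2 N1 N2 Q1 Q2 \<mu> c1 P1 P2 \<le> expected_cost Y1 Y2 U1 U2 N1 N2 Q1 Q2 \<mu> c1 P P2"
      unfolding expected_cost_def expected_cost_value[OF c(1)] randomized_policies_def
      by (rule deviation_cost1[OF c(1)]) (use eq(1) in blast)
  next
    fix P assume "P \<in> randomized_policies Y2 U2 N2 Q2"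
    then show "expected_cost Y1 Y2 U1 U2 N1 N2 Q1 Q2 \<mu> c2 P1 P2 \<le> expected_cost Y1 Y2 U1 U2 N1 N2 Q1 Q2 \<mu> c2 P1 P"
      unfolding expected_cost_def expected_cost_value[OF c(2)] randomized_policies_def
      by (rule deviation_cost2[OF c(2)]) (use eq(2) in blast)
  qed (rule sym2(4), rule sym1(4))
qed

theorem theorem2:
  fixes Pr :: "'w measure"
    and \<Omega>0 :: "'o::polish_space set"
    and Y1 :: "'a::euclidean_space set" and Y2 :: "'b::euclidean_space set"
    and U1 :: "'u::euclidean_space set" and U2 :: "'v::euclidean_space set"
    and w0 :: "'w \<Rightarrow> 'o"
    and y1 :: "enat \<Rightarrow> enat \<Rightarrow> nat \<Rightarrow> 'w \<Rightarrow> 'a"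
    and y2 :: "enat \<Rightarrow> enat \<Rightarrow> nat \<Rightarrow> 'w \<Rightarrow> 'b"
    and \<kappa> :: "enat \<Rightarrow> enat \<Rightarrow> 'o \<Rightarrow> ((nat \<Rightarrow> 'a) \<times> (nat \<Rightarrow> 'b)) measure"
    and Q1 :: "enat \<Rightarrow> enat \<Rightarrow> nat \<Rightarrow> 'a measure"
    and Q2 :: "enat \<Rightarrow> enat \<Rightarrow> nat \<Rightarrow> 'b measure"
    and f1 :: "enat \<Rightarrow> enat \<Rightarrow> nat \<Rightarrow> 'a \<Rightarrow> 'o \<Rightarrow> (nat \<Rightarrow> 'a) \<Rightarrow> (nat \<Rightarrow> 'b) \<Rightarrow> real"
    and f2 :: "enat \<Rightarrow> enat \<Rightarrow> nat \<Rightarrow> 'b \<Rightarrow> 'o \<Rightarrow> (nat \<Rightarrow> 'b) \<Rightarrow> (nat \<Rightarrow> 'a) \<Rightarrow> real"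
    and c1 c2 :: "'o \<Rightarrow> (nat \<Rightarrow> 'u) \<Rightarrow> (nat \<Rightarrow> 'v) \<Rightarrow> real"
    and N1 N2 :: nat
  assumes sizes: "N1 \<ge> 1" "N2 \<ge> 1"
    and borel_sets: "\<Omega>0 \<in> sets borel" "Y1 \<in> sets borel" "Y2 \<in> sets borel"
        "U1 \<in> sets borel" "U2 \<in> sets borel"
    and nonempty_actions: "U1 \<noteq> {}" "U2 \<noteq> {}"
    and prob: "prob_space Pr"
    and w0: "w0 \<in> Pr \<rightarrow>\<^sub>M sborel \<Omega>0"
    and y1: "\<And>M1 M2 k. M1 \<ge> 1 \<Longrightarrow> M2 \<ge> 1 \<Longrightarrow> k \<in> dms M1 \<Longrightarrow> y1 M1 M2 k \<in> Pr \<rightarrow>\<^sub>M sborel Y1"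
    and y2: "\<And>M1 M2 k. M1 \<ge> 1 \<Longrightarrow> M2 \<ge> 1 \<Longrightarrow> k \<in> dms M2 \<Longrightarrow> y2 M1 M2 k \<in> Pr \<rightarrow>\<^sub>M sborel Y2"
    and cond_dist: "\<And>M1 M2. M1 \<ge> 1 \<Longrightarrow> M2 \<ge> 1 \<Longrightarrow>
          is_cond_dist Pr (sborel \<Omega>0) w0
            (prof_space Y1 (dms M1) \<Otimes>\<^sub>M prof_space Y2 (dms M2))
            (obs_pair (dms M1) (dms M2) (y1 M1 M2) (y2 M1 M2)) (\<kappa> M1 M2)"
    and cost: "is_cost \<Omega>0 U1 U2 N1 N2 c1" "is_cost \<Omega>0 U1 U2 N1 N2 c2"
    and exch_cost: "exchangeable_cost \<Omega>0 U1 U2 N1 N2 c1" "exchangeable_cost \<Omega>0 U1 U2 N1 N2 c2"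
    and ref_measures: "\<And>M1 M2 k. M1 \<ge> 1 \<Longrightarrow> M2 \<ge> 1 \<Longrightarrow> k \<in> dms M1 \<Longrightarrow> is_ref_measure Y1 (Q1 M1 M2 k)"
        "\<And>M1 M2 k. M1 \<ge> 1 \<Longrightarrow> M2 \<ge> 1 \<Longrightarrow> k \<in> dms M2 \<Longrightarrow> is_ref_measure Y2 (Q2 M1 M2 k)"
    and factors: "\<And>M1 M2. M1 \<ge> 1 \<Longrightarrow> M2 \<ge> 1 \<Longrightarrow> bounded_factors \<Omega>0 Y1 Y2 M1 M2 (f1 M1 M2)"
        "\<And>M1 M2. M1 \<ge> 1 \<Longrightarrow> M2 \<ge> 1 \<Longrightarrow> bounded_factors \<Omega>0 Y2 Y1 M2 M1 (f2 M1 M2)"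
    and abs_cont: "\<And>M1 M2. M1 \<ge> 1 \<Longrightarrow> M2 \<ge> 1 \<Longrightarrow>
          AE w in distr Pr (sborel \<Omega>0) w0.
            has_product_density Y1 Y2 M1 M2 (Q1 M1 M2) (Q2 M1 M2) (f1 M1 M2) (f2 M1 M2) w (\<kappa> M1 M2 w)"
    and compact_actions: "compact U1" "compact U2"
    and cont_cost: "continuous_bounded_cost \<Omega>0 U1 U2 N1 N2 c1" "continuous_bounded_cost \<Omega>0 U1 U2 N1 N2 c2"
    and cond_exch: "AE w in distr Pr (sborel \<Omega>0) w0.
          exchangeable_vars (\<kappa> N1 N2 w) N1 (sborel Y1) (\<lambda>k (x, z). x k) \<and>
          exchangeable_vars (\<kappa> N1 N2 w) N2 (sborel Y2) (\<lambda>k (x, z). z k)"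
    and cond_indep: "AE w in distr Pr (sborel \<Omega>0) w0.
          independent_vars (\<kappa> N1 N2 w) (prof_space Y1 {..<N1}) fst (prof_space Y2 {..<N2}) snd"
  shows "let \<mu> = distr Pr (sborel \<Omega>0 \<Otimes>\<^sub>M prof_space Y1 {..<N1} \<Otimes>\<^sub>M prof_space Y2 {..<N2})
                   (\<lambda>\<omega>. (w0 \<omega>, obs_pair {..<N1} {..<N2} (y1 N1 N2) (y2 N1 N2) \<omega>));
             J = expected_cost Y1 Y2 U1 U2 N1 N2 (Q1 N1 N2) (Q2 N1 N2) \<mu>
         in \<exists>P1 \<in> exchangeable_policies Y1 U1 N1 (Q1 N1 N2).
            \<exists>P2 \<in> exchangeable_policies Y2 U2 N2 (Q2 N1 N2).
              (\<forall>P \<in> randomized_policies Y1 U1 N1 (Q1 N1 N2). J c1 P1 P2 \<le> J c1 P P2) \<and>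
              (\<forall>P \<in> randomized_policies Y2 U2 N2 (Q2 N1 N2). J c2 P1 P2 \<le> J c2 P1 P)"
proof -
  \<comment> \<open>The family of games is indexed by extended naturals; its hypotheses are
    instantiated at the sizes of this game.\<close>
  have N: "enat N1 \<ge> 1" "enat N2 \<ge> 1" using sizes by (auto simp: one_enat_def)
  define Z where "Z = obs_pair {..<N1} {..<N2} (y1 N1 N2) (y2 N1 N2)"
  let ?T = "prof_space Y1 {..<N1} \<Otimes>\<^sub>M prof_space Y2 {..<N2}"
  let ?P0 = "distr Pr (sborel \<Omega>0) w0"
  let ?\<mu> = "distr Pr (sborel \<Omega>0 \<Otimes>\<^sub>M ?T) (\<lambda>\<omega>. (w0 \<omega>, Z \<omega>))"
  have Z: "Z \<in> Pr \<rightarrow>\<^sub>M ?T"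
    unfolding Z_def obs_pair_def using y1[OF N] y2[OF N] by (intro measurable_Pair measurable_restrict) auto
  have cd: "is_cond_dist Pr (sborel \<Omega>0) w0 ?T Z (\<kappa> N1 N2)" using cond_dist[OF N] by (simp add: Z_def)
  have Q: "k < N1 \<Longrightarrow> is_ref_measure Y1 (Q1 N1 N2 k)" "k < N2 \<Longrightarrow> is_ref_measure Y2 (Q2 N1 N2 k)" for k
    using ref_measures[OF N] by auto
  obtain D where D: "integrable (?P0 \<Otimes>\<^sub>M PiM {..<N1} (Q1 N1 N2) \<Otimes>\<^sub>M PiM {..<N2} (Q2 N1 N2)) D" "\<forall>x. 0 \<le> D x"
    "?\<mu> = density (?P0 \<Otimes>\<^sub>M PiM {..<N1} (Q1 N1 N2) \<Otimes>\<^sub>M PiM {..<N2} (Q2 N1 N2)) (\<lambda>x. ennreal (D x))"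
    using joint_law_density[OF prob w0 Z cd Q factors[OF N] abs_cont[OF N]] by blast
  have w0Z: "(\<lambda>\<omega>. (w0 \<omega>, Z \<omega>)) \<in> Pr \<rightarrow>\<^sub>M sborel \<Omega>0 \<Otimes>\<^sub>M ?T" using w0 Z by simp
  interpret two_teams \<Omega>0 Y1 Y2 U1 U2 N1 N2 "Q1 N1 N2" "Q2 N1 N2" ?P0 D ?\<mu>
  proof (rule two_teams.intro)
    show "prob_space ?P0" by (rule prob_space.prob_space_distr[OF prob w0])
    show "prob_space ?\<mu>" by (rule prob_space.prob_space_distr[OF prob w0Z])
    show "distr ?\<mu> (sborel \<Omega>0 \<Otimes>\<^sub>M ?T) (\<lambda>(w, y, z). (w, permuted N1 \<sigma> y, permuted N2 \<tau> z)) = ?\<mu>"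
      if "\<sigma> permutes {..<N1}" "\<tau> permutes {..<N2}" for \<sigma> \<tau>
      by (rule joint_law_permuted(2)[OF prob w0 Z cd cond_exch cond_indep that])
  qed (use borel_sets compact_actions nonempty_actions Q D in \<open>simp_all (no_asm_simp)\<close>)
  have c: "good_cost c1" "good_cost c2" using cost exch_cost cont_cost by (auto simp: good_cost_def)
  have "N1 > 0" "N2 > 0" using sizes by auto
  from exchangeable_equilibrium[OF this c] show ?thesis by (simp add: Z_def Let_def)
qed

end
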